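(* There exist computable $a_k>0$, $k\in\{0,1\}$, such that if $P$ is a triangle, $P_3$ is an equilateral triangle, $$\delta_\lambda(P):=|P|\lambda(P)-|P_3|\lambda(P_3),\qquad \delta_{\mathcal{P}}(P):=\frac{L^2(P)}{12\sqrt3\,|P|}-1,$$ then $$a_0|P_3|^{3/2}\,\delta_{\mathcal{P}}(P)\le\delta_\lambda(P)\le a_1|P_3|^{3/2}\,\delta_{\mathcal{P}}(P).$$
   Context: $\lambda(\Omega)$ is the first Dirichlet eigenvalue of $-\Delta$ on $\Omega$; $|P|$ is the area and $L(P)$ the perimeter of $P$.
   Formalization: The constants a_0, a_1 are allowed to depend on the area |P_3| (not on P or otherwise on P_3): both deficits are invariant under scaling P_3 while |P_3|^{3/2} is not, so constants independent of |P_3| cannot exist. *)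

theory Defs
  imports "HOL-Analysis.Analysis" "HOL-Library.Nat_Bijection"
begin

section \<open>Computable real numbers\<close>

text \<open>The total recursive functions, coded as unary functions by means of the pairing
  \<^const>\<open>prod_encode\<close>. Minimization is applied to regular functions only, so every function
  in the class is total.\<close>

inductive recursive_fun :: "(nat \<Rightarrow> nat) \<Rightarrow> bool" where
  zero: "recursive_fun (\<lambda>_. 0)"
| succ: "recursive_fun Suc"
| left: "recursive_fun (\<lambda>x. fst (prod_decode x))"
| right: "recursive_fun (\<lambda>x. snd (prod_decode x))"
| comp: "recursive_fun f \<Longrightarrow> recursive_fun g \<Longrightarrow> recursive_fun (\<lambda>x. f (g x))"
| pair: "recursive_fun f \<Longrightarrow> recursive_fun g \<Longrightarrow> recursive_fun (\<lambda>x. prod_encode (f x, g x))"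
| prim_rec: "recursive_fun f \<Longrightarrow> recursive_fun g \<Longrightarrow>
    recursive_fun (\<lambda>x. case prod_decode x of (n, y) \<Rightarrow>
      rec_nat (f y) (\<lambda>i r. g (prod_encode (i, prod_encode (r, y)))) n)"
| minimize: "recursive_fun f \<Longrightarrow> (\<And>x. \<exists>y. f (prod_encode (y, x)) = 0) \<Longrightarrow>
    recursive_fun (\<lambda>x. LEAST y. f (prod_encode (y, x)) = 0)"

definition computable_real :: "real \<Rightarrow> bool" where
  "computable_real a \<longleftrightarrow> (\<exists>p q r. recursive_fun p \<and> recursive_fun q \<and> recursive_fun r \<and>
     (\<forall>n. \<bar>a - (real (p n) - real (q n)) / real (Suc (r n))\<bar> \<le> 1 / 2 ^ n))"

section \<open>The first Dirichlet eigenvalue\<close>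

text \<open>\<open>test_function \<Omega> \<phi> \<phi>'\<close>: the function \<open>\<phi>\<close> is of class \<open>C\<^sup>1\<close> with compact support in
  \<open>\<Omega>\<close>, and \<open>\<phi>'\<close> is its gradient.\<close>

definition test_function ::
    "'a::euclidean_space set \<Rightarrow> ('a \<Rightarrow> real) \<Rightarrow> ('a \<Rightarrow> 'a) \<Rightarrow> bool" where
  "test_function \<Omega> \<phi> \<phi>' \<longleftrightarrow>
     (\<forall>x. (\<phi> has_derivative (\<lambda>h. \<phi>' x \<bullet> h)) (at x)) \<and>
     continuous_on UNIV \<phi>' \<and>
     (\<exists>K. compact K \<and> K \<subseteq> \<Omega> \<and> (\<forall>x. x \<notin> K \<longrightarrow> \<phi> x = 0))"

text \<open>\<open>sobolev_zero \<Omega> u g\<close>: the function \<open>u\<close> lies in the Sobolev space \<open>H\<^sup>1\<^sub>0(\<Omega>)\<close>, the closure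
  of the test functions in \<open>H\<^sup>1(\<Omega>)\<close>, and \<open>g\<close> is its weak gradient. (The closure of \<open>C\<^sup>1\<^sub>c\<close> and
  that of the infinitely differentiable functions of compact support agree, by mollification.)\<close>

definition sobolev_zero ::
    "'a::euclidean_space set \<Rightarrow> ('a \<Rightarrow> real) \<Rightarrow> ('a \<Rightarrow> 'a) \<Rightarrow> bool" where
  "sobolev_zero \<Omega> u g \<longleftrightarrow>
     u \<in> borel_measurable (lebesgue_on \<Omega>) \<and> integrable (lebesgue_on \<Omega>) (\<lambda>x. (u x)\<^sup>2) \<and>
     g \<in> borel_measurable (lebesgue_on \<Omega>) \<and> integrable (lebesgue_on \<Omega>) (\<lambda>x. (norm (g x))\<^sup>2) \<and>
     (\<exists>\<phi> \<phi>'. (\<forall>n::nat. test_function \<Omega> (\<phi> n) (\<phi>' n)) \<and>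
        (\<lambda>n. LINT x|lebesgue_on \<Omega>. (\<phi> n x - u x)\<^sup>2) \<longlonglongrightarrow> 0 \<and>
        (\<lambda>n. LINT x|lebesgue_on \<Omega>. (norm (\<phi>' n x - g x))\<^sup>2) \<longlonglongrightarrow> 0)"

text \<open>\<open>- \<Delta> u = \<mu> u\<close> in the weak sense, for some nonzero \<open>u\<close> in \<open>H\<^sup>1\<^sub>0(\<Omega>)\<close>.\<close>

definition dirichlet_eigenvalue :: "'a::euclidean_space set \<Rightarrow> real \<Rightarrow> bool" where
  "dirichlet_eigenvalue \<Omega> \<mu> \<longleftrightarrow> (\<exists>u g. sobolev_zero \<Omega> u g \<and>
     \<not> (AE x in lebesgue_on \<Omega>. u x = 0) \<and>
     (\<forall>\<phi> \<phi>'. test_function \<Omega> \<phi> \<phi>' \<longrightarrow>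
        (LINT x|lebesgue_on \<Omega>. g x \<bullet> \<phi>' x) = \<mu> * (LINT x|lebesgue_on \<Omega>. u x * \<phi> x)))"

definition first_dirichlet_eigenvalue :: "'a::euclidean_space set \<Rightarrow> real" where
  "first_dirichlet_eigenvalue \<Omega> = (LEAST \<mu>. dirichlet_eigenvalue \<Omega> \<mu>)"

section \<open>Triangles in the plane\<close>

text \<open>Triangles are given by their vertices and are nondegenerate.\<close>

definition is_triangle :: "real^2 \<Rightarrow> real^2 \<Rightarrow> real^2 \<Rightarrow> bool" where
  "is_triangle a b c \<longleftrightarrow> \<not> collinear {a, b, c}"

definition is_equilateral :: "real^2 \<Rightarrow> real^2 \<Rightarrow> real^2 \<Rightarrow> bool" where
  "is_equilateral a b c \<longleftrightarrow> is_triangle a b c \<and> dist a b = dist b c \<and> dist b c = dist c a"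

definition tri_area :: "real^2 \<Rightarrow> real^2 \<Rightarrow> real^2 \<Rightarrow> real" where
  "tri_area a b c = measure lebesgue (convex hull {a, b, c})"

definition tri_perimeter :: "real^2 \<Rightarrow> real^2 \<Rightarrow> real^2 \<Rightarrow> real" where
  "tri_perimeter a b c = dist a b + dist b c + dist c a"

definition tri_eigenvalue :: "real^2 \<Rightarrow> real^2 \<Rightarrow> real^2 \<Rightarrow> real" where
  "tri_eigenvalue a b c = first_dirichlet_eigenvalue (interior (convex hull {a, b, c}))"

text \<open>The triangle \<open>P\<close> has vertices \<open>a b c\<close>; the equilateral triangle \<open>P\<^sub>3\<close> has vertices
  \<open>p q r\<close>.\<close>

definition eigenvalue_deficit ::
    "real^2 \<Rightarrow> real^2 \<Rightarrow> real^2 \<Rightarrow> real^2 \<Rightarrow> real^2 \<Rightarrow> real^2 \<Rightarrow> real" where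
  "eigenvalue_deficit a b c p q r =
     tri_area a b c * tri_eigenvalue a b c - tri_area p q r * tri_eigenvalue p q r"

definition isoperimetric_deficit :: "real^2 \<Rightarrow> real^2 \<Rightarrow> real^2 \<Rightarrow> real" where
  "isoperimetric_deficit a b c = (tri_perimeter a b c)\<^sup>2 / (12 * sqrt 3 * tri_area a b c) - 1"

end

theory Submission imports Defs "HOL-Analysis.Analysis"
begin

text \<open>An affine map carries a triangle \<open>P\<close> to the unit triangle with vertices \<open>(0,0)\<close>, \<open>(1,0)\<close>,
  \<open>(0,1)\<close>. In these coordinates \<open>|P| \<lambda>(P)\<close> is the infimum, over the test functions \<open>\<phi>\<close>, of
  \<open>(cx X + cy Y + cz Z) / N\<close>, where \<open>N\<close>, \<open>X\<close>, \<open>Y\<close>, \<open>Z\<close> are the integrals of the squares of \<open>\<phi>\<close>,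
  \<open>\<phi>\<^sub>x\<close>, \<open>\<phi>\<^sub>y\<close> and \<open>\<phi>\<^sub>x - \<phi>\<^sub>y\<close>. The weights are half the cotangents of the angles of \<open>P\<close>; they satisfy
  \<open>cx cy + cy cz + cz cx = 1/4\<close> and have the sum \<open>\<sigma> = (sum of the squared sides) / (8 |P|)\<close>. For the
  equilateral triangle all three are equal, \<open>\<sigma> = \<surd>3/2\<close>, and the infimum is \<open>\<Lambda> = 4\<pi>\<^sup>2/\<surd>3\<close>. With the distortion
  \<open>\<rho> = 2\<sigma>/\<surd>3\<close> the theorem follows from two facts.

  First, the isoperimetric deficit lies between \<open>2/3 (\<rho> - 1)\<close> and \<open>\<rho> - 1\<close>
  (\<open>triangle.deficit_bounds\<close>): the upper bound is the inequality between the arithmetic and the quadratic mean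
  of the sides, the lower bound is the inequality of Finsler and Hadwiger.

  Second, \<open>\<Lambda> (99/100 + \<rho>/100) \<le> |P| \<lambda>(P) \<le> \<Lambda> \<rho>\<close> (\<open>triangle.eigenvalue_lower\<close>,
  \<open>triangle.eigenvalue_upper\<close>). For the upper bound, a relabelling of the vertices permutes \<open>X\<close>, \<open>Y\<close>, \<open>Z\<close>;
  averaging over the three cyclic relabellings replaces each weight by \<open>\<sigma>/3\<close>, and the ground state of the equilateral
  triangle is inserted. For the lower bound put \<open>K = 8\<pi>\<^sup>2 N\<close>, the infimum of \<open>X + Y + Z\<close> for given \<open>N\<close>. The energies of
  every test function satisfy the inequality \<open>anisotropy_bound\<close>, which says that \<open>X + Y + Z\<close> exceeds \<open>K\<close> by an
  amount that grows with the spread of \<open>X\<close>, \<open>Y\<close>, \<open>Z\<close>. In determinant form it says that the Gram matrix of the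
  gradient remains large after the subtraction of \<open>K/300\<close> from each energy, and the inequality
  \<open>tr (A B) \<ge> 2 \<surd>(det A det B)\<close> turns this into the stated bound: the part that was subtracted pays for the term
  \<open>\<rho>/100\<close>.

  The anisotropy bound has two regimes. A large spread is controlled by explicit first eigenvalues: strips, the
  right isosceles triangle and half of the equilateral triangle. All of these come from positive eigenfunctions
  by the method of Barta. A small spread is controlled by perturbation theory around the equilateral triangle
  (\<open>near_isotropic_bound\<close>): the first eigenfunction and the pair of eigenfunctions for the next eigenvalue, which is
  \<open>7/3\<close> times the first, are known explicitly, the rest of the spectrum starts at four times the first, and
  the coupling of the ground state to the second eigenspace by a traceless perturbation is an explicit integral.

  Since the first eigenvalue is defined as the least eigenvalue of the weak problem, it has to be identified with the
  infimum of the Rayleigh quotient. The minimiser is found with a compactness inequality that is obtained from the Poincare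
  inequality on small squares.\<close>

section \<open>Square integrable functions\<close>

definition sq_integrable :: "'a measure \<Rightarrow> ('a \<Rightarrow> 'b::euclidean_space) \<Rightarrow> bool" where
  "sq_integrable M f \<longleftrightarrow> f \<in> borel_measurable M \<and> integrable M (\<lambda>x. (norm (f x))\<^sup>2)"

lemma integrable_inner:
  assumes "sq_integrable M f" "sq_integrable M g"
  shows "integrable M (\<lambda>x. f x \<bullet> g x)"
proof (rule Bochner_Integration.integrable_bound)
  show "integrable M (\<lambda>x. (norm (f x))\<^sup>2 + (norm (g x))\<^sup>2)"
    using assms by (auto simp: sq_integrable_def)
  show "(\<lambda>x. f x \<bullet> g x) \<in> borel_measurable M"
    using assms by (auto simp: sq_integrable_def)
  have "\<bar>f x \<bullet> g x\<bar> \<le> (norm (f x))\<^sup>2 + (norm (g x))\<^sup>2" for x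
  proof -
    have "\<bar>f x \<bullet> g x\<bar> \<le> norm (f x) * norm (g x)" by (rule Cauchy_Schwarz_ineq2)
    also have "\<dots> \<le> (norm (f x))\<^sup>2 + (norm (g x))\<^sup>2"
      using sum_squares_bound[of "norm (f x)" "norm (g x)"] mult_nonneg_nonneg[OF norm_ge_zero[of "f x"] norm_ge_zero[of "g x"]]
      by linarith
    finally show ?thesis .
  qed
  then show "AE x in M. norm (f x \<bullet> g x) \<le> norm ((norm (f x))\<^sup>2 + (norm (g x))\<^sup>2)"
    by auto
qed

lemma sq_integrable_scaleR: "sq_integrable M f \<Longrightarrow> sq_integrable M (\<lambda>x. c *\<^sub>R f x)"
  by (auto simp: sq_integrable_def power_mult_distrib)

lemma norm_add_sq: "(norm (a + b))\<^sup>2 = (norm a)\<^sup>2 + 2 * (a \<bullet> b) + (norm (b::'b::real_inner))\<^sup>2"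
  by (simp add: power2_norm_eq_inner inner_add_left inner_add_right inner_commute algebra_simps)

lemma sq_integrable_add:
  assumes "sq_integrable M f" "sq_integrable M g"
  shows "sq_integrable M (\<lambda>x. f x + g x)"
  using assms integrable_inner[OF assms] by (auto simp: sq_integrable_def norm_add_sq)

lemma sq_integrable_diff:
  assumes "sq_integrable M f" "sq_integrable M g"
  shows "sq_integrable M (\<lambda>x. f x - g x)"
  using sq_integrable_add[OF assms(1) sq_integrable_scaleR[OF assms(2), of "-1"]] by simp

lemma integral_norm_add_sq:
  assumes "sq_integrable M f" "sq_integrable M g"
  shows "(LINT x|M. (norm (f x + c *\<^sub>R g x))\<^sup>2) =
    (LINT x|M. (norm (f x))\<^sup>2) + 2 * c * (LINT x|M. f x \<bullet> g x) + c\<^sup>2 * (LINT x|M. (norm (g x))\<^sup>2)"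
  using assms integrable_inner[OF assms]
  by (simp add: sq_integrable_def norm_add_sq power_mult_distrib)

text \<open>The discriminant argument in a form that includes the degenerate leading coefficient \<open>0\<close>. It is used for
  the Cauchy-Schwarz inequality, for the Euler equation of a minimiser and for the Gram matrix of a gradient.\<close>

lemma nonneg_quadratic_discriminant:
  fixes a b c :: real
  assumes "\<And>t. a + 2 * t * b + t\<^sup>2 * c \<ge> 0"
  shows "b\<^sup>2 \<le> a * c"
proof (cases "c = 0")
  case True
  have "b = 0"
  proof (rule ccontr)
    assume "b \<noteq> 0"
    then show False using assms[of "- (a + 1) / (2 * b)"] True by (simp add: field_simps)
  qed
  then show ?thesis using True by simp
next
  case False
  have c: "c \<ge> 0"
  proof (rule ccontr)
    assume "\<not> c \<ge> 0"
    then have c: "c < 0" by simp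
    define t where "t = (\<bar>a\<bar> + 2 * \<bar>b\<bar> + 1) / (- c) + 1"
    have t1: "t \<ge> 1" using c divide_nonneg_pos[of "\<bar>a\<bar> + 2 * \<bar>b\<bar> + 1" "-c"] by (simp only: t_def) linarith
    have "t * (-c) = \<bar>a\<bar> + 2 * \<bar>b\<bar> + 1 - c" using c by (simp add: t_def field_simps)
    then have tc: "t * c < - \<bar>a\<bar> - 2 * \<bar>b\<bar>" using c by linarith
    have "a + 2 * t * b + t\<^sup>2 * c \<le> \<bar>a\<bar> * t + 2 * t * \<bar>b\<bar> + t * (t * c)"
    proof -
      have "a \<le> \<bar>a\<bar> * t" using mult_left_mono[OF t1, of "\<bar>a\<bar>"] by linarith
      moreover have "2 * t * b \<le> 2 * t * \<bar>b\<bar>" using t1 by (intro mult_left_mono) auto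
      ultimately show ?thesis by (simp add: power2_eq_square algebra_simps)
    qed
    also have "\<dots> = t * (\<bar>a\<bar> + 2 * \<bar>b\<bar> + t * c)" by (simp add: algebra_simps)
    also have "\<dots> < 0" using t1 tc by (intro mult_pos_neg) auto
    finally show False using assms[of t] by simp
  qed
  have "a + 2 * (- b / c) * b + (- b / c)\<^sup>2 * c = a - b\<^sup>2 / c"
    using False by (simp add: power2_eq_square field_simps)
  then have "b\<^sup>2 / c \<le> a" using assms[of "- b / c"] by simp
  then show ?thesis using c False by (simp add: divide_le_eq)
qed

lemma integral_Cauchy_Schwarz:
  assumes "sq_integrable M f" "sq_integrable M g"
  shows "(LINT x|M. f x \<bullet> g x)\<^sup>2 \<le> (LINT x|M. (norm (f x))\<^sup>2) * (LINT x|M. (norm (g x))\<^sup>2)"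
proof (rule nonneg_quadratic_discriminant)
  fix t :: real
  have "0 \<le> (LINT x|M. (norm (f x + t *\<^sub>R g x))\<^sup>2)" by simp
  then show "0 \<le> (LINT x|M. (norm (f x))\<^sup>2) + 2 * t * (LINT x|M. f x \<bullet> g x) + t\<^sup>2 * (LINT x|M. (norm (g x))\<^sup>2)"
    by (simp only: integral_norm_add_sq[OF assms])
qed

lemma tendsto_integral_inner:
  assumes f: "\<And>n. sq_integrable M (f n)" "sq_integrable M u" and g: "sq_integrable M g"
    and lim: "(\<lambda>n. LINT x|M. (norm (f n x - u x))\<^sup>2) \<longlonglongrightarrow> 0"
  shows "(\<lambda>n. LINT x|M. f n x \<bullet> g x) \<longlonglongrightarrow> (LINT x|M. u x \<bullet> g x)"
proof -
  have "(\<lambda>n. (LINT x|M. (f n x - u x) \<bullet> g x)\<^sup>2) \<longlonglongrightarrow> 0"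
  proof (rule tendsto_sandwich[OF _ _ tendsto_const])
    show "\<forall>\<^sub>F n in sequentially. (LINT x|M. (f n x - u x) \<bullet> g x)\<^sup>2
        \<le> (LINT x|M. (norm (f n x - u x))\<^sup>2) * (LINT x|M. (norm (g x))\<^sup>2)"
      using integral_Cauchy_Schwarz[OF sq_integrable_diff[OF f(1) f(2)] g] by auto
    show "(\<lambda>n. (LINT x|M. (norm (f n x - u x))\<^sup>2) * (LINT x|M. (norm (g x))\<^sup>2)) \<longlonglongrightarrow> 0"
      using tendsto_mult_right[OF lim, of "LINT x|M. (norm (g x))\<^sup>2"] by simp
  qed auto
  then have "(\<lambda>n. sqrt ((LINT x|M. (f n x - u x) \<bullet> g x)\<^sup>2)) \<longlonglongrightarrow> sqrt 0"
    by (rule tendsto_real_sqrt)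
  then have "(\<lambda>n. LINT x|M. (f n x - u x) \<bullet> g x) \<longlonglongrightarrow> 0"
    by (simp only: real_sqrt_abs real_sqrt_zero tendsto_rabs_zero_iff)
  moreover have "(LINT x|M. (f n x - u x) \<bullet> g x) = (LINT x|M. f n x \<bullet> g x) - (LINT x|M. u x \<bullet> g x)" for n
    by (simp add: inner_diff_left integrable_inner f g)
  ultimately show ?thesis by (simp add: LIM_zero_iff)
qed

lemma tendsto_integral_norm_sq:
  assumes f: "\<And>n. sq_integrable M (f n)" "sq_integrable M u"
    and lim: "(\<lambda>n. LINT x|M. (norm (f n x - u x))\<^sup>2) \<longlonglongrightarrow> 0"
  shows "(\<lambda>n. LINT x|M. (norm (f n x))\<^sup>2) \<longlonglongrightarrow> (LINT x|M. (norm (u x))\<^sup>2)"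
proof -
  have "(LINT x|M. (norm (f n x))\<^sup>2) = (LINT x|M. (norm (f n x - u x))\<^sup>2)
      + 2 * (LINT x|M. f n x \<bullet> u x) - (LINT x|M. (norm (u x))\<^sup>2)" for n
    using integral_norm_add_sq[OF f(1)[of n] f(2), of "-1"] by simp
  moreover have "(\<lambda>n. (LINT x|M. (norm (f n x - u x))\<^sup>2)
      + 2 * (LINT x|M. f n x \<bullet> u x) - (LINT x|M. (norm (u x))\<^sup>2))
    \<longlonglongrightarrow> 0 + 2 * (LINT x|M. u x \<bullet> u x) - (LINT x|M. (norm (u x))\<^sup>2)"
    by (intro tendsto_intros lim tendsto_integral_inner[OF f f(2) lim])
  ultimately show ?thesis by (simp add: power2_norm_eq_inner)
qed

text \<open>Completeness of the space of square integrable functions, for vector values and in terms of integrals rather than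
  equivalence classes. On a finite measure space the sequence is also Cauchy in mean, so a subsequence converges almost
  everywhere, and Fatou's lemma gives the limit in quadratic mean.\<close>

lemma sq_integrable_complete:
  fixes f :: "nat \<Rightarrow> 'a \<Rightarrow> 'b::euclidean_space"
  assumes fin: "finite_measure M" and f: "\<And>n. sq_integrable M (f n)"
    and cauchy: "\<And>e. e > 0 \<Longrightarrow> \<exists>N. \<forall>m\<ge>N. \<forall>n\<ge>N. (LINT x|M. (norm (f m x - f n x))\<^sup>2) < e"
  shows "\<exists>u. sq_integrable M u \<and> (\<lambda>n. LINT x|M. (norm (f n x - u x))\<^sup>2) \<longlonglongrightarrow> 0"
proof -
  interpret finite_measure M by (rule fin)
  have one: "sq_integrable M (\<lambda>_. 1::real)" by (simp add: sq_integrable_def)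
  have nf: "sq_integrable M (\<lambda>x. norm (f m x - f n x))" for m n
    using sq_integrable_diff[OF f f, of m n] unfolding sq_integrable_def by (auto intro: borel_measurable_norm)
  have L1: "\<exists>N. \<forall>i\<ge>N. \<forall>j\<ge>N. (LINT x|M. norm (f i x - f j x)) < e" if e: "e > 0" for e
  proof -
    define C where "C = measure M (space M) + 1"
    have C: "C > 0" using measure_nonneg[of M "space M"] unfolding C_def by linarith
    obtain N where N: "\<And>m n. m \<ge> N \<Longrightarrow> n \<ge> N \<Longrightarrow> (LINT x|M. (norm (f m x - f n x))\<^sup>2) < e\<^sup>2 / C"
      using cauchy[of "e\<^sup>2 / C"] e C by auto
    have "(LINT x|M. norm (f i x - f j x)) < e" if "i \<ge> N" "j \<ge> N" for i j
    proof -
      have "(LINT x|M. norm (f i x - f j x) \<bullet> 1)\<^sup>2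
          \<le> (LINT x|M. (norm (norm (f i x - f j x)))\<^sup>2) * (LINT x|M. (norm (1::real))\<^sup>2)"
        by (rule integral_Cauchy_Schwarz[OF nf one])
      also have "\<dots> \<le> (LINT x|M. (norm (f i x - f j x))\<^sup>2) * C"
        by (simp add: C_def mult_left_mono)
      also have "\<dots> < e\<^sup>2 / C * C"
        using N[OF that] C by (intro mult_strict_right_mono)
      also have "\<dots> = e\<^sup>2" using C by simp
      finally have "(LINT x|M. norm (f i x - f j x))\<^sup>2 < e\<^sup>2" by simp
      then show ?thesis using e by (simp add: power2_less_imp_less)
    qed
    then show ?thesis by blast
  qed
  have intf: "integrable M (f n)" for n
  proof (rule Bochner_Integration.integrable_bound[of M "\<lambda>x. 1 + (norm (f n x))\<^sup>2"])
    show "integrable M (\<lambda>x. 1 + (norm (f n x))\<^sup>2)" using f[of n] by (simp add: sq_integrable_def)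
    show "f n \<in> borel_measurable M" using f[of n] by (simp add: sq_integrable_def)
    have "norm y \<le> 1 + (norm y)\<^sup>2" for y :: 'b
      using sum_squares_bound[of "norm y" 1] norm_ge_zero[of y] unfolding one_power2 by linarith
    then show "AE x in M. norm (f n x) \<le> norm (1 + (norm (f n x))\<^sup>2)"
      by (auto simp: abs_of_nonneg)
  qed
  have "\<exists>r. strict_mono r \<and> (AE x in M. Cauchy (\<lambda>i. f (r i) x))"
  proof (rule cauchy_L1_AE_cauchy_subseq[OF intf])
    show "\<And>e. 0 < e \<Longrightarrow> \<exists>N. \<forall>i\<ge>N. \<forall>j\<ge>N. LINT x|M. norm (f i x - f j x) < e" by (rule L1)
  qed blast
  then obtain r where r: "strict_mono r" and ae: "AE x in M. Cauchy (\<lambda>i. f (r i) x)" by blast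
  define u where "u = (\<lambda>x. if Cauchy (\<lambda>i. f (r i) x) then lim (\<lambda>i. f (r i) x) else 0)"
  have mf[measurable]: "f n \<in> borel_measurable M" for n using f[of n] by (simp add: sq_integrable_def)
  have um[measurable]: "u \<in> borel_measurable M"
    unfolding u_def by measurable
  have lim: "AE x in M. (\<lambda>i. f (r i) x) \<longlonglongrightarrow> u x"
    using ae by eventually_elim (auto simp: u_def convergent_LIMSEQ_iff[symmetric] Cauchy_convergent_iff)
  have bound: "integrable M (\<lambda>x. (norm (f n x - u x))\<^sup>2) \<and> (LINT x|M. (norm (f n x - u x))\<^sup>2) \<le> e"
    if e: "e > 0" and N: "\<And>m. m \<ge> N \<Longrightarrow> (LINT x|M. (norm (f n x - f m x))\<^sup>2) < e" for n N e
  proof -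
    have id: "integrable M (\<lambda>x. (norm (f n x - f m x))\<^sup>2)" for m
      using nf[of n m] by (simp add: sq_integrable_def)
    have "(\<integral>\<^sup>+x. ennreal ((norm (f n x - u x))\<^sup>2) \<partial>M)
        = (\<integral>\<^sup>+x. liminf (\<lambda>i. ennreal ((norm (f n x - f (r i) x))\<^sup>2)) \<partial>M)"
    proof (rule nn_integral_cong_AE, use lim in eventually_elim)
      fix x assume "(\<lambda>i. f (r i) x) \<longlonglongrightarrow> u x"
      then have "(\<lambda>i. ennreal ((norm (f n x - f (r i) x))\<^sup>2)) \<longlonglongrightarrow> ennreal ((norm (f n x - u x))\<^sup>2)"
        by (intro tendsto_intros)
      then show "ennreal ((norm (f n x - u x))\<^sup>2) = liminf (\<lambda>i. ennreal ((norm (f n x - f (r i) x))\<^sup>2))"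
        using lim_imp_Liminf[OF trivial_limit_sequentially] by metis
    qed
    also have "\<dots> \<le> liminf (\<lambda>i. \<integral>\<^sup>+x. ennreal ((norm (f n x - f (r i) x))\<^sup>2) \<partial>M)"
      by (rule nn_integral_liminf) measurable
    also have "\<dots> \<le> ennreal e"
    proof (rule Liminf_le)
      have "(\<integral>\<^sup>+x. ennreal ((norm (f n x - f (r i) x))\<^sup>2) \<partial>M) \<le> ennreal e" if "i \<ge> N" for i
      proof -
        have "r i \<ge> N" using seq_suble[OF r, of i] that by simp
        then show ?thesis using N[of "r i"] by (subst nn_integral_eq_integral[OF id]) (auto intro: ennreal_leI)
      qed
      then show "\<forall>\<^sub>F i in sequentially. (\<integral>\<^sup>+x. ennreal ((norm (f n x - f (r i) x))\<^sup>2) \<partial>M) \<le> ennreal e"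
        by (auto simp: eventually_sequentially)
    qed simp
    finally have b: "(\<integral>\<^sup>+x. ennreal ((norm (f n x - u x))\<^sup>2) \<partial>M) \<le> ennreal e" .
    then have int: "integrable M (\<lambda>x. (norm (f n x - u x))\<^sup>2)"
      by (intro integrableI_bounded) (simp_all add: order_le_less_trans[OF b])
    then show ?thesis using b e by (simp add: nn_integral_eq_integral)
  qed
  have conv: "(\<lambda>n. LINT x|M. (norm (f n x - u x))\<^sup>2) \<longlonglongrightarrow> 0"
  proof (rule LIMSEQ_I)
    fix e :: real assume "e > 0"
    then obtain N where N: "\<And>m n. m \<ge> N \<Longrightarrow> n \<ge> N \<Longrightarrow> (LINT x|M. (norm (f m x - f n x))\<^sup>2) < e / 2"
      using cauchy[of "e / 2"] by auto
    have "(LINT x|M. (norm (f n x - u x))\<^sup>2) \<le> e / 2" if "n \<ge> N" for n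
      using bound[of "e / 2" N n] N[OF that] \<open>e > 0\<close> by simp
    then show "\<exists>no. \<forall>n\<ge>no. norm ((LINT x|M. (norm (f n x - u x))\<^sup>2) - 0) < e"
      using \<open>e > 0\<close> by (intro exI[of _ N]) (force simp: abs_of_nonneg)
  qed
  obtain N where N: "\<And>m n. m \<ge> N \<Longrightarrow> n \<ge> N \<Longrightarrow> (LINT x|M. (norm (f m x - f n x))\<^sup>2) < 1"
    using cauchy[of 1] by auto
  have "integrable M (\<lambda>x. (norm (f N x - u x))\<^sup>2)" using bound[of 1 N N] N by auto
  then have "sq_integrable M (\<lambda>x. f N x - u x)" by (simp add: sq_integrable_def)
  from sq_integrable_diff[OF f[of N] this] have "sq_integrable M u" by simp
  then show ?thesis using conv by blast
qed

section \<open>Test functions\<close>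

text \<open>The gradient vanishes off the same compact set, since that set is closed.\<close>

lemma test_function_support:
  assumes "test_function \<Omega> \<phi> \<phi>'"
  obtains K where "compact K" "K \<subseteq> \<Omega>" "\<And>x. x \<notin> K \<Longrightarrow> \<phi> x = 0" "\<And>x. x \<notin> K \<Longrightarrow> \<phi>' x = 0"
proof -
  from assms obtain K where K: "compact K" "K \<subseteq> \<Omega>" "\<And>x. x \<notin> K \<Longrightarrow> \<phi> x = 0"
    by (auto simp: test_function_def)
  have "\<phi>' x = 0" if x: "x \<notin> K" for x
  proof -
    have "(\<phi> has_derivative (\<lambda>h. 0)) (at x)"
    proof (rule has_derivative_transform_within_open[of "\<lambda>_. 0" _ _ _ "- K"])
      show "open (- K)" using K(1) by (simp add: compact_imp_closed open_Compl)
    qed (use x K(3) in auto)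
    moreover have "(\<phi> has_derivative (\<lambda>h. \<phi>' x \<bullet> h)) (at x)"
      using assms by (simp add: test_function_def)
    ultimately have "(\<lambda>h. \<phi>' x \<bullet> h) = (\<lambda>h. 0)" by (rule has_derivative_unique[THEN sym])
    then have "\<phi>' x \<bullet> \<phi>' x = 0" by meson
    then show ?thesis by simp
  qed
  then show ?thesis using that K by blast
qed

lemma test_function_support_ex:
  assumes "test_function \<Omega> \<phi> \<phi>'"
  shows "\<exists>K. compact K \<and> K \<subseteq> \<Omega> \<and> (\<forall>x. x \<notin> K \<longrightarrow> \<phi> x = 0) \<and> (\<forall>x. x \<notin> K \<longrightarrow> \<phi>' x = 0)"
  using test_function_support[OF assms] by metis

lemma test_function_continuous:
  assumes "test_function \<Omega> \<phi> \<phi>'"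
  shows "continuous_on UNIV \<phi>" "continuous_on UNIV \<phi>'"
  using assms
  by (auto simp: test_function_def intro!: continuous_at_imp_continuous_on has_derivative_continuous)

lemma sq_integrable_compact_support:
  fixes f :: "'a::euclidean_space \<Rightarrow> 'b::euclidean_space"
  assumes f: "continuous_on UNIV f" and K: "compact K" "\<And>x. x \<notin> K \<Longrightarrow> f x = 0"
    and \<Omega>: "bounded \<Omega>" "open \<Omega>"
  shows "sq_integrable (lebesgue_on \<Omega>) f"
proof -
  have m: "f \<in> borel_measurable (lebesgue_on \<Omega>)"
    using f by (intro continuous_imp_measurable_on_sets_lebesgue)
      (auto simp: \<Omega> lmeasurable_open fmeasurableD intro: continuous_on_subset[OF f])
  interpret finite_measure "lebesgue_on \<Omega>"
    using \<Omega> by (intro finite_measure_lebesgue_on) (simp add: lmeasurable_open)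
  have "bounded (f ` K)"
    using f K(1) by (intro compact_imp_bounded compact_continuous_image) (auto intro: continuous_on_subset)
  then obtain B where B: "\<And>x. x \<in> K \<Longrightarrow> norm (f x) \<le> B" by (auto simp: bounded_iff)
  have B': "norm (f x) \<le> \<bar>B\<bar>" for x
    using B[of x] K(2)[of x] by (cases "x \<in> K") auto
  have "integrable (lebesgue_on \<Omega>) (\<lambda>x. (norm (f x))\<^sup>2)"
  proof (rule integrable_const_bound)
    have "norm ((norm (f x))\<^sup>2) \<le> B\<^sup>2" for x
      using power_mono[OF B'[of x] norm_ge_zero, of 2] by simp
    then show "AE x in lebesgue_on \<Omega>. norm ((norm (f x))\<^sup>2) \<le> B\<^sup>2" by blast
    show "(\<lambda>x. (norm (f x))\<^sup>2) \<in> borel_measurable (lebesgue_on \<Omega>)"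
      using m by measurable
  qed
  with m show ?thesis by (simp add: sq_integrable_def)
qed

lemma test_function_sq_integrable:
  assumes "test_function \<Omega> \<phi> \<phi>'" "bounded \<Omega>" "open \<Omega>"
  shows "sq_integrable (lebesgue_on \<Omega>) \<phi>" "sq_integrable (lebesgue_on \<Omega>) \<phi>'"
proof -
  obtain K where K: "compact K" "K \<subseteq> \<Omega>" "\<And>x. x \<notin> K \<Longrightarrow> \<phi> x = 0" "\<And>x. x \<notin> K \<Longrightarrow> \<phi>' x = 0"
    using test_function_support[OF assms(1)] by blast
  show "sq_integrable (lebesgue_on \<Omega>) \<phi>" 
    by (rule sq_integrable_compact_support[OF test_function_continuous(1)[OF assms(1)] K(1,3) assms(2,3)])
  show "sq_integrable (lebesgue_on \<Omega>) \<phi>'"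
    by (rule sq_integrable_compact_support[OF test_function_continuous(2)[OF assms(1)] K(1,4) assms(2,3)])
qed

lemma test_function_add_scaled:
  assumes "test_function \<Omega> \<phi> \<phi>'" "test_function \<Omega> \<psi> \<psi>'"
  shows "test_function \<Omega> (\<lambda>x. \<phi> x + c *\<^sub>R \<psi> x) (\<lambda>x. \<phi>' x + c *\<^sub>R \<psi>' x)"
proof -
  obtain K where K: "compact K" "K \<subseteq> \<Omega>" "\<And>x. x \<notin> K \<Longrightarrow> \<phi> x = 0"
    using assms(1) by (auto simp: test_function_def)
  obtain L where L: "compact L" "L \<subseteq> \<Omega>" "\<And>x. x \<notin> L \<Longrightarrow> \<psi> x = 0"
    using assms(2) by (auto simp: test_function_def)
  have "((\<lambda>x. \<phi> x + c *\<^sub>R \<psi> x) has_derivative (\<lambda>h. (\<phi>' x + c *\<^sub>R \<psi>' x) \<bullet> h)) (at x)" for x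
  proof -
    have "(\<phi> has_derivative (\<lambda>h. \<phi>' x \<bullet> h)) (at x)" "(\<psi> has_derivative (\<lambda>h. \<psi>' x \<bullet> h)) (at x)"
      using assms by (auto simp: test_function_def)
    from has_derivative_add[OF this(1) has_derivative_scaleR_right[OF this(2), of c]]
    show ?thesis by (simp add: inner_add_left)
  qed
  moreover have "continuous_on UNIV (\<lambda>x. \<phi>' x + c *\<^sub>R \<psi>' x)"
    using assms by (auto simp: test_function_def intro!: continuous_intros)
  ultimately show ?thesis
    unfolding test_function_def using K L by (intro conjI exI[of _ "K \<union> L"]) (auto intro: compact_Un)
qed

section \<open>The first eigenvalue as the minimum of the Rayleigh quotient\<close>

text \<open>Only finitely many bounded sequences occur, so a subsequence along which all of them converge is found by finite induction.\<close>

lemma common_convergent_subsequence: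
  fixes x :: "nat \<Rightarrow> nat \<Rightarrow> real"
  assumes "\<And>i. i < N \<Longrightarrow> bounded (range (x i))"
  shows "\<exists>r. strict_mono (r::nat\<Rightarrow>nat) \<and> (\<forall>i<N. convergent (\<lambda>n. x i (r n)))"
  using assms
proof (induction N)
  case 0
  show ?case by (rule exI[of _ id]) (auto simp: strict_mono_def)
next
  case (Suc N)
  then obtain r where r: "strict_mono r" "\<forall>i<N. convergent (\<lambda>n. x i (r n))"
    by (metis less_Suc_eq)
  have "bounded (range (\<lambda>n. x N (r n)))"
    using Suc.prems[of N] by (rule bounded_subset) auto
  then obtain l q where q: "strict_mono q" "((\<lambda>n. x N (r n)) \<circ> q) \<longlonglongrightarrow> l"
    using bounded_imp_convergent_subsequence by blast
  show ?case
  proof (intro exI[of _ "r \<circ> q"] conjI allI impI)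
    show "strict_mono (r \<circ> q)" using r(1) q(1) by (simp add: strict_mono_o)
    fix i assume "i < Suc N"
    then consider "i = N" | "i < N" by linarith
    then show "convergent (\<lambda>n. x i ((r \<circ> q) n))"
    proof cases
      case 1
      then show ?thesis using q(2) by (auto simp: o_def convergent_def)
    next
      case 2
      then show ?thesis using r(2) convergent_subseq_convergent[of "\<lambda>n. x i (r n)" q] q(1)
        by (auto simp: o_def)
    qed
  qed
qed

text \<open>The last assumption replaces the compactness theorem of Rellich: up to finitely many bounded linear functionals,
  the energy dominates any prescribed multiple of the squared norm. This is exactly what makes a minimising sequence
  Cauchy once the functionals converge along it.\<close>

locale rayleigh =
  fixes \<Omega> :: "'a::euclidean_space set"
  assumes op: "open \<Omega>" and bd: "bounded \<Omega>"
    and nontrivial: "\<exists>\<phi> \<phi>'. test_function \<Omega> \<phi> \<phi>' \<and> (LINT x|lebesgue_on \<Omega>. (norm (\<phi> x))\<^sup>2) > 0"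
    and compactness: "\<And>\<Lambda>. \<exists>N C (L :: nat \<Rightarrow> ('a \<Rightarrow> real) \<Rightarrow> real). C \<ge> 0 \<and>
      (\<forall>\<phi> \<phi>'. test_function \<Omega> \<phi> \<phi>' \<longrightarrow>
        (\<forall>i<N. (L i \<phi>)\<^sup>2 \<le> C * (LINT x|lebesgue_on \<Omega>. (norm (\<phi> x))\<^sup>2)) \<and>
        \<Lambda> * (LINT x|lebesgue_on \<Omega>. (norm (\<phi> x))\<^sup>2)
          \<le> (LINT x|lebesgue_on \<Omega>. (norm (\<phi>' x))\<^sup>2) + C * (\<Sum>i<N. (L i \<phi>)\<^sup>2)) \<and>
      (\<forall>\<phi> \<phi>' \<psi> \<psi>' i. test_function \<Omega> \<phi> \<phi>' \<longrightarrow> test_function \<Omega> \<psi> \<psi>' \<longrightarrow>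
        L i (\<lambda>x. \<phi> x - \<psi> x) = L i \<phi> - L i \<psi>)"
begin

abbreviation "M \<equiv> lebesgue_on \<Omega>"
abbreviation energy :: "('a \<Rightarrow> 'b::euclidean_space) \<Rightarrow> real" where
  "energy f \<equiv> (LINT x|M. (norm (f x))\<^sup>2)"

definition \<mu> where "\<mu> = Inf {energy \<phi>' |\<phi> \<phi>'. test_function \<Omega> \<phi> \<phi>' \<and> energy \<phi> = 1}"

lemma test_scale:
  "test_function \<Omega> \<phi> \<phi>' \<Longrightarrow> test_function \<Omega> (\<lambda>x. c *\<^sub>R \<phi> x) (\<lambda>x. c *\<^sub>R \<phi>' x)"
proof -
  assume t: "test_function \<Omega> \<phi> \<phi>'"
  have "test_function \<Omega> (\<lambda>x. 0::real) (\<lambda>x. 0)"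
    by (auto simp: test_function_def intro: exI[of _ "{}"])
  from test_function_add_scaled[OF this t, of c] show ?thesis by simp
qed

lemma energy_scale: "energy (\<lambda>x. c *\<^sub>R f x) = c\<^sup>2 * energy f"
  by (simp add: power_mult_distrib)

lemma normalised_test_function:
  "{energy \<phi>' |\<phi> \<phi>'. test_function \<Omega> \<phi> \<phi>' \<and> energy \<phi> = 1} \<noteq> {}"
proof -
  obtain \<phi> \<phi>' where t: "test_function \<Omega> \<phi> \<phi>'" and p: "energy \<phi> > 0" using nontrivial by blast
  have "energy (\<lambda>x. (1 / sqrt (energy \<phi>)) *\<^sub>R \<phi> x) = 1"
    using p by (subst energy_scale) (simp add: power_divide)
  then show ?thesis using test_scale[OF t] by blast
qed

lemma \<mu>_le:
  assumes t: "test_function \<Omega> \<phi> \<phi>'"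
  shows "\<mu> * energy \<phi> \<le> energy \<phi>'"
proof (cases "energy \<phi> > 0")
  case True
  define c where "c = 1 / sqrt (energy \<phi>)"
  have e: "energy (\<lambda>x. c *\<^sub>R \<phi> x) = 1"
    using True by (subst energy_scale) (simp add: power_divide c_def)
  have "energy (\<lambda>x. c *\<^sub>R \<phi>' x) \<in> {energy \<phi>' |\<phi> \<phi>'. test_function \<Omega> \<phi> \<phi>' \<and> energy \<phi> = 1}"
    unfolding mem_Collect_eq
    by (intro exI[of _ "\<lambda>x. c *\<^sub>R \<phi> x"] exI[of _ "\<lambda>x. c *\<^sub>R \<phi>' x"] conjI refl test_scale[OF t] e)
  moreover have "bdd_below {energy \<phi>' |\<phi> \<phi>'. test_function \<Omega> \<phi> \<phi>' \<and> energy \<phi> = 1}"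
    by (rule bdd_belowI[of _ 0]) auto
  ultimately have "\<mu> \<le> energy (\<lambda>x. c *\<^sub>R \<phi>' x)"
    unfolding \<mu>_def by (rule cInf_lower)
  also have "\<dots> = energy \<phi>' / energy \<phi>"
    using True by (subst energy_scale) (simp add: power_divide c_def)
  finally show ?thesis using True by (simp add: field_simps)
next
  case False
  moreover have "energy \<phi> \<ge> 0" by simp
  ultimately have "energy \<phi> = 0" by linarith
  then show ?thesis by simp
qed

lemma test_sq_integrable: "test_function \<Omega> \<phi> \<phi>' \<Longrightarrow> sq_integrable M \<phi>" "test_function \<Omega> \<phi> \<phi>' \<Longrightarrow> sq_integrable M \<phi>'"
  by (rule test_function_sq_integrable(1)[OF _ bd op], assumption)
     (rule test_function_sq_integrable(2)[OF _ bd op], assumption)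

lemma parallelogram:
  assumes "sq_integrable M f" "sq_integrable M g"
  shows "energy (\<lambda>x. f x - g x) = 2 * energy f + 2 * energy g - energy (\<lambda>x. f x + g x)"
  using integral_norm_add_sq[OF assms, of 1] integral_norm_add_sq[OF assms, of "-1"] by simp

lemma finite_M: "finite_measure M"
  using op bd by (intro finite_measure_lebesgue_on) (simp add: lmeasurable_open)

text \<open>The direct method. A minimising sequence along which the functionals converge is Cauchy in the norm and in energy: by the
  parallelogram law \<open>energy (f' m - f' n)\<close> is at most \<open>\<mu> energy (f m - f n)\<close> up to a small error, while the
  compactness assumption with the constant \<open>\<mu> + 1\<close> bounds it from below by \<open>(\<mu> + 1) energy (f m - f n)\<close> up to
  the differences of the functionals. The weak equation of the limit is the vanishing of the first variation, in the
  quantitative form of a discriminant that tends to \<open>0\<close>.\<close>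

lemma eigen_\<mu>: "dirichlet_eigenvalue \<Omega> \<mu>"
proof -
  have "\<exists>\<phi> \<phi>'. test_function \<Omega> \<phi> \<phi>' \<and> energy \<phi> = 1 \<and> energy \<phi>' < \<mu> + 1 / Suc n" for n
  proof -
    have "\<mu> < \<mu> + 1 / Suc n" by simp
    then show ?thesis
      unfolding \<mu>_def using cInf_lessD[OF normalised_test_function] by blast
  qed
  then obtain f0 f0' where f0: "\<And>n. test_function \<Omega> (f0 n) (f0' n)" "\<And>n. energy (f0 n) = 1"
    "\<And>n. energy (f0' n) < \<mu> + 1 / Suc n"
    by metis
  obtain N C and L :: "nat \<Rightarrow> ('a \<Rightarrow> real) \<Rightarrow> real" where C: "C \<ge> 0"
    and Lb: "\<And>\<phi> \<phi>' i. test_function \<Omega> \<phi> \<phi>' \<Longrightarrow> i < N \<Longrightarrow> (L i \<phi>)\<^sup>2 \<le> C * energy \<phi>"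
    and coer: "\<And>\<phi> \<phi>'. test_function \<Omega> \<phi> \<phi>' \<Longrightarrow> (\<mu> + 1) * energy \<phi> \<le> energy \<phi>' + C * (\<Sum>i<N. (L i \<phi>)\<^sup>2)"
    and Ld: "\<And>\<phi> \<phi>' \<psi> \<psi>' i. test_function \<Omega> \<phi> \<phi>' \<Longrightarrow> test_function \<Omega> \<psi> \<psi>' \<Longrightarrow>
        L i (\<lambda>x. \<phi> x - \<psi> x) = L i \<phi> - L i \<psi>"
    using compactness[of "\<mu> + 1"] by blast
  have "bounded (range (\<lambda>n. L i (f0 n)))" if "i < N" for i
  proof -
    have "\<bar>L i (f0 n)\<bar> \<le> sqrt C" for n
      using Lb[OF f0(1) that, of n] f0(2)[of n] by (intro real_le_rsqrt) simp
    then show ?thesis by (auto simp: bounded_iff)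
  qed
  then obtain r where r: "strict_mono (r :: nat \<Rightarrow> nat)"
    and conv: "\<And>i. i < N \<Longrightarrow> convergent (\<lambda>n. L i (f0 (r n)))"
    using common_convergent_subsequence[of N "\<lambda>i n. L i (f0 n)"] by auto
  define f where "f n = f0 (r n)" for n
  define f' where "f' n = f0' (r n)" for n
  have tf: "test_function \<Omega> (f n) (f' n)" for n using f0 by (simp add: f_def f'_def)
  have nf: "energy (f n) = 1" for n using f0(2) by (simp add: f_def)
  have ef: "energy (f' n) \<le> \<mu> + 1 / Suc n" for n
  proof -
    have "r n \<ge> n" by (rule seq_suble[OF r])
    then have "1 / real (Suc (r n)) \<le> 1 / Suc n" by (intro divide_left_mono) auto
    then show ?thesis using f0(3)[of "r n"] by (simp add: f'_def)
  qed
  have elow: "energy (f' n) \<ge> \<mu>" for n using \<mu>_le[OF tf[of n]] nf[of n] by simp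
  have tdiff: "test_function \<Omega> (\<lambda>x. f m x - f n x) (\<lambda>x. f' m x - f' n x)" for m n
    using test_function_add_scaled[OF tf[of m] tf[of n], of "-1"] by simp
  have tadd: "test_function \<Omega> (\<lambda>x. f m x + f n x) (\<lambda>x. f' m x + f' n x)" for m n
    using test_function_add_scaled[OF tf[of m] tf[of n], of "1"] by simp
  \<comment> \<open>The parallelogram law; the sum of two members is compared with the infimum.\<close>
  have up: "energy (\<lambda>x. f' m x - f' n x) \<le> \<mu> * energy (\<lambda>x. f m x - f n x) + 2 / Suc m + 2 / Suc n" for m n
  proof -
    have "energy (\<lambda>x. f' m x - f' n x) = 2 * energy (f' m) + 2 * energy (f' n) - energy (\<lambda>x. f' m x + f' n x)"
      by (rule parallelogram) (use test_sq_integrable tf in blast)+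
    moreover have "energy (\<lambda>x. f m x - f n x) = 2 * energy (f m) + 2 * energy (f n) - energy (\<lambda>x. f m x + f n x)"
      by (rule parallelogram) (use test_sq_integrable tf in blast)+
    then have "energy (\<lambda>x. f m x + f n x) = 4 - energy (\<lambda>x. f m x - f n x)"
      unfolding nf by linarith
    then have "\<mu> * energy (\<lambda>x. f m x + f n x) = 4 * \<mu> - \<mu> * energy (\<lambda>x. f m x - f n x)"
      by (simp only: right_diff_distrib mult.commute)
    moreover note \<mu>_le[OF tadd[of m n]] ef[of m] ef[of n]
    ultimately show ?thesis by simp
  qed
  \<comment> \<open>A common threshold for the finitely many functionals is the sum of the individual ones.\<close>
  have lcauchy: "\<exists>n0. \<forall>m\<ge>n0. \<forall>n\<ge>n0. C * (\<Sum>i<N. (L i (\<lambda>x. f m x - f n x))\<^sup>2) < e" if e: "e > 0" for e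
  proof -
    define d where "d = sqrt (e / (C * N + 1))"
    have CN: "C * N + 1 > 0" using C by (intro add_nonneg_pos mult_nonneg_nonneg) auto
    have d: "d > 0" using e CN by (simp add: d_def)
    have "\<exists>k. \<forall>m\<ge>k. \<forall>n\<ge>k. \<bar>L i (f m) - L i (f n)\<bar> < d" if "i < N" for i
    proof -
      have "Cauchy (\<lambda>n. L i (f n))" using conv[OF that] by (simp add: f_def convergent_Cauchy)
      then show ?thesis using d by (simp add: Cauchy_def dist_real_def)
    qed
    then obtain k where k: "\<And>i m n. i < N \<Longrightarrow> m \<ge> k i \<Longrightarrow> n \<ge> k i \<Longrightarrow> \<bar>L i (f m) - L i (f n)\<bar> < d"
      by metis
    define n0 where "n0 = (\<Sum>i<N. k i)"
    have "C * (\<Sum>i<N. (L i (\<lambda>x. f m x - f n x))\<^sup>2) < e" if mn: "m \<ge> n0" "n \<ge> n0" for m n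
    proof -
      have "(L i (\<lambda>x. f m x - f n x))\<^sup>2 \<le> d\<^sup>2" if "i < N" for i
      proof -
        have "k i \<le> n0" unfolding n0_def using that by (intro member_le_sum) auto
        then have "\<bar>L i (f m) - L i (f n)\<bar> < d" using k[OF that] mn by auto
        then show ?thesis
          unfolding Ld[OF tf tf] using abs_le_square_iff[of "L i (f m) - L i (f n)" d] d by simp
      qed
      then have "(\<Sum>i<N. (L i (\<lambda>x. f m x - f n x))\<^sup>2) \<le> (\<Sum>i<N. d\<^sup>2)"
        by (intro sum_mono) auto
      then have "C * (\<Sum>i<N. (L i (\<lambda>x. f m x - f n x))\<^sup>2) \<le> C * (N * d\<^sup>2)"
        using C by (simp add: mult_left_mono)
      also have "\<dots> = (C * N) * (e / (C * N + 1))" using e CN by (simp add: d_def)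
      also have "\<dots> < e" using e CN by (simp add: field_simps)
      finally show ?thesis .
    qed
    then show ?thesis by blast
  qed
  have low: "energy (\<lambda>x. f m x - f n x) \<le> 2 / Suc m + 2 / Suc n + C * (\<Sum>i<N. (L i (\<lambda>x. f m x - f n x))\<^sup>2)" for m n
    using coer[OF tdiff[of m n]] up[of m n] by (simp add: algebra_simps)
  have tail: "\<exists>n0. \<forall>m\<ge>n0. \<forall>n\<ge>n0. 2 / Suc m + 2 / Suc n < e" if e: "e > 0" for e :: real
  proof -
    obtain n0 :: nat where n0: "4 / e < n0" using reals_Archimedean2 by blast
    have half: "2 / real (Suc m) < e / 2" if "m \<ge> n0" for m
    proof -
      have "4 / e < Suc m" using n0 that by linarith
      then show ?thesis using e by (simp add: field_simps)
    qed
    have "2 / real (Suc m) + 2 / real (Suc n) < e" if "m \<ge> n0" "n \<ge> n0" for m n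
      using half[OF that(1)] half[OF that(2)] by linarith
    then show ?thesis by blast
  qed
  have cauchy: "\<exists>n0. \<forall>m\<ge>n0. \<forall>n\<ge>n0. energy (\<lambda>x. f m x - f n x) < e" if e: "e > 0" for e
  proof -
    obtain a where a: "\<And>m n. m \<ge> a \<Longrightarrow> n \<ge> a \<Longrightarrow> C * (\<Sum>i<N. (L i (\<lambda>x. f m x - f n x))\<^sup>2) < e / 2"
      using lcauchy[of "e / 2"] e by auto
    obtain b where b: "\<And>m n. m \<ge> b \<Longrightarrow> n \<ge> b \<Longrightarrow> 2 / Suc m + 2 / Suc n < e / 2"
      using tail[of "e / 2"] e by auto
    have "energy (\<lambda>x. f m x - f n x) < e" if "m \<ge> max a b" "n \<ge> max a b" for m n
      using a[of m n] b[of m n] low[of m n] that by simp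
    then show ?thesis by blast
  qed
  have \<mu>0: "\<mu> \<ge> 0"
    unfolding \<mu>_def using normalised_test_function by (intro cInf_greatest) auto
  have cauchy': "\<exists>n0. \<forall>m\<ge>n0. \<forall>n\<ge>n0. energy (\<lambda>x. f' m x - f' n x) < e" if e: "e > 0" for e
  proof -
    have "e / 2 / (\<mu> + 1) > 0" using e \<mu>0 by simp
    then obtain a where a: "\<And>m n. m \<ge> a \<Longrightarrow> n \<ge> a \<Longrightarrow> energy (\<lambda>x. f m x - f n x) < e / 2 / (\<mu> + 1)"
      using cauchy by blast
    obtain b where b: "\<And>m n. m \<ge> b \<Longrightarrow> n \<ge> b \<Longrightarrow> 2 / Suc m + 2 / Suc n < e / 2"
      using tail[of "e / 2"] e by auto
    have "energy (\<lambda>x. f' m x - f' n x) < e" if "m \<ge> max a b" "n \<ge> max a b" for m n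
    proof -
      have "\<mu> * energy (\<lambda>x. f m x - f n x) \<le> (\<mu> + 1) * (e / 2 / (\<mu> + 1))"
        using a[of m n] that \<mu>0 by (intro mult_mono) (auto intro: less_imp_le)
      also have "\<dots> = e / 2" using \<mu>0 by (intro nonzero_mult_div_cancel_left[of "\<mu> + 1", unfolded times_divide_eq_right[symmetric]]) simp
      finally show ?thesis using b[of m n] up[of m n] that by simp
    qed
    then show ?thesis by blast
  qed
  obtain u where u: "sq_integrable M u" "(\<lambda>n. energy (\<lambda>x. f n x - u x)) \<longlonglongrightarrow> 0"
    using sq_integrable_complete[OF finite_M, of f] test_sq_integrable(1)[OF tf] cauchy by blast
  obtain g where g: "sq_integrable M g" "(\<lambda>n. energy (\<lambda>x. f' n x - g x)) \<longlonglongrightarrow> 0"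
    using sq_integrable_complete[OF finite_M, of f'] test_sq_integrable(2)[OF tf] cauchy' by blast
  have sob: "sobolev_zero \<Omega> u g"
    unfolding sobolev_zero_def using u g tf
    by (auto simp: sq_integrable_def intro!: exI[of _ f] exI[of _ f'])
  have "energy u = 1"
    using LIMSEQ_unique[OF tendsto_integral_norm_sq[OF test_sq_integrable(1)[OF tf] u]] nf by simp
  then have nz: "\<not> (AE x in M. u x = 0)"
  proof -
    have False if "AE x in M. u x = 0"
    proof -
      have "energy u = (LINT x|M. (0::real))"
        by (rule integral_cong_AE) (use that u(1) in \<open>auto simp: sq_integrable_def\<close>)
      then show False using \<open>energy u = 1\<close> by simp
    qed
    then show ?thesis by blast
  qed
  have weak: "(LINT x|M. g x \<bullet> \<phi>' x) = \<mu> * (LINT x|M. u x * \<phi> x)" if t: "test_function \<Omega> \<phi> \<phi>'" for \<phi> \<phi>'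
  proof -
    define B where "B n = (LINT x|M. f' n x \<bullet> \<phi>' x) - \<mu> * (LINT x|M. f n x \<bullet> \<phi> x)" for n
    have lim: "B \<longlonglongrightarrow> (LINT x|M. g x \<bullet> \<phi>' x) - \<mu> * (LINT x|M. u x \<bullet> \<phi> x)"
      unfolding B_def by (intro tendsto_intros tendsto_integral_inner test_sq_integrable[OF tf] u g test_sq_integrable[OF t])
    \<comment> \<open>The first variation at an almost minimiser is small.\<close>
    have "(B n)\<^sup>2 \<le> (energy (f' n) - \<mu>) * (energy \<phi>' - \<mu> * energy \<phi>)" for n
    proof (rule nonneg_quadratic_discriminant)
      fix s :: real
      have "\<mu> * energy (\<lambda>x. f n x + s *\<^sub>R \<phi> x) \<le> energy (\<lambda>x. f' n x + s *\<^sub>R \<phi>' x)"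
        by (rule \<mu>_le[OF test_function_add_scaled[OF tf t]])
      then show "0 \<le> energy (f' n) - \<mu> + 2 * s * B n + s\<^sup>2 * (energy \<phi>' - \<mu> * energy \<phi>)"
        unfolding integral_norm_add_sq[OF test_sq_integrable(1)[OF tf] test_sq_integrable(1)[OF t]] integral_norm_add_sq[OF test_sq_integrable(2)[OF tf] test_sq_integrable(2)[OF t]] nf B_def
        by (simp add: algebra_simps)
    qed
    moreover have "(energy (f' n) - \<mu>) * (energy \<phi>' - \<mu> * energy \<phi>) \<le> 1 / Suc n * (energy \<phi>' - \<mu> * energy \<phi>)" for n
      using ef[of n] \<mu>_le[OF t] by (intro mult_right_mono) auto
    ultimately have b: "(B n)\<^sup>2 \<le> 1 / Suc n * (energy \<phi>' - \<mu> * energy \<phi>)" for n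
      by (meson order_trans)
    have z: "(\<lambda>n. 1 / real (Suc n) * (energy \<phi>' - \<mu> * energy \<phi>)) \<longlonglongrightarrow> 0"
      using tendsto_mult_right[OF LIMSEQ_Suc[OF lim_1_over_n]] by (auto simp: tendsto_mult_left_zero)
    have "(\<lambda>n. (B n)\<^sup>2) \<longlonglongrightarrow> 0"
      by (rule tendsto_sandwich[OF _ _ tendsto_const z]) (use b in auto)
    from LIMSEQ_unique[OF this tendsto_power[OF lim]]
    show ?thesis by simp
  qed
  show ?thesis
    unfolding dirichlet_eigenvalue_def using sob nz weak by blast
qed

text \<open>The eigenfunction is a limit of test functions, so it may be inserted both into the weak equation and into the
  variational inequality.\<close>

lemma eigen_ge:
  assumes "dirichlet_eigenvalue \<Omega> \<nu>"
  shows "\<mu> \<le> \<nu>"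
proof -
  obtain u g where sob: "sobolev_zero \<Omega> u g" and nz: "\<not> (AE x in M. u x = 0)"
    and weak: "\<And>\<phi> \<phi>'. test_function \<Omega> \<phi> \<phi>' \<Longrightarrow> (LINT x|M. g x \<bullet> \<phi>' x) = \<nu> * (LINT x|M. u x * \<phi> x)"
    using assms by (auto simp: dirichlet_eigenvalue_def)
  obtain f f' where tf: "\<And>n. test_function \<Omega> (f n) (f' n)"
    and l: "(\<lambda>n. LINT x|M. (f n x - u x)\<^sup>2) \<longlonglongrightarrow> 0" and l': "(\<lambda>n. energy (\<lambda>x. f' n x - g x)) \<longlonglongrightarrow> 0"
    and u: "sq_integrable M u" and g: "sq_integrable M g"
    using sob by (auto simp: sobolev_zero_def sq_integrable_def)
  have l: "(\<lambda>n. energy (\<lambda>x. f n x - u x)) \<longlonglongrightarrow> 0" using l by simp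
  note c = tendsto_integral_inner[OF test_sq_integrable(1)[OF tf] u u l] tendsto_integral_inner[OF test_sq_integrable(2)[OF tf] g g l']
  have "(LINT x|M. f' n x \<bullet> g x) = \<nu> * (LINT x|M. f n x \<bullet> u x)" for n
    using weak[OF tf[of n]] by (simp add: inner_commute mult.commute)
  then have eq: "(LINT x|M. g x \<bullet> g x) = \<nu> * (LINT x|M. u x \<bullet> u x)"
    using LIMSEQ_unique[OF c(2)] tendsto_mult_left[OF c(1), of \<nu>] by simp
  have "\<mu> * energy u \<le> energy g"
    by (rule LIMSEQ_le[OF tendsto_mult_left[OF tendsto_integral_norm_sq[OF test_sq_integrable(1)[OF tf] u l]]
        tendsto_integral_norm_sq[OF test_sq_integrable(2)[OF tf] g l']]) (use \<mu>_le[OF tf] in auto)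
  moreover have "energy g = \<nu> * energy u" using eq by (simp only: power2_norm_eq_inner)
  ultimately have le: "\<mu> * energy u \<le> \<nu> * energy u" by simp
  have "energy u \<noteq> 0"
  proof
    assume "energy u = 0"
    then have "AE x in M. (norm (u x))\<^sup>2 = 0"
      using u by (subst (asm) integral_nonneg_eq_0_iff_AE) (auto simp: sq_integrable_def)
    then show False using nz by simp
  qed
  moreover have "energy u \<ge> 0" by simp
  ultimately have "energy u > 0" by linarith
  with le show ?thesis by simp
qed

lemma first_eigenvalue: "first_dirichlet_eigenvalue \<Omega> = \<mu>"
  unfolding first_dirichlet_eigenvalue_def using eigen_\<mu> eigen_ge by (intro Least_equality) auto

lemma first_eigenvalue_le:
  "test_function \<Omega> \<phi> \<phi>' \<Longrightarrow> first_dirichlet_eigenvalue \<Omega> * energy \<phi> \<le> energy \<phi>'"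
  unfolding first_eigenvalue by (rule \<mu>_le)

lemma le_first_eigenvalue:
  assumes "\<And>\<phi> \<phi>'. test_function \<Omega> \<phi> \<phi>' \<Longrightarrow> B * energy \<phi> \<le> energy \<phi>'"
  shows "B \<le> first_dirichlet_eigenvalue \<Omega>"
  unfolding first_eigenvalue \<mu>_def
  using normalised_test_function
proof (rule cInf_greatest)
  fix x assume "x \<in> {energy \<phi>' |\<phi> \<phi>'. test_function \<Omega> \<phi> \<phi>' \<and> energy \<phi> = 1}"
  then show "B \<le> x" using assms by force
qed

end

section \<open>Affine coordinates on a triangle\<close>

definition unit_triangle :: "(real \<times> real) set" where
  "unit_triangle = {p. 0 \<le> fst p \<and> 0 \<le> snd p \<and> fst p + snd p \<le> 1}"

definition open_unit_triangle :: "(real \<times> real) set" where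
  "open_unit_triangle = {p. 0 < fst p \<and> 0 < snd p \<and> fst p + snd p < 1}"

lemma open_unit_triangle_open: "open open_unit_triangle"
proof -
  have "open_unit_triangle = {p. 0 < fst p} \<inter> {p. 0 < snd p} \<inter> {p. fst p + snd p < 1}"
    by (auto simp: open_unit_triangle_def)
  also have "open \<dots>"
    by (intro open_Int open_Collect_less continuous_intros)
  finally show ?thesis .
qed

text \<open>The value of the Jacobian is irrelevant below, because only quotients of integrals matter; hence the factor \<open>D\<close> is
  left unspecified. If the first coefficient is nonzero, the substitution is done one variable at a time; otherwise the
  two variables are interchanged.\<close>

lemma nn_integral_plane_affine:
  fixes \<alpha> \<beta> \<gamma> \<delta> r s :: real
  assumes det: "\<alpha> * \<delta> - \<beta> * \<gamma> \<noteq> 0"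
  shows "\<exists>D>0. \<forall>F \<in> borel_measurable (borel :: (real \<times> real) measure). (\<integral>\<^sup>+p. F (r + \<alpha> * fst p + \<beta> * snd p, s + \<gamma> * fst p + \<delta> * snd p) \<partial>lborel)
    = ennreal D * (\<integral>\<^sup>+p. F p \<partial>lborel)"
proof -
  have main: "\<exists>D>0. \<forall>F \<in> borel_measurable (borel :: (real \<times> real) measure).
      (\<integral>\<^sup>+y. \<integral>\<^sup>+x. F (r + \<alpha> * x + \<beta> * y, s + \<gamma> * x + \<delta> * y) \<partial>lborel \<partial>lborel) = ennreal D * (\<integral>\<^sup>+p. F p \<partial>lborel)"
    if det: "\<alpha> * \<delta> - \<beta> * \<gamma> \<noteq> 0" and \<alpha>: "\<alpha> \<noteq> 0" for \<alpha> \<beta> \<gamma> \<delta> :: real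
  proof -
    define d where "d = \<delta> - \<beta> * \<gamma> / \<alpha>"
    have d: "d \<noteq> 0" using det \<alpha> by (auto simp: d_def field_simps)
    define D where "D = 1 / \<bar>\<alpha>\<bar> * (1 / \<bar>d\<bar>)"
    have "(\<integral>\<^sup>+y. \<integral>\<^sup>+x. F (r + \<alpha> * x + \<beta> * y, s + \<gamma> * x + \<delta> * y) \<partial>lborel \<partial>lborel) = ennreal D * (\<integral>\<^sup>+p. F p \<partial>lborel)"
      if [measurable]: "F \<in> borel_measurable (borel :: (real \<times> real) measure)" for F
    proof -
      have [measurable]: "F \<in> borel_measurable (borel \<Otimes>\<^sub>M borel)" by (simp add: borel_prod)
      have 1: "(\<integral>\<^sup>+x. F (r + \<alpha> * x + \<beta> * y, s + \<gamma> * x + \<delta> * y) \<partial>lborel)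
          = ennreal (1 / \<bar>\<alpha>\<bar>) * (\<integral>\<^sup>+x. F (x, s + \<gamma> * (x - r) / \<alpha> + d * y) \<partial>lborel)" for y
      proof -
        define i where "i = inverse \<alpha>"
        have i: "\<alpha> * i = 1" using \<alpha> by (simp add: i_def)
        have arg: "(r + \<alpha> * (- (r + \<beta> * y) * i + i * x) + \<beta> * y, s + \<gamma> * (- (r + \<beta> * y) * i + i * x) + \<delta> * y)
            = (x, s + \<gamma> * (x - r) / \<alpha> + d * y)" for x
        proof -
          have "\<alpha> * (- (r + \<beta> * y) * i + i * x) = (\<alpha> * i) * (x - r - \<beta> * y)" by (simp add: algebra_simps)
          then show ?thesis unfolding i by (simp add: d_def divide_inverse i_def[symmetric] algebra_simps)
        qed
        have "\<bar>i\<bar> = 1 / \<bar>\<alpha>\<bar>" by (simp add: i_def divide_inverse)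
        moreover have "i \<noteq> 0" using \<alpha> by (simp add: i_def)
        ultimately show ?thesis
          by (subst nn_integral_real_affine[where c = i and t = "- (r + \<beta> * y) * i"]) (simp_all only: arg, measurable)
      qed
      have 2: "(\<integral>\<^sup>+y. F (x, s + \<gamma> * (x - r) / \<alpha> + d * y) \<partial>lborel) = ennreal (1 / \<bar>d\<bar>) * (\<integral>\<^sup>+y. F (x, y) \<partial>lborel)" for x
        by (subst nn_integral_real_affine[where c = "1 / d" and t = "- (s + \<gamma> * (x - r) / \<alpha>) / d"])
           (use d in \<open>auto simp: field_simps intro!: nn_integral_cong\<close>)
      have "(\<integral>\<^sup>+y. \<integral>\<^sup>+x. F (r + \<alpha> * x + \<beta> * y, s + \<gamma> * x + \<delta> * y) \<partial>lborel \<partial>lborel)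
          = ennreal (1 / \<bar>\<alpha>\<bar>) * (\<integral>\<^sup>+y. \<integral>\<^sup>+x. F (x, s + \<gamma> * (x - r) / \<alpha> + d * y) \<partial>lborel \<partial>lborel)"
        unfolding 1 by (rule nn_integral_cmult) measurable
      also have "(\<integral>\<^sup>+y. \<integral>\<^sup>+x. F (x, s + \<gamma> * (x - r) / \<alpha> + d * y) \<partial>lborel \<partial>lborel)
          = (\<integral>\<^sup>+x. \<integral>\<^sup>+y. F (x, s + \<gamma> * (x - r) / \<alpha> + d * y) \<partial>lborel \<partial>lborel)"
        by (rule lborel_pair.Fubini') measurable
      also have "\<dots> = ennreal (1 / \<bar>d\<bar>) * (\<integral>\<^sup>+x. \<integral>\<^sup>+y. F (x, y) \<partial>lborel \<partial>lborel)"
        unfolding 2 by (rule nn_integral_cmult) measurable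
      also have "(\<integral>\<^sup>+x. \<integral>\<^sup>+y. F (x, y) \<partial>lborel \<partial>lborel) = (\<integral>\<^sup>+p. F p \<partial>lborel)"
        unfolding lborel_prod[symmetric] by (rule lborel.nn_integral_fst) measurable
      finally show ?thesis unfolding D_def by (subst ennreal_mult) (auto simp: mult.assoc)
    qed
    moreover have "D > 0" using \<alpha> d by (simp add: D_def)
    ultimately show ?thesis by blast
  qed
  have iter: "(\<integral>\<^sup>+p. G (fst p) (snd p) \<partial>lborel) = (\<integral>\<^sup>+y. \<integral>\<^sup>+x. G x y \<partial>lborel \<partial>lborel)"
    "(\<integral>\<^sup>+p. G (fst p) (snd p) \<partial>lborel) = (\<integral>\<^sup>+x. \<integral>\<^sup>+y. G x y \<partial>lborel \<partial>lborel)"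
    if [measurable]: "case_prod G \<in> borel_measurable (borel :: (real \<times> real) measure)" for G
  proof -
    have [measurable]: "case_prod G \<in> borel_measurable (borel \<Otimes>\<^sub>M borel)" by (simp add: borel_prod)
    show "(\<integral>\<^sup>+p. G (fst p) (snd p) \<partial>lborel) = (\<integral>\<^sup>+x. \<integral>\<^sup>+y. G x y \<partial>lborel \<partial>lborel)"
      unfolding lborel_prod[symmetric] using lborel.nn_integral_fst[of "case_prod G" lborel]
      by (simp add: case_prod_beta')
    also have "\<dots> = (\<integral>\<^sup>+y. \<integral>\<^sup>+x. G x y \<partial>lborel \<partial>lborel)"
      by (rule lborel_pair.Fubini'[symmetric]) measurable
    finally show "(\<integral>\<^sup>+p. G (fst p) (snd p) \<partial>lborel) = (\<integral>\<^sup>+y. \<integral>\<^sup>+x. G x y \<partial>lborel \<partial>lborel)" .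
  qed
  have meas: "(\<lambda>(x, y). F (r + \<alpha> * x + \<beta> * y, s + \<gamma> * x + \<delta> * y)) \<in> borel_measurable borel"
    if [measurable]: "F \<in> borel_measurable (borel :: (real \<times> real) measure)" for F :: "real \<times> real \<Rightarrow> ennreal"
  proof -
    have [measurable]: "F \<in> borel_measurable (borel \<Otimes>\<^sub>M borel)" by (simp add: borel_prod)
    have "(\<lambda>(x, y). F (r + \<alpha> * x + \<beta> * y, s + \<gamma> * x + \<delta> * y)) \<in> borel_measurable (borel \<Otimes>\<^sub>M borel)"
      by measurable
    then show ?thesis by (simp add: borel_prod)
  qed
  show ?thesis
  proof (cases "\<alpha> = 0")
    case False
    obtain D where "D > 0" and D: "\<And>F. F \<in> borel_measurable borel \<Longrightarrow>
      (\<integral>\<^sup>+y. \<integral>\<^sup>+x. F (r + \<alpha> * x + \<beta> * y, s + \<gamma> * x + \<delta> * y) \<partial>lborel \<partial>lborel) = ennreal D * (\<integral>\<^sup>+p. F p \<partial>lborel)"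
      using main[OF det False] by blast
    then show ?thesis using iter(1)[OF meas] by (intro exI[of _ D]) simp
  next
    case True
    then have "\<beta> * \<gamma> - \<alpha> * \<delta> \<noteq> 0" "\<beta> \<noteq> 0" using det by auto
    from main[OF this] obtain D where "D > 0" and D: "\<And>F. F \<in> borel_measurable borel \<Longrightarrow>
      (\<integral>\<^sup>+x. \<integral>\<^sup>+y. F (r + \<beta> * y + \<alpha> * x, s + \<delta> * y + \<gamma> * x) \<partial>lborel \<partial>lborel) = ennreal D * (\<integral>\<^sup>+p. F p \<partial>lborel)"
      by blast
    then show ?thesis using iter(2)[OF meas] by (intro exI[of _ D]) (simp add: add.commute add.left_commute)
  qed
qed

text \<open>The plane occurs in two versions: \<open>real^2\<close>, in which triangles live, and \<open>real \<times> real\<close>, for which iterated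
  integrals are available. The map \<open>vec2\<close> identifies them and preserves Lebesgue measure.\<close>

definition vec2 :: "real \<times> real \<Rightarrow> real^2" where
  "vec2 p = (\<chi> i. if i = 1 then fst p else snd p)"

lemma vec2_nth [simp]: "vec2 p $ 1 = fst p" "vec2 p $ 2 = snd p"
  by (simp_all add: vec2_def)

lemma UNIV_2_insert: "(UNIV :: 2 set) = {1, 2}"
  using exhaust_2 by auto

lemma continuous_vec2: "continuous_on UNIV vec2"
proof -
  have "continuous_on UNIV (\<lambda>p::real\<times>real. if i = 1 then fst p else snd p)" for i :: 2
    by (cases "i = 1") (auto intro: continuous_intros)
  then show ?thesis unfolding vec2_def by (rule continuous_on_vec_lambda)
qed

lemma Basis_2: "(Basis :: (real^2) set) = {axis 1 1, axis 2 1}"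
  by (auto simp: Basis_vec_def UNIV_2_insert)

lemma distr_vec2: "distr lborel borel vec2 = lborel"
proof (rule lborel_eqI[symmetric])
  have [measurable]: "vec2 \<in> borel_measurable borel"
    using continuous_vec2 by (rule borel_measurable_continuous_onI)
  have prodB: "(\<Prod>b\<in>Basis. f b) = f (axis 1 1) * f (axis 2 1)" for f :: "real^2 \<Rightarrow> real"
  proof -
    have "axis 1 1 \<noteq> (axis 2 1 :: real^2)" by (simp add: axis_eq_axis)
    then show ?thesis by (simp add: Basis_2)
  qed
  fix l u :: "real^2"
  assume lu: "\<And>b. b \<in> Basis \<Longrightarrow> l \<bullet> b \<le> u \<bullet> b"
  have le: "l $ 1 \<le> u $ 1" "l $ 2 \<le> u $ 2"
    using lu[of "axis 1 1"] lu[of "axis 2 1"] by (auto simp: Basis_2 inner_axis)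
  have pre: "vec2 -` box l u = box (l $ 1, l $ 2) (u $ 1, u $ 2)"
    by (auto simp: mem_box Basis_2 inner_axis Basis_prod_def inner_prod_def)
  have "emeasure (distr lborel borel vec2) (box l u) = emeasure lborel (box (l $ 1, l $ 2) (u $ 1, u $ 2))"
    by (subst emeasure_distr) (auto simp: pre)
  also have "\<dots> = (\<Prod>b\<in>Basis. ((u $ 1, u $ 2) - (l $ 1, l $ 2)) \<bullet> b)"
    by (rule emeasure_lborel_box) (use le in \<open>auto simp: Basis_prod_def inner_prod_def\<close>)
  also have "\<dots> = (u $ 1 - l $ 1) * (u $ 2 - l $ 2)"
    by (simp add: Basis_prod_def inner_prod_def mult.commute)
  also have "\<dots> = (\<Prod>b\<in>Basis. (u - l) \<bullet> b)"
    by (simp add: prodB inner_axis inner_diff_left mult.commute)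
  finally show "emeasure (distr lborel borel vec2) (box l u) = (\<Prod>b\<in>Basis. (u - l) \<bullet> b)" .
qed simp

text \<open>The edge vectors \<open>e\<close> and \<open>f\<close> at the vertex \<open>a\<close> are a basis; \<open>T\<close> maps the unit triangle onto the
  given one, and \<open>S\<close>, its inverse, reads off the coordinates with the dual basis \<open>s1\<close>, \<open>s2\<close>.\<close>

locale triangle =
  fixes a b c :: "real^2"
  assumes nondeg: "(b - a) $ 1 * (c - a) $ 2 - (b - a) $ 2 * (c - a) $ 1 \<noteq> 0"
begin

abbreviation "e \<equiv> b - a"
abbreviation "f \<equiv> c - a"

definition edge_det where "edge_det = e $ 1 * f $ 2 - e $ 2 * f $ 1"

lemma edge_det: "edge_det \<noteq> 0" using nondeg by (simp add: edge_det_def)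

definition T :: "real \<times> real \<Rightarrow> real^2" where
  "T p = a + fst p *\<^sub>R e + snd p *\<^sub>R f"

definition s1 :: "real^2" where "s1 = vec2 (f $ 2 / edge_det, - f $ 1 / edge_det)"
definition s2 :: "real^2" where "s2 = vec2 (- e $ 2 / edge_det, e $ 1 / edge_det)"

definition S :: "real^2 \<Rightarrow> real \<times> real" where
  "S q = (s1 \<bullet> (q - a), s2 \<bullet> (q - a))"

lemma inner2: "(v::real^2) \<bullet> w = v $ 1 * w $ 1 + v $ 2 * w $ 2"
  by (simp add: inner_vec_def UNIV_2_insert)

lemma dual: "s1 \<bullet> e = 1" "s1 \<bullet> f = 0" "s2 \<bullet> e = 0" "s2 \<bullet> f = 1"
proof -
  have "s1 \<bullet> e = (e $ 1 * f $ 2 - e $ 2 * f $ 1) / edge_det"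
    unfolding inner2 s1_def vec2_nth fst_conv snd_conv divide_inverse by algebra
  then show "s1 \<bullet> e = 1" using edge_det by (simp add: edge_det_def)
  have "s2 \<bullet> f = (e $ 1 * f $ 2 - e $ 2 * f $ 1) / edge_det"
    unfolding inner2 s2_def vec2_nth fst_conv snd_conv divide_inverse by algebra
  then show "s2 \<bullet> f = 1" using edge_det by (simp add: edge_det_def)
  show "s1 \<bullet> f = 0" "s2 \<bullet> e = 0" 
    unfolding inner2 s1_def s2_def vec2_nth fst_conv snd_conv divide_inverse
    by (simp_all del: vector_minus_component add: ac_simps)
qed

lemma ST: "S (T p) = p"
  by (simp add: S_def T_def inner_add_right dual)

lemma TS: "T (S q) = q"
proof -
  have 1: "(s1 \<bullet> v) * e $ 1 + (s2 \<bullet> v) * f $ 1 = v $ 1" for v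
  proof -
    have "(s1 \<bullet> v) * e $ 1 + (s2 \<bullet> v) * f $ 1 = v $ 1 * ((e $ 1 * f $ 2 - e $ 2 * f $ 1) / edge_det)"
      unfolding inner2 s1_def s2_def vec2_nth fst_conv snd_conv divide_inverse
      by (simp del: vector_minus_component add: algebra_simps)
    then show ?thesis using edge_det by (simp add: edge_det_def)
  qed
  have 2: "(s1 \<bullet> v) * e $ 2 + (s2 \<bullet> v) * f $ 2 = v $ 2" for v
  proof -
    have "(s1 \<bullet> v) * e $ 2 + (s2 \<bullet> v) * f $ 2 = v $ 2 * ((e $ 1 * f $ 2 - e $ 2 * f $ 1) / edge_det)"
      unfolding inner2 s1_def s2_def vec2_nth fst_conv snd_conv divide_inverse
      by (simp del: vector_minus_component add: algebra_simps)
    then show ?thesis using edge_det by (simp add: edge_det_def)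
  qed
  show ?thesis
    using 1[of "q - a"] 2[of "q - a"] by (simp add: vec_eq_iff forall_2 T_def S_def)
qed

lemma continuous_T: "continuous_on A T" unfolding T_def by (intro continuous_intros)
lemma continuous_S: "continuous_on A S" unfolding S_def by (intro continuous_intros)

lemma hull_eq: "convex hull {a, b, c} = T ` unit_triangle"
  unfolding convex_hull_3_alt T_def unit_triangle_def
  by (force simp: image_iff)

lemma interior_unit_triangle: "interior unit_triangle = open_unit_triangle"
proof
  show "open_unit_triangle \<subseteq> interior unit_triangle"
    by (rule interior_maximal) (auto simp: open_unit_triangle_open, auto simp: open_unit_triangle_def unit_triangle_def)
  show "interior unit_triangle \<subseteq> open_unit_triangle"
  proof
    fix p assume "p \<in> interior unit_triangle"
    then obtain r where r: "r > 0" "ball p r \<subseteq> unit_triangle" by (auto simp: mem_interior)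
    have *: "p + v \<in> unit_triangle" if "norm v < r" for v
      using r(2) that by (auto simp: dist_norm subset_eq)
    have "p + (- r / 2, 0) \<in> unit_triangle" "p + (0, - r / 2) \<in> unit_triangle" "p + (r / 2, 0) \<in> unit_triangle"
      by (rule *; use r(1) in \<open>simp add: norm_Pair\<close>)+
    then show "p \<in> open_unit_triangle" using r(1) by (auto simp: unit_triangle_def open_unit_triangle_def)
  qed
qed

lemma T_image_S: "T ` A = S -` A"
  using ST TS by (auto simp: image_iff) (metis TS)

lemma interior_hull: "interior (convex hull {a, b, c}) = T ` open_unit_triangle"
proof
  have "open (T ` open_unit_triangle)"
    unfolding T_image_S by (rule open_vimage[OF open_unit_triangle_open continuous_S])
  moreover have "T ` open_unit_triangle \<subseteq> T ` unit_triangle"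
    by (intro image_mono) (auto simp: open_unit_triangle_def unit_triangle_def)
  ultimately show "T ` open_unit_triangle \<subseteq> interior (convex hull {a, b, c})"
    unfolding hull_eq by (intro interior_maximal)
  have "open (T -` interior (T ` unit_triangle))"
    by (rule open_vimage[OF open_interior continuous_T])
  moreover have "T -` interior (T ` unit_triangle) \<subseteq> unit_triangle"
  proof
    fix p assume "p \<in> T -` interior (T ` unit_triangle)"
    then have "T p \<in> T ` unit_triangle" using interior_subset by blast
    then show "p \<in> unit_triangle" by (metis ST imageE)
  qed
  ultimately have "T -` interior (T ` unit_triangle) \<subseteq> open_unit_triangle"
    unfolding interior_unit_triangle[symmetric] by (intro interior_maximal)
  then show "interior (convex hull {a, b, c}) \<subseteq> T ` open_unit_triangle"
    unfolding hull_eq T_image_S[of open_unit_triangle] using TS by (auto simp: subset_eq)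
qed

lemma T_measure: "\<exists>D>0. distr lborel borel T = density lborel (\<lambda>_. ennreal D)"
proof -
  define A where "A p = (a $ 1 + e $ 1 * fst p + f $ 1 * snd p, a $ 2 + e $ 2 * fst p + f $ 2 * snd p)" for p :: "real \<times> real"
  have T: "T = vec2 \<circ> A"
    by (auto simp: fun_eq_iff T_def A_def vec_eq_iff forall_2 algebra_simps)
  have [measurable]: "vec2 \<in> borel_measurable borel"
    using continuous_vec2 by (rule borel_measurable_continuous_onI)
  have [measurable]: "A \<in> borel_measurable borel"
    unfolding A_def by (intro borel_measurable_continuous_onI continuous_intros)
  have [measurable]: "T \<in> borel_measurable borel"
    by (rule borel_measurable_continuous_onI[OF continuous_T])
  have "e $ 1 * f $ 2 - f $ 1 * e $ 2 \<noteq> 0" using edge_det by (simp add: edge_det_def mult.commute)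
  from nn_integral_plane_affine[OF this, of "a $ 1" "a $ 2"]
  obtain D where D: "D > 0" "\<And>F. F \<in> borel_measurable borel \<Longrightarrow> (\<integral>\<^sup>+p. F (A p) \<partial>lborel) = ennreal D * (\<integral>\<^sup>+p. F p \<partial>lborel)"
    unfolding A_def by blast
  have "distr lborel borel T = density lborel (\<lambda>_. ennreal D)"
  proof (rule measure_eqI)
    fix X assume "X \<in> sets (distr lborel borel T)"
    then have X[measurable]: "X \<in> sets borel" by simp
    have "emeasure (distr lborel borel T) X = (\<integral>\<^sup>+q. indicator X q \<partial>(distr lborel borel T))" by simp
    also have "\<dots> = (\<integral>\<^sup>+p. indicator X (vec2 (A p)) \<partial>lborel)"
      by (subst nn_integral_distr) (auto simp: T)
    also have "\<dots> = ennreal D * (\<integral>\<^sup>+p. indicator X (vec2 p) \<partial>lborel)"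
      by (rule D(2)) measurable
    also have "(\<integral>\<^sup>+p. indicator X (vec2 p) \<partial>lborel) = (\<integral>\<^sup>+q. indicator X q \<partial>(distr lborel borel vec2))"
      by (subst nn_integral_distr) auto
    also have "\<dots> = emeasure lborel X" unfolding distr_vec2 by simp
    finally show "emeasure (distr lborel borel T) X = emeasure (density lborel (\<lambda>_. ennreal D)) X"
      by (simp add: emeasure_density_const)
  qed simp
  with D(1) show ?thesis by blast
qed

lemma T_integral: "\<exists>D>0. \<forall>F :: real^2 \<Rightarrow> real. F \<in> borel_measurable borel \<longrightarrow>
  (LINT p|lborel. F (T p)) = D * (LINT q|lborel. F q)"
proof -
  obtain D where D: "D > 0" "distr lborel borel T = density lborel (\<lambda>_. ennreal D)"
    using T_measure by blast
  have "(LINT p|lborel. F (T p)) = D * (LINT q|lborel. F q)" if [measurable]: "F \<in> borel_measurable borel" for F :: "real^2 \<Rightarrow> real"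
  proof -
    have T: "T \<in> borel_measurable borel"
      by (rule borel_measurable_continuous_onI[OF continuous_T])
    have "(LINT p|lborel. F (T p)) = (LINT q|distr lborel borel T. F q)"
      by (subst integral_distr) (use T in auto)
    also have "\<dots> = (LINT q|lborel. D *\<^sub>R F q)"
      unfolding D(2) by (subst integral_density) (use D(1) in auto)
    finally show ?thesis by simp
  qed
  with D(1) show ?thesis by blast
qed

lemma compact_T_image: "compact K \<Longrightarrow> compact (T ` K)"
  by (intro compact_continuous_image continuous_T)

lemma compact_S_image: "compact K \<Longrightarrow> compact (S ` K)"
  by (intro compact_continuous_image continuous_S)

lemma pull_back:
  assumes "test_function (T ` open_unit_triangle) \<psi> \<psi>'"
  shows "test_function open_unit_triangle (\<psi> \<circ> T) (\<lambda>p. (\<psi>' (T p) \<bullet> e, \<psi>' (T p) \<bullet> f))"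
proof -
  obtain K where K: "compact K" "K \<subseteq> T ` open_unit_triangle" "\<And>x. x \<notin> K \<Longrightarrow> \<psi> x = 0"
    using assms by (auto simp: test_function_def)
  have "(T has_derivative (\<lambda>h. fst h *\<^sub>R e + snd h *\<^sub>R f)) (at p)" for p
    unfolding T_def by (auto intro!: derivative_eq_intros)
  moreover have "(\<psi> has_derivative (\<lambda>h. \<psi>' q \<bullet> h)) (at q)" for q
    using assms by (simp add: test_function_def)
  ultimately have "((\<psi> \<circ> T) has_derivative ((\<lambda>h. \<psi>' (T p) \<bullet> h) \<circ> (\<lambda>h. fst h *\<^sub>R e + snd h *\<^sub>R f))) (at p)" for p
    by (rule diff_chain_at)
  then have "((\<psi> \<circ> T) has_derivative (\<lambda>h. (\<psi>' (T p) \<bullet> e, \<psi>' (T p) \<bullet> f) \<bullet> h)) (at p)" for p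
    by (simp add: o_def inner_prod_def inner_add_right mult.commute)
  moreover have "continuous_on UNIV (\<lambda>p. \<psi>' (T p))"
    using assms by (intro continuous_on_compose2[OF _ continuous_T, of UNIV \<psi>']) (auto simp: test_function_def)
  then have "continuous_on UNIV (\<lambda>p. (\<psi>' (T p) \<bullet> e, \<psi>' (T p) \<bullet> f))"
    by (intro continuous_intros)
  moreover have "S ` K \<subseteq> open_unit_triangle" using K(2) ST by force
  moreover have "(\<psi> \<circ> T) p = 0" if "p \<notin> S ` K" for p
    using K(3)[of "T p"] that ST[of p] by (metis comp_apply image_eqI)
  ultimately show ?thesis
    unfolding test_function_def using compact_S_image[OF K(1)] by blast
qed

lemma push_forward:
  assumes "test_function open_unit_triangle \<phi> \<phi>'"
  shows "test_function (T ` open_unit_triangle) (\<phi> \<circ> S) (\<lambda>q. fst (\<phi>' (S q)) *\<^sub>R s1 + snd (\<phi>' (S q)) *\<^sub>R s2)"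
proof -
  obtain K where K: "compact K" "K \<subseteq> open_unit_triangle" "\<And>x. x \<notin> K \<Longrightarrow> \<phi> x = 0"
    using assms by (auto simp: test_function_def)
  have "(S has_derivative (\<lambda>h. (s1 \<bullet> h, s2 \<bullet> h))) (at q)" for q
    unfolding S_def by (auto intro!: derivative_eq_intros)
  moreover have "(\<phi> has_derivative (\<lambda>h. \<phi>' q \<bullet> h)) (at q)" for q
    using assms unfolding test_function_def by (rule conjunct1[THEN spec])
  ultimately have "((\<phi> \<circ> S) has_derivative ((\<lambda>h. \<phi>' (S q) \<bullet> h) \<circ> (\<lambda>h. (s1 \<bullet> h, s2 \<bullet> h)))) (at q)" for q
    by (rule diff_chain_at)
  then have "((\<phi> \<circ> S) has_derivative (\<lambda>h. (fst (\<phi>' (S q)) *\<^sub>R s1 + snd (\<phi>' (S q)) *\<^sub>R s2) \<bullet> h)) (at q)" for q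
    by (simp add: o_def inner_prod_def inner_add_left)
  moreover have "continuous_on UNIV (\<lambda>q. \<phi>' (S q))"
    using assms by (intro continuous_on_compose2[OF _ continuous_S, of UNIV \<phi>']) (auto simp: test_function_def)
  then have "continuous_on UNIV (\<lambda>q. fst (\<phi>' (S q)) *\<^sub>R s1 + snd (\<phi>' (S q)) *\<^sub>R s2)"
    by (intro continuous_intros)
  moreover have "T ` K \<subseteq> T ` open_unit_triangle" using K(2) by blast
  moreover have "(\<phi> \<circ> S) q = 0" if "q \<notin> T ` K" for q
    using K(3)[of "S q"] that TS[of q] by (metis comp_apply image_eqI)
  ultimately show ?thesis
    unfolding test_function_def using compact_T_image[OF K(1)] by blast
qed

lemma gradient_norm:
  fixes v :: "real^2"
  defines "X \<equiv> v \<bullet> e" and "Y \<equiv> v \<bullet> f"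
  shows "edge_det\<^sup>2 * (norm v)\<^sup>2 = (norm f)\<^sup>2 * X\<^sup>2 - 2 * (e \<bullet> f) * X * Y + (norm e)\<^sup>2 * Y\<^sup>2"
  unfolding X_def Y_def power2_norm_eq_inner inner2 edge_det_def
  by (simp del: vector_minus_component add: power2_eq_square algebra_simps)

end

section \<open>Poincare inequalities\<close>

lemma iterated_integral_snd:
  fixes g :: "real \<times> real \<Rightarrow> real"
  assumes A: "compact A" and g: "continuous_on UNIV g"
    and sec: "\<And>x y. (x, y) \<in> A \<longleftrightarrow> y \<in> {0..1} \<and> x \<in> {l y..u y}"
  shows "(LINT p|lborel. indicator A p * g p) = integral {0..1} (\<lambda>y. integral {l y..u y} (\<lambda>x. g (x, y)))"
proof -
  let ?f = "\<lambda>x y. indicator A (x, y) * g (x, y)"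
  have int: "integrable (lborel \<Otimes>\<^sub>M lborel) (case_prod ?f)"
    using borel_integrable_compact[OF A continuous_on_subset[OF g subset_UNIV]]
    by (simp add: lborel_prod case_prod_beta')
  have inner: "(LINT x|lborel. ?f x y) = indicator {0..1} y * integral {l y..u y} (\<lambda>x. g (x, y))" for y
  proof -
    have "continuous_on {l y..u y} (\<lambda>x. g (x, y))"
      by (rule continuous_on_compose2[OF g]) (auto intro!: continuous_intros)
    then have "set_integrable lborel {l y..u y} (\<lambda>x. g (x, y))"
      unfolding set_integrable_def by (rule borel_integrable_compact[OF compact_Icc])
    from set_borel_integral_eq_integral(2)[OF this]
    have "(LINT x|lborel. indicator {l y..u y} x * g (x, y)) = integral {l y..u y} (\<lambda>x. g (x, y))"
      by (simp add: set_lebesgue_integral_def)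
    moreover have eq: "(\<lambda>x. ?f x y) = (\<lambda>x. indicator {0..1} y * (indicator {l y..u y} x * g (x, y)))"
      by (rule ext) (use sec in \<open>auto simp: indicator_def\<close>)
    ultimately show ?thesis unfolding eq by simp
  qed
  have int1: "integrable lborel (\<lambda>y. indicator {0..1} y * integral {l y..u y} (\<lambda>x. g (x, y)))"
    using lborel_pair.integrable_snd[OF int] by (simp only: inner)
  have "(LINT p|lborel. indicator A p * g p) = (LINT p|(lborel \<Otimes>\<^sub>M lborel). case_prod ?f p)"
    by (simp add: lborel_prod case_prod_beta')
  also have "\<dots> = (LINT y|lborel. LINT x|lborel. ?f x y)"
    by (rule lborel_pair.integral_snd[OF int, symmetric])
  also have "\<dots> = integral UNIV (\<lambda>y. indicator {0..1} y * integral {l y..u y} (\<lambda>x. g (x, y)))"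
    unfolding inner by (rule integral_lborel[OF int1, symmetric])
  also have "\<dots> = integral UNIV (\<lambda>y. if y \<in> {0..1} then integral {l y..u y} (\<lambda>x. g (x, y)) else 0)"
    by (rule integral_cong) (auto simp: indicator_def)
  also have "\<dots> = integral {0..1} (\<lambda>y. integral {l y..u y} (\<lambda>x. g (x, y)))"
    by (rule integral_restrict_UNIV)
  finally show ?thesis .
qed

lemma iterated_integral_fst:
  fixes g :: "real \<times> real \<Rightarrow> real"
  assumes A: "compact A" and g: "continuous_on UNIV g"
    and sec: "\<And>x y. (x, y) \<in> A \<longleftrightarrow> x \<in> {0..1} \<and> y \<in> {l x..u x}"
  shows "(LINT p|lborel. indicator A p * g p) = integral {0..1} (\<lambda>x. integral {l x..u x} (\<lambda>y. g (x, y)))"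
proof -
  have A': "compact (prod.swap ` A)"
    using A by (intro compact_continuous_image continuous_on_swap)
  have g': "continuous_on UNIV (\<lambda>p. g (prod.swap p))"
    by (rule continuous_on_compose2[OF g continuous_on_swap]) auto
  have "(LINT p|lborel. indicator (prod.swap ` A) p * g (prod.swap p))
      = integral {0..1} (\<lambda>x. integral {l x..u x} (\<lambda>y. g (x, y)))"
    using iterated_integral_snd[OF A' g', of l u] sec by (simp add: pair_in_swap_image)
  moreover have "(LINT p|lborel. indicator (prod.swap ` A) p * g (prod.swap p)) = (LINT p|lborel. indicator A p * g p)"
  proof -
    have "(\<lambda>p. indicator A p * g p) \<in> borel_measurable (lborel \<Otimes>\<^sub>M lborel)"
      using borel_integrable_compact[OF A continuous_on_subset[OF g subset_UNIV]]
      by (simp add: lborel_prod)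
    from lborel_pair.integral_product_swap[OF this]
    have "(LINT (x, y)|lborel. indicator A (y, x) * g (y, x)) = (LINT p|lborel. indicator A p * g p)"
      unfolding lborel_prod by simp
    moreover have "(\<lambda>p. indicator (prod.swap ` A) p * g (prod.swap p)) = (\<lambda>(x, y). indicator A (y, x) * g (y, x))"
      by (auto simp: fun_eq_iff indicator_def pair_in_swap_image)
    ultimately show ?thesis by simp
  qed
  ultimately show ?thesis by simp
qed

lemma test_partial:
  assumes "test_function \<Omega> \<phi> \<phi>'"
  shows "((\<lambda>x. \<phi> (x, y)) has_real_derivative fst (\<phi>' (x, y))) (at x)"
    and "((\<lambda>y. \<phi> (x, y)) has_real_derivative snd (\<phi>' (x, y))) (at y)"
proof -
  have d: "(\<phi> has_derivative (\<lambda>h. \<phi>' q \<bullet> h)) (at q)" for q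
    using assms unfolding test_function_def by blast
  have "((\<lambda>x. (x, y)) has_derivative (\<lambda>h. (h, 0))) (at x)"
    by (auto intro!: derivative_eq_intros)
  from has_derivative_compose[OF this d]
  show "((\<lambda>x. \<phi> (x, y)) has_real_derivative fst (\<phi>' (x, y))) (at x)"
    by (simp add: has_field_derivative_def inner_prod_def)
  have "((\<lambda>y. (x, y)) has_derivative (\<lambda>h. (0, h))) (at y)"
    by (auto intro!: derivative_eq_intros)
  from has_derivative_compose[OF this d]
  show "((\<lambda>y. \<phi> (x, y)) has_real_derivative snd (\<phi>' (x, y))) (at y)"
    by (simp add: has_field_derivative_def inner_prod_def)
qed

lemma interval_square_mean:
  fixes f :: "real \<Rightarrow> real"
  assumes ab: "a < b" and f: "continuous_on {a..b} f"
  shows "(integral {a..b} f)\<^sup>2 \<le> (b - a) * integral {a..b} (\<lambda>x. (f x)\<^sup>2)"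
    and "integral {a..b} (\<lambda>x. (f x - integral {a..b} f / (b - a))\<^sup>2)
      = integral {a..b} (\<lambda>x. (f x)\<^sup>2) - (integral {a..b} f)\<^sup>2 / (b - a)"
proof -
  define m where "m = integral {a..b} f / (b - a)"
  have m: "integral {a..b} f = m * (b - a)" using ab by (simp add: m_def)
  have i: "f integrable_on {a..b}" "(\<lambda>x. (f x)\<^sup>2) integrable_on {a..b}"
    by (intro integrable_continuous_real continuous_intros f)+
  have "integral {a..b} (\<lambda>x. (f x - m)\<^sup>2) = integral {a..b} (\<lambda>x. (f x)\<^sup>2 - 2 * m * f x + m\<^sup>2)"
    by (rule integral_cong) (simp add: power2_eq_square algebra_simps)
  also have "\<dots> = integral {a..b} (\<lambda>x. (f x)\<^sup>2) - 2 * m * integral {a..b} f + m\<^sup>2 * (b - a)"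
    using i ab
    by (subst integral_add, simp_all add: integrable_diff integral_diff integrable_on_mult_right integrable_const_ivl)
  also have "\<dots> = integral {a..b} (\<lambda>x. (f x)\<^sup>2) - m\<^sup>2 * (b - a)"
    unfolding m by (simp add: power2_eq_square algebra_simps)
  also have "m\<^sup>2 * (b - a) = (integral {a..b} f)\<^sup>2 / (b - a)"
    unfolding m_def using ab by (simp add: power2_eq_square)
  finally show eq: "integral {a..b} (\<lambda>x. (f x - integral {a..b} f / (b - a))\<^sup>2)
      = integral {a..b} (\<lambda>x. (f x)\<^sup>2) - (integral {a..b} f)\<^sup>2 / (b - a)" by (simp add: m_def)
  have "0 \<le> integral {a..b} (\<lambda>x. (f x - integral {a..b} f / (b - a))\<^sup>2)"
    by (intro integral_nonneg integrable_continuous_real continuous_intros f) auto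
  then show "(integral {a..b} f)\<^sup>2 \<le> (b - a) * integral {a..b} (\<lambda>x. (f x)\<^sup>2)"
    unfolding eq using ab by (simp add: field_simps)
qed

text \<open>A crude constant suffices: \<open>f\<close> takes its mean value at some point \<open>t\<close>, and the distance of \<open>f x\<close> from
  \<open>f t\<close> is bounded by the integral of the derivative.\<close>

lemma interval_Poincare:
  fixes f f' :: "real \<Rightarrow> real"
  assumes ab: "a < b" and d: "\<And>x. (f has_real_derivative f' x) (at x)" and f': "continuous_on UNIV f'"
  shows "integral {a..b} (\<lambda>x. (f x)\<^sup>2) \<le> (integral {a..b} f)\<^sup>2 / (b - a) + (b - a)\<^sup>2 * integral {a..b} (\<lambda>x. (f' x)\<^sup>2)"
proof -
  have f: "continuous_on A f" for A
    using d by (intro continuous_at_imp_continuous_on) (auto intro: DERIV_isCont)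
  have f's: "continuous_on A f'" for A by (rule continuous_on_subset[OF f']) simp
  define m where "m = integral {a..b} f / (b - a)"
  define E where "E = integral {a..b} (\<lambda>x. (f' x)\<^sup>2)"
  have ne: "{a..b} \<noteq> {}" using ab by simp
  obtain p where p: "p \<in> {a..b}" "\<And>x. x \<in> {a..b} \<Longrightarrow> f p \<le> f x"
    using continuous_attains_inf[OF compact_Icc ne f] by blast
  obtain q where q: "q \<in> {a..b}" "\<And>x. x \<in> {a..b} \<Longrightarrow> f x \<le> f q"
    using continuous_attains_sup[OF compact_Icc ne f] by blast
  have "integral {a..b} (\<lambda>x. f p) \<le> integral {a..b} f" "integral {a..b} f \<le> integral {a..b} (\<lambda>x. f q)"
    by (rule integral_le; use p q in \<open>simp add: integrable_continuous_real f\<close>)+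
  then have "f p \<le> m" "m \<le> f q" using ab by (auto simp: m_def field_simps)
  moreover have "connected (f ` {a..b})" by (intro connected_continuous_image f) auto
  then have "{f p..f q} \<subseteq> f ` {a..b}" using p(1) q(1) by (intro connected_contains_Icc) auto
  ultimately have "\<exists>t\<in>{a..b}. f t = m" by force
  then obtain t where t: "t \<in> {a..b}" "f t = m" by blast
  have sub: "(integral {c..d} f')\<^sup>2 \<le> (b - a) * E" if cd: "a \<le> c" "c < d" "d \<le> b" for c d
  proof -
    have "(integral {c..d} f')\<^sup>2 \<le> (d - c) * integral {c..d} (\<lambda>x. (f' x)\<^sup>2)"
      by (rule interval_square_mean(1)[OF cd(2) f's])
    also have "\<dots> \<le> (b - a) * integral {a..b} (\<lambda>x. (f' x)\<^sup>2)"
      using cd by (intro mult_mono integral_subset_le integral_nonneg integrable_continuous_real continuous_intros f's) auto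
    finally show ?thesis by (simp add: E_def)
  qed
  have ftc: "integral {c..d} f' = f d - f c" if "c \<le> d" for c d
    using that by (intro integral_unique fundamental_theorem_of_calculus)
      (auto simp: has_real_derivative_iff_has_vector_derivative[symmetric] intro: has_field_derivative_at_within d)
  have E0: "E \<ge> 0" unfolding E_def
    by (intro integral_nonneg integrable_continuous_real continuous_intros f's) auto
  have pt: "(f x - m)\<^sup>2 \<le> (b - a) * E" if x: "x \<in> {a..b}" for x
  proof (cases x t rule: linorder_cases)
    case less
    then show ?thesis using sub[of x t] ftc[of x t] x t by (simp add: power2_commute)
  next
    case equal
    then show ?thesis using t E0 ab by simp
  next
    case greater
    then show ?thesis using sub[of t x] ftc[of t x] x t by simp
  qed
  have "integral {a..b} (\<lambda>x. (f x - m)\<^sup>2) \<le> integral {a..b} (\<lambda>x. (b - a) * E)"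
    using pt by (intro integral_le integrable_continuous_real continuous_intros f) auto
  also have "\<dots> = (b - a)\<^sup>2 * E" using ab by (simp add: power2_eq_square)
  finally show ?thesis
    using interval_square_mean(2)[OF ab f] by (simp add: m_def E_def)
qed

text \<open>The one-dimensional inequality is applied in the first variable on each line and then in the second variable to the
  means over the lines, whose derivatives are again controlled by Cauchy-Schwarz.\<close>

lemma rectangle_Poincare:
  fixes \<phi> \<phi>x \<phi>y :: "real \<times> real \<Rightarrow> real" and a b h :: real
  assumes h: "h > 0"
    and c: "continuous_on UNIV \<phi>" "continuous_on UNIV \<phi>x" "continuous_on UNIV \<phi>y"
    and dx: "\<And>x y. ((\<lambda>x. \<phi> (x, y)) has_real_derivative \<phi>x (x, y)) (at x)"
    and dy: "\<And>x y. ((\<lambda>y. \<phi> (x, y)) has_real_derivative \<phi>y (x, y)) (at y)"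
  defines "J g \<equiv> integral {b..b+h} (\<lambda>y. integral {a..a+h} (\<lambda>x. g (x, y)))"
  shows "J (\<lambda>p. (\<phi> p)\<^sup>2) \<le> (J \<phi>)\<^sup>2 / h\<^sup>2 + h\<^sup>2 * (J (\<lambda>p. (\<phi>x p)\<^sup>2) + J (\<lambda>p. (\<phi>y p)\<^sup>2))"
    and "(J \<phi>)\<^sup>2 \<le> h\<^sup>2 * J (\<lambda>p. (\<phi> p)\<^sup>2)"
proof -
  have sl: "continuous_on A (\<lambda>x. g (x, y))" if "continuous_on UNIV g" for A y and g :: "real \<times> real \<Rightarrow> real"
    by (rule continuous_on_compose2[OF that]) (auto intro!: continuous_intros)
  have cI: "continuous_on A (\<lambda>y. integral {a..a+h} (\<lambda>x. g (x, y)))" if "continuous_on UNIV g" for A and g :: "real \<times> real \<Rightarrow> real"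
  proof -
    have "continuous_on (A \<times> cbox a (a + h)) (\<lambda>(y, x). g (x, y))"
      unfolding case_prod_beta' by (rule continuous_on_compose2[OF that]) (auto intro!: continuous_intros)
    then show ?thesis using integral_continuous_on_param[of A a "a + h" "\<lambda>y x. g (x, y)"] by simp
  qed
  have c2: "continuous_on UNIV (\<lambda>p. (g p)\<^sup>2)" if "continuous_on UNIV g" for g :: "real \<times> real \<Rightarrow> real"
    using that by (intro continuous_intros)
  define F where "F y = integral {a..a+h} (\<lambda>x. \<phi> (x, y))" for y
  define F' where "F' y = integral {a..a+h} (\<lambda>x. \<phi>y (x, y))" for y
  have dF: "(F has_real_derivative F' y) (at y)" for y
  proof -
    have "((\<lambda>y. integral (cbox a (a+h)) (\<lambda>x. \<phi> (x, y))) has_field_derivative integral (cbox a (a+h)) (\<lambda>x. \<phi>y (x, y))) (at y within UNIV)"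
    proof (rule leibniz_rule_field_derivative)
      show "continuous_on (UNIV \<times> cbox a (a+h)) (\<lambda>(y, x). \<phi>y (x, y))"
        unfolding case_prod_beta' by (rule continuous_on_compose2[OF c(3)]) (auto intro!: continuous_intros)
    qed (auto intro!: dy integrable_continuous_real sl c)
    then show ?thesis by (simp add: F_def[abs_def] F'_def)
  qed
  have mono: "J g1 \<le> integral {b..b+h} k" if "continuous_on UNIV g1" "continuous_on {b..b+h} k"
    "\<And>y. integral {a..a+h} (\<lambda>x. g1 (x, y)) \<le> k y" for g1 k
    unfolding J_def using that by (intro integral_le integrable_continuous_real cI) auto
  have mono': "integral {b..b+h} k \<le> J g1" if "continuous_on UNIV g1" "continuous_on {b..b+h} k"
    "\<And>y. k y \<le> integral {a..a+h} (\<lambda>x. g1 (x, y))" for g1 k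
    unfolding J_def using that by (intro integral_le integrable_continuous_real cI) auto
  have ab: "a < a + h" "b < b + h" using h by auto
  have cF: "continuous_on A F" for A unfolding F_def by (rule cI[OF c(1)])
  have cF': "continuous_on A F'" for A unfolding F'_def by (rule cI[OF c(3)])
  have 1: "J (\<lambda>p. (\<phi> p)\<^sup>2) \<le> integral {b..b+h} (\<lambda>y. (F y)\<^sup>2 / h + h\<^sup>2 * integral {a..a+h} (\<lambda>x. (\<phi>x (x, y))\<^sup>2))"
  proof (rule mono)
    show "continuous_on {b..b+h} (\<lambda>y. (F y)\<^sup>2 / h + h\<^sup>2 * integral {a..a+h} (\<lambda>x. (\<phi>x (x, y))\<^sup>2))"
      using h by (intro continuous_intros cF cI c2 c) auto
    show "integral {a..a+h} (\<lambda>x. (\<phi> (x, y))\<^sup>2) \<le> (F y)\<^sup>2 / h + h\<^sup>2 * integral {a..a+h} (\<lambda>x. (\<phi>x (x, y))\<^sup>2)" for y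
      using interval_Poincare[OF ab(1) dx sl[OF c(2)], of y] by (simp add: F_def)
  qed (intro c2 c)
  have 2: "integral {b..b+h} (\<lambda>y. (F y)\<^sup>2 / h + h\<^sup>2 * integral {a..a+h} (\<lambda>x. (\<phi>x (x, y))\<^sup>2))
      = integral {b..b+h} (\<lambda>y. (F y)\<^sup>2) / h + h\<^sup>2 * J (\<lambda>p. (\<phi>x p)\<^sup>2)"
    unfolding J_def using h
    by (subst integral_add) (auto intro!: integrable_continuous_real continuous_intros cF cI c2 c)
  have 3: "integral {b..b+h} (\<lambda>y. (F y)\<^sup>2) \<le> (J \<phi>)\<^sup>2 / h + h\<^sup>2 * integral {b..b+h} (\<lambda>y. (F' y)\<^sup>2)"
    using interval_Poincare[OF ab(2) dF cF'] unfolding J_def F_def[symmetric] by simp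
  have 4: "integral {b..b+h} (\<lambda>y. (F' y)\<^sup>2) \<le> h * J (\<lambda>p. (\<phi>y p)\<^sup>2)"
  proof -
    have "integral {b..b+h} (\<lambda>y. (F' y)\<^sup>2 / h) \<le> J (\<lambda>p. (\<phi>y p)\<^sup>2)"
    proof (rule mono')
      show "(F' y)\<^sup>2 / h \<le> integral {a..a+h} (\<lambda>x. (\<phi>y (x, y))\<^sup>2)" for y
        using interval_square_mean(1)[OF ab(1) sl[OF c(3)], of y] h by (simp add: F'_def field_simps)
    qed (use h in \<open>intro c2 c continuous_intros cF'; simp\<close>)+
    then show ?thesis using h by (simp add: field_simps)
  qed
  have "J (\<lambda>p. (\<phi> p)\<^sup>2) \<le> ((J \<phi>)\<^sup>2 / h + h\<^sup>2 * (h * J (\<lambda>p. (\<phi>y p)\<^sup>2))) / h + h\<^sup>2 * J (\<lambda>p. (\<phi>x p)\<^sup>2)"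
  proof -
    have "integral {b..b+h} (\<lambda>y. (F y)\<^sup>2) \<le> (J \<phi>)\<^sup>2 / h + h\<^sup>2 * (h * J (\<lambda>p. (\<phi>y p)\<^sup>2))"
      using 3 mult_left_mono[OF 4, of "h\<^sup>2"] by simp
    then have "integral {b..b+h} (\<lambda>y. (F y)\<^sup>2) / h \<le> ((J \<phi>)\<^sup>2 / h + h\<^sup>2 * (h * J (\<lambda>p. (\<phi>y p)\<^sup>2))) / h"
      using h by (intro divide_right_mono) auto
    then show ?thesis using 1 2 by linarith
  qed
  also have "\<dots> = (J \<phi>)\<^sup>2 / h\<^sup>2 + h\<^sup>2 * (J (\<lambda>p. (\<phi>x p)\<^sup>2) + J (\<lambda>p. (\<phi>y p)\<^sup>2))"
    using h by (simp add: field_simps power2_eq_square)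
  finally show "J (\<lambda>p. (\<phi> p)\<^sup>2) \<le> (J \<phi>)\<^sup>2 / h\<^sup>2 + h\<^sup>2 * (J (\<lambda>p. (\<phi>x p)\<^sup>2) + J (\<lambda>p. (\<phi>y p)\<^sup>2))" .
  have "integral {b..b+h} (\<lambda>y. (F y)\<^sup>2 / h) \<le> J (\<lambda>p. (\<phi> p)\<^sup>2)"
  proof (rule mono')
    show "(F y)\<^sup>2 / h \<le> integral {a..a+h} (\<lambda>x. (\<phi> (x, y))\<^sup>2)" for y
      using interval_square_mean(1)[OF ab(1) sl[OF c(1)], of y] h by (simp add: F_def field_simps)
  qed (use h in \<open>intro c2 c continuous_intros cF; simp\<close>)+
  then have "integral {b..b+h} (\<lambda>y. (F y)\<^sup>2) \<le> h * J (\<lambda>p. (\<phi> p)\<^sup>2)" using h by (simp add: field_simps)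
  moreover have "(J \<phi>)\<^sup>2 \<le> h * integral {b..b+h} (\<lambda>y. (F y)\<^sup>2)"
    using interval_square_mean(1)[OF ab(2) cF] unfolding J_def F_def[symmetric] by simp
  ultimately have "(J \<phi>)\<^sup>2 \<le> h * (h * J (\<lambda>p. (\<phi> p)\<^sup>2))"
    using h by (meson mult_left_mono less_imp_le order_trans)
  then show "(J \<phi>)\<^sup>2 \<le> h\<^sup>2 * J (\<lambda>p. (\<phi> p)\<^sup>2)" by (simp add: power2_eq_square mult.assoc)
qed

lemma integral_split_unit:
  fixes g :: "real \<Rightarrow> real"
  assumes g: "continuous_on {0..1} g" and n: "n > 0"
  shows "integral {0..1} g = (\<Sum>i<n. integral {real i / n..real i / n + 1 / n} g)"
proof -
  have "integral {0..real k / n} g = (\<Sum>i<k. integral {real i / n..real i / n + 1 / n} g)" if "k \<le> n" for k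
    using that
  proof (induction k)
    case 0
    show ?case by simp
  next
    case (Suc k)
    have "integral {0..real k / n} g + integral {real k / n..real (Suc k) / n} g = integral {0..real (Suc k) / n} g"
    proof (rule Henstock_Kurzweil_Integration.integral_combine)
      show "g integrable_on {0..real (Suc k) / n}"
        using Suc.prems n by (intro integrable_continuous_real continuous_on_subset[OF g]) (auto simp: field_simps)
    qed (use n in \<open>auto simp: divide_right_mono\<close>)
    moreover have "real (Suc k) / n = real k / n + 1 / n" by (simp add: add_divide_distrib)
    ultimately show ?case using Suc by simp
  qed
  from this[of n] show ?thesis using n by simp
qed

definition sq_int :: "((real \<times> real) \<Rightarrow> real) \<Rightarrow> real" where
  "sq_int f = (LINT p|lborel. (f p)\<^sup>2)"

lemma sq_int_nonneg: "sq_int f \<ge> 0" by (simp add: sq_int_def)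

text \<open>The integral over one square of the grid with mesh \<open>1/n\<close>, the functional for which \<open>rayleigh\<close> asks.\<close>

definition cell :: "nat \<Rightarrow> nat \<Rightarrow> nat \<Rightarrow> ((real \<times> real) \<Rightarrow> real) \<Rightarrow> real" where
  "cell n i j g = integral {real j / n..real j / n + 1 / n} (\<lambda>y. integral {real i / n..real i / n + 1 / n} (\<lambda>x. g (x, y)))"

lemma sq_int_cells:
  fixes f :: "(real \<times> real) \<Rightarrow> real"
  assumes f: "continuous_on UNIV f" and z: "\<And>p. p \<notin> open_unit_triangle \<Longrightarrow> f p = 0" and n: "n > 0"
  shows "sq_int f = (\<Sum>j<n. \<Sum>i<n. cell n i j (\<lambda>p. (f p)\<^sup>2))"
proof -
  let ?Q = "{0..1} \<times> {0..1} :: (real \<times> real) set"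
  have f2: "continuous_on UNIV (\<lambda>p. (f p)\<^sup>2)" using f by (intro continuous_intros)
  have sl: "continuous_on A (\<lambda>x. (f (x, y))\<^sup>2)" for A y
    by (rule continuous_on_compose2[OF f2]) (auto intro!: continuous_intros)
  have cI: "continuous_on A (\<lambda>y. integral {a..b} (\<lambda>x. (f (x, y))\<^sup>2))" for A a b
  proof -
    have "continuous_on (A \<times> cbox a b) (\<lambda>(y, x). (f (x, y))\<^sup>2)"
      unfolding case_prod_beta' by (rule continuous_on_compose2[OF f2]) (auto intro!: continuous_intros)
    then show ?thesis using integral_continuous_on_param[of A a b "\<lambda>y x. (f (x, y))\<^sup>2"] by simp
  qed
  have zz: "f p = 0" if "p \<notin> ?Q" for p
    using that by (intro z) (auto simp: open_unit_triangle_def mem_Times_iff)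
  have "sq_int f = (LINT p|lborel. indicator ?Q p * (f p)\<^sup>2)"
    unfolding sq_int_def by (rule Bochner_Integration.integral_cong) (use zz in \<open>auto simp: indicator_def\<close>)
  also have "\<dots> = integral {0..1} (\<lambda>y. integral {0..1} (\<lambda>x. (f (x, y))\<^sup>2))"
    by (rule iterated_integral_snd[OF _ f2]) (auto intro: compact_Times)
  also have "\<dots> = (\<Sum>j<n. integral {real j / n..real j / n + 1 / n} (\<lambda>y. integral {0..1} (\<lambda>x. (f (x, y))\<^sup>2)))"
    by (rule integral_split_unit[OF cI n])
  also have "\<dots> = (\<Sum>j<n. \<Sum>i<n. cell n i j (\<lambda>p. (f p)\<^sup>2))"
  proof (rule sum.cong[OF refl])
    fix j
    have "integral {real j / n..real j / n + 1 / n} (\<lambda>y. integral {0..1} (\<lambda>x. (f (x, y))\<^sup>2))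
      = integral {real j / n..real j / n + 1 / n} (\<lambda>y. \<Sum>i<n. integral {real i / n..real i / n + 1 / n} (\<lambda>x. (f (x, y))\<^sup>2))"
      by (rule integral_cong) (rule integral_split_unit[OF sl n])
    also have "\<dots> = (\<Sum>i<n. cell n i j (\<lambda>p. (f p)\<^sup>2))"
      unfolding cell_def by (rule integral_sum) (auto intro: integrable_continuous_real cI)
    finally show "integral {real j / n..real j / n + 1 / n} (\<lambda>y. integral {0..1} (\<lambda>x. (f (x, y))\<^sup>2))
      = (\<Sum>i<n. cell n i j (\<lambda>p. (f p)\<^sup>2))" .
  qed
  finally show ?thesis .
qed

lemma test_zero:
  assumes "test_function open_unit_triangle \<phi> \<phi>'" "p \<notin> open_unit_triangle"
  shows "\<phi> p = 0" "\<phi>' p = 0"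
  using test_function_support_ex[OF assms(1)] assms(2) by (meson subsetD)+

text \<open>Summing the Poincare inequality over the grid: the energy enters with the factor \<open>1/n\<^sup>2\<close>, so a fine grid makes
  any multiple of the squared norm small compared with the energy.\<close>

lemma test_cells:
  assumes t: "test_function open_unit_triangle \<phi> \<phi>'" and n: "n > 0"
  shows "sq_int \<phi> \<le> (real n)\<^sup>2 * (\<Sum>j<n. \<Sum>i<n. (cell n i j \<phi>)\<^sup>2)
      + (sq_int (\<lambda>p. fst (\<phi>' p)) + sq_int (\<lambda>p. snd (\<phi>' p))) / (real n)\<^sup>2"
    and "i < n \<Longrightarrow> j < n \<Longrightarrow> (cell n i j \<phi>)\<^sup>2 \<le> sq_int \<phi>"
proof -
  note c = test_function_continuous[OF t]
  have c1: "continuous_on UNIV (\<lambda>p. fst (\<phi>' p))" "continuous_on UNIV (\<lambda>p. snd (\<phi>' p))"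
    using c by (auto intro!: continuous_intros)
  have z: "\<And>p. p \<notin> open_unit_triangle \<Longrightarrow> \<phi> p = 0"
    "\<And>p. p \<notin> open_unit_triangle \<Longrightarrow> fst (\<phi>' p) = 0" "\<And>p. p \<notin> open_unit_triangle \<Longrightarrow> snd (\<phi>' p) = 0"
    using test_zero[OF t] by auto
  have S1: "sq_int \<phi> = (\<Sum>j<n. \<Sum>i<n. cell n i j (\<lambda>p. (\<phi> p)\<^sup>2))"
    by (rule sq_int_cells[OF c(1) _ n]) (rule z)
  have S2: "sq_int (\<lambda>p. fst (\<phi>' p)) = (\<Sum>j<n. \<Sum>i<n. cell n i j (\<lambda>p. (fst (\<phi>' p))\<^sup>2))"
    by (rule sq_int_cells[OF c1(1) _ n]) (rule z)
  have S3: "sq_int (\<lambda>p. snd (\<phi>' p)) = (\<Sum>j<n. \<Sum>i<n. cell n i j (\<lambda>p. (snd (\<phi>' p))\<^sup>2))"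
    by (rule sq_int_cells[OF c1(2) _ n]) (rule z)
  have h: "1 / real n > 0" using n by simp
  note R = rectangle_Poincare[OF h c(1) c1 test_partial[OF t], folded cell_def]
  have "(\<Sum>j<n. \<Sum>i<n. cell n i j (\<lambda>p. (\<phi> p)\<^sup>2)) \<le> (\<Sum>j<n. \<Sum>i<n. (real n)\<^sup>2 * (cell n i j \<phi>)\<^sup>2 +
     (cell n i j (\<lambda>p. (fst (\<phi>' p))\<^sup>2) + cell n i j (\<lambda>p. (snd (\<phi>' p))\<^sup>2)) / (real n)\<^sup>2)"
  proof (intro sum_mono)
    fix i j
    show "cell n i j (\<lambda>p. (\<phi> p)\<^sup>2) \<le> (real n)\<^sup>2 * (cell n i j \<phi>)\<^sup>2 +
     (cell n i j (\<lambda>p. (fst (\<phi>' p))\<^sup>2) + cell n i j (\<lambda>p. (snd (\<phi>' p))\<^sup>2)) / (real n)\<^sup>2"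
      using R(1)[of "real j / n" "real i / n"] by (simp add: cell_def power_divide mult.commute)
  qed
  also have "\<dots> = (real n)\<^sup>2 * (\<Sum>j<n. \<Sum>i<n. (cell n i j \<phi>)\<^sup>2)
      + (sq_int (\<lambda>p. fst (\<phi>' p)) + sq_int (\<lambda>p. snd (\<phi>' p))) / (real n)\<^sup>2"
    unfolding S2 S3
    by (simp add: sum.distrib sum_distrib_left add_divide_distrib sum_divide_distrib)
  finally show "sq_int \<phi> \<le> (real n)\<^sup>2 * (\<Sum>j<n. \<Sum>i<n. (cell n i j \<phi>)\<^sup>2)
      + (sq_int (\<lambda>p. fst (\<phi>' p)) + sq_int (\<lambda>p. snd (\<phi>' p))) / (real n)\<^sup>2"
    unfolding S1 .
  assume ij: "i < n" "j < n"
  have pos: "cell n i j (\<lambda>p. (\<phi> p)\<^sup>2) \<ge> 0" for i j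
  proof -
    have "0 \<le> (1 / real n)\<^sup>2 * cell n i j (\<lambda>p. (\<phi> p)\<^sup>2)"
      unfolding cell_def by (rule order_trans[OF zero_le_power2 R(2)])
    moreover have "0 < (1 / real n)\<^sup>2" using h by (rule zero_less_power)
    ultimately show ?thesis by (simp only: zero_le_mult_iff) linarith
  qed
  have "(cell n i j \<phi>)\<^sup>2 \<le> (1 / n)\<^sup>2 * cell n i j (\<lambda>p. (\<phi> p)\<^sup>2)"
    using R(2)[of "real j / n" "real i / n"] by (simp add: cell_def)
  also have "\<dots> \<le> 1 * cell n i j (\<lambda>p. (\<phi> p)\<^sup>2)"
    using n pos by (intro mult_right_mono) (auto simp: power_le_one)
  also have "\<dots> \<le> (\<Sum>i<n. cell n i j (\<lambda>p. (\<phi> p)\<^sup>2))"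
    using member_le_sum[of i "{..<n}" "\<lambda>i. cell n i j (\<lambda>p. (\<phi> p)\<^sup>2)"] ij pos by simp
  also have "\<dots> \<le> (\<Sum>j<n. \<Sum>i<n. cell n i j (\<lambda>p. (\<phi> p)\<^sup>2))"
    using member_le_sum[of j "{..<n}" "\<lambda>j. \<Sum>i<n. cell n i j (\<lambda>p. (\<phi> p)\<^sup>2)"] ij pos by (simp add: sum_nonneg)
  finally show "(cell n i j \<phi>)\<^sup>2 \<le> sq_int \<phi>"
    unfolding S1 .
qed

lemma cell_diff:
  assumes "continuous_on UNIV f" "continuous_on UNIV g"
  shows "cell n i j (\<lambda>x. f x - g x) = cell n i j f - cell n i j g"
proof -
  have sl: "continuous_on A (\<lambda>x. h (x, y))" if "continuous_on UNIV h" for A y and h :: "real \<times> real \<Rightarrow> real"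
    by (rule continuous_on_compose2[OF that]) (auto intro!: continuous_intros)
  have cI: "continuous_on A (\<lambda>y. integral {a..b} (\<lambda>x. h (x, y)))" if "continuous_on UNIV h" for A a b and h :: "real \<times> real \<Rightarrow> real"
  proof -
    have "continuous_on (A \<times> cbox a b) (\<lambda>(y, x). h (x, y))"
      unfolding case_prod_beta' by (rule continuous_on_compose2[OF that]) (auto intro!: continuous_intros)
    then show ?thesis using integral_continuous_on_param[of A a b "\<lambda>y x. h (x, y)"] by simp
  qed
  show ?thesis
    unfolding cell_def
    by (simp add: integral_diff integrable_continuous_real sl cI assms)
qed

section \<open>Dirichlet energies in affine coordinates\<close>

context triangle
begin

definition "cx = ((norm f)\<^sup>2 - e \<bullet> f) / (2 * \<bar>edge_det\<bar>)"
definition "cy = ((norm e)\<^sup>2 - e \<bullet> f) / (2 * \<bar>edge_det\<bar>)"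
definition "cz = (e \<bullet> f) / (2 * \<bar>edge_det\<bar>)"

lemma area: "tri_area a b c = \<bar>edge_det\<bar> / 2"
proof -
  have "tri_area a b c = measure lborel (convex hull {a, b, c})"
    unfolding tri_area_def by (rule measure_completion) (simp add: compact_convex_hull compact_imp_closed finite_imp_compact borel_closed)
  then show ?thesis
    unfolding content_triangle edge_det_def by (simp add: abs_minus_commute mult.commute)
qed

lemma Lagrange: "(norm e)\<^sup>2 * (norm f)\<^sup>2 - (e \<bullet> f)\<^sup>2 = edge_det\<^sup>2"
  unfolding power2_norm_eq_inner inner2 edge_det_def
  by (simp del: vector_minus_component add: power2_eq_square algebra_simps)

text \<open>The identity \<open>cot A cot B + cot B cot C + cot C cot A = 1\<close>: the weights are \<open>cz = cot A / 2\<close>,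
  \<open>cy = cot B / 2\<close> and \<open>cx = cot C / 2\<close> for the angles at \<open>a\<close>, \<open>b\<close>, \<open>c\<close>. One of them may be negative,
  but the sum of two is positive.\<close>

lemma coeff_det: "cx * cy + cy * cz + cz * cx = 1 / 4"
proof -
  have "cx * cy + cy * cz + cz * cx = ((norm e)\<^sup>2 * (norm f)\<^sup>2 - (e \<bullet> f)\<^sup>2) / (2 * \<bar>edge_det\<bar>)\<^sup>2"
    unfolding cx_def cy_def cz_def times_divide_times_eq add_divide_distrib[symmetric]
    by (simp add: power2_eq_square algebra_simps)
  also have "\<dots> = 1 / 4" unfolding Lagrange using edge_det by (simp add: power_mult_distrib)
  finally show ?thesis .
qed

lemma coeff_pos: "cx + cz > 0" "cy + cz > 0"
proof -
  have "e \<noteq> 0" "f \<noteq> 0" using edge_det by (auto simp: edge_det_def)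
  then show "cx + cz > 0" "cy + cz > 0"
    using edge_det by (simp_all add: cx_def cy_def cz_def add_divide_distrib[symmetric])
qed

definition quad :: "real \<times> real \<Rightarrow> real" where
  "quad v = cx * (fst v)\<^sup>2 + cy * (snd v)\<^sup>2 + cz * (fst v - snd v)\<^sup>2"

lemma quad_gradient: "tri_area a b c * (norm v)\<^sup>2 = quad (v \<bullet> e, v \<bullet> f)"
proof -
  define X Y where "X = v \<bullet> e" "Y = v \<bullet> f"
  have g: "edge_det\<^sup>2 * (norm v)\<^sup>2 = (norm f)\<^sup>2 * X\<^sup>2 - 2 * (e \<bullet> f) * X * Y + (norm e)\<^sup>2 * Y\<^sup>2"
    unfolding X_Y_def by (rule gradient_norm)
  have "quad (X, Y) = ((norm f)\<^sup>2 * X\<^sup>2 - 2 * (e \<bullet> f) * X * Y + (norm e)\<^sup>2 * Y\<^sup>2) / (2 * \<bar>edge_det\<bar>)"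
    unfolding quad_def cx_def cy_def cz_def fst_conv snd_conv times_divide_eq_left add_divide_distrib[symmetric]
    by (rule arg_cong[where f = "\<lambda>t. t / (2 * \<bar>edge_det\<bar>)"]) (simp add: power2_eq_square algebra_simps)
  also have "\<dots> = \<bar>edge_det\<bar> / 2 * (norm v)\<^sup>2"
    unfolding g[symmetric] using edge_det by (simp add: field_simps power2_eq_square)
  finally show ?thesis by (simp add: area X_Y_def)
qed

text \<open>A positive definite binary form is at least its determinant divided by its trace.\<close>

lemma quad_coercive: "(fst v)\<^sup>2 + (snd v)\<^sup>2 \<le> 4 * (cx + cy + 2 * cz) * quad v"
proof -
  define p q s t where "p = cx + cz" "q = cy + cz" "s = fst v" "t = snd v"
  have pq: "p > 0" "q > 0" using coeff_pos by (auto simp: p_q_s_t_def)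
  have det: "p * q - cz\<^sup>2 = 1 / 4"
    using coeff_det by (simp add: p_q_s_t_def power2_eq_square algebra_simps)
  have "(p + q) * (p * s\<^sup>2 - 2 * cz * s * t + q * t\<^sup>2) - (p * q - cz\<^sup>2) * (s\<^sup>2 + t\<^sup>2) = (p * s - cz * t)\<^sup>2 + (q * t - cz * s)\<^sup>2"
    by (simp add: power2_eq_square algebra_simps)
  moreover have "(p * s - cz * t)\<^sup>2 + (q * t - cz * s)\<^sup>2 \<ge> 0" by simp
  moreover have "p * s\<^sup>2 - 2 * cz * s * t + q * t\<^sup>2 = quad v"
    by (simp add: quad_def p_q_s_t_def power2_eq_square algebra_simps)
  ultimately have "(p + q) * quad v - 1 / 4 * (s\<^sup>2 + t\<^sup>2) \<ge> 0" unfolding det by simp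
  moreover have "Y \<le> 4 * X" if "X - 1 / 4 * Y \<ge> 0" for X Y :: real using that by simp
  ultimately have "s\<^sup>2 + t\<^sup>2 \<le> 4 * ((p + q) * quad v)" by blast
  then show ?thesis by (simp add: p_q_s_t_def algebra_simps)
qed

abbreviation "P \<equiv> interior (convex hull {a, b, c})"

lemma open_P: "open P" by simp
lemma bounded_P: "bounded P"
  by (rule bounded_subset[OF bounded_convex_hull interior_subset]) (simp add: finite_imp_bounded)

lemma integral_P: "\<exists>D>0. \<forall>G :: real^2 \<Rightarrow> real. continuous_on UNIV G \<longrightarrow> (\<forall>q. q \<notin> P \<longrightarrow> G q = 0) \<longrightarrow>
  (LINT q|lebesgue_on P. G q) = D * (LINT p|lborel. G (T p))"
proof -
  obtain D where D: "D > 0" "\<And>F :: real^2 \<Rightarrow> real. F \<in> borel_measurable borel \<Longrightarrow> (LINT p|lborel. F (T p)) = D * (LINT q|lborel. F q)"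
    using T_integral by blast
  have "(LINT q|lebesgue_on P. G q) = 1 / D * (LINT p|lborel. G (T p))"
    if G: "continuous_on UNIV G" and z: "\<And>q. q \<notin> P \<Longrightarrow> G q = 0" for G :: "real^2 \<Rightarrow> real"
  proof -
    have "(LINT q|lebesgue_on P. G q) = (LINT q|lebesgue. indicator P q *\<^sub>R G q)"
      by (rule integral_restrict_space) simp
    also have "\<dots> = (LINT q|lebesgue. G q)"
      by (rule Bochner_Integration.integral_cong) (use z in \<open>auto simp: indicator_def\<close>)
    also have "\<dots> = (LINT q|lborel. G q)"
      by (rule integral_completion) (use borel_measurable_continuous_onI[OF G] in simp)
    finally show ?thesis using D(1) D(2)[OF borel_measurable_continuous_onI[OF G]] by simp
  qed
  then show ?thesis using D(1) by (intro exI[of _ "1 / D"]) auto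
qed

definition qform :: "(real \<times> real \<Rightarrow> real \<times> real) \<Rightarrow> real" where
  "qform \<phi>' = cx * sq_int (\<lambda>p. fst (\<phi>' p)) + cy * sq_int (\<lambda>p. snd (\<phi>' p)) + cz * sq_int (\<lambda>p. fst (\<phi>' p) - snd (\<phi>' p))"

end

lemma integrable_test_gradient:
  assumes t: "test_function open_unit_triangle \<phi> \<phi>'" and g: "continuous_on UNIV g" "g (0, 0) = 0"
  shows "integrable lborel (\<lambda>p. (g (\<phi>' p) :: real))"
proof -
  obtain K where K: "compact K" "\<And>x. x \<notin> K \<Longrightarrow> \<phi>' x = 0"
    using test_function_support_ex[OF t] by meson
  have "continuous_on K (\<lambda>p. g (\<phi>' p))"
    by (rule continuous_on_compose2[OF g(1) continuous_on_subset[OF test_function_continuous(2)[OF t]]]) auto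
  from borel_integrable_compact[OF K(1) this]
  have "integrable lborel (\<lambda>p. indicator K p *\<^sub>R g (\<phi>' p))" .
  moreover have "(\<lambda>p. indicator K p *\<^sub>R g (\<phi>' p)) = (\<lambda>p. g (\<phi>' p))"
    using K(2) g(2) by (auto simp: fun_eq_iff indicator_def zero_prod_def)
  ultimately show ?thesis by simp
qed

context triangle
begin

lemma integral_quad:
  assumes t: "test_function open_unit_triangle \<phi> \<phi>'"
  shows "(LINT p|lborel. quad (\<phi>' p)) = qform \<phi>'"
proof -
  have i: "integrable lborel (\<lambda>p. (fst (\<phi>' p))\<^sup>2)" "integrable lborel (\<lambda>p. (snd (\<phi>' p))\<^sup>2)"
    "integrable lborel (\<lambda>p. (fst (\<phi>' p) - snd (\<phi>' p))\<^sup>2)"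
    by (rule integrable_test_gradient[OF t]; auto intro!: continuous_intros)+
  show ?thesis
    unfolding quad_def qform_def sq_int_def using i by simp
qed

lemma qform_coercive:
  assumes t: "test_function open_unit_triangle \<phi> \<phi>'"
  shows "sq_int (\<lambda>p. fst (\<phi>' p)) + sq_int (\<lambda>p. snd (\<phi>' p)) \<le> 4 * (cx + cy + 2 * cz) * qform \<phi>'"
proof -
  have i: "integrable lborel (\<lambda>p. (fst (\<phi>' p))\<^sup>2)" "integrable lborel (\<lambda>p. (snd (\<phi>' p))\<^sup>2)"
    by (rule integrable_test_gradient[OF t]; auto intro!: continuous_intros)+
  have iq: "integrable lborel (\<lambda>p. quad (\<phi>' p))"
    by (rule integrable_test_gradient[OF t]) (auto simp: quad_def intro!: continuous_intros)
  have "sq_int (\<lambda>p. fst (\<phi>' p)) + sq_int (\<lambda>p. snd (\<phi>' p)) = (LINT p|lborel. (fst (\<phi>' p))\<^sup>2 + (snd (\<phi>' p))\<^sup>2)"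
    unfolding sq_int_def using i by simp
  also have "\<dots> \<le> (LINT p|lborel. 4 * (cx + cy + 2 * cz) * quad (\<phi>' p))"
    by (rule integral_mono) (use i iq quad_coercive in auto)
  finally show ?thesis by (simp add: integral_quad[OF t])
qed

text \<open>Both quadratic forms are transported to the unit triangle, where the cells provide the functionals. The energy is
  multiplied by the area because \<open>|P| \<lambda>(P)\<close> does not change under scaling.\<close>

lemma rayleigh_P:
  assumes nontrivial: "\<exists>\<phi> \<phi>'. test_function open_unit_triangle \<phi> \<phi>' \<and> sq_int \<phi> > 0"
  shows "\<exists>D>0. rayleigh P \<and>
    (\<forall>\<psi> \<psi>'. test_function P \<psi> \<psi>' \<longrightarrow> (LINT q|lebesgue_on P. (norm (\<psi> q))\<^sup>2) = D * sq_int (\<psi> \<circ> T)) \<and>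
    (\<forall>\<psi> \<psi>'. test_function P \<psi> \<psi>' \<longrightarrow>
      tri_area a b c * (LINT q|lebesgue_on P. (norm (\<psi>' q))\<^sup>2) = D * qform (\<lambda>p. (\<psi>' (T p) \<bullet> e, \<psi>' (T p) \<bullet> f)))"
proof -
  obtain D where D: "D > 0" and int: "\<And>G :: real^2 \<Rightarrow> real. continuous_on UNIV G \<Longrightarrow> (\<And>q. q \<notin> P \<Longrightarrow> G q = 0) \<Longrightarrow>
      (LINT q|lebesgue_on P. G q) = D * (LINT p|lborel. G (T p))"
    using integral_P by blast
  have A: "tri_area a b c > 0" using edge_det by (simp add: area)
  have I: "P = T ` open_unit_triangle" by (rule interior_hull)
  have e1: "(LINT q|lebesgue_on P. (norm (\<psi> q))\<^sup>2) = D * sq_int (\<psi> \<circ> T)" if t: "test_function P \<psi> \<psi>'" for \<psi> \<psi>'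
  proof -
    obtain K where "K \<subseteq> P" "\<And>x. x \<notin> K \<Longrightarrow> \<psi> x = 0" using test_function_support_ex[OF t] by meson
    then have "\<And>q. q \<notin> P \<Longrightarrow> (norm (\<psi> q))\<^sup>2 = 0" by auto
    moreover have "continuous_on UNIV (\<lambda>q. (norm (\<psi> q))\<^sup>2)"
      by (intro continuous_intros test_function_continuous(1)[OF t])
    ultimately show ?thesis using int[of "\<lambda>q. (norm (\<psi> q))\<^sup>2"] by (simp add: sq_int_def)
  qed
  have e2: "tri_area a b c * (LINT q|lebesgue_on P. (norm (\<psi>' q))\<^sup>2) = D * qform (\<lambda>p. (\<psi>' (T p) \<bullet> e, \<psi>' (T p) \<bullet> f))"
    if t: "test_function P \<psi> \<psi>'" for \<psi> \<psi>'
  proof -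
    obtain K where "K \<subseteq> P" "\<And>x. x \<notin> K \<Longrightarrow> \<psi>' x = 0" using test_function_support_ex[OF t] by meson
    then have "\<And>q. q \<notin> P \<Longrightarrow> (norm (\<psi>' q))\<^sup>2 = 0" by auto
    moreover have "continuous_on UNIV (\<lambda>q. (norm (\<psi>' q))\<^sup>2)"
      by (intro continuous_intros test_function_continuous(2)[OF t])
    ultimately have "(LINT q|lebesgue_on P. (norm (\<psi>' q))\<^sup>2) = D * (LINT p|lborel. (norm (\<psi>' (T p)))\<^sup>2)"
      using int[of "\<lambda>q. (norm (\<psi>' q))\<^sup>2"] by simp
    then have "tri_area a b c * (LINT q|lebesgue_on P. (norm (\<psi>' q))\<^sup>2) = D * (LINT p|lborel. tri_area a b c * (norm (\<psi>' (T p)))\<^sup>2)"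
      by simp
    also have "\<dots> = D * (LINT p|lborel. quad (\<psi>' (T p) \<bullet> e, \<psi>' (T p) \<bullet> f))"
      unfolding quad_gradient ..
    also have "\<dots> = D * qform (\<lambda>p. (\<psi>' (T p) \<bullet> e, \<psi>' (T p) \<bullet> f))"
      using integral_quad[OF pull_back[OF t[unfolded I]]] by simp
    finally show ?thesis .
  qed
  have "rayleigh P"
  proof
    show "open P" "bounded P" by (rule open_P bounded_P)+
    obtain \<phi> \<phi>' where t: "test_function open_unit_triangle \<phi> \<phi>'" and p: "sq_int \<phi> > 0"
      using nontrivial by blast
    have ST': "\<phi> \<circ> S \<circ> T = \<phi>" by (auto simp: fun_eq_iff ST)
    note pf = push_forward[OF t, folded I]
    have "0 < (LINT x|lebesgue_on P. (norm ((\<phi> \<circ> S) x))\<^sup>2)"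
      unfolding e1[OF pf] ST' using p D(1) by simp
    with pf show "\<exists>\<phi> \<phi>'. test_function P \<phi> \<phi>' \<and> 0 < (LINT x|lebesgue_on P. (norm (\<phi> x))\<^sup>2)"
      by (intro exI conjI)
  next
    fix \<Lambda> :: real
    define W where "W = 4 * (cx + cy + 2 * cz) * tri_area a b c"
    have W: "W > 0" using coeff_pos A by (simp add: W_def)
    obtain n0 :: nat where n0: "\<bar>\<Lambda>\<bar> * W < n0" using reals_Archimedean2 by blast
    define n where "n = Suc n0"
    have n: "n > 0" "\<bar>\<Lambda>\<bar> * W \<le> (real n)\<^sup>2"
    proof -
      have "\<bar>\<Lambda>\<bar> * W \<le> real n" using n0 by (simp add: n_def)
      also have "\<dots> \<le> (real n)\<^sup>2" by (rule self_le_power) (auto simp: n_def)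
      finally show "\<bar>\<Lambda>\<bar> * W \<le> (real n)\<^sup>2" .
    qed (simp add: n_def)
    define L :: "nat \<Rightarrow> (real^2 \<Rightarrow> real) \<Rightarrow> real" where
      "L k \<psi> = cell n (k mod n) (k div n) (\<psi> \<circ> T)" for k \<psi>
    \<comment> \<open>The first summand serves the coercivity, the second one the bound of the functionals.\<close>
    define C where "C = \<bar>\<Lambda>\<bar> * D * (real n)\<^sup>2 + 1 / D"
    have C: "C \<ge> 0" using D by (simp add: C_def)
    have reindex: "(\<Sum>k<n * n. (L k \<psi>)\<^sup>2) = (\<Sum>j<n. \<Sum>i<n. (cell n i j (\<psi> \<circ> T))\<^sup>2)" for \<psi>
    proof -
      have "(\<Sum>k<n * n. (L k \<psi>)\<^sup>2) = (\<Sum>j<n. \<Sum>k = j * n..<j * n + n. (L k \<psi>)\<^sup>2)"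
        by (rule sum.nat_group[symmetric])
      also have "\<dots> = (\<Sum>j<n. \<Sum>i<n. (L (i + j * n) \<psi>)\<^sup>2)"
      proof (rule sum.cong[OF refl])
        fix j
        have "{j * n..<j * n + n} = {0 + j * n..<n + j * n}" by (simp add: add.commute)
        then show "(\<Sum>k = j * n..<j * n + n. (L k \<psi>)\<^sup>2) = (\<Sum>i<n. (L (i + j * n) \<psi>)\<^sup>2)"
          by (simp only: sum.shift_bounds_nat_ivl lessThan_atLeast0)
      qed
      also have "\<dots> = (\<Sum>j<n. \<Sum>i<n. (cell n i j (\<psi> \<circ> T))\<^sup>2)"
        using n(1) by (intro sum.cong refl) (auto simp: L_def)
      finally show ?thesis .
    qed
    have bounds: "(\<forall>k<n * n. (L k \<psi>)\<^sup>2 \<le> C * (LINT x|lebesgue_on P. (norm (\<psi> x))\<^sup>2)) \<and>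
        \<Lambda> * (LINT x|lebesgue_on P. (norm (\<psi> x))\<^sup>2)
          \<le> (LINT x|lebesgue_on P. (norm (\<psi>' x))\<^sup>2) + C * (\<Sum>k<n * n. (L k \<psi>)\<^sup>2)"
      if t: "test_function P \<psi> \<psi>'" for \<psi> \<psi>'
    proof (intro conjI allI impI)
      note pb = pull_back[OF t[unfolded I]]
      let ?N = "sq_int (\<psi> \<circ> T)" and ?q = "qform (\<lambda>p. (\<psi>' (T p) \<bullet> e, \<psi>' (T p) \<bullet> f))"
      note E = e1[OF t] e2[OF t]
      have N0: "?N \<ge> 0" by (rule sq_int_nonneg)
      have CD: "C * D \<ge> 1"
      proof -
        have "C * D = \<bar>\<Lambda>\<bar> * D * (real n)\<^sup>2 * D + 1" using D by (simp add: C_def algebra_simps)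
        then show ?thesis using D by simp
      qed
      fix k assume "k < n * n"
      then have "k mod n < n" "k div n < n" using n(1) by (auto simp: less_mult_imp_div_less)
      then have "(L k \<psi>)\<^sup>2 \<le> ?N" unfolding L_def by (rule test_cells(2)[OF pb n(1)])
      also have "\<dots> \<le> (C * D) * ?N" using mult_right_mono[OF CD N0] by simp
      finally show "(L k \<psi>)\<^sup>2 \<le> C * (LINT x|lebesgue_on P. (norm (\<psi> x))\<^sup>2)" unfolding E by (simp add: mult.assoc)
    next
      note pb = pull_back[OF t[unfolded I]]
      let ?N = "sq_int (\<psi> \<circ> T)" and ?q = "qform (\<lambda>p. (\<psi>' (T p) \<bullet> e, \<psi>' (T p) \<bullet> f))"
      note E = e1[OF t] e2[OF t]
      define s where "s = (\<Sum>k<n * n. (L k \<psi>)\<^sup>2)"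
      define G where "G = (LINT x|lebesgue_on P. (norm (\<psi>' x))\<^sup>2)"
      have s0: "s \<ge> 0" by (simp add: s_def sum_nonneg)
      have q: "?q = tri_area a b c * G / D" using E(2) D by (simp add: G_def field_simps)
      have G0: "G \<ge> 0" by (simp add: G_def)
      have "?N \<le> (real n)\<^sup>2 * s + (4 * (cx + cy + 2 * cz) * ?q) / (real n)\<^sup>2"
        using test_cells(1)[OF pb n(1)] divide_right_mono[OF qform_coercive[OF pb], of "(real n)\<^sup>2"]
        unfolding s_def reindex by simp
      also have "4 * (cx + cy + 2 * cz) * ?q = W * G / D" unfolding q W_def by simp
      finally have N: "D * ?N \<le> D * (real n)\<^sup>2 * s + W * G / (real n)\<^sup>2"
      proof -
        assume le: "?N \<le> (real n)\<^sup>2 * s + W * G / D / (real n)\<^sup>2"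
        have "D * ?N \<le> D * ((real n)\<^sup>2 * s + W * G / D / (real n)\<^sup>2)"
          by (rule mult_left_mono[OF le]) (use D(1) in simp)
        also have "\<dots> = D * (real n)\<^sup>2 * s + W * G / (real n)\<^sup>2" using D(1) by (simp add: algebra_simps)
        finally show ?thesis .
      qed
      have "\<Lambda> * (D * ?N) \<le> \<bar>\<Lambda>\<bar> * (D * ?N)"
        using D sq_int_nonneg[of "\<psi> \<circ> T"] by (intro mult_right_mono) auto
      also have "\<dots> \<le> \<bar>\<Lambda>\<bar> * (D * (real n)\<^sup>2 * s + W * G / (real n)\<^sup>2)"
        using N by (intro mult_left_mono) auto
      also have "\<dots> = \<bar>\<Lambda>\<bar> * D * (real n)\<^sup>2 * s + (\<bar>\<Lambda>\<bar> * W / (real n)\<^sup>2) * G" by (simp add: algebra_simps)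
      also have "(\<bar>\<Lambda>\<bar> * W / (real n)\<^sup>2) * G \<le> 1 * G"
        using n G0 by (intro mult_right_mono) auto
      also have "\<bar>\<Lambda>\<bar> * D * (real n)\<^sup>2 * s \<le> C * s"
        using s0 D by (intro mult_right_mono) (auto simp: C_def)
      finally show "\<Lambda> * (LINT x|lebesgue_on P. (norm (\<psi> x))\<^sup>2)
          \<le> (LINT x|lebesgue_on P. (norm (\<psi>' x))\<^sup>2) + C * (\<Sum>k<n * n. (L k \<psi>)\<^sup>2)"
        unfolding E s_def G_def by simp
    qed
    have diff: "L k (\<lambda>x. \<psi>1 x - \<psi>2 x) = L k \<psi>1 - L k \<psi>2"
      if t: "test_function P \<psi>1 \<psi>1'" "test_function P \<psi>2 \<psi>2'" for \<psi>1 \<psi>1' \<psi>2 \<psi>2' k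
    proof -
      have "continuous_on UNIV (\<psi>1 \<circ> T)" "continuous_on UNIV (\<psi>2 \<circ> T)"
        by (rule test_function_continuous(1)[OF pull_back[OF t(1)[unfolded I]]])
          (rule test_function_continuous(1)[OF pull_back[OF t(2)[unfolded I]]])
      from cell_diff[OF this] show ?thesis by (simp add: L_def o_def)
    qed
    show "\<exists>N C (L :: nat \<Rightarrow> (real^2 \<Rightarrow> real) \<Rightarrow> real). C \<ge> 0 \<and>
      (\<forall>\<phi> \<phi>'. test_function P \<phi> \<phi>' \<longrightarrow>
        (\<forall>i<N. (L i \<phi>)\<^sup>2 \<le> C * (LINT x|lebesgue_on P. (norm (\<phi> x))\<^sup>2)) \<and>
        \<Lambda> * (LINT x|lebesgue_on P. (norm (\<phi> x))\<^sup>2)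
          \<le> (LINT x|lebesgue_on P. (norm (\<phi>' x))\<^sup>2) + C * (\<Sum>i<N. (L i \<phi>)\<^sup>2)) \<and>
      (\<forall>\<phi> \<phi>' \<psi> \<psi>' i. test_function P \<phi> \<phi>' \<longrightarrow> test_function P \<psi> \<psi>' \<longrightarrow>
        L i (\<lambda>x. \<phi> x - \<psi> x) = L i \<phi> - L i \<psi>)"
    proof (intro exI[of _ "n * n"] exI[of _ C] exI[of _ L] conjI allI impI)
      show "C \<ge> 0" by (rule C)
    next
      fix \<phi> \<phi>' k assume t: "test_function P \<phi> \<phi>'" "k < n * n"
      then show "(L k \<phi>)\<^sup>2 \<le> C * (LINT x|lebesgue_on P. (norm (\<phi> x))\<^sup>2)"
        using bounds[OF t(1)] by blast
    next
      fix \<phi> \<phi>' assume t: "test_function P \<phi> \<phi>'"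
      show "\<Lambda> * (LINT x|lebesgue_on P. (norm (\<phi> x))\<^sup>2)
          \<le> (LINT x|lebesgue_on P. (norm (\<phi>' x))\<^sup>2) + C * (\<Sum>i<n * n. (L i \<phi>)\<^sup>2)"
        using bounds[OF t] by blast
    next
      fix \<phi> \<phi>' \<psi> \<psi>' i assume t: "test_function P \<phi> \<phi>'" "test_function P \<psi> \<psi>'"
      show "L i (\<lambda>x. \<phi> x - \<psi> x) = L i \<phi> - L i \<psi>" by (rule diff[OF t])
    qed
  qed
  with D e1 e2 show ?thesis by blast
qed

lemma eigenvalue_le:
  assumes nontrivial: "\<exists>\<phi> \<phi>'. test_function open_unit_triangle \<phi> \<phi>' \<and> sq_int \<phi> > 0"
    and t: "test_function open_unit_triangle \<phi> \<phi>'"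
  shows "tri_area a b c * tri_eigenvalue a b c * sq_int \<phi> \<le> qform \<phi>'"
proof -
  obtain D where D: "D > 0" "rayleigh P"
    "\<And>\<psi> \<psi>'. test_function P \<psi> \<psi>' \<Longrightarrow> (LINT q|lebesgue_on P. (norm (\<psi> q))\<^sup>2) = D * sq_int (\<psi> \<circ> T)"
    "\<And>\<psi> \<psi>'. test_function P \<psi> \<psi>' \<Longrightarrow> tri_area a b c * (LINT q|lebesgue_on P. (norm (\<psi>' q))\<^sup>2) = D * qform (\<lambda>p. (\<psi>' (T p) \<bullet> e, \<psi>' (T p) \<bullet> f))"
    using rayleigh_P[OF nontrivial] by blast
  interpret rayleigh P by (rule D(2))
  have A: "tri_area a b c > 0" using edge_det by (simp add: area)
  note pf = push_forward[OF t, folded interior_hull]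
  have 1: "\<phi> \<circ> S \<circ> T = \<phi>" by (auto simp: fun_eq_iff ST)
  have 2: "((fst (\<phi>' (S (T p))) *\<^sub>R s1 + snd (\<phi>' (S (T p))) *\<^sub>R s2) \<bullet> e, (fst (\<phi>' (S (T p))) *\<^sub>R s1 + snd (\<phi>' (S (T p))) *\<^sub>R s2) \<bullet> f) = \<phi>' p" for p
    by (simp add: ST inner_add_left dual)
  have "tri_area a b c * (tri_eigenvalue a b c * (D * sq_int \<phi>)) \<le> D * qform \<phi>'"
    using mult_left_mono[OF first_eigenvalue_le[OF pf], of "tri_area a b c"] A
    unfolding D(3)[OF pf] D(4)[OF pf] 1 2 by (simp add: tri_eigenvalue_def)
  then have "D * (tri_area a b c * tri_eigenvalue a b c * sq_int \<phi>) \<le> D * qform \<phi>'"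
    by (simp add: algebra_simps)
  then show ?thesis using D(1) by (rule mult_left_le_imp_le)
qed

lemma le_eigenvalue:
  assumes nontrivial: "\<exists>\<phi> \<phi>'. test_function open_unit_triangle \<phi> \<phi>' \<and> sq_int \<phi> > 0"
    and B: "\<And>\<phi> \<phi>'. test_function open_unit_triangle \<phi> \<phi>' \<Longrightarrow> B * sq_int \<phi> \<le> qform \<phi>'"
  shows "B \<le> tri_area a b c * tri_eigenvalue a b c"
proof -
  obtain D where D: "D > 0" "rayleigh P"
    "\<And>\<psi> \<psi>'. test_function P \<psi> \<psi>' \<Longrightarrow> (LINT q|lebesgue_on P. (norm (\<psi> q))\<^sup>2) = D * sq_int (\<psi> \<circ> T)"
    "\<And>\<psi> \<psi>'. test_function P \<psi> \<psi>' \<Longrightarrow> tri_area a b c * (LINT q|lebesgue_on P. (norm (\<psi>' q))\<^sup>2) = D * qform (\<lambda>p. (\<psi>' (T p) \<bullet> e, \<psi>' (T p) \<bullet> f))"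
    using rayleigh_P[OF nontrivial] by blast
  interpret rayleigh P by (rule D(2))
  have A: "tri_area a b c > 0" using edge_det by (simp add: area)
  have "B / tri_area a b c \<le> first_dirichlet_eigenvalue P"
  proof (rule le_first_eigenvalue)
    fix \<psi> \<psi>' assume t: "test_function P \<psi> \<psi>'"
    have "D * (B * sq_int (\<psi> \<circ> T)) \<le> tri_area a b c * (LINT q|lebesgue_on P. (norm (\<psi>' q))\<^sup>2)"
      unfolding D(4)[OF t] using B[OF pull_back[OF t[unfolded interior_hull]]] D(1) by (intro mult_left_mono) auto
    then show "B / tri_area a b c * (LINT q|lebesgue_on P. (norm (\<psi> q))\<^sup>2) \<le> (LINT q|lebesgue_on P. (norm (\<psi>' q))\<^sup>2)"
      unfolding D(3)[OF t] using A by (simp add: field_simps)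
  qed
  then show ?thesis using A by (simp add: tri_eigenvalue_def field_simps)
qed

end

section \<open>Integration over the unit triangle\<close>

lemma compact_unit_triangle: "compact unit_triangle"
proof -
  have "unit_triangle = {p. 0 \<le> fst p} \<inter> {p. 0 \<le> snd p} \<inter> {p. fst p + snd p \<le> 1}"
    by (auto simp: unit_triangle_def)
  also have "closed \<dots>"
    by (intro closed_Int closed_Collect_le continuous_intros)
  finally have c: "closed unit_triangle" .
  have "unit_triangle \<subseteq> cbox (0, 0) (1, 1)"
    by (auto simp: unit_triangle_def cbox_Pair_eq)
  then have "bounded unit_triangle" by (rule bounded_subset[OF bounded_cbox])
  with c show ?thesis by (simp add: compact_eq_bounded_closed)
qed

lemma open_subset_unit_triangle: "open_unit_triangle \<subseteq> unit_triangle"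
  by (auto simp: open_unit_triangle_def unit_triangle_def)

text \<open>Lebesgue measure on the closed unit triangle; the boundary terms in the integrations by parts are then values on
  the three edges.\<close>

definition tri_measure :: "(real \<times> real) measure" where
  "tri_measure = restrict_space lborel unit_triangle"

lemma sets_unit_triangle: "unit_triangle \<in> sets borel"
  using compact_unit_triangle by (simp add: compact_imp_closed borel_closed)

lemma space_tri_measure: "space tri_measure = unit_triangle"
  by (simp add: tri_measure_def space_restrict_space)

lemma integral_tri_measure:
  "(LINT p|tri_measure. g p) = (LINT p|lborel. indicator unit_triangle p * (g p :: real))"
  unfolding tri_measure_def using sets_unit_triangle by (subst integral_restrict_space) auto

lemma integrable_tri_measure:
  assumes "continuous_on UNIV g" shows "integrable tri_measure (g :: real \<times> real \<Rightarrow> real)"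
proof -
  have "integrable lborel (\<lambda>p. indicator unit_triangle p *\<^sub>R g p)"
    by (rule borel_integrable_compact[OF compact_unit_triangle continuous_on_subset[OF assms subset_UNIV]])
  then show ?thesis
    unfolding tri_measure_def using sets_unit_triangle by (simp add: integrable_restrict_space)
qed

lemma integral_tri_measure_eq_lborel:
  assumes "\<And>p. p \<notin> open_unit_triangle \<Longrightarrow> g p = 0"
  shows "(LINT p|tri_measure. g p) = (LINT p|lborel. (g p :: real))"
  unfolding integral_tri_measure
  by (rule Bochner_Integration.integral_cong)
    (use assms open_subset_unit_triangle in \<open>auto simp: indicator_def subset_eq\<close>)

lemma integral_tri_measure_mono:
  assumes "continuous_on UNIV f" "continuous_on UNIV g" "\<And>p. p \<in> unit_triangle \<Longrightarrow> f p \<le> (g p :: real)"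
  shows "(LINT p|tri_measure. f p) \<le> (LINT p|tri_measure. g p)"
  by (rule integral_mono) (use assms in \<open>auto simp: integrable_tri_measure space_tri_measure\<close>)

lemma FTC_real:
  fixes H h :: "real \<Rightarrow> real"
  assumes "a \<le> b" "\<And>x. (H has_real_derivative h x) (at x)"
  shows "integral {a..b} h = H b - H a"
  using assms by (intro integral_unique fundamental_theorem_of_calculus)
    (auto simp: has_real_derivative_iff_has_vector_derivative[symmetric] intro: has_field_derivative_at_within)

text \<open>Fubini and the fundamental theorem of calculus on the segments from \<open>(0, y)\<close> to \<open>(1 - y, y)\<close>.\<close>

lemma integral_tri_measure_dx:
  assumes c: "continuous_on UNIV h"
    and d: "\<And>x y. ((\<lambda>x. H (x, y)) has_real_derivative h (x, y)) (at x)"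
  shows "(LINT p|tri_measure. h p) = integral {0..1} (\<lambda>y. H (1 - y, y) - H (0, y))"
proof -
  have "(LINT p|tri_measure. h p) = integral {0..1} (\<lambda>y. integral {0..1 - y} (\<lambda>x. h (x, y)))"
    unfolding integral_tri_measure
    by (rule iterated_integral_snd[OF compact_unit_triangle c]) (auto simp: unit_triangle_def)
  also have "\<dots> = integral {0..1} (\<lambda>y. H (1 - y, y) - H (0, y))"
    by (rule integral_cong) (rule FTC_real[where H = "\<lambda>x. H (x, y)" for y], auto intro: d)
  finally show ?thesis .
qed

lemma integral_tri_measure_dy:
  assumes c: "continuous_on UNIV h"
    and d: "\<And>x y. ((\<lambda>y. H (x, y)) has_real_derivative h (x, y)) (at y)"
  shows "(LINT p|tri_measure. h p) = integral {0..1} (\<lambda>x. H (x, 1 - x) - H (x, 0))"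
proof -
  have "(LINT p|tri_measure. h p) = integral {0..1} (\<lambda>x. integral {0..1 - x} (\<lambda>y. h (x, y)))"
    unfolding integral_tri_measure
    by (rule iterated_integral_fst[OF compact_unit_triangle c]) (auto simp: unit_triangle_def)
  also have "\<dots> = integral {0..1} (\<lambda>x. H (x, 1 - x) - H (x, 0))"
    by (rule integral_cong) (rule FTC_real[where H = "\<lambda>y. H (x, y)" for x], auto intro: d)
  finally show ?thesis .
qed

lemma continuous_zero_extension:
  assumes L: "compact L" "L \<subseteq> open_unit_triangle"
    and c: "continuous_on open_unit_triangle g"
    and z: "\<And>p. p \<in> open_unit_triangle \<Longrightarrow> p \<notin> L \<Longrightarrow> g p = 0"
  shows "continuous_on UNIV (\<lambda>p. if p \<in> open_unit_triangle then g p else (0 :: 'a :: real_normed_vector))"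
proof -
  let ?f = "\<lambda>p. if p \<in> open_unit_triangle then g p else 0"
  have "continuous_on open_unit_triangle ?f"
    using c by (rule continuous_on_eq) simp
  moreover have "continuous_on (- L) ?f"
    by (rule continuous_on_eq[of _ "\<lambda>_. 0"]) (use z in auto)
  moreover have "open (- L)" using L(1) by (simp add: compact_imp_closed open_Compl)
  ultimately have "continuous_on (open_unit_triangle \<union> - L) ?f"
    by (intro continuous_on_open_Un open_unit_triangle_open)
  moreover have "open_unit_triangle \<union> - L = UNIV" using L(2) by auto
  ultimately show ?thesis by simp
qed

lemma slice_derivative_zero_extension:
  assumes L: "compact L" "L \<subseteq> open_unit_triangle"
    and z: "\<And>p. p \<in> open_unit_triangle \<Longrightarrow> p \<notin> L \<Longrightarrow> g p = (0 :: real)"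
    and \<gamma>: "continuous_on UNIV \<gamma>"
    and d: "\<gamma> t \<in> open_unit_triangle \<Longrightarrow> ((\<lambda>t. g (\<gamma> t)) has_real_derivative g') (at t)"
  shows "((\<lambda>t. if \<gamma> t \<in> open_unit_triangle then g (\<gamma> t) else 0) has_real_derivative
      (if \<gamma> t \<in> open_unit_triangle then g' else 0)) (at t)"
proof (cases "\<gamma> t \<in> open_unit_triangle")
  case True
  have "open (\<gamma> -` open_unit_triangle)" by (rule open_vimage[OF open_unit_triangle_open \<gamma>])
  then have "((\<lambda>t. if \<gamma> t \<in> open_unit_triangle then g (\<gamma> t) else 0) has_real_derivative g') (at t)"
    by (rule has_field_derivative_transform_within_open[OF d[OF True]]) (use True in auto)
  then show ?thesis using True by simp
next
  case False
  have "open (\<gamma> -` (- L))" using L(1) by (intro open_vimage[OF _ \<gamma>]) (simp add: compact_imp_closed open_Compl)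
  then have "((\<lambda>t. if \<gamma> t \<in> open_unit_triangle then g (\<gamma> t) else 0) has_real_derivative 0) (at t)"
    by (rule has_field_derivative_transform_within_open[OF DERIV_const]) (use False z L in auto)
  then show ?thesis using False by simp
qed

section \<open>Lower bounds from positive eigenfunctions\<close>

text \<open>With \<open>\<phi> = r w\<close> the energy density of \<open>\<phi>\<close> minus \<open>\<mu> \<phi>\<^sup>2\<close> is the nonnegative form in \<open>w \<nabla>r\<close> plus the divergence of
  \<open>\<phi>\<^sup>2/w\<close> times the flux of \<open>w\<close>, and the divergence integrates to \<open>0\<close> because \<open>\<phi>\<close> vanishes near the boundary.\<close>

lemma Barta:
  fixes w wx wy Fx Gy :: "real \<times> real \<Rightarrow> real" and c1 c2 c3 \<mu> :: real
  assumes t: "test_function open_unit_triangle \<phi> \<phi>'"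
    and w: "\<And>p. p \<in> open_unit_triangle \<Longrightarrow> w p > 0"
    and c: "continuous_on UNIV w" "continuous_on UNIV wx" "continuous_on UNIV wy"
      "continuous_on UNIV Fx" "continuous_on UNIV Gy"
    and dwx: "\<And>x y. ((\<lambda>x. w (x, y)) has_real_derivative wx (x, y)) (at x)"
    and dwy: "\<And>x y. ((\<lambda>y. w (x, y)) has_real_derivative wy (x, y)) (at y)"
    and dF: "\<And>x y. ((\<lambda>x. (c1 + c3) * wx (x, y) - c3 * wy (x, y)) has_real_derivative Fx (x, y)) (at x)"
    and dG: "\<And>x y. ((\<lambda>y. (c2 + c3) * wy (x, y) - c3 * wx (x, y)) has_real_derivative Gy (x, y)) (at y)"
    and pde: "\<And>p. Fx p + Gy p = - \<mu> * w p"
    and psd: "\<And>s t. c1 * s\<^sup>2 + c2 * t\<^sup>2 + c3 * (s - t)\<^sup>2 \<ge> 0"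
  shows "\<mu> * sq_int \<phi> \<le> c1 * sq_int (\<lambda>p. fst (\<phi>' p)) + c2 * sq_int (\<lambda>p. snd (\<phi>' p))
    + c3 * sq_int (\<lambda>p. fst (\<phi>' p) - snd (\<phi>' p))"
proof -
  let ?O = open_unit_triangle
  obtain L where L: "compact L" "L \<subseteq> ?O" and L0: "\<And>x. x \<notin> L \<Longrightarrow> \<phi> x = 0" "\<And>x. x \<notin> L \<Longrightarrow> \<phi>' x = 0"
    using test_function_support_ex[OF t] by meson
  define F where "F p = (c1 + c3) * wx p - c3 * wy p" for p
  define G where "G p = (c2 + c3) * wy p - c3 * wx p" for p
  define gx where "gx p = 2 * \<phi> p * fst (\<phi>' p) * F p / w p + (\<phi> p)\<^sup>2 * Fx p / w p - (\<phi> p)\<^sup>2 * F p * wx p / (w p)\<^sup>2" for p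
  define gy where "gy p = 2 * \<phi> p * snd (\<phi>' p) * G p / w p + (\<phi> p)\<^sup>2 * Gy p / w p - (\<phi> p)\<^sup>2 * G p * wy p / (w p)\<^sup>2" for p
  define hx where "hx p = (if p \<in> ?O then gx p else 0)" for p
  define hy where "hy p = (if p \<in> ?O then gy p else 0)" for p
  note ct = test_function_continuous[OF t]
  have cF: "continuous_on UNIV F" "continuous_on UNIV G" unfolding F_def G_def by (intro continuous_intros c)+
  have w0: "\<And>p. p \<in> ?O \<Longrightarrow> w p \<noteq> 0" using w by force
  have sub: "continuous_on ?O f" if "continuous_on UNIV f" for f :: "real \<times> real \<Rightarrow> 'b::topological_space"
    by (rule continuous_on_subset[OF that]) simp
  have "continuous_on ?O gx" unfolding gx_def
    by (intro continuous_intros sub c cF ct ballI) (simp_all add: w0)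
  then have chx: "continuous_on UNIV hx" unfolding hx_def
    by (rule continuous_zero_extension[OF L]) (simp add: gx_def L0)
  have "continuous_on ?O gy" unfolding gy_def
    by (intro continuous_intros sub c cF ct ballI) (simp_all add: w0)
  then have chy: "continuous_on UNIV hy" unfolding hy_def
    by (rule continuous_zero_extension[OF L]) (simp add: gy_def L0)
  have ix: "(LINT p|tri_measure. hx p) = 0"
  proof -
    have "((\<lambda>x. if (x, y) \<in> ?O then (\<phi> (x, y))\<^sup>2 * F (x, y) / w (x, y) else 0) has_real_derivative hx (x, y)) (at x)" for x y
      unfolding hx_def
    proof (rule slice_derivative_zero_extension[OF L, where g = "\<lambda>p. (\<phi> p)\<^sup>2 * F p / w p" and \<gamma> = "\<lambda>x. (x, y)"])
      assume "(x, y) \<in> ?O"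
      have "((\<lambda>x. F (x, y)) has_real_derivative Fx (x, y)) (at x)" unfolding F_def by (rule dF)
      note [derivative_intros] = this dwx test_partial(1)[OF t]
      show "((\<lambda>x. (\<phi> (x, y))\<^sup>2 * F (x, y) / w (x, y)) has_real_derivative gx (x, y)) (at x)"
        by (auto intro!: derivative_eq_intros simp: w0[OF \<open>(x, y) \<in> ?O\<close>] gx_def)
           (use w0[OF \<open>(x, y) \<in> ?O\<close>] in \<open>simp add: field_simps power2_eq_square\<close>)
    qed (use L0 in \<open>auto intro!: continuous_intros\<close>)
    from integral_tri_measure_dx[OF chx, of "\<lambda>p. if p \<in> ?O then (\<phi> p)\<^sup>2 * F p / w p else 0", OF this]
    show ?thesis by (simp add: open_unit_triangle_def)
  qed
  have iy: "(LINT p|tri_measure. hy p) = 0"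
  proof -
    have "((\<lambda>y. if (x, y) \<in> ?O then (\<phi> (x, y))\<^sup>2 * G (x, y) / w (x, y) else 0) has_real_derivative hy (x, y)) (at y)" for x y
      unfolding hy_def
    proof (rule slice_derivative_zero_extension[OF L, where g = "\<lambda>p. (\<phi> p)\<^sup>2 * G p / w p" and \<gamma> = "\<lambda>y. (x, y)"])
      assume "(x, y) \<in> ?O"
      have "((\<lambda>y. G (x, y)) has_real_derivative Gy (x, y)) (at y)" unfolding G_def by (rule dG)
      note [derivative_intros] = this dwy test_partial(2)[OF t]
      show "((\<lambda>y. (\<phi> (x, y))\<^sup>2 * G (x, y) / w (x, y)) has_real_derivative gy (x, y)) (at y)"
        by (auto intro!: derivative_eq_intros simp: w0[OF \<open>(x, y) \<in> ?O\<close>] gy_def)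
           (use w0[OF \<open>(x, y) \<in> ?O\<close>] in \<open>simp add: field_simps power2_eq_square\<close>)
    qed (use L0 in \<open>auto intro!: continuous_intros\<close>)
    from integral_tri_measure_dy[OF chy, of "\<lambda>p. if p \<in> ?O then (\<phi> p)\<^sup>2 * G p / w p else 0", OF this]
    show ?thesis by (simp add: open_unit_triangle_def)
  qed
  define q where "q p = c1 * (fst (\<phi>' p))\<^sup>2 + c2 * (snd (\<phi>' p))\<^sup>2 + c3 * (fst (\<phi>' p) - snd (\<phi>' p))\<^sup>2" for p
  have pt: "\<mu> * (\<phi> p)\<^sup>2 + hx p + hy p \<le> q p" for p
  proof (cases "p \<in> ?O")
    case True
    define r where "r = \<phi> p / w p"
    have rw: "\<phi> p = r * w p" using w0[OF True] by (simp add: r_def)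
    define s u where "s = fst (\<phi>' p)" "u = snd (\<phi>' p)"
    have "gx p + gy p = 2 * s * r * F p + 2 * u * r * G p + \<phi> p * r * (Fx p + Gy p) - r\<^sup>2 * (F p * wx p + G p * wy p)"
      using w0[OF True] by (simp add: gx_def gy_def r_def s_u_def power2_eq_square field_simps)
    also have "\<phi> p * r * (Fx p + Gy p) = - \<mu> * (\<phi> p)\<^sup>2"
      unfolding pde rw by (simp add: power2_eq_square)
    finally have "\<mu> * (\<phi> p)\<^sup>2 + hx p + hy p = 2 * s * r * F p + 2 * u * r * G p - r\<^sup>2 * (F p * wx p + G p * wy p)"
      using True by (simp add: hx_def hy_def)
    moreover have "c1 * (s - r * wx p)\<^sup>2 + c2 * (u - r * wy p)\<^sup>2 + c3 * ((s - r * wx p) - (u - r * wy p))\<^sup>2 \<ge> 0"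
      by (rule psd)
    moreover have "c1 * (s - r * wx p)\<^sup>2 + c2 * (u - r * wy p)\<^sup>2 + c3 * ((s - r * wx p) - (u - r * wy p))\<^sup>2
        = q p - (2 * s * r * F p + 2 * u * r * G p - r\<^sup>2 * (F p * wx p + G p * wy p))"
      by (simp add: q_def F_def G_def s_u_def power2_eq_square algebra_simps)
    ultimately show ?thesis by linarith
  next
    case False
    then have "p \<notin> L" using L by blast
    then show ?thesis using False psd by (simp add: hx_def hy_def L0 q_def)
  qed
  have cq: "continuous_on UNIV q" unfolding q_def by (intro continuous_intros ct)
  have "(LINT p|tri_measure. \<mu> * (\<phi> p)\<^sup>2 + hx p + hy p) \<le> (LINT p|tri_measure. q p)"
    by (rule integral_tri_measure_mono) (use pt in \<open>auto intro!: continuous_intros ct chx chy cq\<close>)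
  moreover have "(LINT p|tri_measure. \<mu> * (\<phi> p)\<^sup>2 + hx p + hy p) = \<mu> * (LINT p|tri_measure. (\<phi> p)\<^sup>2)"
  proof -
    have "integrable tri_measure (\<lambda>p. \<mu> * (\<phi> p)\<^sup>2)" "integrable tri_measure hx" "integrable tri_measure hy"
      by (intro integrable_tri_measure continuous_intros ct chx chy)+
    then show ?thesis using ix iy by simp
  qed
  moreover have "(LINT p|tri_measure. (\<phi> p)\<^sup>2) = sq_int \<phi>"
    unfolding sq_int_def by (rule integral_tri_measure_eq_lborel) (use L L0 in auto)
  moreover have "(LINT p|tri_measure. q p) = (LINT p|lborel. q p)"
    by (rule integral_tri_measure_eq_lborel) (use L L0 in \<open>auto simp: q_def subset_eq\<close>)
  moreover have "(LINT p|lborel. q p) = c1 * sq_int (\<lambda>p. fst (\<phi>' p)) + c2 * sq_int (\<lambda>p. snd (\<phi>' p))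
    + c3 * sq_int (\<lambda>p. fst (\<phi>' p) - snd (\<phi>' p))"
  proof -
    have i: "integrable lborel (\<lambda>p. (fst (\<phi>' p))\<^sup>2)" "integrable lborel (\<lambda>p. (snd (\<phi>' p))\<^sup>2)"
      "integrable lborel (\<lambda>p. (fst (\<phi>' p) - snd (\<phi>' p))\<^sup>2)"
      by (rule integrable_test_gradient[OF t]; auto intro!: continuous_intros)+
    show ?thesis unfolding q_def sq_int_def using i by simp
  qed
  ultimately show ?thesis by simp
qed

lemma sin_pi_pos: "0 < r \<Longrightarrow> r < 1 \<Longrightarrow> sin (pi * r) > 0"
  by (rule sin_gt_zero) auto

text \<open>The rank one form \<open>(s \<phi>\<^sub>x + t \<phi>\<^sub>y)\<^sup>2\<close> sees only a strip: each of the three pairs, side and opposite vertex, gives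
  a strip that contains the triangle.\<close>

lemma direction_bounds:
  assumes t: "test_function open_unit_triangle \<phi> \<phi>'"
  defines "q \<equiv> \<lambda>s t. (s\<^sup>2 + s * t) * sq_int (\<lambda>p. fst (\<phi>' p)) + (t\<^sup>2 + s * t) * sq_int (\<lambda>p. snd (\<phi>' p))
    + (- (s * t)) * sq_int (\<lambda>p. fst (\<phi>' p) - snd (\<phi>' p))"
  shows "(pi\<^sup>2 * s\<^sup>2) * sq_int \<phi> \<le> q s t" "(pi\<^sup>2 * t\<^sup>2) * sq_int \<phi> \<le> q s t" "(pi\<^sup>2 * (s + t)\<^sup>2) * sq_int \<phi> \<le> q s t"
proof -
  have psd: "(s\<^sup>2 + s * t) * a\<^sup>2 + (t\<^sup>2 + s * t) * b\<^sup>2 + (- (s * t)) * (a - b)\<^sup>2 \<ge> 0" for a b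
  proof -
    have "(s\<^sup>2 + s * t) * a\<^sup>2 + (t\<^sup>2 + s * t) * b\<^sup>2 + (- (s * t)) * (a - b)\<^sup>2 = (s * a + t * b)\<^sup>2"
      by (simp add: power2_eq_square algebra_simps)
    then show ?thesis by simp
  qed
  have pos: "sin (pi * fst p) > 0" "sin (pi * snd p) > 0" "sin (pi * (fst p + snd p)) > 0" if "p \<in> open_unit_triangle" for p
    using that by (auto intro!: sin_pi_pos simp: open_unit_triangle_def)
  show "(pi\<^sup>2 * s\<^sup>2) * sq_int \<phi> \<le> q s t"
    unfolding q_def
    by (rule Barta[OF t, where w = "\<lambda>p. sin (pi * fst p)" and wx = "\<lambda>p. pi * cos (pi * fst p)" and wy = "\<lambda>p. 0"
          and Fx = "\<lambda>p. - (s\<^sup>2) * pi\<^sup>2 * sin (pi * fst p)" and Gy = "\<lambda>p. 0"])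
       (rule psd pos | (auto intro!: continuous_intros derivative_eq_intros simp: power2_eq_square algebra_simps)[1])+
  show "(pi\<^sup>2 * t\<^sup>2) * sq_int \<phi> \<le> q s t"
    unfolding q_def
    by (rule Barta[OF t, where w = "\<lambda>p. sin (pi * snd p)" and wx = "\<lambda>p. 0" and wy = "\<lambda>p. pi * cos (pi * snd p)"
          and Fx = "\<lambda>p. 0" and Gy = "\<lambda>p. - (t\<^sup>2) * pi\<^sup>2 * sin (pi * snd p)"])
       (rule psd pos | (auto intro!: continuous_intros derivative_eq_intros simp: power2_eq_square algebra_simps)[1])+
  show "(pi\<^sup>2 * (s + t)\<^sup>2) * sq_int \<phi> \<le> q s t"
    unfolding q_def
    by (rule Barta[OF t, where w = "\<lambda>p. sin (pi * (fst p + snd p))" and wx = "\<lambda>p. pi * cos (pi * (fst p + snd p))"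
          and wy = "\<lambda>p. pi * cos (pi * (fst p + snd p))"
          and Fx = "\<lambda>p. - (s\<^sup>2 + s * t) * pi\<^sup>2 * sin (pi * (fst p + snd p))"
          and Gy = "\<lambda>p. - (t\<^sup>2 + s * t) * pi\<^sup>2 * sin (pi * (fst p + snd p))"])
       (rule psd pos | (auto intro!: continuous_intros derivative_eq_intros simp: power2_eq_square algebra_simps)[1])+
qed

text \<open>The first eigenfunction of the right isosceles triangle is an antisymmetric combination of eigenfunctions of the
  square; written as \<open>2 sin \<pi>x sin \<pi>y (cos \<pi>x + cos \<pi>y)\<close> it is visibly positive.\<close>

lemma right_isosceles_bound:
  assumes t: "test_function open_unit_triangle \<phi> \<phi>'"
  shows "5 * pi\<^sup>2 * sq_int \<phi> \<le> sq_int (\<lambda>p. fst (\<phi>' p)) + sq_int (\<lambda>p. snd (\<phi>' p))"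
proof -
  define w where "w p = sin (pi * fst p) * sin (2 * pi * snd p) + sin (2 * pi * fst p) * sin (pi * snd p)" for p :: "real \<times> real"
  have pos: "w p > 0" if "p \<in> open_unit_triangle" for p
  proof -
    define x y where "x = fst p" "y = snd p"
    note xy = x_y_def[symmetric]
    have p: "0 < x" "0 < y" "x + y < 1" using that by (auto simp: open_unit_triangle_def x_y_def)
    have "cos (pi - pi * y) < cos (pi * x)"
    proof (rule cos_monotone_0_pi)
      have "pi * (x + y) < pi * 1" using p by (intro mult_strict_left_mono) auto
      then show "pi * x < pi - pi * y" by (simp add: algebra_simps)
    qed (use p in auto)
    then have "cos (pi * x) + cos (pi * y) > 0" by simp
    moreover have "w p = 2 * (sin (pi * x) * sin (pi * y)) * (cos (pi * x) + cos (pi * y))"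
      using sin_double[of "pi * x"] sin_double[of "pi * y"] by (simp add: w_def xy algebra_simps)
    moreover have "sin (pi * x) > 0" "sin (pi * y) > 0" using p by (auto intro!: sin_pi_pos)
    ultimately show ?thesis by simp
  qed
  have "(5 * pi\<^sup>2) * sq_int \<phi> \<le> 1 * sq_int (\<lambda>p. fst (\<phi>' p)) + 1 * sq_int (\<lambda>p. snd (\<phi>' p)) + 0 * sq_int (\<lambda>p. fst (\<phi>' p) - snd (\<phi>' p))"
    by (rule Barta[OF t pos, where wx = "\<lambda>p. pi * cos (pi * fst p) * sin (2 * pi * snd p) + 2 * pi * cos (2 * pi * fst p) * sin (pi * snd p)"
          and wy = "\<lambda>p. 2 * pi * sin (pi * fst p) * cos (2 * pi * snd p) + pi * sin (2 * pi * fst p) * cos (pi * snd p)"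
          and Fx = "\<lambda>p. - (pi\<^sup>2) * sin (pi * fst p) * sin (2 * pi * snd p) - 4 * pi\<^sup>2 * sin (2 * pi * fst p) * sin (pi * snd p)"
          and Gy = "\<lambda>p. - 4 * pi\<^sup>2 * sin (pi * fst p) * sin (2 * pi * snd p) - pi\<^sup>2 * sin (2 * pi * fst p) * sin (pi * snd p)"])
       (auto intro!: continuous_intros derivative_eq_intros simp: w_def power2_eq_square algebra_simps)
  then show ?thesis by simp
qed

text \<open>The product form of the first eigenfunction of half of an equilateral triangle; it shows the sign.\<close>

lemma half_equilateral_product:
  fixes a \<eta> :: real
  shows "sin a * sin (3 * \<eta>) - sin (4 * a) * sin (2 * \<eta>) + sin (5 * a) * sin \<eta>
    = 16 * (sin \<eta> * sin a * (sin ((3 * a + \<eta>) / 2) * sin ((\<eta> - 3 * a) / 2)) * (sin ((a + \<eta>) / 2) * sin ((\<eta> - a) / 2)))"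
proof -
  have prod: "sin ((x + \<eta>) / 2) * sin ((\<eta> - x) / 2) = (cos x - cos \<eta>) / 2" for x :: real
    unfolding sin_times_sin by (simp add: field_simps)
  have s3: "sin (3 * x) = sin x * (4 * (cos x)\<^sup>2 - 1)" for x :: real
  proof -
    have "sin (3 * x) = sin (2 * x + x)" by simp
    also have "\<dots> = 2 * sin x * cos x * cos x + (2 * (cos x)\<^sup>2 - 1) * sin x"
      unfolding sin_add sin_double cos_double_cos ..
    finally show ?thesis by (simp add: power2_eq_square algebra_simps)
  qed
  have c3: "cos (3 * a) = 4 * cos a ^ 3 - 3 * cos a" by (rule cos_treble_cos)
  have s4: "sin (4 * a) = sin a * (8 * cos a ^ 3 - 4 * cos a)"
  proof -
    have "sin (4 * a) = 2 * sin (2 * a) * cos (2 * a)" using sin_double[of "2 * a"] by simp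
    also have "\<dots> = 2 * (2 * sin a * cos a) * (2 * (cos a)\<^sup>2 - 1)" unfolding sin_double cos_double_cos ..
    finally show ?thesis by (simp add: power2_eq_square power3_eq_cube algebra_simps)
  qed
  have s5: "sin (5 * a) = sin a * (16 * cos a ^ 4 - 12 * (cos a)\<^sup>2 + 1)"
  proof -
    have "sin (5 * a) = sin (3 * a + 2 * a)" by simp
    also have "\<dots> = sin a * (4 * (cos a)\<^sup>2 - 1) * (2 * (cos a)\<^sup>2 - 1) + (4 * cos a ^ 3 - 3 * cos a) * (2 * sin a * cos a)"
      unfolding sin_add s3 c3 sin_double cos_double_cos ..
    finally show ?thesis by (simp add: power2_eq_square power3_eq_cube power4_eq_xxxx algebra_simps)
  qed
  show ?thesis
    unfolding prod s3 s4 s5 c3 sin_double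
    by (simp add: power2_eq_square power3_eq_cube power4_eq_xxxx field_simps)
qed

text \<open>The form \<open>3 X + Y\<close> is, up to scaling, the Dirichlet energy on the triangle with angles of 30, 60 and 90 degrees,
  whose first eigenfunction is the first eigenfunction of the equilateral triangle that is odd under a reflection.\<close>

lemma half_equilateral_bound:
  assumes t: "test_function open_unit_triangle \<phi> \<phi>'"
  shows "28 / 3 * pi\<^sup>2 * sq_int \<phi> \<le> 3 * sq_int (\<lambda>p. fst (\<phi>' p)) + sq_int (\<lambda>p. snd (\<phi>' p))"
proof -
  define S C where "S k x = sin (k * (pi * x / 3))" "C k x = cos (k * (pi * x / 3))" for k x :: real
  define U V where "U k y = sin (k * (pi * (1 - y)))" "V k y = cos (k * (pi * (1 - y)))" for k y :: real
  define w where "w p = S 1 (fst p) * U 3 (snd p) - S 4 (fst p) * U 2 (snd p) + S 5 (fst p) * U 1 (snd p)" for p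
  have pos: "w p > 0" if "p \<in> open_unit_triangle" for p
  proof -
    define x y where "x = fst p" "y = snd p"
    have p: "0 < x" "0 < y" "x + y < 1" using that by (auto simp: open_unit_triangle_def x_y_def)
    have e: "(3 * (pi * x / 3) + pi * (1 - y)) / 2 = pi * ((x + (1 - y)) / 2)" "(pi * (1 - y) - 3 * (pi * x / 3)) / 2 = pi * (((1 - y) - x) / 2)"
      "(pi * x / 3 + pi * (1 - y)) / 2 = pi * ((x / 3 + (1 - y)) / 2)" "(pi * (1 - y) - pi * x / 3) / 2 = pi * (((1 - y) - x / 3) / 2)"
      "pi * x / 3 = pi * (x / 3)"
      by (simp_all add: algebra_simps)
    have "w p = sin (pi * x / 3) * sin (3 * (pi * (1 - y))) - sin (4 * (pi * x / 3)) * sin (2 * (pi * (1 - y))) + sin (5 * (pi * x / 3)) * sin (pi * (1 - y))"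
      by (simp add: w_def S_C_def U_V_def x_y_def)
    also have "\<dots> = 16 * (sin (pi * (1 - y)) * sin (pi * (x / 3)) * (sin (pi * ((x + (1 - y)) / 2)) * sin (pi * (((1 - y) - x) / 2)))
      * (sin (pi * ((x / 3 + (1 - y)) / 2)) * sin (pi * (((1 - y) - x / 3) / 2))))"
      unfolding half_equilateral_product e(1-4) by simp
    also have "\<dots> > 0"
      by (intro mult_pos_pos sin_pi_pos) (use p in auto)
    finally show ?thesis .
  qed
  have dS: "((\<lambda>x. S k x) has_real_derivative k * pi / 3 * C k x) (at x)" for k x
    unfolding S_C_def by (auto intro!: derivative_eq_intros)
  have dC: "((\<lambda>x. C k x) has_real_derivative - k * pi / 3 * S k x) (at x)" for k x
    unfolding S_C_def by (auto intro!: derivative_eq_intros)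
  have dU: "((\<lambda>x. U k x) has_real_derivative - k * pi * V k x) (at x)" for k x
    unfolding U_V_def by (auto intro!: derivative_eq_intros)
  have dV: "((\<lambda>x. V k x) has_real_derivative k * pi * U k x) (at x)" for k x
    unfolding U_V_def by (auto intro!: derivative_eq_intros)
  have cSC: "continuous_on UNIV (\<lambda>p :: real \<times> real. S k (fst p))" "continuous_on UNIV (\<lambda>p :: real \<times> real. C k (fst p))"
    "continuous_on UNIV (\<lambda>p :: real \<times> real. U k (snd p))" "continuous_on UNIV (\<lambda>p :: real \<times> real. V k (snd p))" for k
    unfolding S_C_def U_V_def by (auto intro!: continuous_intros)
  note [derivative_intros] = DERIV_cong[OF dS] DERIV_cong[OF dC] DERIV_cong[OF dU] DERIV_cong[OF dV]
  have "(28 / 3 * pi\<^sup>2) * sq_int \<phi> \<le> 3 * sq_int (\<lambda>p. fst (\<phi>' p)) + 1 * sq_int (\<lambda>p. snd (\<phi>' p)) + 0 * sq_int (\<lambda>p. fst (\<phi>' p) - snd (\<phi>' p))"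
  proof (rule Barta[OF t pos, where
           wx = "\<lambda>p. pi / 3 * C 1 (fst p) * U 3 (snd p) - 4 * pi / 3 * C 4 (fst p) * U 2 (snd p) + 5 * pi / 3 * C 5 (fst p) * U 1 (snd p)"
          and wy = "\<lambda>p. - 3 * pi * S 1 (fst p) * V 3 (snd p) + 2 * pi * S 4 (fst p) * V 2 (snd p) - pi * S 5 (fst p) * V 1 (snd p)"
          and Fx = "\<lambda>p. - (pi\<^sup>2 / 3) * S 1 (fst p) * U 3 (snd p) + 16 * pi\<^sup>2 / 3 * S 4 (fst p) * U 2 (snd p) - 25 * pi\<^sup>2 / 3 * S 5 (fst p) * U 1 (snd p)"
          and Gy = "\<lambda>p. - (9 * pi\<^sup>2) * S 1 (fst p) * U 3 (snd p) + 4 * pi\<^sup>2 * S 4 (fst p) * U 2 (snd p) - pi\<^sup>2 * S 5 (fst p) * U 1 (snd p)"])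
  qed (auto intro!: continuous_intros derivative_eq_intros cSC dS dC dU dV simp: w_def power2_eq_square algebra_simps)
  then show ?thesis by simp
qed

section \<open>Relabelling the vertices\<close>

lemma affine_integral_plane:
  fixes \<alpha> \<beta> \<gamma> \<delta> r s :: real
  assumes det: "\<alpha> * \<delta> - \<beta> * \<gamma> \<noteq> 0"
  defines "A \<equiv> \<lambda>p. (r + \<alpha> * fst p + \<beta> * snd p, s + \<gamma> * fst p + \<delta> * snd p)"
  shows "\<exists>D>0. \<forall>F :: real \<times> real \<Rightarrow> real. continuous_on UNIV F \<longrightarrow> (\<forall>p. F p \<ge> 0) \<longrightarrow>
    (LINT p|lborel. F (A p)) = D * (LINT p|lborel. F p)"
proof -
  obtain D where D: "D > 0" "\<And>F. F \<in> borel_measurable borel \<Longrightarrow> (\<integral>\<^sup>+p. F (A p) \<partial>lborel) = ennreal D * (\<integral>\<^sup>+p. F p \<partial>lborel)"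
    using nn_integral_plane_affine[OF det, of r s] unfolding A_def by blast
  have "(LINT p|lborel. F (A p)) = D * (LINT p|lborel. F p)" if F: "continuous_on UNIV F" "\<And>p. F p \<ge> 0" for F :: "real \<times> real \<Rightarrow> real"
  proof -
    have [measurable]: "F \<in> borel_measurable borel" by (rule borel_measurable_continuous_onI[OF F(1)])
    have [measurable]: "(\<lambda>p. F (A p)) \<in> borel_measurable borel"
      by (rule borel_measurable_continuous_onI, rule continuous_on_compose2[OF F(1)])
        (auto simp: A_def intro!: continuous_intros)
    have "(LINT p|lborel. F (A p)) = enn2real (\<integral>\<^sup>+p. ennreal (F (A p)) \<partial>lborel)"
      by (rule integral_eq_nn_integral) (use F in auto)
    also have "\<dots> = enn2real (ennreal D * (\<integral>\<^sup>+p. ennreal (F p) \<partial>lborel))"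
      using D(2)[of "\<lambda>p. ennreal (F p)"] by simp
    also have "\<dots> = D * enn2real (\<integral>\<^sup>+p. ennreal (F p) \<partial>lborel)"
      using D(1) by (simp add: enn2real_mult)
    also have "enn2real (\<integral>\<^sup>+p. ennreal (F p) \<partial>lborel) = (LINT p|lborel. F p)"
      by (rule integral_eq_nn_integral[symmetric]) (use F in auto)
    finally show ?thesis .
  qed
  then show ?thesis using D(1) by blast
qed

text \<open>The set of quadruples of energies of test functions. Statements about this set, rather than about functions, make
  the symmetry under relabelling of the vertices available as a permutation of \<open>X\<close>, \<open>Y\<close>, \<open>Z\<close>.\<close>

definition energies :: "real \<Rightarrow> real \<Rightarrow> real \<Rightarrow> real \<Rightarrow> bool" where
  "energies N X Y Z \<longleftrightarrow> (\<exists>\<phi> \<phi>'. test_function open_unit_triangle \<phi> \<phi>' \<and> N = sq_int \<phi> \<and>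
     X = sq_int (\<lambda>p. fst (\<phi>' p)) \<and> Y = sq_int (\<lambda>p. snd (\<phi>' p)) \<and> Z = sq_int (\<lambda>p. fst (\<phi>' p) - snd (\<phi>' p)))"

lemma energies_symmetric:
  fixes \<alpha> \<beta> \<gamma> \<delta> r s :: real
  assumes E: "energies N X Y Z"
    and A: "A = (\<lambda>p. (r + \<alpha> * fst p + \<beta> * snd p, s + \<gamma> * fst p + \<delta> * snd p))"
    and det: "\<alpha> * \<delta> - \<beta> * \<gamma> \<noteq> 0" and inv: "\<And>p. A (B p) = p" "\<And>p. B (A p) = p"
    and B: "continuous_on UNIV B" "\<And>p. p \<in> open_unit_triangle \<Longrightarrow> B p \<in> open_unit_triangle"
  shows "\<exists>D>0. \<exists>\<phi> \<phi>'. test_function open_unit_triangle (\<phi> \<circ> A) (\<lambda>p. (\<alpha> * fst (\<phi>' (A p)) + \<gamma> * snd (\<phi>' (A p)), \<beta> * fst (\<phi>' (A p)) + \<delta> * snd (\<phi>' (A p)))) \<and>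
    sq_int (\<phi> \<circ> A) = D * N \<and> (\<forall>g :: real \<times> real \<Rightarrow> real. continuous_on UNIV g \<longrightarrow> sq_int (\<lambda>p. g (\<phi>' (A p))) = D * sq_int (\<lambda>p. g (\<phi>' p))) \<and>
    X = sq_int (\<lambda>p. fst (\<phi>' p)) \<and> Y = sq_int (\<lambda>p. snd (\<phi>' p)) \<and> Z = sq_int (\<lambda>p. fst (\<phi>' p) - snd (\<phi>' p))"
proof -
  obtain \<phi> \<phi>' where t: "test_function open_unit_triangle \<phi> \<phi>'" and N: "N = sq_int \<phi>"
    and XYZ: "X = sq_int (\<lambda>p. fst (\<phi>' p))" "Y = sq_int (\<lambda>p. snd (\<phi>' p))" "Z = sq_int (\<lambda>p. fst (\<phi>' p) - snd (\<phi>' p))"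
    using E unfolding energies_def by blast
  note ct = test_function_continuous[OF t]
  obtain K where K: "compact K" "K \<subseteq> open_unit_triangle" "\<And>x. x \<notin> K \<Longrightarrow> \<phi> x = 0"
    using test_function_support_ex[OF t] by meson
  have cA: "continuous_on UNIV A" unfolding A by (intro continuous_intros)
  have dA: "(A has_derivative (\<lambda>h. (\<alpha> * fst h + \<beta> * snd h, \<gamma> * fst h + \<delta> * snd h))) (at p)" for p
    unfolding A by (auto intro!: derivative_eq_intros)
  have d\<phi>: "(\<phi> has_derivative (\<lambda>h. \<phi>' q \<bullet> h)) (at q)" for q
    using t unfolding test_function_def by blast
  have t': "test_function open_unit_triangle (\<phi> \<circ> A) (\<lambda>p. (\<alpha> * fst (\<phi>' (A p)) + \<gamma> * snd (\<phi>' (A p)), \<beta> * fst (\<phi>' (A p)) + \<delta> * snd (\<phi>' (A p))))"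
    unfolding test_function_def
  proof (intro conjI allI exI[of _ "B ` K"] impI)
    fix p
    show "(\<phi> \<circ> A has_derivative (\<lambda>h. (\<alpha> * fst (\<phi>' (A p)) + \<gamma> * snd (\<phi>' (A p)), \<beta> * fst (\<phi>' (A p)) + \<delta> * snd (\<phi>' (A p))) \<bullet> h)) (at p)"
      using diff_chain_at[OF dA d\<phi>, of p] by (simp add: o_def inner_prod_def algebra_simps)
  next
    have "continuous_on UNIV (\<lambda>p. \<phi>' (A p))" by (rule continuous_on_compose2[OF ct(2) cA]) auto
    then show "continuous_on UNIV (\<lambda>p. (\<alpha> * fst (\<phi>' (A p)) + \<gamma> * snd (\<phi>' (A p)), \<beta> * fst (\<phi>' (A p)) + \<delta> * snd (\<phi>' (A p))))"
      by (intro continuous_intros)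
  next
    show "compact (B ` K)" by (intro compact_continuous_image continuous_on_subset[OF B(1)] K) auto
    show "B ` K \<subseteq> open_unit_triangle" using B(2) K(2) by auto
    fix p assume "p \<notin> B ` K"
    then have "A p \<notin> K" using inv(2)[of p] by (metis image_eqI)
    then show "(\<phi> \<circ> A) p = 0" using K(3) by simp
  qed
  obtain D where D: "D > 0" "\<And>F :: real \<times> real \<Rightarrow> real. continuous_on UNIV F \<Longrightarrow> (\<And>p. F p \<ge> 0) \<Longrightarrow> (LINT p|lborel. F (A p)) = D * (LINT p|lborel. F p)"
    using affine_integral_plane[OF det, of r s] unfolding A by blast
  have "sq_int (\<phi> \<circ> A) = D * N"
    unfolding sq_int_def N o_def by (rule D(2)[of "\<lambda>p. (\<phi> p)\<^sup>2"]) (auto intro!: continuous_intros ct)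
  moreover have "sq_int (\<lambda>p. g (\<phi>' (A p))) = D * sq_int (\<lambda>p. g (\<phi>' p))" if "continuous_on UNIV g" for g :: "real \<times> real \<Rightarrow> real"
    unfolding sq_int_def
    by (rule D(2)[of "\<lambda>p. (g (\<phi>' p))\<^sup>2"]) (auto intro!: continuous_intros continuous_on_compose2[OF that ct(2)])
  ultimately show ?thesis using t' D(1) XYZ by blast
qed

text \<open>Reflection of the triangle that interchanges its two legs.\<close>

lemma energies_swap:
  assumes "energies N X Y Z"
  shows "\<exists>D>0. energies (D * N) (D * Y) (D * X) (D * Z)"
proof -
  define A :: "real \<times> real \<Rightarrow> real \<times> real" where "A = (\<lambda>p. (0 + 0 * fst p + 1 * snd p, 0 + 1 * fst p + 0 * snd p))"
  have AA: "A (A p) = p" for p by (simp add: A_def)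
  have cA: "continuous_on UNIV A" unfolding A_def by (intro continuous_intros)
  have mA: "A p \<in> open_unit_triangle" if "p \<in> open_unit_triangle" for p using that by (auto simp: A_def open_unit_triangle_def)
  from energies_symmetric[OF assms A_def _ AA AA cA mA] obtain D \<phi> \<phi>' where D: "D > 0"
    and t: "test_function open_unit_triangle (\<phi> \<circ> A) (\<lambda>p. (snd (\<phi>' (A p)), fst (\<phi>' (A p))))"
    and N: "sq_int (\<phi> \<circ> A) = D * N" and g: "\<And>g :: real \<times> real \<Rightarrow> real. continuous_on UNIV g \<Longrightarrow> sq_int (\<lambda>p. g (\<phi>' (A p))) = D * sq_int (\<lambda>p. g (\<phi>' p))"
    and XYZ: "X = sq_int (\<lambda>p. fst (\<phi>' p))" "Y = sq_int (\<lambda>p. snd (\<phi>' p))" "Z = sq_int (\<lambda>p. fst (\<phi>' p) - snd (\<phi>' p))"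
    by auto
  have cs: "continuous_on UNIV (\<lambda>v :: real \<times> real. fst v)" "continuous_on UNIV (\<lambda>v :: real \<times> real. snd v)"
    "continuous_on UNIV (\<lambda>v :: real \<times> real. fst v - snd v)" by (intro continuous_intros)+
  have "sq_int (\<lambda>p. snd (\<phi>' (A p)) - fst (\<phi>' (A p))) = sq_int (\<lambda>p. fst (\<phi>' (A p)) - snd (\<phi>' (A p)))"
    by (simp add: sq_int_def power2_commute)
  then have e: "sq_int (\<lambda>p. snd (\<phi>' (A p))) = D * Y" "sq_int (\<lambda>p. fst (\<phi>' (A p))) = D * X"
    "sq_int (\<lambda>p. snd (\<phi>' (A p)) - fst (\<phi>' (A p))) = D * Z"
    using g[OF cs(1)] g[OF cs(2)] g[OF cs(3)] XYZ by simp_all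
  have "energies (D * N) (D * Y) (D * X) (D * Z)"
    unfolding energies_def
    by (intro exI[of _ "\<phi> \<circ> A"] exI[of _ "\<lambda>p. (snd (\<phi>' (A p)), fst (\<phi>' (A p)))"]) (simp only: t N e fst_conv snd_conv simp_thms)
  then show ?thesis using D by blast
qed

text \<open>Cyclic permutation of the three vertices.\<close>

lemma energies_rotate:
  assumes "energies N X Y Z"
  shows "\<exists>D>0. energies (D * N) (D * Y) (D * Z) (D * X)"
proof -
  define A :: "real \<times> real \<Rightarrow> real \<times> real" where "A = (\<lambda>p. (0 + 0 * fst p + 1 * snd p, 1 + (-1) * fst p + (-1) * snd p))"
  define B :: "real \<times> real \<Rightarrow> real \<times> real" where "B p = (1 - fst p - snd p, fst p)" for p
  have AB: "A (B p) = p" "B (A p) = p" for p by (simp_all add: A_def B_def)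
  have cB: "continuous_on UNIV B" unfolding B_def by (intro continuous_intros)
  have mB: "B p \<in> open_unit_triangle" if "p \<in> open_unit_triangle" for p using that by (auto simp: B_def open_unit_triangle_def)
  from energies_symmetric[OF assms A_def _ AB cB mB] obtain D \<phi> \<phi>' where D: "D > 0"
    and t: "test_function open_unit_triangle (\<phi> \<circ> A) (\<lambda>p. (- snd (\<phi>' (A p)), fst (\<phi>' (A p)) - snd (\<phi>' (A p))))"
    and N: "sq_int (\<phi> \<circ> A) = D * N" and g: "\<And>g :: real \<times> real \<Rightarrow> real. continuous_on UNIV g \<Longrightarrow> sq_int (\<lambda>p. g (\<phi>' (A p))) = D * sq_int (\<lambda>p. g (\<phi>' p))"
    and XYZ: "X = sq_int (\<lambda>p. fst (\<phi>' p))" "Y = sq_int (\<lambda>p. snd (\<phi>' p))" "Z = sq_int (\<lambda>p. fst (\<phi>' p) - snd (\<phi>' p))"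
    by auto
  have cs: "continuous_on UNIV (\<lambda>v :: real \<times> real. fst v)" "continuous_on UNIV (\<lambda>v :: real \<times> real. - snd v)"
    "continuous_on UNIV (\<lambda>v :: real \<times> real. fst v - snd v)" by (intro continuous_intros)+
  have "sq_int (\<lambda>p. - snd (\<phi>' (A p)) - (fst (\<phi>' (A p)) - snd (\<phi>' (A p)))) = sq_int (\<lambda>p. fst (\<phi>' (A p)))"
    "sq_int (\<lambda>p. - snd (\<phi>' p)) = Y"
    by (simp_all add: sq_int_def XYZ)
  then have e: "sq_int (\<lambda>p. - snd (\<phi>' (A p))) = D * Y" "sq_int (\<lambda>p. fst (\<phi>' (A p)) - snd (\<phi>' (A p))) = D * Z"
    "sq_int (\<lambda>p. - snd (\<phi>' (A p)) - (fst (\<phi>' (A p)) - snd (\<phi>' (A p)))) = D * X"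
    using g[OF cs(1)] g[OF cs(2)] g[OF cs(3)] XYZ by simp_all
  have "energies (D * N) (D * Y) (D * Z) (D * X)"
    unfolding energies_def
    by (intro exI[of _ "\<phi> \<circ> A"] exI[of _ "\<lambda>p. (- snd (\<phi>' (A p)), fst (\<phi>' (A p)) - snd (\<phi>' (A p)))"])
      (simp only: t N e fst_conv snd_conv simp_thms)
  then show ?thesis using D by blast
qed

section \<open>Trigonometric modes of the equilateral triangle\<close>

text \<open>The waves with these phases are the ones that are compatible with the lattice generated by the reflections of the
  unit triangle, seen as an equilateral triangle in affine coordinates.\<close>

definition phase :: "int \<Rightarrow> int \<Rightarrow> real \<times> real \<Rightarrow> real" where
  "phase i j p = 2 * pi / 3 * (of_int (2 * i + j) * fst p + of_int (i + 2 * j) * snd p)"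

definition cos_wave :: "int \<Rightarrow> int \<Rightarrow> real \<times> real \<Rightarrow> real" where "cos_wave i j p = cos (phase i j p)"
definition sin_wave :: "int \<Rightarrow> int \<Rightarrow> real \<times> real \<Rightarrow> real" where "sin_wave i j p = sin (phase i j p)"

text \<open>A mode is the alternating sum of a wave over the six elements of the reflection group of the triangle. The group
  acts on the frequencies by \<open>(i, j) \<mapsto> (- i, i + j)\<close> and \<open>(i, j) \<mapsto> (i + j, - j)\<close>.\<close>

definition cos_mode :: "int \<Rightarrow> int \<Rightarrow> real \<times> real \<Rightarrow> real" where
  "cos_mode i j p = cos_wave i j p - cos_wave (- i) (i + j) p - cos_wave (i + j) (- j) p + cos_wave (- i - j) i p + cos_wave j (- i - j) p - cos_wave (- j) (- i) p"
definition sin_mode :: "int \<Rightarrow> int \<Rightarrow> real \<times> real \<Rightarrow> real" where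
  "sin_mode i j p = sin_wave i j p - sin_wave (- i) (i + j) p - sin_wave (i + j) (- j) p + sin_wave (- i - j) i p + sin_wave j (- i - j) p - sin_wave (- j) (- i) p"

text \<open>Real and imaginary part of the sum of the wave \<open>(1, 0)\<close> over its orbit. This function is invariant under the
  reflections, so multiplication by it maps modes to sums of modes.\<close>

definition orbit_re :: "real \<times> real \<Rightarrow> real" where "orbit_re p = cos_wave 1 0 p + cos_wave (- 1) 1 p + cos_wave 0 (- 1) p"
definition orbit_im :: "real \<times> real \<Rightarrow> real" where "orbit_im p = sin_wave 1 0 p + sin_wave (- 1) 1 p + sin_wave 0 (- 1) p"

text \<open>The squared length of the frequency in the hexagonal lattice; the eigenvalue is \<open>8\<pi>\<^sup>2/3\<close> times it.\<close>

definition wave_norm :: "int \<Rightarrow> int \<Rightarrow> int" where "wave_norm i j = i\<^sup>2 + i * j + j\<^sup>2"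

lemma phase_add: "phase i j p + phase k l p = phase (i + k) (j + l) p"
  and phase_diff: "phase i j p - phase k l p = phase (i - k) (j - l) p"
  by (simp_all add: phase_def algebra_simps)

lemma cos_wave_cos_wave: "cos_wave i j p * cos_wave k l p = (cos_wave (i - k) (j - l) p + cos_wave (i + k) (j + l) p) / 2"
  and sin_wave_sin_wave: "sin_wave i j p * sin_wave k l p = (cos_wave (i - k) (j - l) p - cos_wave (i + k) (j + l) p) / 2"
  and sin_wave_cos_wave: "sin_wave i j p * cos_wave k l p = (sin_wave (i + k) (j + l) p + sin_wave (i - k) (j - l) p) / 2"
  and cos_wave_sin_wave: "cos_wave i j p * sin_wave k l p = (sin_wave (i + k) (j + l) p - sin_wave (i - k) (j - l) p) / 2"
  unfolding cos_wave_def sin_wave_def phase_add[symmetric] phase_diff[symmetric]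
  by (simp_all add: sin_add sin_diff cos_add cos_diff)

lemma minus_one_diff: "(- 1 :: int) - k = - k - 1"
  by simp

lemma cos_mode_orbit_re: "cos_mode i j p * orbit_re p = (cos_mode (i + 1) j p + cos_mode (i - 1) (j + 1) p + cos_mode i (j - 1) p
    + cos_mode (i - 1) j p + cos_mode (i + 1) (j - 1) p + cos_mode i (j + 1) p) / 2"
  unfolding orbit_re_def cos_mode_def
  by (simp only: distrib_left distrib_right left_diff_distrib cos_wave_cos_wave) (simp add: add_divide_distrib diff_divide_distrib algebra_simps minus_one_diff)

lemma cos_mode_orbit_im: "cos_mode i j p * orbit_im p = (sin_mode (i + 1) j p + sin_mode (i - 1) (j + 1) p + sin_mode i (j - 1) p
    - sin_mode (i - 1) j p - sin_mode (i + 1) (j - 1) p - sin_mode i (j + 1) p) / 2"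
  unfolding orbit_im_def cos_mode_def sin_mode_def
  by (simp only: distrib_left distrib_right left_diff_distrib cos_wave_sin_wave) (simp add: add_divide_distrib diff_divide_distrib algebra_simps minus_one_diff)

lemma sin_mode_orbit_re: "sin_mode i j p * orbit_re p = (sin_mode (i + 1) j p + sin_mode (i - 1) (j + 1) p + sin_mode i (j - 1) p
    + sin_mode (i - 1) j p + sin_mode (i + 1) (j - 1) p + sin_mode i (j + 1) p) / 2"
  unfolding orbit_re_def sin_mode_def
  by (simp only: distrib_left distrib_right left_diff_distrib sin_wave_cos_wave) (simp add: add_divide_distrib diff_divide_distrib algebra_simps minus_one_diff)

lemma sin_mode_orbit_im: "sin_mode i j p * orbit_im p = - (cos_mode (i + 1) j p + cos_mode (i - 1) (j + 1) p + cos_mode i (j - 1) p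
    - cos_mode (i - 1) j p - cos_mode (i + 1) (j - 1) p - cos_mode i (j + 1) p) / 2"
  unfolding orbit_im_def cos_mode_def sin_mode_def
  by (simp only: distrib_left distrib_right left_diff_distrib sin_wave_sin_wave) (simp add: add_divide_distrib diff_divide_distrib algebra_simps minus_one_diff)

section \<open>Eigenfunctions and orthogonality\<close>

text \<open>The partial derivatives are carried along as separate functions, and the boundary condition is imposed on the three
  lines that contain the edges.\<close>

definition C1_zero :: "(real \<times> real \<Rightarrow> real) \<Rightarrow> (real \<times> real \<Rightarrow> real) \<Rightarrow> (real \<times> real \<Rightarrow> real) \<Rightarrow> bool" where
  "C1_zero u ux uy \<longleftrightarrow> continuous_on UNIV u \<and> continuous_on UNIV ux \<and> continuous_on UNIV uy \<and>
    (\<forall>x y. ((\<lambda>x. u (x, y)) has_real_derivative ux (x, y)) (at x)) \<and>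
    (\<forall>x y. ((\<lambda>y. u (x, y)) has_real_derivative uy (x, y)) (at y)) \<and>
    (\<forall>t. u (0, t) = 0 \<and> u (t, 0) = 0 \<and> u (1 - t, t) = 0)"

text \<open>The equation for the operator with symbol \<open>2 \<xi>\<^sup>2 - 2 \<xi> \<eta> + 2 \<eta>\<^sup>2\<close>, which belongs to the energy \<open>X + Y + Z\<close>. The two
  functions \<open>Fx\<close> and \<open>Gy\<close> are the summands of the divergence of the flux.\<close>

definition Helmholtz :: "real \<Rightarrow> (real \<times> real \<Rightarrow> real) \<Rightarrow> (real \<times> real \<Rightarrow> real) \<Rightarrow> (real \<times> real \<Rightarrow> real) \<Rightarrow> bool" where
  "Helmholtz \<kappa> v vx vy \<longleftrightarrow> (\<exists>Fx Gy. continuous_on UNIV Fx \<and> continuous_on UNIV Gy \<and>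
    (\<forall>x y. ((\<lambda>x. 2 * vx (x, y) - vy (x, y)) has_real_derivative Fx (x, y)) (at x)) \<and>
    (\<forall>x y. ((\<lambda>y. 2 * vy (x, y) - vx (x, y)) has_real_derivative Gy (x, y)) (at y)) \<and>
    (\<forall>p. Fx p + Gy p = - \<kappa> * v p))"

definition eigen :: "real \<Rightarrow> (real \<times> real \<Rightarrow> real) \<Rightarrow> (real \<times> real \<Rightarrow> real) \<Rightarrow> (real \<times> real \<Rightarrow> real) \<Rightarrow> bool" where
  "eigen \<kappa> v vx vy \<longleftrightarrow> C1_zero v vx vy \<and> Helmholtz \<kappa> v vx vy"

definition l2_inner :: "(real \<times> real \<Rightarrow> real) \<Rightarrow> (real \<times> real \<Rightarrow> real) \<Rightarrow> real" where
  "l2_inner f g = (LINT p|tri_measure. f p * g p)"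

text \<open>The bilinear form that belongs to \<open>X + Y + Z\<close>.\<close>

definition iso_energy :: "(real \<times> real \<Rightarrow> real) \<Rightarrow> (real \<times> real \<Rightarrow> real) \<Rightarrow> (real \<times> real \<Rightarrow> real) \<Rightarrow> (real \<times> real \<Rightarrow> real) \<Rightarrow> real" where
  "iso_energy ux uy vx vy = (LINT p|tri_measure. ux p * (2 * vx p - vy p) + uy p * (2 * vy p - vx p))"

lemma C1_zeroD:
  assumes "C1_zero u ux uy"
  shows "continuous_on UNIV u" "continuous_on UNIV ux" "continuous_on UNIV uy"
    "((\<lambda>x. u (x, y)) has_real_derivative ux (x, y)) (at x)"
    "((\<lambda>y. u (x, y)) has_real_derivative uy (x, y)) (at y)"
    "u (0, t) = 0" "u (t, 0) = 0" "u (1 - t, t) = 0"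
  using assms unfolding C1_zero_def by simp_all

lemma integration_by_parts:
  assumes u: "C1_zero u ux uy"
    and c: "continuous_on UNIV F" "continuous_on UNIV G" "continuous_on UNIV Fx" "continuous_on UNIV Gy"
    and dF: "\<And>x y. ((\<lambda>x. F (x, y)) has_real_derivative Fx (x, y)) (at x)"
    and dG: "\<And>x y. ((\<lambda>y. G (x, y)) has_real_derivative Gy (x, y)) (at y)"
  shows "(LINT p|tri_measure. ux p * F p + uy p * G p) = - (LINT p|tri_measure. u p * (Fx p + Gy p))"
proof -
  note cu = C1_zeroD(1-3)[OF u]
  define hx where "hx p = ux p * F p + Fx p * u p" for p
  define hy where "hy p = uy p * G p + Gy p * u p" for p
  have ch: "continuous_on UNIV hx" "continuous_on UNIV hy"
    unfolding hx_def hy_def by (intro continuous_intros cu c)+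
  have dx: "((\<lambda>x. u (x, y) * F (x, y)) has_real_derivative hx (x, y)) (at x)" for x y
    unfolding hx_def by (rule DERIV_mult[OF C1_zeroD(4)[OF u] dF])
  have dy: "((\<lambda>y. u (x, y) * G (x, y)) has_real_derivative hy (x, y)) (at y)" for x y
    unfolding hy_def by (rule DERIV_mult[OF C1_zeroD(5)[OF u] dG])
  have b: "u (t, 1 - t) = 0" for t using C1_zeroD(8)[OF u, of "1 - t"] by simp
  have "(LINT p|tri_measure. hx p) = 0"
    using integral_tri_measure_dx[OF ch(1), of "\<lambda>p. u p * F p", OF dx] by (simp add: C1_zeroD(6-8)[OF u])
  moreover have "(LINT p|tri_measure. hy p) = 0"
    using integral_tri_measure_dy[OF ch(2), of "\<lambda>p. u p * G p", OF dy] by (simp add: C1_zeroD(6-8)[OF u] b)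
  moreover have "(LINT p|tri_measure. hx p + hy p) = (LINT p|tri_measure. hx p) + (LINT p|tri_measure. hy p)"
    by (rule Bochner_Integration.integral_add) (intro integrable_tri_measure ch)+
  moreover have "hx p + hy p = (ux p * F p + uy p * G p) + u p * (Fx p + Gy p)" for p
    by (simp add: hx_def hy_def algebra_simps)
  moreover have "integrable tri_measure (\<lambda>p. ux p * F p + uy p * G p)" "integrable tri_measure (\<lambda>p. u p * (Fx p + Gy p))"
    by (intro integrable_tri_measure continuous_intros cu c)+
  ultimately show ?thesis by simp
qed

lemma Green:
  assumes u: "C1_zero u ux uy" and v: "eigen \<kappa> v vx vy"
  shows "iso_energy ux uy vx vy = \<kappa> * l2_inner u v"
proof -
  obtain Fx Gy where c: "continuous_on UNIV Fx" "continuous_on UNIV Gy"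
    and dF: "\<And>x y. ((\<lambda>x. 2 * vx (x, y) - vy (x, y)) has_real_derivative Fx (x, y)) (at x)"
    and dG: "\<And>x y. ((\<lambda>y. 2 * vy (x, y) - vx (x, y)) has_real_derivative Gy (x, y)) (at y)"
    and pde: "\<And>p. Fx p + Gy p = - \<kappa> * v p"
    using v unfolding eigen_def Helmholtz_def by blast
  have vc: "C1_zero v vx vy" using v by (simp add: eigen_def)
  have cF: "continuous_on UNIV (\<lambda>p. 2 * vx p - vy p)" "continuous_on UNIV (\<lambda>p. 2 * vy p - vx p)"
    by (intro continuous_intros C1_zeroD[OF vc])+
  have "iso_energy ux uy vx vy = - (LINT p|tri_measure. u p * (Fx p + Gy p))"
    unfolding iso_energy_def by (rule integration_by_parts[OF u cF c dF dG])
  also have "\<dots> = - (LINT p|tri_measure. - \<kappa> * (u p * v p))"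
    unfolding pde by (simp add: mult.left_commute)
  also have "\<dots> = \<kappa> * l2_inner u v" by (simp add: l2_inner_def)
  finally show ?thesis .
qed

lemma l2_inner_commute: "l2_inner f g = l2_inner g f" by (simp add: l2_inner_def mult.commute)
lemma iso_energy_commute: "iso_energy ux uy vx vy = iso_energy vx vy ux uy"
  unfolding iso_energy_def by (rule Bochner_Integration.integral_cong) (auto simp: algebra_simps)

lemma eigen_orthogonal:
  assumes "eigen \<kappa> v vx vy" "eigen \<kappa>' w wx wy" "\<kappa> \<noteq> \<kappa>'"
  shows "l2_inner v w = 0"
proof -
  have "\<kappa>' * l2_inner v w = \<kappa> * l2_inner w v"
    using Green[of v vx vy \<kappa>' w wx wy] Green[of w wx wy \<kappa> v vx vy] assms iso_energy_commute
    by (metis eigen_def)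
  then show ?thesis using assms(3) by (simp add: l2_inner_commute)
qed

lemma l2_inner_add: "continuous_on UNIV f \<Longrightarrow> continuous_on UNIV g \<Longrightarrow> continuous_on UNIV h \<Longrightarrow> l2_inner (\<lambda>p. f p + g p) h = l2_inner f h + l2_inner g h"
  and l2_inner_diff: "continuous_on UNIV f \<Longrightarrow> continuous_on UNIV g \<Longrightarrow> continuous_on UNIV h \<Longrightarrow> l2_inner (\<lambda>p. f p - g p) h = l2_inner f h - l2_inner g h"
  and l2_inner_scale: "l2_inner (\<lambda>p. c * f p) h = c * l2_inner f h"
proof -
  assume c: "continuous_on UNIV f" "continuous_on UNIV g" "continuous_on UNIV h"
  have i: "integrable tri_measure (\<lambda>p. f p * h p)" "integrable tri_measure (\<lambda>p. g p * h p)"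
    by (intro integrable_tri_measure continuous_intros c)+
  then show "l2_inner (\<lambda>p. f p + g p) h = l2_inner f h + l2_inner g h" "l2_inner (\<lambda>p. f p - g p) h = l2_inner f h - l2_inner g h"
    by (simp_all add: l2_inner_def distrib_right left_diff_distrib)
qed (simp add: l2_inner_def mult.assoc)

lemma l2_inner_zero: "l2_inner (\<lambda>p. 0) h = 0" by (simp add: l2_inner_def)

lemma l2_inner_sum:
  assumes "finite A" "\<And>n. n \<in> A \<Longrightarrow> continuous_on UNIV (f n)" "continuous_on UNIV h"
  shows "l2_inner (\<lambda>p. \<Sum>n\<in>A. f n p) h = (\<Sum>n\<in>A. l2_inner (f n) h)"
  using assms(1,2)
proof (induction A rule: finite_induct)
  case (insert n A)
  have "continuous_on UNIV (\<lambda>p. \<Sum>n\<in>A. f n p)" using insert by (intro continuous_on_sum) auto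
  then show ?case using insert assms(3) by (simp add: l2_inner_add)
qed (simp add: l2_inner_zero)

lemma C1_zero_lin:
  assumes "C1_zero u ux uy" "C1_zero v vx vy"
  shows "C1_zero (\<lambda>p. a * u p + b * v p) (\<lambda>p. a * ux p + b * vx p) (\<lambda>p. a * uy p + b * vy p)"
  using assms unfolding C1_zero_def
  by (auto intro!: continuous_intros DERIV_add DERIV_cmult)

lemma Helmholtz_lin:
  assumes "Helmholtz \<kappa> u ux uy" "Helmholtz \<kappa> v vx vy"
  shows "Helmholtz \<kappa> (\<lambda>p. a * u p + b * v p) (\<lambda>p. a * ux p + b * vx p) (\<lambda>p. a * uy p + b * vy p)"
proof -
  obtain Fx Gy where u: "continuous_on UNIV Fx" "continuous_on UNIV Gy"
    "\<And>x y. ((\<lambda>x. 2 * ux (x, y) - uy (x, y)) has_real_derivative Fx (x, y)) (at x)"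
    "\<And>x y. ((\<lambda>y. 2 * uy (x, y) - ux (x, y)) has_real_derivative Gy (x, y)) (at y)"
    "\<And>p. Fx p + Gy p = - \<kappa> * u p"
    using assms(1) unfolding Helmholtz_def by blast
  obtain Fx' Gy' where v: "continuous_on UNIV Fx'" "continuous_on UNIV Gy'"
    "\<And>x y. ((\<lambda>x. 2 * vx (x, y) - vy (x, y)) has_real_derivative Fx' (x, y)) (at x)"
    "\<And>x y. ((\<lambda>y. 2 * vy (x, y) - vx (x, y)) has_real_derivative Gy' (x, y)) (at y)"
    "\<And>p. Fx' p + Gy' p = - \<kappa> * v p"
    using assms(2) unfolding Helmholtz_def by blast
  show ?thesis
    unfolding Helmholtz_def
  proof (rule exI[of _ "\<lambda>p. a * Fx p + b * Fx' p"], rule exI[of _ "\<lambda>p. a * Gy p + b * Gy' p"], intro conjI allI)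
    show "((\<lambda>x. 2 * (a * ux (x, y) + b * vx (x, y)) - (a * uy (x, y) + b * vy (x, y))) has_real_derivative a * Fx (x, y) + b * Fx' (x, y)) (at x)" for x y
      using DERIV_add[OF DERIV_cmult[OF u(3)[of y x], of a] DERIV_cmult[OF v(3)[of y x], of b]]
      by (simp add: algebra_simps)
    show "((\<lambda>y. 2 * (a * uy (x, y) + b * vy (x, y)) - (a * ux (x, y) + b * vx (x, y))) has_real_derivative a * Gy (x, y) + b * Gy' (x, y)) (at y)" for x y
      using DERIV_add[OF DERIV_cmult[OF u(4)[of x y], of a] DERIV_cmult[OF v(4)[of x y], of b]]
      by (simp add: algebra_simps)
    show "a * Fx p + b * Fx' p + (a * Gy p + b * Gy' p) = - \<kappa> * (a * u p + b * v p)" for p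
    proof -
      have "a * Fx p + b * Fx' p + (a * Gy p + b * Gy' p) = a * (Fx p + Gy p) + b * (Fx' p + Gy' p)" by (simp add: algebra_simps)
      then show ?thesis unfolding u(5) v(5) by (simp add: algebra_simps)
    qed
  qed (intro continuous_intros u v)+
qed

lemma eigen_lin:
  assumes "eigen \<kappa> u ux uy" "eigen \<kappa> v vx vy"
  shows "eigen \<kappa> (\<lambda>p. a * u p + b * v p) (\<lambda>p. a * ux p + b * vx p) (\<lambda>p. a * uy p + b * vy p)"
  using assms C1_zero_lin Helmholtz_lin unfolding eigen_def by blast

definition cos_wave_dx :: "int \<Rightarrow> int \<Rightarrow> real \<times> real \<Rightarrow> real" where "cos_wave_dx i j p = - (2 * pi / 3 * of_int (2 * i + j)) * sin_wave i j p"
definition cos_wave_dy :: "int \<Rightarrow> int \<Rightarrow> real \<times> real \<Rightarrow> real" where "cos_wave_dy i j p = - (2 * pi / 3 * of_int (i + 2 * j)) * sin_wave i j p"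
definition sin_wave_dx :: "int \<Rightarrow> int \<Rightarrow> real \<times> real \<Rightarrow> real" where "sin_wave_dx i j p = (2 * pi / 3 * of_int (2 * i + j)) * cos_wave i j p"
definition sin_wave_dy :: "int \<Rightarrow> int \<Rightarrow> real \<times> real \<Rightarrow> real" where "sin_wave_dy i j p = (2 * pi / 3 * of_int (i + 2 * j)) * cos_wave i j p"

lemma cos_wave_deriv:
  "((\<lambda>x. cos_wave i j (x, y)) has_real_derivative cos_wave_dx i j (x, y)) (at x)"
  "((\<lambda>y. cos_wave i j (x, y)) has_real_derivative cos_wave_dy i j (x, y)) (at y)"
  "((\<lambda>x. sin_wave i j (x, y)) has_real_derivative sin_wave_dx i j (x, y)) (at x)"
  "((\<lambda>y. sin_wave i j (x, y)) has_real_derivative sin_wave_dy i j (x, y)) (at y)"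
  unfolding cos_wave_def sin_wave_def cos_wave_dx_def cos_wave_dy_def sin_wave_dx_def sin_wave_dy_def phase_def
  by (auto intro!: derivative_eq_intros)

lemma cos_wave_continuous: "continuous_on A (cos_wave i j)" "continuous_on A (sin_wave i j)"
  "continuous_on A (cos_wave_dx i j)" "continuous_on A (cos_wave_dy i j)" "continuous_on A (sin_wave_dx i j)" "continuous_on A (sin_wave_dy i j)"
proof -
  have c: "continuous_on A (phase i j)" unfolding phase_def by (intro continuous_intros)
  show "continuous_on A (cos_wave i j)" "continuous_on A (sin_wave i j)"
    "continuous_on A (cos_wave_dx i j)" "continuous_on A (cos_wave_dy i j)" "continuous_on A (sin_wave_dx i j)" "continuous_on A (sin_wave_dy i j)"
    unfolding cos_wave_dx_def cos_wave_dy_def sin_wave_dx_def sin_wave_dy_def cos_wave_def sin_wave_def by (intro continuous_intros c)+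
qed

lemma cos_wave_Helmholtz:
  assumes "wave_norm i j = n"
  shows "Helmholtz (8 * pi\<^sup>2 / 3 * of_int n) (cos_wave i j) (cos_wave_dx i j) (cos_wave_dy i j)"
    and "Helmholtz (8 * pi\<^sup>2 / 3 * of_int n) (sin_wave i j) (sin_wave_dx i j) (sin_wave_dy i j)"
proof -
  define a b :: real where "a = of_int (2 * i + j)" "b = of_int (i + 2 * j)"
  have n: "a\<^sup>2 + b\<^sup>2 - a * b = 3 * of_int n"
    unfolding a_b_def assms[symmetric] wave_norm_def by (simp add: power2_eq_square algebra_simps)
  have n': "2 * a * a + 2 * b * b - 2 * a * b = 6 * of_int n" using n by (simp add: power2_eq_square)
  have D: "((\<lambda>x. sin_wave i j (x, y)) has_real_derivative 2 * pi / 3 * a * cos_wave i j (x, y)) (at x)"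
    "((\<lambda>y. sin_wave i j (x, y)) has_real_derivative 2 * pi / 3 * b * cos_wave i j (x, y)) (at y)"
    "((\<lambda>x. cos_wave i j (x, y)) has_real_derivative - (2 * pi / 3 * a) * sin_wave i j (x, y)) (at x)"
    "((\<lambda>y. cos_wave i j (x, y)) has_real_derivative - (2 * pi / 3 * b) * sin_wave i j (x, y)) (at y)" for x y
    unfolding a_b_def by (rule cos_wave_deriv[unfolded cos_wave_dx_def cos_wave_dy_def sin_wave_dx_def sin_wave_dy_def])+
  show "Helmholtz (8 * pi\<^sup>2 / 3 * of_int n) (cos_wave i j) (cos_wave_dx i j) (cos_wave_dy i j)"
    unfolding Helmholtz_def
  proof (rule exI[of _ "\<lambda>p. - (4 * pi\<^sup>2 / 9) * (2 * a - b) * a * cos_wave i j p"], rule exI[of _ "\<lambda>p. - (4 * pi\<^sup>2 / 9) * (2 * b - a) * b * cos_wave i j p"], intro conjI allI)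
    show "((\<lambda>x. 2 * cos_wave_dx i j (x, y) - cos_wave_dy i j (x, y)) has_real_derivative - (4 * pi\<^sup>2 / 9) * (2 * a - b) * a * cos_wave i j (x, y)) (at x)" for x y
      unfolding cos_wave_dx_def cos_wave_dy_def a_b_def[symmetric]
      by (rule derivative_eq_intros D refl)+ (simp add: power2_eq_square field_simps)
    show "((\<lambda>y. 2 * cos_wave_dy i j (x, y) - cos_wave_dx i j (x, y)) has_real_derivative - (4 * pi\<^sup>2 / 9) * (2 * b - a) * b * cos_wave i j (x, y)) (at y)" for x y
      unfolding cos_wave_dx_def cos_wave_dy_def a_b_def[symmetric]
      by (rule derivative_eq_intros D refl)+ (simp add: power2_eq_square field_simps)
    show "- (4 * pi\<^sup>2 / 9) * (2 * a - b) * a * cos_wave i j p + - (4 * pi\<^sup>2 / 9) * (2 * b - a) * b * cos_wave i j p = - (8 * pi\<^sup>2 / 3 * of_int n) * cos_wave i j p" for p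
    proof -
      have "- (4 * pi\<^sup>2 / 9) * (2 * a - b) * a * cos_wave i j p + - (4 * pi\<^sup>2 / 9) * (2 * b - a) * b * cos_wave i j p
        = - (4 * pi\<^sup>2 / 9) * (2 * a * a + 2 * b * b - 2 * a * b) * cos_wave i j p" by (simp add: field_simps)
      then show ?thesis unfolding n' by simp
    qed
  qed (intro continuous_intros cos_wave_continuous)+
  show "Helmholtz (8 * pi\<^sup>2 / 3 * of_int n) (sin_wave i j) (sin_wave_dx i j) (sin_wave_dy i j)"
    unfolding Helmholtz_def
  proof (rule exI[of _ "\<lambda>p. - (4 * pi\<^sup>2 / 9) * (2 * a - b) * a * sin_wave i j p"], rule exI[of _ "\<lambda>p. - (4 * pi\<^sup>2 / 9) * (2 * b - a) * b * sin_wave i j p"], intro conjI allI)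
    show "((\<lambda>x. 2 * sin_wave_dx i j (x, y) - sin_wave_dy i j (x, y)) has_real_derivative - (4 * pi\<^sup>2 / 9) * (2 * a - b) * a * sin_wave i j (x, y)) (at x)" for x y
      unfolding sin_wave_dx_def sin_wave_dy_def a_b_def[symmetric]
      by (rule derivative_eq_intros D refl)+ (simp add: power2_eq_square field_simps)
    show "((\<lambda>y. 2 * sin_wave_dy i j (x, y) - sin_wave_dx i j (x, y)) has_real_derivative - (4 * pi\<^sup>2 / 9) * (2 * b - a) * b * sin_wave i j (x, y)) (at y)" for x y
      unfolding sin_wave_dx_def sin_wave_dy_def a_b_def[symmetric]
      by (rule derivative_eq_intros D refl)+ (simp add: power2_eq_square field_simps)
    show "- (4 * pi\<^sup>2 / 9) * (2 * a - b) * a * sin_wave i j p + - (4 * pi\<^sup>2 / 9) * (2 * b - a) * b * sin_wave i j p = - (8 * pi\<^sup>2 / 3 * of_int n) * sin_wave i j p" for p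
    proof -
      have "- (4 * pi\<^sup>2 / 9) * (2 * a - b) * a * sin_wave i j p + - (4 * pi\<^sup>2 / 9) * (2 * b - a) * b * sin_wave i j p
        = - (4 * pi\<^sup>2 / 9) * (2 * a * a + 2 * b * b - 2 * a * b) * sin_wave i j p" by (simp add: field_simps)
      then show ?thesis unfolding n' by simp
    qed
  qed (intro continuous_intros cos_wave_continuous)+
qed

definition cos_mode_dx where "cos_mode_dx i j p = cos_wave_dx i j p - cos_wave_dx (- i) (i + j) p - cos_wave_dx (i + j) (- j) p + cos_wave_dx (- i - j) i p + cos_wave_dx j (- i - j) p - cos_wave_dx (- j) (- i) p"
definition cos_mode_dy where "cos_mode_dy i j p = cos_wave_dy i j p - cos_wave_dy (- i) (i + j) p - cos_wave_dy (i + j) (- j) p + cos_wave_dy (- i - j) i p + cos_wave_dy j (- i - j) p - cos_wave_dy (- j) (- i) p"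
definition sin_mode_dx where "sin_mode_dx i j p = sin_wave_dx i j p - sin_wave_dx (- i) (i + j) p - sin_wave_dx (i + j) (- j) p + sin_wave_dx (- i - j) i p + sin_wave_dx j (- i - j) p - sin_wave_dx (- j) (- i) p"
definition sin_mode_dy where "sin_mode_dy i j p = sin_wave_dy i j p - sin_wave_dy (- i) (i + j) p - sin_wave_dy (i + j) (- j) p + sin_wave_dy (- i - j) i p + sin_wave_dy j (- i - j) p - sin_wave_dy (- j) (- i) p"

lemma wave_norm_orbit: "wave_norm (- i) (i + j) = wave_norm i j" "wave_norm (i + j) (- j) = wave_norm i j" "wave_norm (- i - j) i = wave_norm i j"
  "wave_norm j (- i - j) = wave_norm i j" "wave_norm (- j) (- i) = wave_norm i j"
  by (simp_all add: wave_norm_def power2_eq_square algebra_simps)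

lemma phase_boundary:
  "phase (- i) (i + j) (0, t) = phase i j (0, t)" "phase (- i - j) i (0, t) = phase (i + j) (- j) (0, t)" "phase (- j) (- i) (0, t) = phase j (- i - j) (0, t)"
  "phase (i + j) (- j) (t, 0) = phase i j (t, 0)" "phase (- i - j) i (t, 0) = phase (- j) (- i) (t, 0)" "phase j (- i - j) (t, 0) = phase (- i) (i + j) (t, 0)"
  "phase i j (1 - t, t) = phase (- j) (- i) (1 - t, t) + 2 * pi * of_int (i + j)"
  "phase (- i - j) i (1 - t, t) = phase (- i) (i + j) (1 - t, t) + 2 * pi * of_int (- j)"
  "phase j (- i - j) (1 - t, t) = phase (i + j) (- j) (1 - t, t) + 2 * pi * of_int (- i)"
  by (simp_all add: phase_def algebra_simps)

text \<open>Each reflection that fixes an edge pairs the six waves so that the two members of a pair have opposite signs and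
  agree on that edge, up to a period of the sine and cosine.\<close>

lemma mode_boundary:
  "cos_mode i j (0, t) = 0" "cos_mode i j (t, 0) = 0" "cos_mode i j (1 - t, t) = 0"
  "sin_mode i j (0, t) = 0" "sin_mode i j (t, 0) = 0" "sin_mode i j (1 - t, t) = 0"
proof -
  have per: "cos (x + 2 * pi * of_int k) = cos x" "sin (x + 2 * pi * of_int k) = sin x" for x k
    using sin_cos_eq_iff[of "x + 2 * pi * of_int k" x] by auto
  show "cos_mode i j (0, t) = 0" "cos_mode i j (t, 0) = 0" "sin_mode i j (0, t) = 0" "sin_mode i j (t, 0) = 0"
    unfolding cos_mode_def sin_mode_def cos_wave_def sin_wave_def phase_boundary(1,2,4,5)[of i j t] phase_boundary(3,6)[of j i t] by simp_all
  show "cos_mode i j (1 - t, t) = 0" "sin_mode i j (1 - t, t) = 0"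
    unfolding cos_mode_def sin_mode_def cos_wave_def sin_wave_def phase_boundary(7,8)[of i j t] phase_boundary(9)[of j i t] per by simp_all
qed

lemma mode_continuous: "continuous_on A (cos_mode i j)" "continuous_on A (sin_mode i j)" "continuous_on A (cos_mode_dx i j)" "continuous_on A (cos_mode_dy i j)"
  "continuous_on A (sin_mode_dx i j)" "continuous_on A (sin_mode_dy i j)"
  unfolding cos_mode_def sin_mode_def cos_mode_dx_def cos_mode_dy_def sin_mode_dx_def sin_mode_dy_def by (intro continuous_intros cos_wave_continuous)+

lemma Helmholtz_add_scaled:
  assumes "Helmholtz \<kappa> u ux uy" "Helmholtz \<kappa> v vx vy"
  shows "Helmholtz \<kappa> (\<lambda>p. u p + v p) (\<lambda>p. ux p + vx p) (\<lambda>p. uy p + vy p)"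
    and "Helmholtz \<kappa> (\<lambda>p. u p - v p) (\<lambda>p. ux p - vx p) (\<lambda>p. uy p - vy p)"
  using Helmholtz_lin[OF assms, of 1 1] Helmholtz_lin[OF assms, of 1 "-1"] by simp_all

lemma mode_eigen_basic:
  "eigen (8 * pi\<^sup>2 / 3 * of_int (wave_norm i j)) (cos_mode i j) (cos_mode_dx i j) (cos_mode_dy i j)"
  "eigen (8 * pi\<^sup>2 / 3 * of_int (wave_norm i j)) (sin_mode i j) (sin_mode_dx i j) (sin_mode_dy i j)"
proof -
  have "Helmholtz (8 * pi\<^sup>2 / 3 * of_int (wave_norm i j)) (cos_mode i j) (cos_mode_dx i j) (cos_mode_dy i j)"
    unfolding cos_mode_def[abs_def] cos_mode_dx_def[abs_def] cos_mode_dy_def[abs_def]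
    by (intro Helmholtz_add_scaled cos_wave_Helmholtz refl wave_norm_orbit)
  moreover have "C1_zero (cos_mode i j) (cos_mode_dx i j) (cos_mode_dy i j)"
    unfolding C1_zero_def
  proof (intro conjI allI mode_continuous mode_boundary)
    show "((\<lambda>x. cos_mode i j (x, y)) has_real_derivative cos_mode_dx i j (x, y)) (at x)" for x y
      unfolding cos_mode_def cos_mode_dx_def by (intro DERIV_add DERIV_diff cos_wave_deriv)
    show "((\<lambda>y. cos_mode i j (x, y)) has_real_derivative cos_mode_dy i j (x, y)) (at y)" for x y
      unfolding cos_mode_def cos_mode_dy_def by (intro DERIV_add DERIV_diff cos_wave_deriv)
  qed
  ultimately show "eigen (8 * pi\<^sup>2 / 3 * of_int (wave_norm i j)) (cos_mode i j) (cos_mode_dx i j) (cos_mode_dy i j)" by (simp add: eigen_def)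
  have "Helmholtz (8 * pi\<^sup>2 / 3 * of_int (wave_norm i j)) (sin_mode i j) (sin_mode_dx i j) (sin_mode_dy i j)"
    unfolding sin_mode_def[abs_def] sin_mode_dx_def[abs_def] sin_mode_dy_def[abs_def]
    by (intro Helmholtz_add_scaled cos_wave_Helmholtz refl wave_norm_orbit)
  moreover have "C1_zero (sin_mode i j) (sin_mode_dx i j) (sin_mode_dy i j)"
    unfolding C1_zero_def
  proof (intro conjI allI mode_continuous mode_boundary)
    show "((\<lambda>x. sin_mode i j (x, y)) has_real_derivative sin_mode_dx i j (x, y)) (at x)" for x y
      unfolding sin_mode_def sin_mode_dx_def by (intro DERIV_add DERIV_diff cos_wave_deriv)
    show "((\<lambda>y. sin_mode i j (x, y)) has_real_derivative sin_mode_dy i j (x, y)) (at y)" for x y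
      unfolding sin_mode_def sin_mode_dy_def by (intro DERIV_add DERIV_diff cos_wave_deriv)
  qed
  ultimately show "eigen (8 * pi\<^sup>2 / 3 * of_int (wave_norm i j)) (sin_mode i j) (sin_mode_dx i j) (sin_mode_dy i j)" by (simp add: eigen_def)
qed

section \<open>Completeness of the modes\<close>

text \<open>The eigenspace with \<open>wave_norm = n\<close>, as the span of the basic modes.\<close>

inductive mode :: "nat \<Rightarrow> (real \<times> real \<Rightarrow> real) \<Rightarrow> bool" for n where
  zero: "mode n (\<lambda>p. 0)"
| step: "mode n v \<Longrightarrow> wave_norm i j = int n \<Longrightarrow> mode n (\<lambda>p. a * cos_mode i j p + b * sin_mode i j p + v p)"

lemma mode_eigen: "mode n v \<Longrightarrow> \<exists>vx vy. eigen (8 * pi\<^sup>2 / 3 * n) v vx vy"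
proof (induction rule: mode.induct)
  case zero
  have "eigen (8 * pi\<^sup>2 / 3 * n) (\<lambda>p. 0) (\<lambda>p. 0) (\<lambda>p. 0)"
    by (auto simp: eigen_def C1_zero_def Helmholtz_def intro!: exI[of _ "\<lambda>p. 0"])
  then show ?case by blast
next
  case (step v i j a b)
  then obtain vx vy where v: "eigen (8 * pi\<^sup>2 / 3 * n) v vx vy" by blast
  have "eigen (8 * pi\<^sup>2 / 3 * n) (cos_mode i j) (cos_mode_dx i j) (cos_mode_dy i j)" "eigen (8 * pi\<^sup>2 / 3 * n) (sin_mode i j) (sin_mode_dx i j) (sin_mode_dy i j)"
    using mode_eigen_basic[of i j] step.hyps by simp_all
  from eigen_lin[OF eigen_lin[OF this, of a b] v, of 1 1] show ?case by (simp) blast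
qed

lemma mode_add: "mode n v \<Longrightarrow> mode n w \<Longrightarrow> mode n (\<lambda>p. v p + w p)"
proof (induction rule: mode.induct)
  case (step v i j a b)
  from mode.step[OF step.IH[OF step.prems] step.hyps(2), of a b] show ?case by (simp add: add.assoc)
qed simp

lemma mode_scale: "mode n v \<Longrightarrow> mode n (\<lambda>p. c * v p)"
proof (induction rule: mode.induct)
  case zero
  show ?case using mode.zero by simp
next
  case (step v i j a b)
  from mode.step[OF step.IH step.hyps(2), of "c * a" "c * b"] show ?case by (simp add: algebra_simps)
qed

definition mode_sum :: "(real \<times> real \<Rightarrow> real) \<Rightarrow> bool" where
  "mode_sum v \<longleftrightarrow> (\<exists>m p. (\<forall>n. mode n (p n)) \<and> v = (\<lambda>x. \<Sum>n\<le>m. p n x))"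

lemma mode_sum_add:
  assumes "mode_sum v" "mode_sum w"
  shows "mode_sum (\<lambda>x. v x + w x)"
proof -
  obtain m p where p: "\<And>n. mode n (p n)" "v = (\<lambda>x. \<Sum>n\<le>m. p n x)" using assms(1) by (auto simp: mode_sum_def)
  obtain k q where q: "\<And>n. mode n (q n)" "w = (\<lambda>x. \<Sum>n\<le>k. q n x)" using assms(2) by (auto simp: mode_sum_def)
  define p' where "p' n = (if n \<le> m then p n else (\<lambda>x. 0))" for n
  define q' where "q' n = (if n \<le> k then q n else (\<lambda>x. 0))" for n
  have "mode n (\<lambda>x. p' n x + q' n x)" for n
    by (rule mode_add) (auto simp: p'_def q'_def p q intro: mode.zero)
  moreover have "(\<Sum>n\<le>max m k. p' n x) = v x" for x
    unfolding p(2) by (rule sum.mono_neutral_cong_right) (auto simp: p'_def)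
  moreover have "(\<Sum>n\<le>max m k. q' n x) = w x" for x
    unfolding q(2) by (rule sum.mono_neutral_cong_right) (auto simp: q'_def)
  ultimately show ?thesis
    unfolding mode_sum_def by (intro exI[of _ "max m k"] exI[of _ "\<lambda>n x. p' n x + q' n x"]) (simp add: sum.distrib)
qed

lemma mode_sum_scale:
  assumes "mode_sum v" shows "mode_sum (\<lambda>x. c * v x)"
proof -
  obtain m p where p: "\<And>n. mode n (p n)" "v = (\<lambda>x. \<Sum>n\<le>m. p n x)" using assms by (auto simp: mode_sum_def)
  then show ?thesis
    unfolding mode_sum_def by (intro exI[of _ m] exI[of _ "\<lambda>n x. c * p n x"]) (simp add: sum_distrib_left mode_scale)
qed

lemma mode_imp_mode_sum: assumes "mode n v" shows "mode_sum v"
  unfolding mode_sum_def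
  by (intro exI[of _ n] exI[of _ "\<lambda>k. if k = n then v else (\<lambda>x. 0)"])
    (use assms in \<open>auto simp: fun_eq_iff if_distribR sum.delta intro: mode.zero\<close>)

lemma mode_sum_zero: "mode_sum (\<lambda>x. 0)"
  by (rule mode_imp_mode_sum[OF mode.zero])

lemma wave_norm_nonneg: "wave_norm i j \<ge> 0"
proof -
  have "4 * wave_norm i j = (2 * i + j)\<^sup>2 + 3 * j\<^sup>2" by (simp add: wave_norm_def power2_eq_square algebra_simps)
  moreover have "(2 * i + j)\<^sup>2 + 3 * j\<^sup>2 \<ge> 0" by simp
  ultimately show ?thesis by linarith
qed

lemma mode_sum_basic: "mode_sum (cos_mode i j)" "mode_sum (sin_mode i j)"
proof -
  have n: "wave_norm i j = int (nat (wave_norm i j))" using wave_norm_nonneg by simp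
  from mode.step[OF mode.zero n, of 1 0] mode.step[OF mode.zero n, of 0 1]
  show "mode_sum (cos_mode i j)" "mode_sum (sin_mode i j)" by (auto dest: mode_imp_mode_sum)
qed

lemma mode_sum_mult_basic:
  "mode_sum (\<lambda>p. cos_mode i j p * orbit_re p)" "mode_sum (\<lambda>p. cos_mode i j p * orbit_im p)"
  "mode_sum (\<lambda>p. sin_mode i j p * orbit_re p)" "mode_sum (\<lambda>p. sin_mode i j p * orbit_im p)"
proof -
  have d: "mode_sum (\<lambda>x. v x - w x)" if "mode_sum v" "mode_sum w" for v w
    using mode_sum_add[OF that(1) mode_sum_scale[OF that(2), of "-1"]] by simp
  have h: "mode_sum (\<lambda>x. v x / 2)" if "mode_sum v" for v
    using mode_sum_scale[OF that, of "1 / 2"] by simp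
  have m: "mode_sum (\<lambda>x. - v x)" if "mode_sum v" for v
    using mode_sum_scale[OF that, of "-1"] by simp
  show "mode_sum (\<lambda>p. cos_mode i j p * orbit_re p)" "mode_sum (\<lambda>p. cos_mode i j p * orbit_im p)"
    "mode_sum (\<lambda>p. sin_mode i j p * orbit_re p)" "mode_sum (\<lambda>p. sin_mode i j p * orbit_im p)"
    unfolding cos_mode_orbit_re cos_mode_orbit_im sin_mode_orbit_re sin_mode_orbit_im by (intro d h m mode_sum_add mode_sum_basic)+
qed

lemma mode_sum_mult:
  assumes "mode_sum v"
  shows "mode_sum (\<lambda>p. v p * orbit_re p)" "mode_sum (\<lambda>p. v p * orbit_im p)"
proof -
  have m: "mode_sum (\<lambda>p. w p * orbit_re p) \<and> mode_sum (\<lambda>p. w p * orbit_im p)" if "mode n w" for n w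
    using that
  proof (induction rule: mode.induct)
    case (step v i j a b)
    have "(\<lambda>p. (a * cos_mode i j p + b * sin_mode i j p + v p) * orbit_re p) = (\<lambda>p. a * (cos_mode i j p * orbit_re p) + b * (sin_mode i j p * orbit_re p) + v p * orbit_re p)"
      "(\<lambda>p. (a * cos_mode i j p + b * sin_mode i j p + v p) * orbit_im p) = (\<lambda>p. a * (cos_mode i j p * orbit_im p) + b * (sin_mode i j p * orbit_im p) + v p * orbit_im p)"
      by (auto simp: algebra_simps)
    then show ?case using step.IH by (auto intro!: mode_sum_add mode_sum_scale mode_sum_mult_basic)
  qed (simp add: mode_sum_zero)
  obtain k p where p: "\<And>n. mode n (p n)" "v = (\<lambda>x. \<Sum>n\<le>k. p n x)" using assms by (auto simp: mode_sum_def)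
  have "mode_sum (\<lambda>x. (\<Sum>n\<le>k. p n x) * orbit_re x) \<and> mode_sum (\<lambda>x. (\<Sum>n\<le>k. p n x) * orbit_im x)"
  proof (induction k)
    case 0
    show ?case using m[OF p(1)[of 0]] by simp
  next
    case (Suc k)
    then show ?case using m[OF p(1)[of "Suc k"]] mode_sum_add by (simp add: distrib_right)
  qed
  then show "mode_sum (\<lambda>p. v p * orbit_re p)" "mode_sum (\<lambda>p. v p * orbit_im p)" unfolding p(2) by auto
qed

text \<open>The algebra generated by \<open>orbit_re\<close> and \<open>orbit_im\<close> acts on the sums of modes.\<close>

lemma mode_sum_mult_polynomial:
  fixes g :: "complex \<Rightarrow> real"
  assumes "real_polynomial_function g"
  shows "mode_sum v \<Longrightarrow> mode_sum (\<lambda>p. v p * g (Complex (orbit_re p) (orbit_im p)))"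
  using assms
proof (induction g arbitrary: v rule: real_polynomial_function.induct)
  case (linear g)
  interpret bounded_linear g by (rule linear)
  have "g (Complex s t) = s * g 1 + t * g \<i>" for s t
  proof -
    have "Complex s t = s *\<^sub>R 1 + t *\<^sub>R \<i>" by (simp add: complex_eq_iff)
    then show ?thesis by (simp only: add scaleR) simp
  qed
  then have "(\<lambda>p. v p * g (Complex (orbit_re p) (orbit_im p))) = (\<lambda>p. g 1 * (v p * orbit_re p) + g \<i> * (v p * orbit_im p))"
    by (auto simp: algebra_simps)
  then show ?case using linear.prems by (auto intro!: mode_sum_add mode_sum_scale mode_sum_mult)
next
  case (const c)
  then show ?case using mode_sum_scale[of v c] by (simp add: mult.commute)
next
  case (add f g)
  then show ?case using mode_sum_add by (simp add: distrib_left)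
next
  case (mult f g)
  from mult.IH(2)[OF mult.IH(1)[OF mult.prems]] show ?case by (simp add: mult.assoc)
qed

text \<open>The three numbers \<open>A\<close>, \<open>B\<close>, \<open>- A - B\<close> are coordinates in which the triangle is a fundamental domain of the affine
  reflection group. A permutation followed by an integer translation that maps one point of the domain to
  another one must therefore fix it; the finitely many cases are linear.\<close>

lemma alcove_translation:
  fixes A B A' B' X Y r q :: real
  assumes o: "A \<ge> B" "B \<ge> - A - B" "- A - B \<ge> A - 1" "A' \<ge> B'" "B' \<ge> - A' - B'" "- A' - B' \<ge> A' - 1"
    and e: "A' = X + r" "B' = Y + q" and r: "r = - 1 \<or> r = 0 \<or> r = 1" and q: "q = - 1 \<or> q = 0 \<or> q = 1"
    and perm: "X = A \<and> Y = B \<or> X = A \<and> Y = - A - B \<or> X = B \<and> Y = A \<or> X = B \<and> Y = - A - B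
      \<or> X = - A - B \<and> Y = A \<or> X = - A - B \<and> Y = B"
  shows "A' = A" "B' = B"
proof -
  have "A' = A \<and> B' = B" if "r = r0" "q = q0" "r0 \<in> {-1, 0, 1}" "q0 \<in> {-1, 0, 1}" for r0 q0
    using perm
  proof (elim disjE conjE)
    assume "X = A" "Y = B"
    then show ?thesis using that o e by (elim insertE emptyE; simp)
  next
    assume "X = A" "Y = - A - B"
    then show ?thesis using that o e by (elim insertE emptyE; simp; linarith)
  next
    assume "X = B" "Y = A"
    then show ?thesis using that o e by (elim insertE emptyE; simp; linarith)
  next
    assume "X = B" "Y = - A - B"
    then show ?thesis using that o e by (elim insertE emptyE; simp; linarith)
  next
    assume "X = - A - B" "Y = A"
    then show ?thesis using that o e by (elim insertE emptyE; simp; linarith)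
  next
    assume "X = - A - B" "Y = B"
    then show ?thesis using that o e by (elim insertE emptyE; simp; linarith)
  qed
  from this[of r q] r q show "A' = A" "B' = B" by auto
qed

lemma alcove_permutation:
  fixes A B C A' B' C' P Q S :: real and k l m :: int
  assumes s: "A + B + C = 0" "A' + B' + C' = 0"
    and o: "A \<ge> B" "B \<ge> C" "C \<ge> A - 1" "A' \<ge> B'" "B' \<ge> C'" "C' \<ge> A' - 1"
    and perm: "(P, Q, S) \<in> {(A, B, C), (A, C, B), (B, A, C), (B, C, A), (C, A, B), (C, B, A)}"
    and e: "A' = P + k" "B' = Q + l" "C' = S + m"
  shows "A' = A \<and> B' = B"
proof -
  have b: "- 1 < A" "A < 1" "- 1 < B" "B < 1" "- 1 < C" "C < 1" "- 1 < A'" "A' < 1" "- 1 < B'" "B' < 1" "- 1 < C'" "C' < 1"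
    by (use s o in linarith)+
  have "- 1 < P \<and> P < 1" "- 1 < Q \<and> Q < 1" "- 1 < S \<and> S < 1" "P + Q + S = 0" using perm b s by auto
  then have "- 2 < real_of_int k \<and> real_of_int k < 2" "- 2 < real_of_int l \<and> real_of_int l < 2" "real_of_int (k + l + m) = 0"
    using e b s by auto
  then have kl: "k \<in> {- 1, 0, 1}" "l \<in> {- 1, 0, 1}" "m = - k - l" by auto
  have k: "real_of_int k = - 1 \<or> real_of_int k = 0 \<or> real_of_int k = 1" "real_of_int l = - 1 \<or> real_of_int l = 0 \<or> real_of_int l = 1"
    "real_of_int m = - real_of_int k - real_of_int l" using kl by auto
  have C: "C = - A - B" "C' = - A' - B'" by (use s in linarith)+
  show ?thesis
    using alcove_translation[OF o[unfolded C] e(1,2) k(1,2)] perm unfolding C by auto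
qed

text \<open>Three numbers of modulus \<open>1\<close> and product \<open>1\<close> are determined by their sum up to order: the second elementary
  symmetric function is the conjugate of the first, so the two triples are the roots of the same cubic.\<close>

lemma cis_triple_eq:
  assumes n: "norm a = 1" "norm b = 1" "norm c = 1" "norm a' = 1" "norm b' = 1" "norm c' = 1"
    and p: "a * b * c = 1" "a' * b' * c' = 1" and s: "a + b + c = a' + b' + (c' :: complex)"
  shows "(a', b', c') \<in> {(a, b, c), (a, c, b), (b, a, c), (b, c, a), (c, a, b), (c, b, a)}"
proof -
  have inv: "cnj z * z = 1" if "norm z = 1" for z :: complex
    using that by (simp add: complex_norm_square[symmetric] mult.commute)
  have e2: "b * c + a * c + a * b = cnj (a + b + c)" if n: "norm a = 1" "norm b = 1" "norm c = 1" and p: "a * b * c = 1" for a b c :: complex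
  proof -
    have "b * c = (cnj a * a) * (b * c)" "a * c = (cnj b * b) * (a * c)" "a * b = (cnj c * c) * (a * b)"
      unfolding inv[OF n(1)] inv[OF n(2)] inv[OF n(3)] by simp_all
    moreover have "(cnj a * a) * (b * c) = cnj a * (a * b * c)" "(cnj b * b) * (a * c) = cnj b * (a * b * c)"
      "(cnj c * c) * (a * b) = cnj c * (a * b * c)" by (simp_all add: algebra_simps)
    ultimately show ?thesis unfolding p by simp
  qed
  have q: "b * c + a * c + a * b = b' * c' + a' * c' + a' * b'"
    unfolding e2[OF n(1-3) p(1)] e2[OF n(4-6) p(2)] s ..
  have root: "(t - a) * (t - b) * (t - c) = (t - a') * (t - b') * (t - c')" for t
  proof -
    have "(t - a) * (t - b) * (t - c) = t^3 - (a + b + c) * t\<^sup>2 + (b * c + a * c + a * b) * t - a * b * c"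
      by (simp add: power2_eq_square power3_eq_cube algebra_simps)
    also have "\<dots> = t^3 - (a' + b' + c') * t\<^sup>2 + (b' * c' + a' * c' + a' * b') * t - a' * b' * c'"
      unfolding p s q ..
    also have "\<dots> = (t - a') * (t - b') * (t - c')"
      by (simp add: power2_eq_square power3_eq_cube algebra_simps)
    finally show ?thesis .
  qed
  have two: "(b', c') = (b, c) \<or> (b', c') = (c, b)" if a: "a' = a" and s': "a + b + c = a' + b' + c'" and r: "b * c + a * c + a * b = b' * c' + a' * c' + a' * b'" for a b c :: complex
  proof -
    have sum: "b' + c' = b + c" using a s' by simp
    have "b' * c' = b * c"
    proof -
      have "b' * c' + a * (b' + c') = b * c + a * (b + c)" using r a by (simp add: algebra_simps)
      then show ?thesis unfolding sum by simp
    qed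
    have "(b' - b) * (b' - c) = b' * b' - b' * (b + c) + b * c" by (simp add: algebra_simps)
    also have "\<dots> = b' * b' - b' * (b' + c') + b' * c'" unfolding sum \<open>b' * c' = b * c\<close> ..
    also have "\<dots> = 0" by (simp add: algebra_simps)
    finally have "b' = b \<or> b' = c" by simp
    then show ?thesis using sum by auto
  qed
  have "(a' - a) * (a' - b) * (a' - c) = 0" using root[of a'] by simp
  then consider "a' = a" | "a' = b" | "a' = c" by auto
  then show ?thesis
  proof cases
    case 1
    then show ?thesis using two[OF 1 s q] by auto
  next
    case 2
    have "b + a + c = a' + b' + c'" "a * c + b * c + b * a = b' * c' + a' * c' + a' * b'"
      using s q by (simp_all add: algebra_simps)
    from two[OF 2 this] show ?thesis using 2 by auto
  next
    case 3
    have "c + a + b = a' + b' + c'" "a * b + c * b + c * a = b' * c' + a' * c' + a' * b'"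
      using s q by (simp_all add: algebra_simps)
    from two[OF 3 this] show ?thesis using 3 by auto
  qed
qed

definition orbit_sum :: "real \<times> real \<Rightarrow> complex" where "orbit_sum p = Complex (orbit_re p) (orbit_im p)"

text \<open>The invariant \<open>orbit_sum\<close> separates the points of the triangle: it determines the set of the three exponentials, hence the
  point up to the affine reflection group, and the triangle is a fundamental domain of that group.\<close>

lemma orbit_sum_inj: "inj_on orbit_sum unit_triangle"
proof (rule inj_onI)
  fix p p' assume T: "p \<in> unit_triangle" "p' \<in> unit_triangle" and eq: "orbit_sum p = orbit_sum p'"
  define A where "A p = (2 * fst p + snd p) / 3" for p :: "real \<times> real"
  define B where "B p = (snd p - fst p) / 3" for p :: "real \<times> real"
  define C where "C p = - (fst p + 2 * snd p) / 3" for p :: "real \<times> real"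
  have s: "A q + B q + C q = 0" for q by (simp add: A_def B_def C_def field_simps)
  have o: "A q \<ge> B q \<and> B q \<ge> C q \<and> C q \<ge> A q - 1" if "q \<in> unit_triangle" for q
    using that by (simp add: A_def B_def C_def unit_triangle_def field_simps)
  have Z: "orbit_sum q = cis (2 * pi * A q) + cis (2 * pi * B q) + cis (2 * pi * C q)" for q
  proof -
    have "phase 1 0 q = 2 * pi * A q" "phase (- 1) 1 q = 2 * pi * B q" "phase 0 (- 1) q = 2 * pi * C q"
      by (simp_all add: phase_def A_def B_def C_def field_simps)
    then show ?thesis by (simp add: orbit_sum_def orbit_re_def orbit_im_def cos_wave_def sin_wave_def complex_eq_iff)
  qed
  have prod: "cis (2 * pi * A q) * cis (2 * pi * B q) * cis (2 * pi * C q) = 1" for q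
  proof -
    have "2 * pi * A q + 2 * pi * B q + 2 * pi * C q = 2 * pi * (A q + B q + C q)" by (simp add: algebra_simps)
    then show ?thesis unfolding cis_mult s by simp
  qed
  have ex: "\<exists>k::int. x = y + k" if "cis (2 * pi * x) = cis (2 * pi * y)" for x y
  proof -
    have "sin (2 * pi * x) = sin (2 * pi * y) \<and> cos (2 * pi * x) = cos (2 * pi * y)" using that by (simp add: complex_eq_iff)
    then obtain k :: int where "2 * pi * x = 2 * pi * y + 2 * pi * k" unfolding sin_cos_eq_iff by blast
    then have "2 * pi * x = 2 * pi * (y + k)" by (simp add: algebra_simps)
    then show ?thesis by auto
  qed
  have "(cis (2 * pi * A p'), cis (2 * pi * B p'), cis (2 * pi * C p')) \<in>
    {(cis (2 * pi * A p), cis (2 * pi * B p), cis (2 * pi * C p)), (cis (2 * pi * A p), cis (2 * pi * C p), cis (2 * pi * B p)),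
     (cis (2 * pi * B p), cis (2 * pi * A p), cis (2 * pi * C p)), (cis (2 * pi * B p), cis (2 * pi * C p), cis (2 * pi * A p)),
     (cis (2 * pi * C p), cis (2 * pi * A p), cis (2 * pi * B p)), (cis (2 * pi * C p), cis (2 * pi * B p), cis (2 * pi * A p))}"
    by (rule cis_triple_eq[OF _ _ _ _ _ _ prod prod]) (use eq in \<open>auto simp: Z\<close>)
  then obtain P Q S where perm: "(P, Q, S) \<in> {(A p, B p, C p), (A p, C p, B p), (B p, A p, C p), (B p, C p, A p), (C p, A p, B p), (C p, B p, A p)}"
    and c: "cis (2 * pi * A p') = cis (2 * pi * P)" "cis (2 * pi * B p') = cis (2 * pi * Q)" "cis (2 * pi * C p') = cis (2 * pi * S)"
    by auto
  obtain k l m :: int where "A p' = P + k" "B p' = Q + l" "C p' = S + m"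
    using ex[OF c(1)] ex[OF c(2)] ex[OF c(3)] by blast
  from alcove_permutation[OF s s _ _ _ _ _ _ perm this] o[OF T(1)] o[OF T(2)]
  have "A p' = A p" "B p' = B p" by auto
  then show "p = p'" by (auto simp: A_def B_def prod_eq_iff field_simps)
qed

lemma orbit_sum_continuous: "continuous_on A orbit_sum"
proof -
  have "continuous_on A orbit_re" "continuous_on A orbit_im" unfolding orbit_re_def orbit_im_def by (intro continuous_intros cos_wave_continuous)+
  then show ?thesis unfolding orbit_sum_def Complex_eq by (intro continuous_intros)
qed

text \<open>The ground state of the equilateral triangle, normalised so that it is positive.\<close>

definition u1 :: "real \<times> real \<Rightarrow> real" where
  "u1 p = sin (2 * pi * fst p) + sin (2 * pi * snd p) - sin (2 * pi * (fst p + snd p))"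

lemma u1_mode: "u1 p = - (1 / 2) * sin_mode 1 1 p"
proof -
  have "phase 1 1 p = 2 * pi * (fst p + snd p)" "phase (- 1) 2 p = 2 * pi * snd p" "phase 2 (- 1) p = 2 * pi * fst p"
    "phase (- 2) 1 p = - (2 * pi * fst p)" "phase 1 (- 2) p = - (2 * pi * snd p)" "phase (- 1) (- 1) p = - (2 * pi * (fst p + snd p))"
    by (simp_all add: phase_def algebra_simps)
  then have "sin_mode 1 1 p = 2 * sin (2 * pi * (fst p + snd p)) - 2 * sin (2 * pi * fst p) - 2 * sin (2 * pi * snd p)"
    by (simp add: sin_mode_def sin_wave_def)
  then show ?thesis unfolding u1_def by linarith
qed

text \<open>The sum equals \<open>4 sin \<pi>x sin \<pi>y sin \<pi>(x + y)\<close>.\<close>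

lemma u1_pos:
  assumes "p \<in> open_unit_triangle" shows "u1 p > 0"
proof -
  define x y where "x = pi * fst p" "y = pi * snd p"
  have "u1 p = 4 * sin x * sin y * sin (x + y)"
  proof -
    have e: "2 * pi * fst p = 2 * x" "2 * pi * snd p = 2 * y" "2 * pi * (fst p + snd p) = 2 * (x + y)"
      by (simp_all add: x_y_def algebra_simps)
    have "u1 p = 2 * sin x * cos x + 2 * sin y * cos y - 2 * (sin x * cos y + cos x * sin y) * (cos x * cos y - sin x * sin y)"
      unfolding u1_def e sin_double sin_add cos_add ..
    also have "\<dots> = 4 * sin x * sin y * (sin x * cos y + cos x * sin y)"
    proof -
      have "(cos x)\<^sup>2 = 1 - (sin x)\<^sup>2" "(cos y)\<^sup>2 = 1 - (sin y)\<^sup>2" by (simp_all add: cos_squared_eq)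
      then show ?thesis by algebra
    qed
    finally show ?thesis by (simp add: sin_add)
  qed
  moreover have "sin x > 0" "sin y > 0" "sin (x + y) > 0"
    using assms unfolding x_y_def distrib_left[symmetric] by (auto intro!: sin_pi_pos simp: open_unit_triangle_def)
  ultimately show ?thesis by simp
qed

lemma u1_continuous: "continuous_on A u1" unfolding u1_def by (intro continuous_intros)

lemma u1_bound: "\<bar>u1 p\<bar> \<le> 3"
  unfolding u1_def using abs_sin_le_one[of "2 * pi * fst p"] abs_sin_le_one[of "2 * pi * snd p"] abs_sin_le_one[of "2 * pi * (fst p + snd p)"]
  by linarith

lemma mode_sum_u1: "mode_sum u1"
  using mode_sum_scale[OF mode_sum_basic(2), of "- (1 / 2)" 1 1] by (simp add: u1_mode[abs_def])

text \<open>A test function is \<open>u1\<close> times a continuous function. On the compact image of the triangle under the injective map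
  \<open>orbit_sum\<close>, the second factor is approximated by a polynomial in the real and imaginary part, by Stone-Weierstrass.
  The product of \<open>u1\<close> with this polynomial is a sum of modes.\<close>

lemma modes_dense:
  assumes f: "continuous_on UNIV f" and L: "compact L" "L \<subseteq> open_unit_triangle" "\<And>p. p \<notin> L \<Longrightarrow> f p = 0" and e: "e > 0"
  shows "\<exists>v. mode_sum v \<and> (\<forall>p\<in>unit_triangle. \<bar>f p - v p\<bar> < e)"
proof -
  define \<rho> where "\<rho> p = (if p \<in> open_unit_triangle then f p / u1 p else 0)" for p
  have nz: "u1 p \<noteq> 0" if "p \<in> open_unit_triangle" for p using u1_pos[OF that] by simp
  have "continuous_on open_unit_triangle (\<lambda>p. f p / u1 p)"
    by (intro continuous_intros continuous_on_subset[OF f] u1_continuous ballI nz subset_UNIV)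
  then have c\<rho>: "continuous_on UNIV \<rho>"
    unfolding \<rho>_def by (rule continuous_zero_extension[OF L(1,2)]) (use L(3) in auto)
  have f\<rho>: "f p = u1 p * \<rho> p" for p
  proof (cases "p \<in> open_unit_triangle")
    case True
    then show ?thesis using u1_pos[OF True] by (simp add: \<rho>_def)
  next
    case False
    then have "p \<notin> L" using L(2) by blast
    then show ?thesis using False by (simp add: \<rho>_def L(3))
  qed
  define g where "g = inv_into unit_triangle orbit_sum"
  have gi: "\<forall>p\<in>unit_triangle. g (orbit_sum p) = p" by (auto simp: g_def inv_into_f_f orbit_sum_inj)
  have cg: "continuous_on (orbit_sum ` unit_triangle) g"
    by (rule continuous_on_inv[OF orbit_sum_continuous compact_unit_triangle gi])
  have "continuous_on (orbit_sum ` unit_triangle) (\<lambda>z. \<rho> (g z))"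
    by (rule continuous_on_compose2[OF c\<rho> cg]) auto
  moreover have "compact (orbit_sum ` unit_triangle)"
    by (intro compact_continuous_image orbit_sum_continuous compact_unit_triangle)
  ultimately obtain P where P: "real_polynomial_function P" "\<And>z. z \<in> orbit_sum ` unit_triangle \<Longrightarrow> \<bar>\<rho> (g z) - P z\<bar> < e / 4"
    using Stone_Weierstrass_real_polynomial_function[of "orbit_sum ` unit_triangle" "\<lambda>z. \<rho> (g z)" "e / 4"] e by auto
  have "mode_sum (\<lambda>p. u1 p * P (Complex (orbit_re p) (orbit_im p)))"
    by (rule mode_sum_mult_polynomial[OF P(1) mode_sum_u1])
  moreover have "\<bar>f p - u1 p * P (Complex (orbit_re p) (orbit_im p))\<bar> < e" if p: "p \<in> unit_triangle" for p
  proof -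
    have "\<bar>\<rho> p - P (orbit_sum p)\<bar> < e / 4" using P(2)[of "orbit_sum p"] p gi by auto
    moreover have "f p - u1 p * P (orbit_sum p) = u1 p * (\<rho> p - P (orbit_sum p))" by (simp add: f\<rho> algebra_simps)
    then have "\<bar>f p - u1 p * P (orbit_sum p)\<bar> \<le> 3 * \<bar>\<rho> p - P (orbit_sum p)\<bar>"
      using u1_bound[of p] by (simp add: abs_mult mult_right_mono)
    ultimately show ?thesis using e by (simp add: orbit_sum_def)
  qed
  ultimately show ?thesis by blast
qed

section \<open>The gap above the second eigenvalue\<close>

text \<open>Together with \<open>u3\<close> a basis of the second eigenspace, the one with \<open>wave_norm = 7\<close>.\<close>

definition u2 where "u2 = cos_mode 2 1"
definition u3 where "u3 = sin_mode 2 1"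

definition low_energy :: "(real \<times> real \<Rightarrow> real) \<Rightarrow> bool" where
  "low_energy v \<longleftrightarrow> (\<exists>a b c. \<forall>p. v p = a * u1 p + b * u2 p + c * u3 p)"

lemma low_energy_add: "low_energy v \<Longrightarrow> low_energy w \<Longrightarrow> low_energy (\<lambda>p. v p + w p)"
proof -
  assume "low_energy v" "low_energy w"
  then obtain a b c a' b' c' where "\<And>p. v p = a * u1 p + b * u2 p + c * u3 p" "\<And>p. w p = a' * u1 p + b' * u2 p + c' * u3 p"
    unfolding low_energy_def by blast
  then have "\<forall>p. v p + w p = (a + a') * u1 p + (b + b') * u2 p + (c + c') * u3 p" by (simp add: algebra_simps)
  then show ?thesis unfolding low_energy_def by blast
qed

lemma low_energy_scale: "low_energy v \<Longrightarrow> low_energy (\<lambda>p. k * v p)"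
proof -
  assume "low_energy v"
  then obtain a b c where "\<And>p. v p = a * u1 p + b * u2 p + c * u3 p" unfolding low_energy_def by blast
  then have "\<forall>p. k * v p = (k * a) * u1 p + (k * b) * u2 p + (k * c) * u3 p" by (simp add: algebra_simps)
  then show ?thesis unfolding low_energy_def by blast
qed

lemma mode_reflect:
  "cos_mode (- i) (i + j) p = - cos_mode i j p" "sin_mode (- i) (i + j) p = - sin_mode i j p"
  "cos_mode (i + j) (- j) p = - cos_mode i j p" "sin_mode (i + j) (- j) p = - sin_mode i j p"
  unfolding cos_mode_def sin_mode_def by (simp_all add: algebra_simps)

lemma mode_minus: "cos_mode (- i) (- j) p = cos_mode i j p" "sin_mode (- i) (- j) p = - sin_mode i j p"
proof -
  have "phase (- i) (- j) p = - phase i j p" "phase (- (- i)) (- i + - j) p = - phase (- i) (i + j) p" "phase (- i + - j) (- (- j)) p = - phase (i + j) (- j) p"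
    "phase (- (- i) - - j) (- i) p = - phase (- i - j) i p" "phase (- j) (- (- i) - - j) p = - phase j (- i - j) p" "phase (- (- j)) (- (- i)) p = - phase (- j) (- i) p"
    by (simp_all add: phase_def algebra_simps)
  then show "cos_mode (- i) (- j) p = cos_mode i j p" "sin_mode (- i) (- j) p = - sin_mode i j p"
    unfolding cos_mode_def sin_mode_def cos_wave_def sin_wave_def by simp_all
qed

definition low_energy_pair :: "int \<Rightarrow> int \<Rightarrow> bool" where
  "low_energy_pair i j \<longleftrightarrow> low_energy (cos_mode i j) \<and> low_energy (sin_mode i j)"

lemma low_energy_minus: "low_energy v \<Longrightarrow> low_energy (\<lambda>p. - v p)"
  using low_energy_scale[of v "-1"] by simp

lemma low_energy_pair_reflect: "low_energy_pair i j \<Longrightarrow> low_energy_pair (- i) (i + j)" "low_energy_pair i j \<Longrightarrow> low_energy_pair (i + j) (- j)" "low_energy_pair i j \<Longrightarrow> low_energy_pair (- i) (- j)"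
  unfolding low_energy_pair_def mode_reflect[abs_def] mode_minus[abs_def] by (auto intro: low_energy_minus)

lemma low_energy_pair_wall: "low_energy_pair 0 j" "low_energy_pair i 0" "low_energy_pair i (- i)"
proof -
  have z: "low_energy v" if "\<And>p. v p = 0" for v
    unfolding low_energy_def by (intro exI[of _ 0]) (simp add: that)
  have 1: "cos_mode 0 j p = 0" "sin_mode 0 j p = 0" for j p using mode_reflect(1,2)[of 0 j p] by simp_all
  have 2: "cos_mode i 0 p = 0" "sin_mode i 0 p = 0" for i p using mode_reflect(3,4)[of i 0 p] by simp_all
  have 3: "cos_mode i (- i) p = 0" "sin_mode i (- i) p = 0" for p using mode_reflect(1,2)[of i "- i" p] 2[of "- i" p] by simp_all
  show "low_energy_pair 0 j" "low_energy_pair i 0" "low_energy_pair i (- i)" unfolding low_energy_pair_def by (auto intro!: z 1 2 3)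
qed

lemma low_energy_pair_base: "low_energy_pair 1 1" "low_energy_pair 2 1"
proof -
  have "cos_mode 1 1 p = 0" for p
  proof -
    have "phase 1 1 p = - phase (- 1) (- 1) p" "phase (- 1) 2 p = - phase 1 (- 2) p" "phase 2 (- 1) p = - phase (- 2) 1 p"
      by (simp_all add: phase_def algebra_simps)
    then show ?thesis by (simp add: cos_mode_def cos_wave_def)
  qed
  then have "low_energy (cos_mode 1 1)" unfolding low_energy_def by (intro exI[of _ 0]) simp
  moreover have "low_energy (sin_mode 1 1)" unfolding low_energy_def
    by (rule exI[of _ "-2"], rule exI[of _ 0], rule exI[of _ 0]) (simp add: u1_mode)
  ultimately show "low_energy_pair 1 1" by (simp add: low_energy_pair_def)
  have "low_energy (cos_mode 2 1)" unfolding low_energy_def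
    by (rule exI[of _ 0], rule exI[of _ 1], rule exI[of _ 0]) (simp add: u2_def)
  moreover have "low_energy (sin_mode 2 1)" unfolding low_energy_def
    by (rule exI[of _ 0], rule exI[of _ 0], rule exI[of _ 1]) (simp add: u3_def)
  ultimately show "low_energy_pair 2 1" by (simp add: low_energy_pair_def)
qed

text \<open>Up to the symmetry group the only frequencies of norm less than \<open>12\<close> off the mirrors are \<open>(1, 1)\<close> and
  \<open>(2, 1)\<close>, and modes of frequencies on the mirrors vanish. The bound \<open>4 wave_norm \<ge> 3 i\<^sup>2\<close> makes the search finite.\<close>

lemma low_energy_pair_below_twelve:
  assumes n: "wave_norm i j < 12" shows "low_energy_pair i j"
proof -
  note r = low_energy_pair_reflect
  have a: "low_energy_pair (- 1) 2" "low_energy_pair 2 (- 1)" using r(1,2)[OF low_energy_pair_base(1)] by simp_all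
  have b: "low_energy_pair 1 (- 2)" "low_energy_pair (- 2) 1" "low_energy_pair (- 1) (- 1)" using r(3)[OF a(1)] r(3)[OF a(2)] r(3)[OF low_energy_pair_base(1)] by simp_all
  have c: "low_energy_pair (- 2) 3" "low_energy_pair 3 (- 1)" using r(1,2)[OF low_energy_pair_base(2)] by simp_all
  have d: "low_energy_pair (- 3) 2" "low_energy_pair 1 (- 3)" using r(1)[OF c(2)] r(2)[OF c(1)] by simp_all
  have e: "low_energy_pair (- 1) (- 2)" using r(1)[OF d(2)] by simp
  have f: "low_energy_pair (- 2) (- 1)" "low_energy_pair 2 (- 3)" "low_energy_pair (- 3) 1" "low_energy_pair 3 (- 2)" "low_energy_pair (- 1) 3" "low_energy_pair 1 2"
    using r(3)[OF low_energy_pair_base(2)] r(3)[OF c(1)] r(3)[OF c(2)] r(3)[OF d(1)] r(3)[OF d(2)] r(3)[OF e] by simp_all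
  have sq: "k \<in> {-3..3}" if "k\<^sup>2 < 16" for k :: int
  proof (rule ccontr)
    assume "k \<notin> {-3..3}"
    then have "\<bar>k\<bar> \<ge> 4" by auto
    then have "\<bar>k\<bar>\<^sup>2 \<ge> 4\<^sup>2" by (intro power_mono) auto
    then show False using that by simp
  qed
  have e1: "4 * wave_norm i j = (2 * i + j)\<^sup>2 + 3 * j\<^sup>2" and e2: "4 * wave_norm i j = (i + 2 * j)\<^sup>2 + 3 * i\<^sup>2"
    by (simp_all add: wave_norm_def power2_eq_square algebra_simps)
  have "j \<in> {-3..3}" by (rule sq) (use e1 n zero_le_power2[of "2 * i + j"] in linarith)
  moreover have "i \<in> {-3..3}" by (rule sq) (use e2 n zero_le_power2[of "i + 2 * j"] in linarith)
  moreover have "{-3..3} = {-3, -2, -1, 0, 1, 2, 3::int}" by auto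
  ultimately have ij: "i = -3 \<or> i = -2 \<or> i = -1 \<or> i = 0 \<or> i = 1 \<or> i = 2 \<or> i = 3"
    "j = -3 \<or> j = -2 \<or> j = -1 \<or> j = 0 \<or> j = 1 \<or> j = 2 \<or> j = 3" by auto
  have w: "low_energy_pair 3 (- 3)" "low_energy_pair 2 (- 2)" "low_energy_pair 1 (- 1)" "low_energy_pair (- 3) 3" "low_energy_pair (- 2) 2" "low_energy_pair (- 1) 1"
    using low_energy_pair_wall(3)[of 3] low_energy_pair_wall(3)[of 2] low_energy_pair_wall(3)[of 1] low_energy_pair_wall(3)[of "-3"] low_energy_pair_wall(3)[of "-2"] low_energy_pair_wall(3)[of "-1"] by simp_all
  show ?thesis
    using ij n by (elim disjE) (simp_all add: wave_norm_def a b c d e f w low_energy_pair_wall low_energy_pair_base)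
qed

lemma low_energy_mode: "mode n v \<Longrightarrow> n < 12 \<Longrightarrow> low_energy v"
proof (induction rule: mode.induct)
  case zero
  show ?case unfolding low_energy_def by (intro exI[of _ 0]) simp
next
  case (step v i j a b)
  have "low_energy_pair i j" by (rule low_energy_pair_below_twelve) (use step in simp)
  then show ?case using step by (auto simp: low_energy_pair_def intro!: low_energy_add low_energy_scale)
qed

text \<open>The next value of \<open>wave_norm\<close> after \<open>3\<close> and \<open>7\<close> is \<open>12\<close>, four times the first. Instead of an expansion of \<open>w\<close> in modes
  a uniform approximation is used: if \<open>v\<close> is a sum of modes close to \<open>w\<close>, with components \<open>P n\<close>, test the energy of \<open>w\<close> against
  \<open>y = \<Sum> (12/n) P n\<close>, the sum being over \<open>n \<ge> 12\<close>. By Green's formula the mixed energy of \<open>w\<close> and \<open>y\<close> is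
  four times \<open>8\<pi>\<^sup>2\<close> times the inner product of \<open>w\<close> with the high part of \<open>v\<close>, so the gradients of the
  approximation do not enter.\<close>

lemma spectral_gap:
  assumes w: "C1_zero w wx wy" and o: "l2_inner w u1 = 0" "l2_inner w u2 = 0" "l2_inner w u3 = 0"
    and approx: "\<And>e. e > 0 \<Longrightarrow> \<exists>v. mode_sum v \<and> (\<forall>p\<in>unit_triangle. \<bar>w p - v p\<bar> < e)"
  shows "4 * (8 * pi\<^sup>2) * l2_inner w w \<le> iso_energy wx wy wx wy"
proof -
  have cw: "continuous_on UNIV w" "continuous_on UNIV wx" "continuous_on UNIV wy" using C1_zeroD[OF w] by auto
  have one: "l2_inner (\<lambda>p. 1) (\<lambda>p. 1) \<ge> 0" by (simp add: l2_inner_def)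
  have key: "4 * (8 * pi\<^sup>2) * (l2_inner w w - e\<^sup>2 * l2_inner (\<lambda>p. 1) (\<lambda>p. 1)) \<le> iso_energy wx wy wx wy" if e: "e > 0" for e
  proof -
    obtain v where "mode_sum v" and ve: "\<forall>p\<in>unit_triangle. \<bar>w p - v p\<bar> < e" using approx[OF e] by blast
    then obtain m P where P: "\<And>n. mode n (P n)" and v: "v = (\<lambda>x. \<Sum>n\<le>m. P n x)" unfolding mode_sum_def by blast
    have "\<forall>n. \<exists>vx vy. eigen (8 * pi\<^sup>2 / 3 * n) (P n) vx vy" using mode_eigen[OF P] by blast
    then obtain Px Py where E: "\<And>n. eigen (8 * pi\<^sup>2 / 3 * n) (P n) (Px n) (Py n)" by metis
    have cP: "continuous_on UNIV (P n)" "continuous_on UNIV (Px n)" "continuous_on UNIV (Py n)" for n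
    proof -
      have "C1_zero (P n) (Px n) (Py n)" using E[of n] by (simp add: eigen_def)
      from C1_zeroD(1-3)[OF this] show "continuous_on UNIV (P n)" "continuous_on UNIV (Px n)" "continuous_on UNIV (Py n)" .
    qed
    have orth: "l2_inner (P n) (P k) = 0" if "n \<noteq> k" for n k
      by (rule eigen_orthogonal[OF E E]) (use that in simp)
    define H where "H = {12..m}"
    define Lo where "Lo = {..<12} \<inter> {..m}"
    have HL: "finite H" "finite Lo" "H \<union> Lo = {..m}" "H \<inter> Lo = {}" by (auto simp: H_def Lo_def)
    define ph' where "ph' x = (\<Sum>n\<in>H. P n x)" for x
    define pl where "pl x = (\<Sum>n\<in>Lo. P n x)" for x
    have vp: "v x = ph' x + pl x" for x
      unfolding v ph'_def pl_def using HL by (subst sum.union_disjoint[symmetric]) auto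
    have c: "continuous_on UNIV ph'" "continuous_on UNIV pl"
      unfolding ph'_def pl_def by (intro continuous_on_sum cP)+
    have "low_energy pl"
    proof -
      have "low_energy (\<lambda>x. \<Sum>n\<in>A. P n x)" if "finite A" "A \<subseteq> {..<12}" for A
        using that
      proof (induction A rule: finite_induct)
        case empty
        show ?case unfolding low_energy_def by (rule exI[of _ 0], rule exI[of _ 0], rule exI[of _ 0]) simp
      next
        case (insert n A)
        then show ?case using low_energy_add[OF low_energy_mode[OF P[of n]]] by simp
      qed
      then show ?thesis unfolding pl_def[abs_def] using HL(2) by (auto simp: Lo_def)
    qed
    then obtain a b c' where lo: "\<And>p. pl p = a * u1 p + b * u2 p + c' * u3 p" unfolding low_energy_def by blast
    have cu: "continuous_on UNIV u1" "continuous_on UNIV u2" "continuous_on UNIV u3"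
      unfolding u2_def u3_def by (intro u1_continuous mode_continuous)+
    have wpl: "l2_inner pl w = 0"
    proof -
      have "l2_inner pl w = a * l2_inner u1 w + b * l2_inner u2 w + c' * l2_inner u3 w"
        unfolding lo[abs_def] by (simp add: l2_inner_add l2_inner_scale continuous_intros cu cw)
      then show ?thesis using o by (simp add: l2_inner_commute)
    qed
    have hpl: "l2_inner ph' pl = 0"
    proof -
      have "l2_inner ph' pl = (\<Sum>n\<in>H. l2_inner (P n) pl)" unfolding ph'_def by (rule l2_inner_sum[OF HL(1) cP(1) c(2)])
      also have "\<dots> = (\<Sum>n\<in>H. \<Sum>k\<in>Lo. l2_inner (P k) (P n))"
        unfolding pl_def by (intro sum.cong refl, subst l2_inner_commute) (rule l2_inner_sum[OF HL(2) cP(1) cP(1)])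
      also have "\<dots> = 0"
      proof (intro sum.neutral ballI)
        fix n k assume "n \<in> H" "k \<in> Lo"
        then have "k \<noteq> n" using HL(4) by blast
        then show "l2_inner (P k) (P n) = 0" by (rule orth)
      qed
      finally show ?thesis .
    qed
    define d where "d p = w p - ph' p" for p
    have cd: "continuous_on UNIV d" unfolding d_def by (intro continuous_intros cw c)
    have dd: "l2_inner d d \<le> e\<^sup>2 * l2_inner (\<lambda>p. 1) (\<lambda>p. 1)"
    proof -
      have dpl: "l2_inner d pl = 0"
        unfolding d_def using l2_inner_diff[OF cw(1) c(1) c(2)] wpl hpl by (simp add: l2_inner_commute)
      have "l2_inner (\<lambda>p. d p - pl p) (\<lambda>p. d p - pl p) = l2_inner d d - 2 * l2_inner d pl + l2_inner pl pl"
      proof -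
        have "l2_inner (\<lambda>p. d p - pl p) (\<lambda>p. d p - pl p) = l2_inner d (\<lambda>p. d p - pl p) - l2_inner pl (\<lambda>p. d p - pl p)"
          by (rule l2_inner_diff) (intro continuous_intros cd c)+
        also have "l2_inner d (\<lambda>p. d p - pl p) = l2_inner d d - l2_inner pl d"
          by (subst l2_inner_commute, rule l2_inner_diff) (intro cd c)+
        also have "l2_inner pl (\<lambda>p. d p - pl p) = l2_inner d pl - l2_inner pl pl"
          by (subst l2_inner_commute, rule l2_inner_diff) (intro cd c)+
        finally show ?thesis by (simp add: l2_inner_commute)
      qed
      moreover have "l2_inner pl pl \<ge> 0" unfolding l2_inner_def by (rule Bochner_Integration.integral_nonneg) simp
      moreover have "l2_inner (\<lambda>p. d p - pl p) (\<lambda>p. d p - pl p) \<le> e\<^sup>2 * l2_inner (\<lambda>p. 1) (\<lambda>p. 1)"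
      proof -
        have "l2_inner (\<lambda>p. d p - pl p) (\<lambda>p. d p - pl p) \<le> (LINT p|tri_measure. e\<^sup>2)"
          unfolding l2_inner_def
        proof (rule integral_tri_measure_mono)
          show "continuous_on UNIV (\<lambda>p. (d p - pl p) * (d p - pl p))" by (intro continuous_intros cd c)
          fix p assume "p \<in> unit_triangle"
          then have "\<bar>w p - v p\<bar> < e" using ve by blast
          moreover have "w p - v p = d p - pl p" by (simp add: d_def vp)
          ultimately have "\<bar>d p - pl p\<bar> < e" by simp
          then have "\<bar>d p - pl p\<bar>\<^sup>2 \<le> e\<^sup>2" by (intro power_mono) auto
          then show "(d p - pl p) * (d p - pl p) \<le> e\<^sup>2" by (simp add: power2_eq_square)
        qed simp
        also have "\<dots> = e\<^sup>2 * l2_inner (\<lambda>p. 1) (\<lambda>p. 1)" by (simp add: l2_inner_def)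
        finally show ?thesis .
      qed
      ultimately show ?thesis using dpl by simp
    qed
    \<comment> \<open>The quotient of the eigenvalue \<open>4 (8\<pi>\<^sup>2)\<close> and the eigenvalue of \<open>P n\<close>.\<close>
    define r where "r n = 12 / real n" for n
    define yx where "yx p = (\<Sum>n\<in>H. r n * Px n p)" for p
    define yy where "yy p = (\<Sum>n\<in>H. r n * Py n p)" for p
    define y where "y p = (\<Sum>n\<in>H. r n * P n p)" for p
    have cy: "continuous_on UNIV y" "continuous_on UNIV yx" "continuous_on UNIV yy"
      unfolding y_def yx_def yy_def by (intro continuous_on_sum continuous_intros cP)+
    have Cy: "C1_zero y yx yy"
    proof -
      have "C1_zero (\<lambda>p. \<Sum>n\<in>A. r n * P n p) (\<lambda>p. \<Sum>n\<in>A. r n * Px n p) (\<lambda>p. \<Sum>n\<in>A. r n * Py n p)" if "finite A" for A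
        using that
      proof (induction A rule: finite_induct)
        case empty
        show ?case by (simp add: C1_zero_def)
      next
        case (insert n A)
        have "C1_zero (P n) (Px n) (Py n)" using E by (simp add: eigen_def)
        from C1_zero_lin[OF this insert.IH, of "r n" 1] show ?case using insert by simp
      qed
      then show ?thesis unfolding y_def[abs_def] yx_def[abs_def] yy_def[abs_def] using HL(1) by blast
    qed
    have En: "iso_energy ux uy yx yy = 4 * (8 * pi\<^sup>2) * l2_inner u ph'" if u: "C1_zero u ux uy" for u ux uy
    proof -
      have cu: "continuous_on UNIV u" "continuous_on UNIV ux" "continuous_on UNIV uy" using C1_zeroD[OF u] by auto
      have "iso_energy yx yy ux uy = (\<Sum>n\<in>H. r n * iso_energy (Px n) (Py n) ux uy)"
      proof -
        have "yx p * (2 * ux p - uy p) + yy p * (2 * uy p - ux p) = (\<Sum>n\<in>H. r n * (Px n p * (2 * ux p - uy p) + Py n p * (2 * uy p - ux p)))" for p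
          unfolding yx_def yy_def by (simp only: sum_distrib_right distrib_left sum.distrib mult.assoc)
        then have "iso_energy yx yy ux uy = (LINT p|tri_measure. (\<Sum>n\<in>H. r n * (Px n p * (2 * ux p - uy p) + Py n p * (2 * uy p - ux p))))"
          by (simp only: iso_energy_def)
        also have "\<dots> = (\<Sum>n\<in>H. LINT p|tri_measure. r n * (Px n p * (2 * ux p - uy p) + Py n p * (2 * uy p - ux p)))"
          by (rule Bochner_Integration.integral_sum) (intro integrable_tri_measure continuous_intros cu cP)
        finally show ?thesis by (simp add: iso_energy_def)
      qed
      also have "\<dots> = (\<Sum>n\<in>H. 4 * (8 * pi\<^sup>2) * l2_inner (P n) u)"
      proof (rule sum.cong[OF refl])
        fix n assume "n \<in> H"
        then have n: "n > 0" by (auto simp: H_def)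
        have eq: "iso_energy (Px n) (Py n) ux uy = 8 * pi\<^sup>2 / 3 * n * l2_inner (P n) u"
          using Green[OF u E] by (simp add: iso_energy_commute l2_inner_commute)
        show "r n * iso_energy (Px n) (Py n) ux uy = 4 * (8 * pi\<^sup>2) * l2_inner (P n) u"
          unfolding eq r_def using n by (simp add: field_simps)
      qed
      also have "\<dots> = 4 * (8 * pi\<^sup>2) * l2_inner ph' u"
      proof -
        have "l2_inner ph' u = (\<Sum>n\<in>H. l2_inner (P n) u)" unfolding ph'_def by (rule l2_inner_sum[OF HL(1) cP(1) cu(1)])
        then show ?thesis by (simp add: sum_distrib_left)
      qed
      finally show ?thesis by (simp add: iso_energy_commute l2_inner_commute)
    qed
    \<comment> \<open>Each coefficient \<open>r n\<close> is at most \<open>1\<close>, as \<open>n \<ge> 12\<close> on the high part.\<close>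
    have yph: "l2_inner y ph' \<le> l2_inner ph' ph'"
    proof -
      have s: "l2_inner (P n) ph' = l2_inner (P n) (P n)" if "n \<in> H" for n
      proof -
        have "l2_inner (P n) ph' = (\<Sum>k\<in>H. l2_inner (P k) (P n))"
          unfolding ph'_def by (subst l2_inner_commute) (rule l2_inner_sum[OF HL(1) cP(1) cP(1)])
        also have "\<dots> = (\<Sum>k\<in>H. if k = n then l2_inner (P n) (P n) else 0)" by (rule sum.cong) (auto simp: orth)
        finally show ?thesis using that HL(1) by simp
      qed
      have "l2_inner y ph' = (\<Sum>n\<in>H. l2_inner (\<lambda>p. r n * P n p) ph')"
        unfolding y_def by (rule l2_inner_sum[OF HL(1) _ c(1)]) (intro continuous_intros cP)
      also have "\<dots> = (\<Sum>n\<in>H. r n * l2_inner (P n) (P n))" by (rule sum.cong) (simp_all add: l2_inner_scale s)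
      also have "\<dots> \<le> (\<Sum>n\<in>H. 1 * l2_inner (P n) (P n))"
      proof (rule sum_mono)
        fix n assume "n \<in> H"
        then have "r n \<le> 1" by (simp add: r_def H_def)
        moreover have "l2_inner (P n) (P n) \<ge> 0" unfolding l2_inner_def by (rule Bochner_Integration.integral_nonneg) simp
        ultimately show "r n * l2_inner (P n) (P n) \<le> 1 * l2_inner (P n) (P n)" by (rule mult_right_mono)
      qed
      also have "\<dots> = (\<Sum>n\<in>H. l2_inner (P n) ph')" by (rule sum.cong) (simp_all add: s)
      also have "\<dots> = l2_inner ph' ph'" unfolding ph'_def by (rule l2_inner_sum[OF HL(1) cP(1) c(1)[unfolded ph'_def], symmetric])
      finally show ?thesis .
    qed
    have "0 \<le> iso_energy (\<lambda>p. wx p - yx p) (\<lambda>p. wy p - yy p) (\<lambda>p. wx p - yx p) (\<lambda>p. wy p - yy p)"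
      unfolding iso_energy_def
    proof (rule Bochner_Integration.integral_nonneg)
      fix p
      have "s * (2 * s - t) + t * (2 * t - s) \<ge> 0" for s t :: real
      proof -
        have "s * (2 * s - t) + t * (2 * t - s) = s\<^sup>2 + t\<^sup>2 + (s - t)\<^sup>2" by (simp add: power2_eq_square algebra_simps)
        then show ?thesis by simp
      qed
      then show "0 \<le> (wx p - yx p) * (2 * (wx p - yx p) - (wy p - yy p)) + (wy p - yy p) * (2 * (wy p - yy p) - (wx p - yx p))" .
    qed
    also have "\<dots> = iso_energy wx wy wx wy - 2 * iso_energy wx wy yx yy + iso_energy yx yy yx yy"
    proof -
      define a1 a2 a3 where "a1 p = wx p * (2 * wx p - wy p) + wy p * (2 * wy p - wx p)"
        "a2 p = wx p * (2 * yx p - yy p) + wy p * (2 * yy p - yx p)" "a3 p = yx p * (2 * yx p - yy p) + yy p * (2 * yy p - yx p)" for p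
      have i: "integrable tri_measure a1" "integrable tri_measure a2" "integrable tri_measure a3"
        unfolding a1_a2_a3_def by (intro integrable_tri_measure continuous_intros cw cy)+
      have "(wx p - yx p) * (2 * (wx p - yx p) - (wy p - yy p)) + (wy p - yy p) * (2 * (wy p - yy p) - (wx p - yx p)) = a1 p - 2 * a2 p + a3 p" for p
        by (simp add: a1_a2_a3_def algebra_simps)
      then have "iso_energy (\<lambda>p. wx p - yx p) (\<lambda>p. wy p - yy p) (\<lambda>p. wx p - yx p) (\<lambda>p. wy p - yy p) = (LINT p|tri_measure. a1 p - 2 * a2 p + a3 p)"
        unfolding iso_energy_def by (simp only:)
      also have "\<dots> = (LINT p|tri_measure. a1 p) - 2 * (LINT p|tri_measure. a2 p) + (LINT p|tri_measure. a3 p)" using i by simp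
      finally show ?thesis unfolding iso_energy_def a1_a2_a3_def .
    qed
    also have "\<dots> = iso_energy wx wy wx wy - 4 * (8 * pi\<^sup>2) * (2 * l2_inner w ph' - l2_inner y ph')"
      unfolding En[OF w] En[OF Cy] by (simp add: algebra_simps)
    finally have "4 * (8 * pi\<^sup>2) * (2 * l2_inner w ph' - l2_inner y ph') \<le> iso_energy wx wy wx wy" by simp
    moreover have "l2_inner d d = l2_inner w w - 2 * l2_inner w ph' + l2_inner ph' ph'"
    proof -
      have "l2_inner d d = l2_inner w d - l2_inner ph' d" unfolding d_def[abs_def] by (rule l2_inner_diff) (intro continuous_intros cw c)+
      also have "l2_inner w d = l2_inner w w - l2_inner ph' w" unfolding d_def[abs_def] by (subst l2_inner_commute, rule l2_inner_diff) (intro cw c)+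
      also have "l2_inner ph' d = l2_inner w ph' - l2_inner ph' ph'" unfolding d_def[abs_def] by (subst l2_inner_commute, rule l2_inner_diff) (intro cw c)+
      finally show ?thesis by (simp add: l2_inner_commute)
    qed
    then have "l2_inner w w - e\<^sup>2 * l2_inner (\<lambda>p. 1) (\<lambda>p. 1) \<le> 2 * l2_inner w ph' - l2_inner y ph'" using dd yph by simp
    then have "4 * (8 * pi\<^sup>2) * (l2_inner w w - e\<^sup>2 * l2_inner (\<lambda>p. 1) (\<lambda>p. 1)) \<le> 4 * (8 * pi\<^sup>2) * (2 * l2_inner w ph' - l2_inner y ph')"
      by (intro mult_left_mono) auto
    ultimately show ?thesis by linarith
  qed
  have lim: "((\<lambda>e. 4 * (8 * pi\<^sup>2) * (l2_inner w w - e\<^sup>2 * l2_inner (\<lambda>p. 1) (\<lambda>p. 1))) \<longlongrightarrow> 4 * (8 * pi\<^sup>2) * (l2_inner w w - 0\<^sup>2 * l2_inner (\<lambda>p. 1) (\<lambda>p. 1))) (at_right 0)"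
    by (intro tendsto_intros)
  have "4 * (8 * pi\<^sup>2) * (l2_inner w w - 0\<^sup>2 * l2_inner (\<lambda>p. 1) (\<lambda>p. 1)) \<le> iso_energy wx wy wx wy"
    by (rule tendsto_upperbound[OF lim]) (rule eventually_mono[OF eventually_at_right_less], erule key, simp)
  then show ?thesis by simp
qed

section \<open>Integrals of plane waves\<close>

lemma integral_tri_measure_swap: 
  assumes "continuous_on UNIV (f :: real \<times> real \<Rightarrow> real)"
  shows "(LINT p|tri_measure. f (snd p, fst p)) = (LINT p|tri_measure. f p)"
proof -
  define g where "g p = indicator unit_triangle p * f p" for p
  have "f \<in> borel_measurable (lborel \<Otimes>\<^sub>M lborel)"
    unfolding lborel_prod using borel_measurable_continuous_onI[OF assms] by simp
  then have g: "g \<in> borel_measurable (lborel \<Otimes>\<^sub>M lborel)"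
    unfolding g_def lborel_prod using sets_unit_triangle by simp
  have "(LINT p|tri_measure. f (snd p, fst p)) = (LINT p|(lborel \<Otimes>\<^sub>M lborel). g (snd p, fst p))"
    unfolding integral_tri_measure lborel_prod g_def
    by (rule Bochner_Integration.integral_cong) (auto simp: indicator_def unit_triangle_def)
  also have "\<dots> = (LINT p|(lborel \<Otimes>\<^sub>M lborel). g p)"
    using lborel_pair.integral_product_swap[OF g] by (simp only: case_prod_unfold)
  finally show ?thesis unfolding integral_tri_measure lborel_prod g_def .
qed

definition cos_wave_integral :: "int \<Rightarrow> int \<Rightarrow> real" where "cos_wave_integral k l = (LINT p|tri_measure. cos_wave k l p)"
definition sin_wave_integral :: "int \<Rightarrow> int \<Rightarrow> real" where "sin_wave_integral k l = (LINT p|tri_measure. sin_wave k l p)"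

lemma phase_swap: "phase k l (snd p, fst p) = phase l k p"
  by (simp add: phase_def algebra_simps)

lemma cos_wave_integral_swap: "cos_wave_integral k l = cos_wave_integral l k"
  using integral_tri_measure_swap[OF cos_wave_continuous(1), of l k] by (simp add: cos_wave_integral_def cos_wave_def phase_swap)

lemma integral_sin_cos_linear:
  fixes c d :: real
  assumes "d \<noteq> 0"
  shows "integral {0..1} (\<lambda>y. sin (c + d * y)) = (cos c - cos (c + d)) / d"
    and "integral {0..1} (\<lambda>y. cos (c + d * y)) = (sin (c + d) - sin c) / d"
proof -
  have "((\<lambda>y. - cos (c + d * y) / d) has_real_derivative sin (c + d * y)) (at y)" for y
    by (rule derivative_eq_intros refl | use assms in simp)+
  from FTC_real[OF zero_le_one this]
  show "integral {0..1} (\<lambda>y. sin (c + d * y)) = (cos c - cos (c + d)) / d"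
    by (simp add: diff_divide_distrib)
  have "((\<lambda>y. sin (c + d * y) / d) has_real_derivative cos (c + d * y)) (at y)" for y
    by (rule derivative_eq_intros refl | use assms in simp)+
  from FTC_real[OF zero_le_one this]
  show "integral {0..1} (\<lambda>y. cos (c + d * y)) = (sin (c + d) - sin c) / d"
    by (simp add: diff_divide_distrib)
qed

lemma wave_integral_slices:
  assumes "2 * k + l \<noteq> 0"
  defines "A \<equiv> 2 * pi / 3 * of_int (2 * k + l)" and "B \<equiv> 2 * pi / 3 * of_int (k + 2 * l)"
  shows "cos_wave_integral k l = (integral {0..1} (\<lambda>y. sin (A + (B - A) * y)) - integral {0..1} (\<lambda>y. sin (0 + B * y))) / A"
    and "sin_wave_integral k l = (integral {0..1} (\<lambda>y. cos (0 + B * y)) - integral {0..1} (\<lambda>y. cos (A + (B - A) * y))) / A"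
proof -
  have A: "A \<noteq> 0" using assms(1) by (simp add: A_def del: of_int_add of_int_mult)
  have p: "phase k l (x, y) = A * x + B * y" for x y
    by (simp add: phase_def A_def B_def field_simps)
  have phase: "phase k l (1 - y, y) = A + (B - A) * y" "phase k l (0, y) = 0 + B * y" for y
    unfolding p by (simp_all add: algebra_simps)
  have i: "(\<lambda>y. sin (c + d * y)) integrable_on {0..1}" "(\<lambda>y. cos (c + d * y)) integrable_on {0..1}" for c d :: real
    by (intro integrable_continuous_interval continuous_intros)+
  have "cos_wave_integral k l = integral {0..1} (\<lambda>y. sin_wave k l (1 - y, y) / A - sin_wave k l (0, y) / A)"
    unfolding cos_wave_integral_def
  proof (rule integral_tri_measure_dx[where H = "\<lambda>p. sin_wave k l p / A", OF cos_wave_continuous(1)])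
    show "((\<lambda>x. sin_wave k l (x, y) / A) has_real_derivative cos_wave k l (x, y)) (at x)" for x y
      using DERIV_cdivide[OF cos_wave_deriv(3)[of k l y x], of A] A by (simp add: sin_wave_dx_def A_def)
  qed
  also have "\<dots> = integral {0..1} (\<lambda>y. (sin (A + (B - A) * y) - sin (0 + B * y)) / A)"
    by (simp add: sin_wave_def phase diff_divide_distrib)
  also have "\<dots> = (integral {0..1} (\<lambda>y. sin (A + (B - A) * y) - sin (0 + B * y))) / A"
    by (rule integral_divide)
  finally show "cos_wave_integral k l = (integral {0..1} (\<lambda>y. sin (A + (B - A) * y)) - integral {0..1} (\<lambda>y. sin (0 + B * y))) / A"
    by (simp only: Henstock_Kurzweil_Integration.integral_diff[OF i(1) i(1)])
  have "sin_wave_integral k l = integral {0..1} (\<lambda>y. - cos_wave k l (1 - y, y) / A - - cos_wave k l (0, y) / A)"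
    unfolding sin_wave_integral_def
  proof (rule integral_tri_measure_dx[where H = "\<lambda>p. - cos_wave k l p / A", OF cos_wave_continuous(2)])
    show "((\<lambda>x. - cos_wave k l (x, y) / A) has_real_derivative sin_wave k l (x, y)) (at x)" for x y
      using DERIV_cdivide[OF DERIV_minus[OF cos_wave_deriv(1)[of k l y x]], of A] A by (simp add: cos_wave_dx_def A_def)
  qed
  also have "\<dots> = integral {0..1} (\<lambda>y. (cos (0 + B * y) - cos (A + (B - A) * y)) / A)"
    by (simp add: cos_wave_def phase diff_divide_distrib)
  also have "\<dots> = (integral {0..1} (\<lambda>y. cos (0 + B * y) - cos (A + (B - A) * y))) / A"
    by (rule integral_divide)
  finally show "sin_wave_integral k l = (integral {0..1} (\<lambda>y. cos (0 + B * y)) - integral {0..1} (\<lambda>y. cos (A + (B - A) * y))) / A"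
    by (simp only: Henstock_Kurzweil_Integration.integral_diff[OF i(2) i(2)])
qed

lemma sin_cos_thirds:
  "cos (2 * pi / 3 * of_int (3 * m + 1)) = - 1 / 2" "sin (2 * pi / 3 * of_int (3 * m + 1)) = sqrt 3 / 2"
  "cos (2 * pi / 3 * of_int (3 * m + 2)) = - 1 / 2" "sin (2 * pi / 3 * of_int (3 * m + 2)) = - sqrt 3 / 2"
proof -
  have per: "cos (x + 2 * pi * of_int n) = cos x" "sin (x + 2 * pi * of_int n) = sin x" for x n
    using sin_cos_eq_iff[of "x + 2 * pi * of_int n" x] by auto
  have e: "2 * pi / 3 * of_int (3 * m + 1) = 2 * pi / 3 + 2 * pi * of_int m"
    "2 * pi / 3 * of_int (3 * m + 2) = - (2 * pi / 3) + 2 * pi * of_int (m + 1)"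
    by (simp_all add: algebra_simps)
  show "cos (2 * pi / 3 * of_int (3 * m + 1)) = - 1 / 2" "sin (2 * pi / 3 * of_int (3 * m + 1)) = sqrt 3 / 2"
    "cos (2 * pi / 3 * of_int (3 * m + 2)) = - 1 / 2" "sin (2 * pi / 3 * of_int (3 * m + 2)) = - sqrt 3 / 2"
    unfolding e per cos_minus sin_minus cos_120 sin_120 by simp_all
qed

text \<open>Both the integral of a cosine and that of a sine over the triangle are elementary; the values at the corners
  enter only through thirds of the period.\<close>

lemma wave_integral_generic:
  fixes cA cB sA sB :: real
  assumes k: "2 * k + l \<noteq> 0" "k + 2 * l \<noteq> 0" "k \<noteq> l"
    and c: "cos (2 * pi / 3 * of_int (2 * k + l)) = - 1 / 2" "cos (2 * pi / 3 * of_int (k + 2 * l)) = - 1 / 2"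
    and s: "sin (2 * pi / 3 * of_int (2 * k + l)) = - sq" "sin (2 * pi / 3 * of_int (k + 2 * l)) = sq"
  shows "cos_wave_integral k l = - 27 / (8 * pi\<^sup>2) / (of_int (2 * k + l) * of_int (k + 2 * l))"
    and "sin_wave_integral k l = 9 * sq / (4 * pi\<^sup>2) * (of_int (3 * (k + l)) / (of_int (2 * k + l) * of_int (k + 2 * l) * of_int (k - l)))"
proof -
  define P Q where "P = real_of_int (2 * k + l)" "Q = real_of_int (k + 2 * l)"
  have nz: "P \<noteq> 0" "Q \<noteq> 0" "Q - P \<noteq> 0" using k by (simp_all add: P_Q_def del: of_int_add of_int_mult)
  define A B where "A = 2 * pi / 3 * P" "B = 2 * pi / 3 * Q"
  have BA: "B - A = 2 * pi / 3 * (Q - P)" by (simp add: A_B_def algebra_simps)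
  have nz': "A \<noteq> 0" "B \<noteq> 0" "B - A \<noteq> 0" using nz unfolding BA unfolding A_B_def by simp_all
  have A: "cos A = - 1 / 2" "sin A = - sq" "cos B = - 1 / 2" "sin B = sq"
    using c s by (simp_all only: A_B_def P_Q_def)
  note S = wave_integral_slices[OF k(1), folded P_Q_def, folded A_B_def]
  have "cos_wave_integral k l = ((cos A - cos B) / (B - A) - (1 - cos B) / B) / A"
    unfolding S(1) integral_sin_cos_linear(1)[OF nz'(3)] integral_sin_cos_linear(1)[OF nz'(2)] by simp
  also have "\<dots> = - (3 / 2) / (A * B)" unfolding A using nz' by (simp add: field_simps)
  also have "\<dots> = - 27 / (8 * pi\<^sup>2) / (P * Q)" unfolding A_B_def using nz by (simp add: field_simps power2_eq_square)
  finally show "cos_wave_integral k l = - 27 / (8 * pi\<^sup>2) / (of_int (2 * k + l) * of_int (k + 2 * l))" unfolding P_Q_def .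
  have "sin_wave_integral k l = (sin B / B - (sin B - sin A) / (B - A)) / A"
    unfolding S(2) integral_sin_cos_linear(2)[OF nz'(3)] integral_sin_cos_linear(2)[OF nz'(2)] by simp
  also have "\<dots> = sq * ((1 / B - 2 / (B - A)) / A)" unfolding A using nz' by (simp add: field_simps)
  also have "(1 / B - 2 / (B - A)) / A = (- A - B) / (A * B * (B - A))" using nz' by (simp add: field_simps)
  also have "\<dots> = (2 * pi / 3 * (- P - Q)) / ((2 * pi / 3) * (2 * pi / 3) * (2 * pi / 3) * (P * Q * (Q - P)))"
    unfolding BA unfolding A_B_def by (rule arg_cong2[where f = divide]) (simp_all add: algebra_simps)
  also have "\<dots> = 9 / (4 * pi\<^sup>2) * ((- P - Q) / (P * Q * (Q - P)))"
  proof -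
    have gen: "c * n / (c * c * c * d) = 1 / (c * c) * (n / d)" if "c \<noteq> 0" for c n d :: real using that by simp
    have "2 * pi / 3 \<noteq> 0" by simp
    moreover have "1 / (2 * pi / 3 * (2 * pi / 3)) = 9 / (4 * pi\<^sup>2)" by (simp add: power2_eq_square)
    ultimately show ?thesis using gen by metis
  qed
  also have "(- P - Q) / (P * Q * (Q - P)) = (P + Q) / (P * Q * (P - Q))"
  proof -
    have "- P - Q = - (P + Q)" "P * Q * (Q - P) = - (P * Q * (P - Q))" by (simp_all add: algebra_simps)
    then show ?thesis by (simp only: minus_divide_divide)
  qed
  also have "P + Q = of_int (3 * (k + l))" by (simp add: P_Q_def)
  also have "P - Q = of_int (k - l)" by (simp add: P_Q_def)
  finally show "sin_wave_integral k l = 9 * sq / (4 * pi\<^sup>2) * (of_int (3 * (k + l)) / (of_int (2 * k + l) * of_int (k + 2 * l) * of_int (k - l)))"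
    unfolding P_Q_def by simp
qed

lemma wave_integral_one:
  assumes "(k - l) mod 3 = 1"
  shows "cos_wave_integral k l = - 27 / (8 * pi\<^sup>2) / (of_int (2 * k + l) * of_int (k + 2 * l))"
    and "sin_wave_integral k l = 9 * sqrt 3 / (8 * pi\<^sup>2) * (of_int (3 * (k + l)) / (of_int (2 * k + l) * of_int (k + 2 * l) * of_int (k - l)))"
proof -
  define m where "m = (k - l) div 3"
  have k: "k = l + 3 * m + 1" using assms mult_div_mod_eq[of 3 "k - l"] by (simp add: m_def)
  have e: "2 * k + l = 3 * (l + 2 * m) + 2" "k + 2 * l = 3 * (l + m) + 1" by (simp_all add: k)
  have "2 * k + l \<noteq> 0" using e(1) by presburger
  moreover have "k + 2 * l \<noteq> 0" using e(2) by presburger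
  moreover have "k \<noteq> l" using k by presburger
  moreover have "cos (2 * pi / 3 * of_int (2 * k + l)) = - 1 / 2" unfolding e by (rule sin_cos_thirds)
  moreover have "cos (2 * pi / 3 * of_int (k + 2 * l)) = - 1 / 2" unfolding e by (rule sin_cos_thirds)
  moreover have "sin (2 * pi / 3 * of_int (2 * k + l)) = - (sqrt 3 / 2)" unfolding e sin_cos_thirds by simp
  moreover have "sin (2 * pi / 3 * of_int (k + 2 * l)) = sqrt 3 / 2" unfolding e by (rule sin_cos_thirds)
  ultimately have G: "cos_wave_integral k l = - 27 / (8 * pi\<^sup>2) / (of_int (2 * k + l) * of_int (k + 2 * l))"
    "sin_wave_integral k l = 9 * (sqrt 3 / 2) / (4 * pi\<^sup>2) * (of_int (3 * (k + l)) / (of_int (2 * k + l) * of_int (k + 2 * l) * of_int (k - l)))"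
    by (rule wave_integral_generic)+
  show "cos_wave_integral k l = - 27 / (8 * pi\<^sup>2) / (of_int (2 * k + l) * of_int (k + 2 * l))" by (rule G(1))
  have "9 * (sqrt 3 / 2) / (4 * pi\<^sup>2) = 9 * sqrt 3 / (8 * pi\<^sup>2)" by simp
  then show "sin_wave_integral k l = 9 * sqrt 3 / (8 * pi\<^sup>2) * (of_int (3 * (k + l)) / (of_int (2 * k + l) * of_int (k + 2 * l) * of_int (k - l)))"
    using G(2) by (simp only:)
qed

lemma wave_integral_two:
  assumes "(k - l) mod 3 = 2"
  shows "cos_wave_integral k l = - 27 / (8 * pi\<^sup>2) / (of_int (2 * k + l) * of_int (k + 2 * l))"
    and "sin_wave_integral k l = - 9 * sqrt 3 / (8 * pi\<^sup>2) * (of_int (3 * (k + l)) / (of_int (2 * k + l) * of_int (k + 2 * l) * of_int (k - l)))"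
proof -
  have "((- k) - (- l)) mod 3 = 1" using assms by presburger
  note G = wave_integral_one[OF this]
  have "phase (- k) (- l) p = - phase k l p" for p by (simp add: phase_def algebra_simps)
  then have m: "cos_wave_integral (- k) (- l) = cos_wave_integral k l" "sin_wave_integral (- k) (- l) = - sin_wave_integral k l"
    by (simp_all add: cos_wave_integral_def sin_wave_integral_def cos_wave_def sin_wave_def)
  have e: "2 * - k + - l = - (2 * k + l)" "- k + 2 * - l = - (k + 2 * l)" "3 * (- k + - l) = - (3 * (k + l))" "- k - - l = - (k - l)"
    by simp_all
  show "cos_wave_integral k l = - 27 / (8 * pi\<^sup>2) / (of_int (2 * k + l) * of_int (k + 2 * l))"
    using G(1) unfolding m e of_int_minus by (simp del: of_int_add of_int_mult of_int_diff)
  show "sin_wave_integral k l = - 9 * sqrt 3 / (8 * pi\<^sup>2) * (of_int (3 * (k + l)) / (of_int (2 * k + l) * of_int (k + 2 * l) * of_int (k - l)))"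
    using G(2) unfolding m e of_int_minus by (simp del: of_int_add of_int_mult of_int_diff)
qed

lemma cos_wave_integral_zero_zero: "cos_wave_integral 0 0 = 1 / 2"
proof -
  have "cos_wave_integral 0 0 = (LINT p|tri_measure. 1)" by (simp add: cos_wave_integral_def cos_wave_def phase_def)
  also have "\<dots> = integral {0..1} (\<lambda>y. (1 - y) - 0)"
    by (rule integral_tri_measure_dx[where H = fst, simplified fst_conv]) (auto intro!: derivative_eq_intros)
  also have "\<dots> = (1 - 1\<^sup>2 / 2) - (0 - 0\<^sup>2 / 2)"
    by (rule FTC_real) (auto intro!: derivative_eq_intros)
  finally show ?thesis by simp
qed

text \<open>If \<open>k\<close> and \<open>l\<close> agree modulo \<open>3\<close>, then the wave has integer frequencies in both coordinates. After the integration
  along the slices only sines of integer frequency remain, and these integrate to \<open>0\<close> over a period.\<close>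

lemma cos_wave_integral_zero:
  assumes "(k - l) mod 3 = 0" "k \<noteq> 0 \<or> l \<noteq> 0"
  shows "cos_wave_integral k l = 0"
proof -
  have per: "integral {0..1} (\<lambda>y. sin (2 * pi * of_int m + 2 * pi * of_int n * y)) = 0" for m n :: int
  proof (cases "n = 0")
    case True
    then show ?thesis using sin_int_2pin[of m] by simp
  next
    case False
    then have "2 * pi * of_int n \<noteq> 0" by simp
    from integral_sin_cos_linear(1)[OF this, of "2 * pi * of_int m"]
    have "integral {0..1} (\<lambda>y. sin (2 * pi * of_int m + 2 * pi * of_int n * y)) = (cos (2 * pi * of_int m) - cos (2 * pi * of_int m + 2 * pi * of_int n)) / (2 * pi * of_int n)" .
    also have "2 * pi * of_int m + 2 * pi * of_int n = 2 * pi * real_of_int (m + n)" by (simp add: algebra_simps)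
    finally show ?thesis unfolding cos_int_2pin by simp
  qed
  have main: "cos_wave_integral k l = 0" if d: "(k - l) mod 3 = 0" and nz: "2 * k + l \<noteq> 0" for k l
  proof -
    obtain q where "k - l = 3 * q" using d by (meson dvdE mod_0_imp_dvd)
    then have k: "k = l + 3 * q" by simp
    define m n where "m = l + 2 * q" "n = l + q"
    have e: "2 * k + l = 3 * m" "k + 2 * l = 3 * n" by (simp_all add: k m_n_def)
    have A: "2 * pi / 3 * of_int (2 * k + l) = 2 * pi * of_int m" "2 * pi / 3 * of_int (k + 2 * l) = 2 * pi * of_int n"
      unfolding e by simp_all
    have BA: "2 * pi * of_int n - 2 * pi * of_int m = 2 * pi * of_int (n - m)" by (simp add: algebra_simps)
    show ?thesis
      unfolding wave_integral_slices(1)[OF nz] A BA per using per[of 0 n] by simp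
  qed
  show ?thesis
  proof (cases "2 * k + l = 0")
    case True
    then have "2 * l + k \<noteq> 0" using assms(2) by linarith
    moreover have "(l - k) mod 3 = 0" using assms(1) by presburger
    ultimately show ?thesis using main cos_wave_integral_swap by metis
  next
    case False
    then show ?thesis by (rule main[OF assms(1)])
  qed
qed

lemma l2_inner_waves:
  "l2_inner (sin_wave i j) (sin_wave k l) = (cos_wave_integral (i - k) (j - l) - cos_wave_integral (i + k) (j + l)) / 2"
  "l2_inner (cos_wave i j) (cos_wave k l) = (cos_wave_integral (i - k) (j - l) + cos_wave_integral (i + k) (j + l)) / 2"
  "l2_inner (sin_wave i j) (cos_wave k l) = (sin_wave_integral (i + k) (j + l) + sin_wave_integral (i - k) (j - l)) / 2"
  unfolding l2_inner_def sin_wave_sin_wave cos_wave_cos_wave sin_wave_cos_wave cos_wave_integral_def sin_wave_integral_def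
  by (simp_all add: integrable_tri_measure cos_wave_continuous)

lemma l2_inner_add_right: "continuous_on UNIV f \<Longrightarrow> continuous_on UNIV g \<Longrightarrow> continuous_on UNIV h \<Longrightarrow> l2_inner h (\<lambda>p. f p + g p) = l2_inner h f + l2_inner h g"
  and l2_inner_diff_right: "continuous_on UNIV f \<Longrightarrow> continuous_on UNIV g \<Longrightarrow> continuous_on UNIV h \<Longrightarrow> l2_inner h (\<lambda>p. f p - g p) = l2_inner h f - l2_inner h g"
  using l2_inner_add[of f g h] l2_inner_diff[of f g h] by (simp_all add: l2_inner_commute)

lemma l2_inner_mode:
  assumes h: "continuous_on UNIV h"
  shows "l2_inner h (cos_mode i j) = l2_inner h (cos_wave i j) - l2_inner h (cos_wave (- i) (i + j)) - l2_inner h (cos_wave (i + j) (- j)) + l2_inner h (cos_wave (- i - j) i) + l2_inner h (cos_wave j (- i - j)) - l2_inner h (cos_wave (- j) (- i))"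
    and "l2_inner h (sin_mode i j) = l2_inner h (sin_wave i j) - l2_inner h (sin_wave (- i) (i + j)) - l2_inner h (sin_wave (i + j) (- j)) + l2_inner h (sin_wave (- i - j) i) + l2_inner h (sin_wave j (- i - j)) - l2_inner h (sin_wave (- j) (- i))"
proof -
  have c: "continuous_on UNIV (\<lambda>p. cos_wave i j p)" "continuous_on UNIV (\<lambda>p. sin_wave i j p)" for i j by (rule cos_wave_continuous)+
  show "l2_inner h (cos_mode i j) = l2_inner h (cos_wave i j) - l2_inner h (cos_wave (- i) (i + j)) - l2_inner h (cos_wave (i + j) (- j)) + l2_inner h (cos_wave (- i - j) i) + l2_inner h (cos_wave j (- i - j)) - l2_inner h (cos_wave (- j) (- i))"
    unfolding cos_mode_def[abs_def] by (simp add: l2_inner_add_right l2_inner_diff_right h c continuous_on_add continuous_on_diff)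
  show "l2_inner h (sin_mode i j) = l2_inner h (sin_wave i j) - l2_inner h (sin_wave (- i) (i + j)) - l2_inner h (sin_wave (i + j) (- j)) + l2_inner h (sin_wave (- i - j) i) + l2_inner h (sin_wave j (- i - j)) - l2_inner h (sin_wave (- j) (- i))"
    unfolding sin_mode_def[abs_def] by (simp add: l2_inner_add_right l2_inner_diff_right h c continuous_on_add continuous_on_diff)
qed

text \<open>The integral of \<open>- sin (2 \<pi> x)\<close> against \<open>u3\<close>; all integrals of the three summands of \<open>u1\<close> against \<open>u2\<close> and \<open>u3\<close> are
  simple multiples of it.\<close>

definition overlap :: real where "overlap = 6561 / (3584 * pi\<^sup>2)"

lemma l2_inner_waves_u2:
  "l2_inner (sin_wave 2 (- 1)) u2 = sqrt 3 * overlap" "l2_inner (sin_wave (- 1) 2) u2 = - (sqrt 3 * overlap)" "l2_inner (sin_wave 1 1) u2 = 0"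
  unfolding u2_def l2_inner_mode(1)[OF cos_wave_continuous(2)] l2_inner_waves overlap_def
  by (simp_all add: wave_integral_one wave_integral_two add_divide_distrib[symmetric] diff_divide_distrib[symmetric])

lemma l2_inner_waves_u3:
  "l2_inner (sin_wave 2 (- 1)) u3 = - overlap" "l2_inner (sin_wave (- 1) 2) u3 = - overlap" "l2_inner (sin_wave 1 1) u3 = - 2 * overlap"
  unfolding u3_def l2_inner_mode(2)[OF cos_wave_continuous(2)] l2_inner_waves overlap_def
  by (simp_all add: wave_integral_one wave_integral_two)

lemma l2_inner_waves_waves:
  "l2_inner (sin_wave 2 (- 1)) (sin_wave 2 (- 1)) = 1 / 4" "l2_inner (sin_wave (- 1) 2) (sin_wave (- 1) 2) = 1 / 4" "l2_inner (sin_wave 1 1) (sin_wave 1 1) = 1 / 4"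
  "l2_inner (sin_wave 2 (- 1)) (sin_wave (- 1) 2) = 0" "l2_inner (sin_wave 2 (- 1)) (sin_wave 1 1) = 0" "l2_inner (sin_wave (- 1) 2) (sin_wave 1 1) = 0"
  by (simp_all add: l2_inner_waves cos_wave_integral_zero cos_wave_integral_zero_zero)

lemma l2_inner_mode_left:
  assumes h: "continuous_on UNIV h"
  shows "l2_inner (cos_mode i j) h = l2_inner (cos_wave i j) h - l2_inner (cos_wave (- i) (i + j)) h - l2_inner (cos_wave (i + j) (- j)) h + l2_inner (cos_wave (- i - j) i) h + l2_inner (cos_wave j (- i - j)) h - l2_inner (cos_wave (- j) (- i)) h"
    and "l2_inner (sin_mode i j) h = l2_inner (sin_wave i j) h - l2_inner (sin_wave (- i) (i + j)) h - l2_inner (sin_wave (i + j) (- j)) h + l2_inner (sin_wave (- i - j) i) h + l2_inner (sin_wave j (- i - j)) h - l2_inner (sin_wave (- j) (- i)) h"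
  using l2_inner_mode[OF h] by (simp_all add: l2_inner_commute)

lemma l2_inner_u2_u2: "l2_inner u2 u2 = 3 / 2"
  unfolding u2_def l2_inner_mode_left(1)[OF mode_continuous(1)] l2_inner_mode(1)[OF cos_wave_continuous(1)] l2_inner_waves
  by (simp add: wave_integral_one wave_integral_two cos_wave_integral_zero cos_wave_integral_zero_zero add_divide_distrib diff_divide_distrib)

lemma l2_inner_u3_u3: "l2_inner u3 u3 = 3 / 2"
  unfolding u3_def l2_inner_mode_left(2)[OF mode_continuous(2)] l2_inner_mode(2)[OF cos_wave_continuous(2)] l2_inner_waves
  by (simp add: wave_integral_one wave_integral_two cos_wave_integral_zero cos_wave_integral_zero_zero add_divide_distrib diff_divide_distrib)

text \<open>The reflection that interchanges the coordinates maps \<open>u2\<close> to \<open>- u2\<close> and fixes \<open>u3\<close>.\<close>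

lemma l2_inner_u2_u3: "l2_inner u2 u3 = 0"
proof -
  have m: "phase (- k) (- l) p = - phase k l p" for k l p by (simp add: phase_def algebra_simps)
  have "cos_wave k l (snd p, fst p) = cos_wave (- l) (- k) p" "sin_wave k l (snd p, fst p) = - sin_wave (- l) (- k) p" for k l p
    by (simp_all add: cos_wave_def sin_wave_def phase_swap m)
  then have "u2 (snd p, fst p) = - u2 p" "u3 (snd p, fst p) = u3 p" for p
    by (simp_all add: u2_def u3_def cos_mode_def sin_mode_def)
  then have "- l2_inner u2 u3 = l2_inner u2 u3"
    using integral_tri_measure_swap[of "\<lambda>p. u2 p * u3 p"] unfolding l2_inner_def u2_def[symmetric] u3_def[symmetric]
    by (simp add: u2_def u3_def mode_continuous continuous_on_mult)
  then show ?thesis by simp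
qed

text \<open>A lower bound for \<open>\<pi>\<close> from \<open>sin (\<pi>/6) = 1/2\<close> and the Taylor polynomial of degree \<open>4\<close>. The constant is
  just large enough for the estimate of the overlap.\<close>

lemma pi_lower: "pi \<ge> 31226 / 10000"
proof (rule ccontr)
  assume "\<not> pi \<ge> 31226 / 10000"
  then have p: "pi < 31226 / 10000" by simp
  define x where "x = pi / 6"
  define y :: real where "y = 15613 / 30000"
  have x: "0 \<le> x" "x < y" "y \<le> pi / 2" using p pi_ge_two by (simp_all add: x_def y_def)
  have "1 / 2 = sin x" using sin_30 by (simp add: x_def)
  also have "\<dots> < sin y" by (rule sin_monotone_2pi) (use x in auto)
  also have "\<dots> \<le> y - y^3 / 6 + y^5 / 120"
  proof -
    have "{..<5} = {0, 1, 2, 3, 4 :: nat}" by auto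
    then have s: "(\<Sum>m<5. sin_coeff m * y ^ m) = y - y^3 / 6"
      by (simp add: sin_coeff_def fact_numeral)
    have y: "0 \<le> y" by (simp add: y_def)
    have "sin y - (y - y^3 / 6) \<le> inverse (fact 5) * \<bar>y\<bar> ^ 5"
      using Maclaurin_sin_bound[of y 5] unfolding s by linarith
    also have "\<dots> = y^5 / 120" using y by (simp add: fact_numeral)
    finally show ?thesis by simp
  qed
  also have "\<dots> < 1 / 2" by (simp add: y_def power_divide)
  finally have "1 / 2 < (1 / 2 :: real)" .
  then show False by (rule less_irrefl[THEN notE])
qed

lemma overlap_bound: "24 * overlap\<^sup>2 \<le> 846 / 1000"
proof -
  have "(31226 / 10000)\<^sup>2 \<le> pi\<^sup>2" by (rule power_mono[OF pi_lower]) simp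
  then have p: "97505 / 10000 \<le> pi\<^sup>2" by (simp add: power2_eq_square)
  then have "overlap \<le> 6561 / (3584 * (97505 / 10000))" unfolding overlap_def
    by (intro divide_left_mono) auto
  moreover have "0 \<le> overlap" by (simp add: overlap_def)
  ultimately have "overlap\<^sup>2 \<le> (6561 / (3584 * (97505 / 10000)))\<^sup>2" by (intro power_mono)
  also have "\<dots> \<le> 846 / 24000" by (simp add: power2_eq_square)
  finally show ?thesis by simp
qed

section \<open>Energies near the isotropic case\<close>

definition u1x :: "real \<times> real \<Rightarrow> real" where "u1x p = 2 * pi * (cos_wave 2 (- 1) p - cos_wave 1 1 p)"
definition u1y :: "real \<times> real \<Rightarrow> real" where "u1y p = 2 * pi * (cos_wave (- 1) 2 p - cos_wave 1 1 p)"

lemma u1_waves: "u1 p = sin_wave 2 (- 1) p + sin_wave (- 1) 2 p - sin_wave 1 1 p"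
proof -
  have "phase 2 (- 1) p = 2 * pi * fst p" "phase (- 1) 2 p = 2 * pi * snd p" "phase 1 1 p = 2 * pi * (fst p + snd p)"
    by (simp_all add: phase_def algebra_simps)
  then show ?thesis by (simp add: u1_def sin_wave_def)
qed

lemma u1_eigen: "eigen (8 * pi\<^sup>2) u1 u1x u1y"
proof -
  have n: "wave_norm 2 (- 1) = 3" "wave_norm (- 1) 2 = 3" "wave_norm 1 1 = 3" by (simp_all add: wave_norm_def)
  have ux: "u1x p = sin_wave_dx 2 (- 1) p + sin_wave_dx (- 1) 2 p - sin_wave_dx 1 1 p" "u1y p = sin_wave_dy 2 (- 1) p + sin_wave_dy (- 1) 2 p - sin_wave_dy 1 1 p" for p
    by (simp_all add: u1x_def u1y_def sin_wave_dx_def sin_wave_dy_def algebra_simps)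
  have "Helmholtz (8 * pi\<^sup>2 / 3 * of_int 3) u1 u1x u1y"
    unfolding u1_waves[abs_def] ux[abs_def] by (intro Helmholtz_add_scaled cos_wave_Helmholtz n)
  moreover have "C1_zero u1 u1x u1y"
    unfolding C1_zero_def
  proof (intro conjI allI)
    show "((\<lambda>x. u1 (x, y)) has_real_derivative u1x (x, y)) (at x)" for x y
      unfolding u1_waves ux by (intro DERIV_add DERIV_diff cos_wave_deriv)
    show "((\<lambda>y. u1 (x, y)) has_real_derivative u1y (x, y)) (at y)" for x y
      unfolding u1_waves ux by (intro DERIV_add DERIV_diff cos_wave_deriv)
    show "continuous_on UNIV u1" by (rule u1_continuous)
    show "continuous_on UNIV u1x" "continuous_on UNIV u1y"
      unfolding u1x_def u1y_def by (intro continuous_intros cos_wave_continuous)+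
    show "u1 (0, t) = 0" "u1 (t, 0) = 0" "u1 (1 - t, t) = 0" for t
      unfolding u1_mode by (simp_all add: mode_boundary)
  qed
  ultimately show ?thesis by (simp add: eigen_def)
qed

lemma u2_eigen: "eigen (7 / 3 * (8 * pi\<^sup>2)) u2 (cos_mode_dx 2 1) (cos_mode_dy 2 1)"
  and u3_eigen: "eigen (7 / 3 * (8 * pi\<^sup>2)) u3 (sin_mode_dx 2 1) (sin_mode_dy 2 1)"
proof -
  have e: "8 * pi\<^sup>2 / 3 * of_int (wave_norm 2 1) = 7 / 3 * (8 * pi\<^sup>2)" by (simp add: wave_norm_def)
  show "eigen (7 / 3 * (8 * pi\<^sup>2)) u2 (cos_mode_dx 2 1) (cos_mode_dy 2 1)"
    using mode_eigen_basic(1)[of 2 1] unfolding e u2_def by simp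
  show "eigen (7 / 3 * (8 * pi\<^sup>2)) u3 (sin_mode_dx 2 1) (sin_mode_dy 2 1)"
    using mode_eigen_basic(2)[of 2 1] unfolding e u3_def by simp
qed

lemma test_C1_zero:
  assumes t: "test_function open_unit_triangle \<phi> \<phi>'"
  shows "C1_zero \<phi> (\<lambda>p. fst (\<phi>' p)) (\<lambda>p. snd (\<phi>' p))"
proof -
  obtain K where K: "K \<subseteq> open_unit_triangle" "\<And>x. x \<notin> K \<Longrightarrow> \<phi> x = 0"
    using test_function_support_ex[OF t] by meson
  have "\<phi> p = 0" if "p \<notin> open_unit_triangle" for p using K that by blast
  then show ?thesis
    unfolding C1_zero_def
    by (intro conjI allI test_partial[OF t] test_function_continuous[OF t] continuous_intros)
      (auto simp: open_unit_triangle_def)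
qed

text \<open>The bilinear form that belongs to \<open>t1 X + t2 Y + t3 Z\<close>; below the weights have sum \<open>0\<close> and describe the deviation from
  the equilateral triangle.\<close>

definition weighted_energy :: "real \<Rightarrow> real \<Rightarrow> real \<Rightarrow> (real \<times> real \<Rightarrow> real) \<Rightarrow> (real \<times> real \<Rightarrow> real) \<Rightarrow> (real \<times> real \<Rightarrow> real) \<Rightarrow> (real \<times> real \<Rightarrow> real) \<Rightarrow> real" where
  "weighted_energy t1 t2 t3 ux uy vx vy = (LINT p|tri_measure. t1 * (ux p * vx p) + t2 * (uy p * vy p) + t3 * ((ux p - uy p) * (vx p - vy p)))"

lemma iso_energy_weighted_energy: "iso_energy ux uy vx vy = weighted_energy 1 1 1 ux uy vx vy"
  unfolding iso_energy_def weighted_energy_def by (rule Bochner_Integration.integral_cong) (simp_all add: algebra_simps)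

lemma weighted_energy_split:
  assumes c: "continuous_on UNIV ux" "continuous_on UNIV uy" "continuous_on UNIV wx" "continuous_on UNIV wy"
    and v: "\<And>p. vx p = k * ux p + wx p" "\<And>p. vy p = k * uy p + wy p"
  shows "weighted_energy t1 t2 t3 vx vy vx vy = k\<^sup>2 * weighted_energy t1 t2 t3 ux uy ux uy + 2 * k * weighted_energy t1 t2 t3 wx wy ux uy + weighted_energy t1 t2 t3 wx wy wx wy"
proof -
  define a1 a2 a3 where "a1 p = t1 * (ux p * ux p) + t2 * (uy p * uy p) + t3 * ((ux p - uy p) * (ux p - uy p))"
    "a2 p = t1 * (wx p * ux p) + t2 * (wy p * uy p) + t3 * ((wx p - wy p) * (ux p - uy p))"
    "a3 p = t1 * (wx p * wx p) + t2 * (wy p * wy p) + t3 * ((wx p - wy p) * (wx p - wy p))" for p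
  have i: "integrable tri_measure a1" "integrable tri_measure a2" "integrable tri_measure a3"
    unfolding a1_a2_a3_def by (intro integrable_tri_measure continuous_intros c)+
  have "t1 * (vx p * vx p) + t2 * (vy p * vy p) + t3 * ((vx p - vy p) * (vx p - vy p)) = k\<^sup>2 * a1 p + 2 * k * a2 p + a3 p" for p
    unfolding v a1_a2_a3_def by (simp add: power2_eq_square algebra_simps)
  then have "weighted_energy t1 t2 t3 vx vy vx vy = (LINT p|tri_measure. k\<^sup>2 * a1 p + 2 * k * a2 p + a3 p)"
    unfolding weighted_energy_def by (simp only:)
  also have "\<dots> = k\<^sup>2 * (LINT p|tri_measure. a1 p) + 2 * k * (LINT p|tri_measure. a2 p) + (LINT p|tri_measure. a3 p)" using i by simp
  finally show ?thesis unfolding weighted_energy_def a1_a2_a3_def .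
qed

text \<open>The perturbed operator, without its isotropic part, applied to \<open>u1\<close> and divided by \<open>4\<pi>\<^sup>2\<close>, up to sign.\<close>

definition tilt :: "real \<Rightarrow> real \<Rightarrow> real \<Rightarrow> real \<times> real \<Rightarrow> real" where
  "tilt t1 t2 t3 p = t2 * sin_wave 2 (- 1) p + t1 * sin_wave (- 1) 2 p - t3 * sin_wave 1 1 p"

lemma tilt_continuous: "continuous_on A (tilt t1 t2 t3)"
  unfolding tilt_def by (intro continuous_intros cos_wave_continuous)

text \<open>Integration by parts moves all derivatives to \<open>u1\<close>.\<close>

lemma weighted_energy_u1:
  assumes u: "C1_zero u ux uy" and t: "t1 + t2 + t3 = 0"
  shows "weighted_energy t1 t2 t3 ux uy u1x u1y = - (4 * pi\<^sup>2) * l2_inner u (tilt t1 t2 t3)"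
proof -
  have d: "((\<lambda>x. u1x (x, y)) has_real_derivative - (4 * pi\<^sup>2) * (sin_wave 2 (- 1) (x, y) - sin_wave 1 1 (x, y))) (at x)"
    "((\<lambda>y. u1x (x, y)) has_real_derivative 4 * pi\<^sup>2 * sin_wave 1 1 (x, y)) (at y)"
    "((\<lambda>x. u1y (x, y)) has_real_derivative 4 * pi\<^sup>2 * sin_wave 1 1 (x, y)) (at x)"
    "((\<lambda>y. u1y (x, y)) has_real_derivative - (4 * pi\<^sup>2) * (sin_wave (- 1) 2 (x, y) - sin_wave 1 1 (x, y))) (at y)" for x y
    unfolding u1x_def u1y_def
    by (rule DERIV_cong[OF DERIV_cmult[OF DERIV_diff[OF cos_wave_deriv(1) cos_wave_deriv(1)]]] DERIV_cong[OF DERIV_cmult[OF DERIV_diff[OF cos_wave_deriv(2) cos_wave_deriv(2)]]],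
        simp add: cos_wave_dx_def cos_wave_dy_def power2_eq_square algebra_simps)+
  define F where "F p = - t2 * u1x p + - t3 * u1y p" for p
  define G where "G p = - t1 * u1y p + - t3 * u1x p" for p
  define Fx where "Fx p = - t2 * (- (4 * pi\<^sup>2) * (sin_wave 2 (- 1) p - sin_wave 1 1 p)) + - t3 * (4 * pi\<^sup>2 * sin_wave 1 1 p)" for p
  define Gy where "Gy p = - t1 * (- (4 * pi\<^sup>2) * (sin_wave (- 1) 2 p - sin_wave 1 1 p)) + - t3 * (4 * pi\<^sup>2 * sin_wave 1 1 p)" for p
  have t3: "t3 = - t1 - t2" using t by linarith
  have "t1 * (ux p * u1x p) + t2 * (uy p * u1y p) + t3 * ((ux p - uy p) * (u1x p - u1y p)) = ux p * F p + uy p * G p" for p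
    unfolding F_def G_def t3 by (simp add: algebra_simps)
  then have "weighted_energy t1 t2 t3 ux uy u1x u1y = (LINT p|tri_measure. ux p * F p + uy p * G p)" unfolding weighted_energy_def by (simp only:)
  also have "\<dots> = - (LINT p|tri_measure. u p * (Fx p + Gy p))"
  proof (rule integration_by_parts[OF u])
    show "continuous_on UNIV F" "continuous_on UNIV G"
      unfolding F_def G_def u1x_def u1y_def by (intro continuous_intros cos_wave_continuous)+
    show "continuous_on UNIV Fx" "continuous_on UNIV Gy"
      unfolding Fx_def Gy_def by (intro continuous_intros cos_wave_continuous)+
    show "((\<lambda>x. F (x, y)) has_real_derivative Fx (x, y)) (at x)" for x y
      unfolding F_def Fx_def by (intro DERIV_add DERIV_cmult d)
    show "((\<lambda>y. G (x, y)) has_real_derivative Gy (x, y)) (at y)" for x y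
      unfolding G_def Gy_def by (intro DERIV_add DERIV_cmult d)
  qed
  also have "Fx p + Gy p = 4 * pi\<^sup>2 * tilt t1 t2 t3 p" for p
    unfolding Fx_def Gy_def tilt_def t3 by (simp add: algebra_simps)
  then have "(LINT p|tri_measure. u p * (Fx p + Gy p)) = (LINT p|tri_measure. 4 * pi\<^sup>2 * (u p * tilt t1 t2 t3 p))"
    by (simp only: mult.left_commute)
  finally show ?thesis by (simp add: l2_inner_def)
qed

lemma binary_form_nonneg:
  fixes a b c p q :: real
  assumes "a \<ge> 0" "b \<ge> 0" "c\<^sup>2 \<le> a * b"
  shows "a * p\<^sup>2 - 2 * c * (p * q) + b * q\<^sup>2 \<ge> 0"
proof (cases "a = 0")
  case True
  then have "c = 0" using assms(3) by simp
  then show ?thesis using assms True by simp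
next
  case False
  have "a * (a * p\<^sup>2 - 2 * c * (p * q) + b * q\<^sup>2) = (a * p - c * q)\<^sup>2 + (a * b - c\<^sup>2) * q\<^sup>2"
    by (simp add: power2_eq_square algebra_simps)
  also have "\<dots> \<ge> 0" using assms(3) by simp
  finally show ?thesis using False assms(1) by (simp add: zero_le_mult_iff)
qed

text \<open>For weights of sum \<open>0\<close> the form \<open>t1 p\<^sup>2 + t2 q\<^sup>2 + t3 (p - q)\<^sup>2\<close> has, with respect to \<open>p\<^sup>2 + q\<^sup>2 + (p - q)\<^sup>2\<close>, the
  eigenvalues \<open>\<plusminus> r\<close> with \<open>6 r\<^sup>2 = t1\<^sup>2 + t2\<^sup>2 + t3\<^sup>2\<close>.\<close>

lemma weighted_energy_lower:
  assumes c: "continuous_on UNIV ux" "continuous_on UNIV uy"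
    and t: "t1 + t2 + t3 = 0" "t1\<^sup>2 + t2\<^sup>2 + t3\<^sup>2 = 6 * r\<^sup>2" and r: "r \<ge> 0"
  shows "- r * iso_energy ux uy ux uy \<le> weighted_energy t1 t2 t3 ux uy ux uy"
proof -
  have t3: "t3 = - t1 - t2" using t by linarith
  have s: "t1\<^sup>2 + t1 * t2 + t2\<^sup>2 = 3 * r\<^sup>2" using t(2) unfolding t3 by (simp add: power2_eq_square algebra_simps)
  have b: "2 * r - t1 \<ge> 0 \<and> 2 * r - t2 \<ge> 0"
  proof -
    have "4 * (3 * r\<^sup>2) = (t1 + 2 * t2)\<^sup>2 + 3 * t1\<^sup>2" "4 * (3 * r\<^sup>2) = (2 * t1 + t2)\<^sup>2 + 3 * t2\<^sup>2"
      unfolding s[symmetric] by (simp_all add: power2_eq_square algebra_simps)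
    moreover have "(t1 + 2 * t2)\<^sup>2 \<ge> 0" "(2 * t1 + t2)\<^sup>2 \<ge> 0" by simp_all
    ultimately have "t1\<^sup>2 \<le> 4 * r\<^sup>2 \<and> t2\<^sup>2 \<le> 4 * r\<^sup>2" by linarith
    then have "t1\<^sup>2 \<le> (2 * r)\<^sup>2" "t2\<^sup>2 \<le> (2 * r)\<^sup>2" unfolding power_mult_distrib by simp_all
    then have "t1 \<le> 2 * r" "t2 \<le> 2 * r" using r by (auto intro: power2_le_imp_le)
    then show ?thesis by simp
  qed
  have pt: "0 \<le> t1 * (p * p) + t2 * (q * q) + t3 * ((p - q) * (p - q)) + r * (p * (2 * p - q) + q * (2 * q - p))" for p q
  proof -
    have "(r + t3)\<^sup>2 \<le> (2 * r - t2) * (2 * r - t1)"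
    proof -
      have "(2 * r - t2) * (2 * r - t1) - (r + t3)\<^sup>2 = 3 * r\<^sup>2 - (t1\<^sup>2 + t1 * t2 + t2\<^sup>2)"
        unfolding t3 by (simp add: power2_eq_square algebra_simps)
      then show ?thesis using s by simp
    qed
    from binary_form_nonneg[OF _ _ this, of p q] b
    have "0 \<le> (2 * r - t2) * p\<^sup>2 - 2 * (r + t3) * (p * q) + (2 * r - t1) * q\<^sup>2" by simp
    also have "\<dots> = t1 * (p * p) + t2 * (q * q) + t3 * ((p - q) * (p - q)) + r * (p * (2 * p - q) + q * (2 * q - p))"
      unfolding t3 by (simp add: power2_eq_square algebra_simps)
    finally show ?thesis .
  qed
  have i: "integrable tri_measure (\<lambda>p. t1 * (ux p * ux p) + t2 * (uy p * uy p) + t3 * ((ux p - uy p) * (ux p - uy p)))"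
    "integrable tri_measure (\<lambda>p. r * (ux p * (2 * ux p - uy p) + uy p * (2 * uy p - ux p)))"
    by (intro integrable_tri_measure continuous_intros c)+
  have "0 \<le> (LINT p|tri_measure. (t1 * (ux p * ux p) + t2 * (uy p * uy p) + t3 * ((ux p - uy p) * (ux p - uy p))) + r * (ux p * (2 * ux p - uy p) + uy p * (2 * uy p - ux p)))"
    by (rule Bochner_Integration.integral_nonneg) (rule pt)
  also have "\<dots> = weighted_energy t1 t2 t3 ux uy ux uy + r * iso_energy ux uy ux uy"
    unfolding weighted_energy_def iso_energy_def by (subst Bochner_Integration.integral_add[OF i]) simp
  finally show ?thesis by simp
qed

text \<open>Pythagoras for the removal of one eigenfunction, simultaneously for the norm and the energy.\<close>

lemma split_off:
  assumes \<phi>: "C1_zero \<phi> \<phi>x \<phi>y" and v: "eigen \<kappa> v vx vy" and n: "l2_inner v v > 0"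
  defines "\<beta> \<equiv> l2_inner \<phi> v / l2_inner v v"
  shows "C1_zero (\<lambda>p. \<phi> p - \<beta> * v p) (\<lambda>p. \<phi>x p - \<beta> * vx p) (\<lambda>p. \<phi>y p - \<beta> * vy p)"
    and "l2_inner (\<lambda>p. \<phi> p - \<beta> * v p) v = 0"
    and "l2_inner \<phi> \<phi> = \<beta>\<^sup>2 * l2_inner v v + l2_inner (\<lambda>p. \<phi> p - \<beta> * v p) (\<lambda>p. \<phi> p - \<beta> * v p)"
    and "iso_energy \<phi>x \<phi>y \<phi>x \<phi>y = \<kappa> * (\<beta>\<^sup>2 * l2_inner v v) + iso_energy (\<lambda>p. \<phi>x p - \<beta> * vx p) (\<lambda>p. \<phi>y p - \<beta> * vy p) (\<lambda>p. \<phi>x p - \<beta> * vx p) (\<lambda>p. \<phi>y p - \<beta> * vy p)"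
    and "continuous_on UNIV h \<Longrightarrow> l2_inner (\<lambda>p. \<phi> p - \<beta> * v p) h = l2_inner \<phi> h - \<beta> * l2_inner v h"
proof -
  have vC: "C1_zero v vx vy" using v by (simp add: eigen_def)
  note c = C1_zeroD(1-3)[OF \<phi>] C1_zeroD(1-3)[OF vC]
  show W: "C1_zero (\<lambda>p. \<phi> p - \<beta> * v p) (\<lambda>p. \<phi>x p - \<beta> * vx p) (\<lambda>p. \<phi>y p - \<beta> * vy p)"
    using C1_zero_lin[OF \<phi> vC, of 1 "- \<beta>"] by simp
  show h: "l2_inner (\<lambda>p. \<phi> p - \<beta> * v p) h = l2_inner \<phi> h - \<beta> * l2_inner v h" if "continuous_on UNIV h" for h
    by (subst l2_inner_diff) (intro continuous_intros c that, intro continuous_intros c that, rule that, simp add: l2_inner_scale)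
  show o: "l2_inner (\<lambda>p. \<phi> p - \<beta> * v p) v = 0"
  proof -
    have "l2_inner \<phi> v - \<beta> * l2_inner v v = 0" unfolding \<beta>_def using n by simp
    then show ?thesis unfolding h[OF c(4)] .
  qed
  define w where "w p = \<phi> p - \<beta> * v p" for p
  have cw: "continuous_on UNIV w" unfolding w_def by (intro continuous_intros c)
  have b: "l2_inner \<phi> v = \<beta> * l2_inner v v" unfolding \<beta>_def using n by simp
  have "l2_inner w w = l2_inner \<phi> w - \<beta> * l2_inner v w" unfolding w_def[abs_def] by (rule h) (intro continuous_intros c)
  also have "l2_inner v w = 0" using o by (simp add: w_def[abs_def] l2_inner_commute)
  also have "l2_inner \<phi> w = l2_inner w \<phi>" by (rule l2_inner_commute)
  also have "l2_inner w \<phi> = l2_inner \<phi> \<phi> - \<beta> * l2_inner v \<phi>" unfolding w_def[abs_def] by (rule h) (rule c)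
  also have "l2_inner v \<phi> = \<beta> * l2_inner v v" using b by (simp add: l2_inner_commute)
  finally show "l2_inner \<phi> \<phi> = \<beta>\<^sup>2 * l2_inner v v + l2_inner (\<lambda>p. \<phi> p - \<beta> * v p) (\<lambda>p. \<phi> p - \<beta> * v p)"
    unfolding w_def[abs_def] by (simp add: power2_eq_square)
  have "iso_energy \<phi>x \<phi>y \<phi>x \<phi>y = \<beta>\<^sup>2 * iso_energy vx vy vx vy + 2 * \<beta> * iso_energy (\<lambda>p. \<phi>x p - \<beta> * vx p) (\<lambda>p. \<phi>y p - \<beta> * vy p) vx vy
    + iso_energy (\<lambda>p. \<phi>x p - \<beta> * vx p) (\<lambda>p. \<phi>y p - \<beta> * vy p) (\<lambda>p. \<phi>x p - \<beta> * vx p) (\<lambda>p. \<phi>y p - \<beta> * vy p)"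
    unfolding iso_energy_weighted_energy by (rule weighted_energy_split) (intro continuous_intros c | simp)+
  then show "iso_energy \<phi>x \<phi>y \<phi>x \<phi>y = \<kappa> * (\<beta>\<^sup>2 * l2_inner v v) + iso_energy (\<lambda>p. \<phi>x p - \<beta> * vx p) (\<lambda>p. \<phi>y p - \<beta> * vy p) (\<lambda>p. \<phi>x p - \<beta> * vx p) (\<lambda>p. \<phi>y p - \<beta> * vy p)"
    unfolding Green[OF vC v] Green[OF W v] o by simp
qed

lemma l2_inner_u1_u1: "l2_inner u1 u1 = 3 / 4"
  and l2_inner_tilt_u1: "l2_inner u1 (tilt t1 t2 t3) = (t1 + t2 + t3) / 4"
  and l2_inner_tilt_tilt: "l2_inner (tilt t1 t2 t3) (tilt t1 t2 t3) = (t1\<^sup>2 + t2\<^sup>2 + t3\<^sup>2) / 4"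
  and l2_inner_tilt_u2: "l2_inner (tilt t1 t2 t3) u2 = sqrt 3 * overlap * (t2 - t1)"
  and l2_inner_tilt_u3: "l2_inner (tilt t1 t2 t3) u3 = overlap * (2 * t3 - t1 - t2)"
proof -
  note c = cos_wave_continuous(2)[of UNIV]
  have lin: "l2_inner (tilt s1 s2 s3) h = s2 * l2_inner (sin_wave 2 (- 1)) h + s1 * l2_inner (sin_wave (- 1) 2) h - s3 * l2_inner (sin_wave 1 1) h" if "continuous_on UNIV h" for s1 s2 s3 h
    unfolding tilt_def[abs_def] using that c
    by (simp add: l2_inner_add l2_inner_diff l2_inner_scale continuous_on_add continuous_on_diff continuous_on_mult_left)
  have c2: "continuous_on UNIV u2" "continuous_on UNIV u3" unfolding u2_def u3_def by (rule mode_continuous)+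
  show "l2_inner (tilt t1 t2 t3) u2 = sqrt 3 * overlap * (t2 - t1)" "l2_inner (tilt t1 t2 t3) u3 = overlap * (2 * t3 - t1 - t2)"
    unfolding lin[OF c2(1)] lin[OF c2(2)] l2_inner_waves_u2 l2_inner_waves_u3 by (simp_all add: algebra_simps)
  have rr: "l2_inner (tilt s1 s2 s3) (tilt t1 t2 t3) = (s1 * t1 + s2 * t2 + s3 * t3) / 4" for s1 s2 s3 t1 t2 t3
  proof -
    have w: "l2_inner (sin_wave k l) (tilt t1 t2 t3) = t2 * l2_inner (sin_wave 2 (- 1)) (sin_wave k l) + t1 * l2_inner (sin_wave (- 1) 2) (sin_wave k l) - t3 * l2_inner (sin_wave 1 1) (sin_wave k l)" for k l
      by (subst l2_inner_commute) (rule lin[OF c])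
    have z: "l2_inner (sin_wave (- 1) 2) (sin_wave 2 (- 1)) = 0" "l2_inner (sin_wave 1 1) (sin_wave 2 (- 1)) = 0" "l2_inner (sin_wave 1 1) (sin_wave (- 1) 2) = 0"
      using l2_inner_waves_waves(4-6) by (simp_all only: l2_inner_commute)
    show ?thesis unfolding lin[OF tilt_continuous] w l2_inner_waves_waves z by (simp add: algebra_simps)
  qed
  have u1: "u1 = tilt 1 1 1" by (auto simp: tilt_def u1_waves)
  show "l2_inner u1 u1 = 3 / 4" "l2_inner u1 (tilt t1 t2 t3) = (t1 + t2 + t3) / 4"
    "l2_inner (tilt t1 t2 t3) (tilt t1 t2 t3) = (t1\<^sup>2 + t2\<^sup>2 + t3\<^sup>2) / 4"
    unfolding u1 rr by (simp_all add: power2_eq_square)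
qed

text \<open>The final estimate of the perturbation argument as a statement about numbers: \<open>\<alpha>\<close>, \<open>\<beta>2\<close>, \<open>\<beta>3\<close> are the
  coefficients on \<open>u1\<close>, \<open>u2\<close>, \<open>u3\<close>, and \<open>C\<close> and \<open>e\<close> are the squared norm and the energy of the remainder. Since \<open>r \<le> 1/4\<close>, three
  quarters of the gaps \<open>7/3\<close> and \<open>4\<close> survive the perturbation, which leaves \<open>7/4 - 1\<close> and \<open>3 - 1\<close> to absorb the
  cross terms by Young's inequality.\<close>

lemma near_isotropic_algebra:
  fixes K r \<alpha> \<beta>2 \<beta>3 F2 F3 h3 C e E Q B :: real
  assumes K: "K > 0" and r: "0 \<le> r" "r \<le> 1 / 4" and C: "C \<ge> 0"
    and e: "4 * K * C \<le> e" and E: "E = 7 / 3 * K * (\<beta>2\<^sup>2 * (3 / 2)) + (7 / 3 * K * (\<beta>3\<^sup>2 * (3 / 2)) + e)"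
    and Q: "Q \<ge> K * (\<alpha>\<^sup>2 * (3 / 4)) - K * \<alpha> * (\<beta>2 * F2 + \<beta>3 * F3 + h3) + (1 - r) * E"
    and F: "F2\<^sup>2 + F3\<^sup>2 = 36 * r\<^sup>2 * B\<^sup>2" and B: "24 * B\<^sup>2 \<le> 846 / 1000"
    and Y: "\<alpha> * h3 \<le> 2 * C + \<alpha>\<^sup>2 * (3 / 2 * r\<^sup>2 - (F2\<^sup>2 + F3\<^sup>2) / (3 / 2)) / 8"
  shows "(1 - 485 / 1000 * r\<^sup>2) * K * (\<alpha>\<^sup>2 * (3 / 4) + (\<beta>2\<^sup>2 * (3 / 2) + (\<beta>3\<^sup>2 * (3 / 2) + C))) \<le> Q"
proof -
  have y: "\<alpha> * \<beta> * F \<le> 9 / 8 * \<beta>\<^sup>2 + 2 / 9 * (\<alpha>\<^sup>2 * F\<^sup>2)" for \<beta> F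
  proof -
    have "9 / 8 * \<beta>\<^sup>2 + 2 / 9 * (\<alpha>\<^sup>2 * F\<^sup>2) - \<alpha> * \<beta> * F = (9 * \<beta> - 4 * (\<alpha> * F))\<^sup>2 / 72"
      by (simp add: power2_eq_square field_simps)
    also have "\<dots> \<ge> 0" by simp
    finally show ?thesis by simp
  qed
  define b where "b = \<beta>2\<^sup>2 + \<beta>3\<^sup>2"
  have b: "b \<ge> 0" by (simp add: b_def)
  define M where "M = \<alpha> * (\<beta>2 * F2 + \<beta>3 * F3 + h3)"
  have "M \<le> 9 / 8 * b + 2 / 9 * (\<alpha>\<^sup>2 * (F2\<^sup>2 + F3\<^sup>2)) + (2 * C + \<alpha>\<^sup>2 * (3 / 2 * r\<^sup>2 - (F2\<^sup>2 + F3\<^sup>2) / (3 / 2)) / 8)"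
    using y[of \<beta>2 F2] y[of \<beta>3 F3] Y unfolding M_def b_def by (simp add: field_simps)
  also have "\<dots> = 9 / 8 * b + 2 * C + \<alpha>\<^sup>2 * r\<^sup>2 * (3 / 16 + 5 * B\<^sup>2)"
    unfolding F by (simp add: field_simps)
  also have "\<dots> \<le> 9 / 8 * b + 2 * C + \<alpha>\<^sup>2 * r\<^sup>2 * (485 / 1000 * (3 / 4))"
    using B by (intro add_left_mono mult_left_mono) auto
  finally have M: "M \<le> 9 / 8 * b + 2 * C + \<alpha>\<^sup>2 * r\<^sup>2 * (485 / 1000 * (3 / 4))" .
  have E': "E \<ge> K * (7 / 2 * b + 4 * C)" unfolding E b_def using e by (simp add: algebra_simps)
  have "K * (7 / 2 * b + 4 * C) \<ge> 0" using K b C by simp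
  then have "(3 / 4) * (K * (7 / 2 * b + 4 * C)) \<le> (1 - r) * E" using r E' by (intro mult_mono) auto
  then have Q': "Q \<ge> K * (\<alpha>\<^sup>2 * (3 / 4) - M + 21 / 8 * b + 3 * C)"
    using Q unfolding M_def by (simp add: algebra_simps)
  have "(1 - 485 / 1000 * r\<^sup>2) * (\<alpha>\<^sup>2 * (3 / 4) + 3 / 2 * b + C) \<le> \<alpha>\<^sup>2 * (3 / 4) - M + 21 / 8 * b + 3 * C"
  proof -
    have "485 / 1000 * r\<^sup>2 * (3 / 2 * b + C) \<ge> 0" using b C by simp
    then show ?thesis using M by (simp add: field_simps)
  qed
  then have "K * ((1 - 485 / 1000 * r\<^sup>2) * (\<alpha>\<^sup>2 * (3 / 4) + 3 / 2 * b + C)) \<le> K * (\<alpha>\<^sup>2 * (3 / 4) - M + 21 / 8 * b + 3 * C)"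
    using K by (intro mult_left_mono) auto
  also have "\<dots> \<le> Q" by (rule Q')
  finally show ?thesis unfolding b_def by (simp add: algebra_simps)
qed

text \<open>Second order perturbation theory with explicit constants. The weights have no first order effect, because the first
  variation at \<open>u1\<close> is proportional to their sum. The second order effect is governed by \<open>tilt\<close>, split into its part in
  the second eigenspace and the rest. Treating the whole of \<open>tilt\<close> as if it lay in the second eigenspace would give
  \<open>(2/3) r\<^sup>2\<close> in place of \<open>(485/1000) r\<^sup>2\<close>, whereas the anisotropy bound requires a constant below \<open>1/2\<close>.\<close>

lemma near_isotropic_bound:
  assumes t: "test_function open_unit_triangle \<phi> \<phi>'"
    and ts: "t1 + t2 + t3 = 0" "t1\<^sup>2 + t2\<^sup>2 + t3\<^sup>2 = 6 * r\<^sup>2" and r: "0 \<le> r" "r \<le> 1 / 4"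
  shows "(1 - 485 / 1000 * r\<^sup>2) * (8 * pi\<^sup>2) * sq_int \<phi> \<le> (1 + t1) * sq_int (\<lambda>p. fst (\<phi>' p))
    + (1 + t2) * sq_int (\<lambda>p. snd (\<phi>' p)) + (1 + t3) * sq_int (\<lambda>p. fst (\<phi>' p) - snd (\<phi>' p))"
proof -
  define \<phi>x \<phi>y where "\<phi>x p = fst (\<phi>' p)" "\<phi>y p = snd (\<phi>' p)" for p
  have C0: "C1_zero \<phi> \<phi>x \<phi>y" unfolding \<phi>x_\<phi>y_def[abs_def] by (rule test_C1_zero[OF t])
  obtain L where L: "compact L" "L \<subseteq> open_unit_triangle" "\<And>x. x \<notin> L \<Longrightarrow> \<phi> x = 0" "\<And>x. x \<notin> L \<Longrightarrow> \<phi>' x = 0"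
    using test_function_support_ex[OF t] by meson
  have Lo: "\<phi> p = 0" "\<phi>' p = 0" if "p \<notin> open_unit_triangle" for p by (use L that in blast)+
  have N: "sq_int \<phi> = l2_inner \<phi> \<phi>"
    unfolding sq_int_def l2_inner_def using integral_tri_measure_eq_lborel[of "\<lambda>p. \<phi> p * \<phi> p"] Lo by (simp add: power2_eq_square)
  have sq: "sq_int g = (LINT p|tri_measure. g p * g p)" if "\<And>p. p \<notin> open_unit_triangle \<Longrightarrow> g p = 0" for g
    unfolding sq_int_def using integral_tri_measure_eq_lborel[of "\<lambda>p. g p * g p"] that by (simp add: power2_eq_square)
  note c0 = C1_zeroD(1-3)[OF C0]
  define f where "f = tilt t1 t2 t3"
  have cf: "continuous_on UNIV f" unfolding f_def by (rule tilt_continuous)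
  have cu: "continuous_on UNIV u1" "continuous_on UNIV u2" "continuous_on UNIV u3"
    unfolding u2_def u3_def by (intro u1_continuous mode_continuous)+
  have o: "l2_inner u1 u2 = 0" "l2_inner u1 u3 = 0" "l2_inner u2 u1 = 0" "l2_inner u3 u1 = 0" "l2_inner u3 u2 = 0"
    using eigen_orthogonal[OF u1_eigen u2_eigen] eigen_orthogonal[OF u1_eigen u3_eigen] l2_inner_u2_u3 by (simp_all add: l2_inner_commute)
  have n: "l2_inner u1 u1 > 0" "l2_inner u2 u2 > 0" "l2_inner u3 u3 > 0" by (simp_all add: l2_inner_u1_u1 l2_inner_u2_u2 l2_inner_u3_u3)
  define \<alpha> where "\<alpha> = l2_inner \<phi> u1 / l2_inner u1 u1"
  define w1 w1x w1y where "w1 p = \<phi> p - \<alpha> * u1 p" "w1x p = \<phi>x p - \<alpha> * u1x p" "w1y p = \<phi>y p - \<alpha> * u1y p" for p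
  note S1 = split_off[OF C0 u1_eigen n(1), folded \<alpha>_def, folded w1_w1x_w1y_def[abs_def]]
  define \<beta>2 where "\<beta>2 = l2_inner w1 u2 / l2_inner u2 u2"
  define w2 w2x w2y where "w2 p = w1 p - \<beta>2 * u2 p" "w2x p = w1x p - \<beta>2 * cos_mode_dx 2 1 p" "w2y p = w1y p - \<beta>2 * cos_mode_dy 2 1 p" for p
  note S2 = split_off[OF S1(1) u2_eigen n(2), folded \<beta>2_def, folded w2_w2x_w2y_def[abs_def]]
  define \<beta>3 where "\<beta>3 = l2_inner w2 u3 / l2_inner u3 u3"
  define w3 w3x w3y where "w3 p = w2 p - \<beta>3 * u3 p" "w3x p = w2x p - \<beta>3 * sin_mode_dx 2 1 p" "w3y p = w2y p - \<beta>3 * sin_mode_dy 2 1 p" for p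
  note S3 = split_off[OF S2(1) u3_eigen n(3), folded \<beta>3_def, folded w3_w3x_w3y_def[abs_def]]
  have w3: "l2_inner w3 u1 = 0" "l2_inner w3 u2 = 0" "l2_inner w3 u3 = 0"
    using S1(2) S2(2) S3(2) S2(5)[OF cu(1)] S3(5)[OF cu(1)] S3(5)[OF cu(2)] o by simp_all
  have c3: "continuous_on UNIV w3" using C1_zeroD(1)[OF S3(1)] .
  define C where "C = l2_inner w3 w3"
  have C: "C \<ge> 0" unfolding C_def l2_inner_def by (rule Bochner_Integration.integral_nonneg) simp
  define e where "e = iso_energy w3x w3y w3x w3y"
  have e: "4 * (8 * pi\<^sup>2) * C \<le> e"
    unfolding C_def e_def
  proof (rule spectral_gap[OF S3(1) w3])
    fix d :: real assume "d > 0"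
    obtain v where v: "mode_sum v" "\<forall>p\<in>unit_triangle. \<bar>\<phi> p - v p\<bar> < d"
      using modes_dense[OF c0(1) L(1,2,3) \<open>d > 0\<close>] by blast
    define v' where "v' p = v p + (- \<alpha>) * u1 p + (- \<beta>2) * u2 p + (- \<beta>3) * u3 p" for p
    have "mode_sum v'" unfolding v'_def[abs_def]
      by (intro mode_sum_add mode_sum_scale v(1) mode_sum_u1 mode_sum_basic[of 2 1, folded u2_def u3_def])
    moreover have "w3 p - v' p = \<phi> p - v p" for p
      by (simp add: v'_def w3_w3x_w3y_def w2_w2x_w2y_def w1_w1x_w1y_def)
    ultimately show "\<exists>v. mode_sum v \<and> (\<forall>p\<in>unit_triangle. \<bar>w3 p - v p\<bar> < d)"
      using v(2) by (intro exI[of _ v']) simp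
  qed
  define F2 F3 where "F2 = l2_inner f u2" "F3 = l2_inner f u3"
  define h3 where "h3 = l2_inner w3 f"
  have h: "l2_inner w1 f = \<beta>2 * F2 + \<beta>3 * F3 + h3"
    using S2(5)[OF cf] S3(5)[OF cf] unfolding F2_F3_def h3_def by (simp add: l2_inner_commute)
  have t3: "t3 = - t1 - t2" using ts by linarith
  \<comment> \<open>The norm of the projection of the tilt to the second eigenspace depends on the weights only through \<open>r\<close>.\<close>
  have F: "F2\<^sup>2 + F3\<^sup>2 = 36 * r\<^sup>2 * overlap\<^sup>2"
  proof -
    have "F2\<^sup>2 + F3\<^sup>2 = overlap\<^sup>2 * (3 * (t2 - t1)\<^sup>2 + (2 * t3 - t1 - t2)\<^sup>2)"
      unfolding F2_F3_def f_def l2_inner_tilt_u2 l2_inner_tilt_u3 by (simp add: power_mult_distrib distrib_left)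
    also have "3 * (t2 - t1)\<^sup>2 + (2 * t3 - t1 - t2)\<^sup>2 = 6 * (t1\<^sup>2 + t2\<^sup>2 + t3\<^sup>2)"
      unfolding t3 by (simp add: power2_eq_square algebra_simps)
    finally show ?thesis unfolding ts(2) by simp
  qed
  have Y: "\<alpha> * h3 \<le> 2 * C + \<alpha>\<^sup>2 * (3 / 2 * r\<^sup>2 - (F2\<^sup>2 + F3\<^sup>2) / (3 / 2)) / 8"
  proof -
    define k2 k3 where "k2 = F2 / (3 / 2)" "k3 = F3 / (3 / 2)"
    define g where "g p = f p - k2 * u2 p - k3 * u3 p" for p
    have cg: "continuous_on UNIV g" unfolding g_def by (intro continuous_intros cf cu)
    have g: "l2_inner g k = l2_inner f k - k2 * l2_inner u2 k - k3 * l2_inner u3 k" if "continuous_on UNIV k" for k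
      unfolding g_def[abs_def] using that cf cu
      by (simp add: l2_inner_diff l2_inner_scale continuous_on_diff continuous_on_mult_left)
    have "l2_inner g u2 = 0" "l2_inner g u3 = 0"
      unfolding g[OF cu(2)] g[OF cu(3)] l2_inner_u2_u2 l2_inner_u3_u3 l2_inner_u2_u3 o k2_k3_def F2_F3_def by simp_all
    then have gg: "l2_inner g g = 3 / 2 * r\<^sup>2 - (F2\<^sup>2 + F3\<^sup>2) / (3 / 2)"
    proof -
      assume z: "l2_inner g u2 = 0" "l2_inner g u3 = 0"
      have "l2_inner g g = l2_inner g f" unfolding g[OF cg] using z by (simp add: l2_inner_commute)
      also have "\<dots> = l2_inner f f - k2 * l2_inner u2 f - k3 * l2_inner u3 f" by (rule g[OF cf])
      also have "l2_inner u2 f = F2" unfolding F2_F3_def by (rule l2_inner_commute)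
      also have "l2_inner u3 f = F3" unfolding F2_F3_def by (rule l2_inner_commute)
      also have "l2_inner f f = 3 / 2 * r\<^sup>2" unfolding f_def l2_inner_tilt_tilt ts(2) by simp
      finally show ?thesis by (simp add: k2_k3_def power2_eq_square field_simps)
    qed
    have gw: "l2_inner g w3 = h3" unfolding g[OF c3] h3_def using w3 by (simp add: l2_inner_commute)
    \<comment> \<open>The square of this function is Young's inequality for the remainder, with the gap \<open>3 - 1\<close>.\<close>
    define d where "d p = \<alpha> / 4 * g p - w3 p" for p
    have cd: "continuous_on UNIV d" unfolding d_def by (intro continuous_intros cg c3)
    have dk: "l2_inner d k = \<alpha> / 4 * l2_inner g k - l2_inner w3 k" if "continuous_on UNIV k" for k
    proof -
      have "l2_inner d k = l2_inner (\<lambda>p. \<alpha> / 4 * g p) k - l2_inner w3 k"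
        unfolding d_def[abs_def] by (rule l2_inner_diff[OF continuous_on_mult_left[OF cg] c3 that])
      then show ?thesis by (simp only: l2_inner_scale)
    qed
    have "0 \<le> l2_inner d d" unfolding l2_inner_def by (rule Bochner_Integration.integral_nonneg) simp
    also have "\<dots> = \<alpha> / 4 * l2_inner d g - l2_inner d w3" unfolding dk[OF cd] by (simp add: l2_inner_commute)
    also have "\<dots> = \<alpha> / 4 * (\<alpha> / 4 * l2_inner g g - h3) - (\<alpha> / 4 * h3 - C)"
      unfolding dk[OF cg] dk[OF c3] gw C_def using gw by (simp add: l2_inner_commute)
    finally show ?thesis unfolding gg by (simp add: power2_eq_square field_simps)
  qed
  define Q where "Q = (1 + t1) * sq_int (\<lambda>p. fst (\<phi>' p)) + (1 + t2) * sq_int (\<lambda>p. snd (\<phi>' p)) + (1 + t3) * sq_int (\<lambda>p. fst (\<phi>' p) - snd (\<phi>' p))"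
  have Q: "Q = iso_energy \<phi>x \<phi>y \<phi>x \<phi>y + weighted_energy t1 t2 t3 \<phi>x \<phi>y \<phi>x \<phi>y"
  proof -
    have i: "integrable tri_measure (\<lambda>p. \<phi>x p * \<phi>x p)" "integrable tri_measure (\<lambda>p. \<phi>y p * \<phi>y p)" "integrable tri_measure (\<lambda>p. (\<phi>x p - \<phi>y p) * (\<phi>x p - \<phi>y p))"
      by (intro integrable_tri_measure continuous_intros c0)+
    have "weighted_energy s1 s2 s3 \<phi>x \<phi>y \<phi>x \<phi>y = s1 * (LINT p|tri_measure. \<phi>x p * \<phi>x p) + s2 * (LINT p|tri_measure. \<phi>y p * \<phi>y p) + s3 * (LINT p|tri_measure. (\<phi>x p - \<phi>y p) * (\<phi>x p - \<phi>y p))" for s1 s2 s3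
      unfolding weighted_energy_def using i by simp
    moreover have "sq_int \<phi>x = (LINT p|tri_measure. \<phi>x p * \<phi>x p)" "sq_int \<phi>y = (LINT p|tri_measure. \<phi>y p * \<phi>y p)"
      "sq_int (\<lambda>p. \<phi>x p - \<phi>y p) = (LINT p|tri_measure. (\<phi>x p - \<phi>y p) * (\<phi>x p - \<phi>y p))"
      by (rule sq, simp add: \<phi>x_\<phi>y_def Lo)+
    ultimately show ?thesis
      unfolding Q_def iso_energy_weighted_energy \<phi>x_\<phi>y_def[symmetric] by (simp add: \<phi>x_\<phi>y_def[abs_def, symmetric] algebra_simps)
  qed
  have "weighted_energy t1 t2 t3 \<phi>x \<phi>y \<phi>x \<phi>y = \<alpha>\<^sup>2 * weighted_energy t1 t2 t3 u1x u1y u1x u1y + 2 * \<alpha> * weighted_energy t1 t2 t3 w1x w1y u1x u1y + weighted_energy t1 t2 t3 w1x w1y w1x w1y"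
  proof (rule weighted_energy_split)
    show "continuous_on UNIV u1x" "continuous_on UNIV u1y" using u1_eigen C1_zeroD(2,3) by (auto simp: eigen_def)
    show "continuous_on UNIV w1x" "continuous_on UNIV w1y" using C1_zeroD(2,3)[OF S1(1)] .
  qed (simp_all add: w1_w1x_w1y_def)
  also have "weighted_energy t1 t2 t3 u1x u1y u1x u1y = 0"
    using weighted_energy_u1[OF _ ts(1), of u1 u1x u1y] u1_eigen l2_inner_tilt_u1[of t1 t2 t3] ts(1) by (simp add: eigen_def)
  also have "weighted_energy t1 t2 t3 w1x w1y u1x u1y = - (4 * pi\<^sup>2) * (\<beta>2 * F2 + \<beta>3 * F3 + h3)"
    using weighted_energy_u1[OF S1(1) ts(1)] h by (simp add: f_def)
  finally have weighted_energy: "weighted_energy t1 t2 t3 \<phi>x \<phi>y \<phi>x \<phi>y = - (8 * pi\<^sup>2) * \<alpha> * (\<beta>2 * F2 + \<beta>3 * F3 + h3) + weighted_energy t1 t2 t3 w1x w1y w1x w1y"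
    by (simp add: algebra_simps)
  have low_energy: "- r * iso_energy w1x w1y w1x w1y \<le> weighted_energy t1 t2 t3 w1x w1y w1x w1y"
    by (rule weighted_energy_lower[OF C1_zeroD(2,3)[OF S1(1)] ts r(1)])
  have E: "iso_energy w1x w1y w1x w1y = 7 / 3 * (8 * pi\<^sup>2) * (\<beta>2\<^sup>2 * (3 / 2)) + (7 / 3 * (8 * pi\<^sup>2) * (\<beta>3\<^sup>2 * (3 / 2)) + e)"
    unfolding S2(4) S3(4) e_def l2_inner_u2_u2 l2_inner_u3_u3 ..
  have "l2_inner \<phi> \<phi> = \<alpha>\<^sup>2 * (3 / 4) + (\<beta>2\<^sup>2 * (3 / 2) + (\<beta>3\<^sup>2 * (3 / 2) + C))"
    unfolding S1(3) S2(3) S3(3) C_def l2_inner_u1_u1 l2_inner_u2_u2 l2_inner_u3_u3 ..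
  moreover have "(1 - 485 / 1000 * r\<^sup>2) * (8 * pi\<^sup>2) * (\<alpha>\<^sup>2 * (3 / 4) + (\<beta>2\<^sup>2 * (3 / 2) + (\<beta>3\<^sup>2 * (3 / 2) + C))) \<le> Q"
  proof (rule near_isotropic_algebra[OF _ r C e E _ F overlap_bound Y])
    show "8 * pi\<^sup>2 * (\<alpha>\<^sup>2 * (3 / 4)) - 8 * pi\<^sup>2 * \<alpha> * (\<beta>2 * F2 + \<beta>3 * F3 + h3) + (1 - r) * iso_energy w1x w1y w1x w1y \<le> Q"
      unfolding Q weighted_energy S1(4) l2_inner_u1_u1 using low_energy by (simp add: algebra_simps)
  qed simp
  ultimately show ?thesis unfolding N Q_def by simp
qed

section \<open>Test functions close to the ground state\<close>

lemma max_square_deriv: "((\<lambda>x. (max 0 x)\<^sup>2) has_real_derivative 2 * max 0 x) (at (x :: real))"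
proof -
  consider "x > 0" | "x < 0" | "x = 0" by linarith
  then show ?thesis
  proof cases
    case 1
    have "((\<lambda>x. x\<^sup>2) has_real_derivative 2 * max 0 x) (at x)"
      using 1 by (auto intro!: derivative_eq_intros)
    then show ?thesis
      by (rule has_field_derivative_transform_within_open[where S = "{0<..}"]) (use 1 in auto)
  next
    case 2
    have "((\<lambda>x. 0) has_real_derivative 2 * max 0 x) (at x)"
      using 2 by (auto intro!: derivative_eq_intros)
    then show ?thesis
      by (rule has_field_derivative_transform_within_open[where S = "{..<0}"]) (use 2 in auto)
  next
    case 3
    have "((\<lambda>h. ((max 0 (0 + h))\<^sup>2 - (max 0 0)\<^sup>2) / h) \<longlongrightarrow> 0) (at (0 :: real))"
    proof (rule Lim_null_comparison)
      show "\<forall>\<^sub>F h in at 0. norm (((max 0 (0 + h))\<^sup>2 - (max 0 0)\<^sup>2) / h) \<le> \<bar>h\<bar>" for h :: real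
        by (rule always_eventually) (auto simp: max_def power2_eq_square)
      show "((\<lambda>h :: real. \<bar>h\<bar>) \<longlongrightarrow> 0) (at 0)" by (intro tendsto_eq_intros) auto
    qed
    then show ?thesis using 3 by (simp add: DERIV_def)
  qed
qed

text \<open>A truncation of the identity: it vanishes for \<open>t \<le> \<epsilon>\<close>, its derivative \<open>1 - \<epsilon>\<^sup>2/t\<^sup>2\<close> beyond \<open>\<epsilon>\<close> is continuous and at most
  \<open>1\<close>, so composition with it turns \<open>u1\<close> into a test function without raising the energy.\<close>

definition cut :: "real \<Rightarrow> real \<Rightarrow> real" where "cut \<epsilon> t = (max 0 (t - \<epsilon>))\<^sup>2 / t"
definition cut' :: "real \<Rightarrow> real \<Rightarrow> real" where "cut' \<epsilon> t = (2 * max 0 (t - \<epsilon>) * t - (max 0 (t - \<epsilon>))\<^sup>2) / (t * t)"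

lemma cut_deriv:
  assumes "t > 0"
  shows "(cut \<epsilon> has_real_derivative cut' \<epsilon> t) (at t)"
proof -
  have "((\<lambda>t. t - \<epsilon>) has_real_derivative 1) (at t)" by (auto intro!: derivative_eq_intros)
  from DERIV_chain2[OF max_square_deriv this]
  have "((\<lambda>t. (max 0 (t - \<epsilon>))\<^sup>2) has_real_derivative 2 * max 0 (t - \<epsilon>)) (at t)" by simp
  from DERIV_divide[OF this DERIV_ident] assms
  show ?thesis unfolding cut_def[abs_def] cut'_def by (auto simp: mult.commute)
qed

lemma cut_zero: "t \<le> \<epsilon> \<Longrightarrow> cut \<epsilon> t = 0" "t \<le> \<epsilon> \<Longrightarrow> cut' \<epsilon> t = 0"
  by (simp_all add: cut_def cut'_def)

lemma cut_bounds:
  assumes "t > 0" "\<epsilon> > 0"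
  shows "\<bar>cut' \<epsilon> t\<bar> \<le> 1" "t\<^sup>2 - 4 * \<epsilon> * t \<le> (cut \<epsilon> t)\<^sup>2"
proof -
  define m where "m = max 0 (t - \<epsilon>)"
  have m: "0 \<le> m" "m \<le> t" "t - \<epsilon> \<le> m" using assms by (auto simp: m_def)
  have "2 * m * t - m\<^sup>2 = t * t - (t - m)\<^sup>2" by (simp add: power2_eq_square algebra_simps)
  moreover have "(t - m)\<^sup>2 \<ge> 0" by simp
  ultimately have "2 * m * t - m\<^sup>2 \<le> t * t" by linarith
  moreover have "0 \<le> 2 * m * t - m\<^sup>2"
  proof -
    have "m * m \<le> m * t" using m by (intro mult_left_mono)
    moreover have "0 \<le> m * t" using m assms by simp
    ultimately show ?thesis by (simp add: power2_eq_square)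
  qed
  ultimately show "\<bar>cut' \<epsilon> t\<bar> \<le> 1" unfolding cut'_def m_def[symmetric] using assms by (simp add: divide_le_eq)
  show "t\<^sup>2 - 4 * \<epsilon> * t \<le> (cut \<epsilon> t)\<^sup>2"
  proof (cases "t \<le> 2 * \<epsilon>")
    case True
    have "t\<^sup>2 - 4 * \<epsilon> * t = t * (t - 4 * \<epsilon>)" by (simp add: power2_eq_square algebra_simps)
    also have "\<dots> \<le> 0" using True assms by (intro mult_nonneg_nonpos) auto
    finally show ?thesis by (rule order_trans) simp
  next
    case False
    have "t - 2 * \<epsilon> \<le> (t - \<epsilon>)\<^sup>2 / t" using assms by (simp add: le_divide_eq power2_eq_square algebra_simps)
    also have "\<dots> = cut \<epsilon> t" using False assms by (simp add: cut_def)
    finally have "(t - 2 * \<epsilon>)\<^sup>2 \<le> (cut \<epsilon> t)\<^sup>2" using False by (intro power_mono) auto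
    moreover have "t\<^sup>2 - 4 * \<epsilon> * t \<le> (t - 2 * \<epsilon>)\<^sup>2" by (simp add: power2_eq_square algebra_simps)
    ultimately show ?thesis by linarith
  qed
qed

lemma u1_derivative: "(u1 has_derivative (\<lambda>h. (u1x p, u1y p) \<bullet> h)) (at p)"
proof -
  have "phase 2 (- 1) p = 2 * pi * fst p" "phase (- 1) 2 p = 2 * pi * snd p" "phase 1 1 p = 2 * pi * (fst p + snd p)"
    by (simp_all add: phase_def algebra_simps)
  then have x: "u1x p = 2 * pi * (cos (2 * pi * fst p) - cos (2 * pi * (fst p + snd p)))" "u1y p = 2 * pi * (cos (2 * pi * snd p) - cos (2 * pi * (fst p + snd p)))"
    by (simp_all add: u1x_def u1y_def cos_wave_def)
  have s: "(sin has_field_derivative cos z) (at z)" for z :: real by (rule DERIV_sin)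
  have l: "((\<lambda>p. 2 * pi * fst p) has_derivative (\<lambda>h. 2 * pi * fst h)) (at p)" "((\<lambda>p. 2 * pi * snd p) has_derivative (\<lambda>h. 2 * pi * snd h)) (at p)"
    "((\<lambda>p. 2 * pi * (fst p + snd p)) has_derivative (\<lambda>h. 2 * pi * (fst h + snd h))) (at p)"
    by (auto intro!: derivative_eq_intros)
  have "((\<lambda>p. sin (2 * pi * fst p) + sin (2 * pi * snd p) - sin (2 * pi * (fst p + snd p))) has_derivative
    (\<lambda>h. 2 * pi * fst h * cos (2 * pi * fst p) + 2 * pi * snd h * cos (2 * pi * snd p) - 2 * pi * (fst h + snd h) * cos (2 * pi * (fst p + snd p)))) (at p)"
    by (intro has_derivative_add has_derivative_diff DERIV_compose_FDERIV[OF s] l)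
  moreover have "(\<lambda>h. 2 * pi * fst h * cos (2 * pi * fst p) + 2 * pi * snd h * cos (2 * pi * snd p) - 2 * pi * (fst h + snd h) * cos (2 * pi * (fst p + snd p)))
    = (\<lambda>h. (u1x p, u1y p) \<bullet> h)"
    by (auto simp: fun_eq_iff x algebra_simps)
  ultimately show ?thesis by (simp add: u1_def[abs_def])
qed

lemma u1_boundary:
  assumes "p \<in> unit_triangle" "p \<notin> open_unit_triangle" shows "u1 p = 0"
proof -
  obtain x y where p: "p = (x, y)" by (metis surj_pair)
  have "x = 0 \<or> y = 0 \<or> x = 1 - y" using assms unfolding p unit_triangle_def open_unit_triangle_def by auto
  then show ?thesis unfolding p u1_mode by (auto simp: mode_boundary)
qed

lemma truncated_ground_state:
  assumes \<epsilon>: "\<epsilon> > 0"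
  shows "\<exists>\<phi> \<phi>'. test_function open_unit_triangle \<phi> \<phi>' \<and> 3 / 4 - 6 * \<epsilon> \<le> sq_int \<phi> \<and>
    sq_int (\<lambda>p. fst (\<phi>' p)) + sq_int (\<lambda>p. snd (\<phi>' p)) + sq_int (\<lambda>p. fst (\<phi>' p) - snd (\<phi>' p)) \<le> 8 * pi\<^sup>2 * (3 / 4)"
proof -
  \<comment> \<open>The support of the truncation; it avoids the boundary, where \<open>u1\<close> vanishes.\<close>
  define L where "L = {p \<in> unit_triangle. \<epsilon> \<le> u1 p}"
  have L: "compact L" "L \<subseteq> open_unit_triangle"
  proof -
    have "closed {p. \<epsilon> \<le> u1 p}" by (intro closed_Collect_le continuous_intros u1_continuous)
    moreover have "L = unit_triangle \<inter> {p. \<epsilon> \<le> u1 p}" by (auto simp: L_def)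
    ultimately show "compact L" using compact_unit_triangle by (simp add: compact_Int_closed)
    show "L \<subseteq> open_unit_triangle" using u1_boundary \<epsilon> by (fastforce simp: L_def)
  qed
  have off: "u1 p \<le> \<epsilon>" if "p \<in> open_unit_triangle" "p \<notin> L" for p
    using that open_subset_unit_triangle by (auto simp: L_def)
  define g where "g p = cut' \<epsilon> (u1 p) *\<^sub>R (u1x p, u1y p)" for p
  define \<phi> where "\<phi> p = (if p \<in> open_unit_triangle then cut \<epsilon> (u1 p) else 0)" for p
  define \<phi>' where "\<phi>' p = (if p \<in> open_unit_triangle then g p else 0)" for p
  have cu: "continuous_on A u1x" "continuous_on A u1y" for A
    unfolding u1x_def u1y_def by (intro continuous_intros cos_wave_continuous)+
  have z: "\<phi> p = 0" "\<phi>' p = 0" if "p \<notin> L" for p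
    using off[OF _ that] cut_zero[of "u1 p" \<epsilon>] by (auto simp: \<phi>_def \<phi>'_def g_def zero_prod_def)
  have test: "test_function open_unit_triangle \<phi> \<phi>'"
    unfolding test_function_def
  proof (intro conjI allI)
    fix p
    show "(\<phi> has_derivative (\<lambda>h. \<phi>' p \<bullet> h)) (at p)"
    proof (cases "p \<in> open_unit_triangle")
      case True
      have "((\<lambda>p. cut \<epsilon> (u1 p)) has_derivative (\<lambda>h. ((u1x p, u1y p) \<bullet> h) * cut' \<epsilon> (u1 p))) (at p)"
        by (rule DERIV_compose_FDERIV[OF cut_deriv[OF u1_pos[OF True]] u1_derivative])
      also have "(\<lambda>h. ((u1x p, u1y p) \<bullet> h) * cut' \<epsilon> (u1 p)) = (\<lambda>h. \<phi>' p \<bullet> h)"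
        using True by (auto simp: \<phi>'_def g_def fun_eq_iff algebra_simps)
      finally show ?thesis
        by (rule has_derivative_transform_within_open[OF _ open_unit_triangle_open True]) (simp add: \<phi>_def)
    next
      case False
      then have pL: "p \<in> - L" using L by auto
      have d: "((\<lambda>p. 0) has_derivative (\<lambda>h. \<phi>' p \<bullet> h)) (at p)" using z pL by simp
      have "open (- L)" using L(1) compact_imp_closed by auto
      then show ?thesis by (rule has_derivative_transform_within_open[OF d _ pL]) (simp add: z)
    qed
  next
    have pos: "u1 p \<noteq> 0" if "p \<in> open_unit_triangle" for p using u1_pos[OF that] by simp
    have "continuous_on open_unit_triangle g"
      unfolding g_def cut'_def by (intro continuous_intros u1_continuous cu) (use pos in auto)
    then show "continuous_on UNIV \<phi>'"
      unfolding \<phi>'_def by (rule continuous_zero_extension[OF L]) (use z \<phi>'_def in metis)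
  next
    show "\<exists>K. compact K \<and> K \<subseteq> open_unit_triangle \<and> (\<forall>x. x \<notin> K \<longrightarrow> \<phi> x = 0)"
      using L z by blast
  qed
  have c: "continuous_on UNIV \<phi>" "continuous_on UNIV \<phi>'" by (rule test_function_continuous[OF test])+
  have sq: "sq_int h = (LINT p|tri_measure. h p * h p)" if "\<And>p. p \<notin> open_unit_triangle \<Longrightarrow> h p = 0" for h
    unfolding sq_int_def using integral_tri_measure_eq_lborel[of "\<lambda>p. h p * h p"] that by (simp add: power2_eq_square)
  have "(LINT p|tri_measure. u1 p * u1 p - 4 * \<epsilon> * u1 p) \<le> (LINT p|tri_measure. \<phi> p * \<phi> p)"
  proof (rule integral_tri_measure_mono)
    show "u1 p * u1 p - 4 * \<epsilon> * u1 p \<le> \<phi> p * \<phi> p" if "p \<in> unit_triangle" for p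
    proof (cases "p \<in> open_unit_triangle")
      case True
      then show ?thesis using cut_bounds(2)[OF u1_pos[OF True] \<epsilon>] by (simp add: \<phi>_def power2_eq_square)
    next
      case False
      then show ?thesis using u1_boundary[OF that False] by (simp add: \<phi>_def)
    qed
  qed (intro continuous_intros u1_continuous c)+
  moreover have "(LINT p|tri_measure. \<phi> p * \<phi> p) = sq_int \<phi>" by (rule sq[symmetric]) (simp add: \<phi>_def)
  moreover have "(LINT p|tri_measure. u1 p * u1 p - 4 * \<epsilon> * u1 p) = 3 / 4 - 4 * \<epsilon> * (LINT p|tri_measure. u1 p)"
  proof -
    have "integrable tri_measure (\<lambda>p. u1 p * u1 p)" "integrable tri_measure u1" by (intro integrable_tri_measure continuous_intros u1_continuous)+
    then show ?thesis using l2_inner_u1_u1 by (simp add: l2_inner_def)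
  qed
  moreover have "(LINT p|tri_measure. u1 p) \<le> 3 / 2"
  proof -
    have "(LINT p|tri_measure. u1 p) \<le> (LINT p|tri_measure. 3)"
      by (rule integral_tri_measure_mono) (use u1_bound in \<open>auto intro: u1_continuous simp: abs_le_iff\<close>)
    also have "\<dots> = 3 * (LINT p|tri_measure. 1)" by simp
    also have "(LINT p|tri_measure. 1) = cos_wave_integral 0 0" by (simp add: cos_wave_integral_def cos_wave_def phase_def)
    finally show ?thesis by (simp add: cos_wave_integral_zero_zero)
  qed
  then have "4 * \<epsilon> * (LINT p|tri_measure. u1 p) \<le> 4 * \<epsilon> * (3 / 2)" using \<epsilon> by (intro mult_left_mono) auto
  ultimately have N: "3 / 4 - 6 * \<epsilon> \<le> sq_int \<phi>" by linarith
  define \<phi>x \<phi>y where "\<phi>x p = fst (\<phi>' p)" "\<phi>y p = snd (\<phi>' p)" for p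
  have cx: "continuous_on UNIV \<phi>x" "continuous_on UNIV \<phi>y" unfolding \<phi>x_\<phi>y_def by (intro continuous_intros c)+
  have i: "integrable tri_measure (\<lambda>p. \<phi>x p * \<phi>x p)" "integrable tri_measure (\<lambda>p. \<phi>y p * \<phi>y p)" "integrable tri_measure (\<lambda>p. (\<phi>x p - \<phi>y p) * (\<phi>x p - \<phi>y p))"
    by (intro integrable_tri_measure continuous_intros cx)+
  have "sq_int \<phi>x + sq_int \<phi>y + sq_int (\<lambda>p. \<phi>x p - \<phi>y p) = (LINT p|tri_measure. \<phi>x p * \<phi>x p) + (LINT p|tri_measure. \<phi>y p * \<phi>y p) + (LINT p|tri_measure. (\<phi>x p - \<phi>y p) * (\<phi>x p - \<phi>y p))"
    by (subst (1 2 3) sq) (auto simp: \<phi>x_\<phi>y_def \<phi>'_def)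
  also have "\<dots> = (LINT p|tri_measure. \<phi>x p * \<phi>x p + \<phi>y p * \<phi>y p + (\<phi>x p - \<phi>y p) * (\<phi>x p - \<phi>y p))" using i by simp
  also have "\<dots> \<le> (LINT p|tri_measure. u1x p * (2 * u1x p - u1y p) + u1y p * (2 * u1y p - u1x p))"
  proof (rule integral_tri_measure_mono)
    fix p
    define k where "k = (if p \<in> open_unit_triangle then cut' \<epsilon> (u1 p) else 0)"
    have "\<bar>k\<bar> \<le> 1" using cut_bounds(1)[OF u1_pos \<epsilon>, of p] by (simp add: k_def)
    then have k: "k\<^sup>2 \<le> 1" by (simp add: abs_square_le_1)
    have kk: "\<phi>x p = k * u1x p" "\<phi>y p = k * u1y p" by (simp_all add: \<phi>x_\<phi>y_def \<phi>'_def g_def k_def)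
    have "\<phi>x p * \<phi>x p + \<phi>y p * \<phi>y p + (\<phi>x p - \<phi>y p) * (\<phi>x p - \<phi>y p) = k\<^sup>2 * ((u1x p)\<^sup>2 + (u1y p)\<^sup>2 + (u1x p - u1y p)\<^sup>2)"
      unfolding kk by (simp add: power2_eq_square algebra_simps)
    also have "\<dots> \<le> 1 * ((u1x p)\<^sup>2 + (u1y p)\<^sup>2 + (u1x p - u1y p)\<^sup>2)" by (intro mult_right_mono k) simp
    also have "\<dots> = u1x p * (2 * u1x p - u1y p) + u1y p * (2 * u1y p - u1x p)" by (simp add: power2_eq_square algebra_simps)
    finally show "\<phi>x p * \<phi>x p + \<phi>y p * \<phi>y p + (\<phi>x p - \<phi>y p) * (\<phi>x p - \<phi>y p) \<le> u1x p * (2 * u1x p - u1y p) + u1y p * (2 * u1y p - u1x p)" .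
  qed (intro continuous_intros cx cu)+
  also have "\<dots> = iso_energy u1x u1y u1x u1y" by (simp add: iso_energy_def)
  also have "\<dots> = 8 * pi\<^sup>2 * (3 / 4)" using Green[OF _ u1_eigen, of u1 u1x u1y] u1_eigen l2_inner_u1_u1 by (simp add: eigen_def)
  finally show ?thesis using N test unfolding \<phi>x_\<phi>y_def by blast
qed

lemma test_function_exists: "\<exists>\<phi> \<phi>'. test_function open_unit_triangle \<phi> \<phi>' \<and> sq_int \<phi> > 0"
  using truncated_ground_state[of "1 / 16"] by fastforce

section \<open>The anisotropy bound\<close>

text \<open>One of the three strips always does at least as well as the average: if \<open>s t \<ge> 0\<close> take \<open>(s + t)\<^sup>2\<close>, otherwise
  the larger of \<open>s\<^sup>2\<close> and \<open>t\<^sup>2\<close>.\<close>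

lemma isotropic_bound:
  assumes t: "test_function open_unit_triangle \<phi> \<phi>'"
  shows "pi\<^sup>2 * (s\<^sup>2 + s * t + t\<^sup>2) * sq_int \<phi> \<le> (s\<^sup>2 + s * t) * sq_int (\<lambda>p. fst (\<phi>' p)) + (t\<^sup>2 + s * t) * sq_int (\<lambda>p. snd (\<phi>' p))
    + (- (s * t)) * sq_int (\<lambda>p. fst (\<phi>' p) - snd (\<phi>' p))"
proof -
  have dj: "s\<^sup>2 + s * t + t\<^sup>2 \<le> s\<^sup>2 \<or> s\<^sup>2 + s * t + t\<^sup>2 \<le> t\<^sup>2 \<or> s\<^sup>2 + s * t + t\<^sup>2 \<le> (s + t)\<^sup>2"
  proof -
    have "t * (s + t) \<le> 0 \<or> s * (s + t) \<le> 0 \<or> s * t \<ge> 0"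
      by (auto simp: mult_le_0_iff zero_le_mult_iff)
    then show ?thesis by (simp add: power2_eq_square algebra_simps)
  qed
  have "pi\<^sup>2 * (s\<^sup>2 + s * t + t\<^sup>2) * sq_int \<phi> \<le> B" if "s\<^sup>2 + s * t + t\<^sup>2 \<le> q" "pi\<^sup>2 * q * sq_int \<phi> \<le> B" for q B
  proof -
    have "pi\<^sup>2 * (s\<^sup>2 + s * t + t\<^sup>2) * sq_int \<phi> \<le> pi\<^sup>2 * q * sq_int \<phi>"
      by (intro mult_right_mono mult_left_mono that(1) sq_int_nonneg) simp
    then show ?thesis using that(2) by linarith
  qed
  note mono = this
  note d = direction_bounds[OF t, where s = s and t = t]
  from dj show ?thesis
  proof (elim disjE)
    assume q: "s\<^sup>2 + s * t + t\<^sup>2 \<le> s\<^sup>2"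
    show ?thesis by (rule mono[OF q d(1)])
  next
    assume q: "s\<^sup>2 + s * t + t\<^sup>2 \<le> t\<^sup>2"
    show ?thesis by (rule mono[OF q d(2)])
  next
    assume q: "s\<^sup>2 + s * t + t\<^sup>2 \<le> (s + t)\<^sup>2"
    show ?thesis by (rule mono[OF q d(3)])
  qed
qed

lemma concave_parabola_nonneg:
  fixes a b c k m :: real
  assumes m: "a \<le> m" "m \<le> b" and ab: "a < b" and k: "k\<^sup>2 \<le> 1"
    and q: "d + a\<^sup>2 \<le> (c + k * a)\<^sup>2" "d + b\<^sup>2 \<le> (c + k * b)\<^sup>2"
  shows "d + m\<^sup>2 \<le> (c + k * m)\<^sup>2"
proof -
  have "(b - m) * (d + a\<^sup>2) \<le> (b - m) * (c + k * a)\<^sup>2" "(m - a) * (d + b\<^sup>2) \<le> (m - a) * (c + k * b)\<^sup>2"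
    using m q by (intro mult_left_mono; simp)+
  moreover have "0 \<le> (1 - k\<^sup>2) * ((m - a) * (b - m)) * (b - a)" using m k ab by simp
  moreover have "(b - a) * ((c + k * m)\<^sup>2 - d - m\<^sup>2) = (b - m) * ((c + k * a)\<^sup>2 - (d + a\<^sup>2)) + (m - a) * ((c + k * b)\<^sup>2 - (d + b\<^sup>2))
    + (1 - k\<^sup>2) * ((m - a) * (b - m)) * (b - a)"
    by (simp add: power2_eq_square algebra_simps)
  ultimately have "0 \<le> (b - a) * ((c + k * m)\<^sup>2 - d - m\<^sup>2)" by (simp add: algebra_simps)
  then show ?thesis using ab by (simp add: zero_le_mult_iff)
qed

text \<open>A linear lower bound \<open>s \<ge> c' + k m\<close> with \<open>k \<le> 1\<close> implies the target on an interval as soon as it does so at both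
  end points, because the difference of the two sides is concave in \<open>m\<close>.\<close>

lemma dominated_parabola:
  fixes a b c k m s :: real
  assumes s: "c + 1 / 100 + k * m \<le> s" and m: "a \<le> m" "m \<le> b" and ab: "0 \<le> a" "a < b" and k: "0 \<le> k" "k \<le> 1" and c: "0 \<le> c"
    and q: "(99 / 100)\<^sup>2 + a\<^sup>2 \<le> (c + k * a)\<^sup>2" "(99 / 100)\<^sup>2 + b\<^sup>2 \<le> (c + k * b)\<^sup>2"
  shows "(99 / 100)\<^sup>2 + m\<^sup>2 \<le> (s - 1 / 100)\<^sup>2"
proof -
  have "k\<^sup>2 \<le> 1" using k by (simp add: abs_square_le_1)
  then have "(99 / 100)\<^sup>2 + m\<^sup>2 \<le> (c + k * m)\<^sup>2" by (rule concave_parabola_nonneg[OF m ab(2) _ q])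
  also have "\<dots> \<le> (s - 1 / 100)\<^sup>2" using s c k m ab by (intro power_mono) auto
  finally show ?thesis .
qed

text \<open>All energies are in units of \<open>8\<pi>\<^sup>2 N\<close>. In terms of the increments \<open>u = Y - X\<close> and \<open>v = Z - Y\<close> each known bound
  is a lower bound for \<open>s = X + Y + Z\<close> that is linear in \<open>m\<close>: the half equilateral triangle is best if \<open>v \<le> 2 u\<close>, the right isosceles
  triangle and then the strip in the direction \<open>(1, 1)\<close> if \<open>2 u \<le> v\<close>, all three directions together if \<open>m\<close> is large, and
  perturbation theory if \<open>m\<close> is small. The constants \<open>614/1000\<close> and \<open>4724/10000\<close> are the worst slopes in the
  two sectors, attained at \<open>v = 2 u\<close> and rounded down.\<close>

lemma constraint_inequality:
  fixes X Y Z m :: real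
  assumes o: "X \<le> Y" "Y \<le> Z"
    and m: "m \<ge> 0" "m\<^sup>2 = 4 * (X\<^sup>2 + Y\<^sup>2 + Z\<^sup>2 - X * Y - Y * Z - Z * X)"
    and H: "7 / 6 \<le> 3 * X + Y" and D: "5 / 8 \<le> X + Y" and M: "1 / 2 \<le> 2 * X + 2 * Y - Z"
    and iso: "m + 3 / 8 \<le> X + Y + Z"
    and loc: "\<And>r. 0 \<le> r \<Longrightarrow> r \<le> 1 / 4 \<Longrightarrow> 1 - 485 / 1000 * r\<^sup>2 + r * m \<le> X + Y + Z"
  shows "(99 / 100)\<^sup>2 + m\<^sup>2 \<le> (X + Y + Z - 1 / 100)\<^sup>2"
proof -
  define s where "s = X + Y + Z"
  define u v where "u = Y - X" "v = Z - Y"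
  have uv: "u \<ge> 0" "v \<ge> 0" using o by (simp_all add: u_v_def)
  have muv: "m\<^sup>2 = 4 * (u\<^sup>2 + u * v + v\<^sup>2)" unfolding m(2) u_v_def by (simp add: power2_eq_square algebra_simps)
  have small: ?thesis if "m \<le> 1 / 4"
  proof -
    \<comment> \<open>The choice \<open>r = m\<close>; the square then gains \<open>2 (99/100) (515/1000) > 1\<close> times \<open>m\<^sup>2\<close>.\<close>
    have "1 + 515 / 1000 * m\<^sup>2 \<le> s" using loc[OF m(1) that] by (simp add: s_def power2_eq_square)
    then have "(99 / 100 + 515 / 1000 * m\<^sup>2)\<^sup>2 \<le> (s - 1 / 100)\<^sup>2" by (intro power_mono) auto
    moreover have "(99 / 100 + 515 / 1000 * m\<^sup>2)\<^sup>2 = (99 / 100)\<^sup>2 + 2 * (99 / 100) * (515 / 1000) * m\<^sup>2 + (515 / 1000 * m\<^sup>2)\<^sup>2"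
      by (simp add: power2_sum)
    moreover have "(515 / 1000 * m\<^sup>2)\<^sup>2 \<ge> 0" "m\<^sup>2 \<ge> 0" by simp_all
    ultimately show ?thesis unfolding s_def by linarith
  qed
  have large: ?thesis if "13 / 10 \<le> m"
  proof -
    have "(m + 73 / 200)\<^sup>2 \<le> (s - 1 / 100)\<^sup>2" using iso m(1) by (intro power_mono) (auto simp: s_def)
    moreover have "(m + 73 / 200)\<^sup>2 = m\<^sup>2 + 73 / 100 * m + (73 / 200)\<^sup>2" by (simp add: power2_sum)
    ultimately show ?thesis unfolding s_def using that by (simp add: power2_eq_square)
  qed
  have k: "614 / 1000 * m \<le> (5 * u + 4 * v) / 4" if "v \<le> 2 * u"
  proof (rule power2_le_imp_le)
    have "v * v \<le> 2 * (u * v)" "v * v \<le> 4 * (u * u)"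
      using mult_right_mono[OF that uv(2)] mult_mono[OF that that _ uv(2)] uv by simp_all
    then have "0 \<le> 496008 / 1000000 * (2 * (u * v) - v * v) + 13629 / 1000000 * (4 * (u * u) - v * v) + 1653 / 1000000 * (v * v)"
      by simp
    also have "\<dots> = ((5 * u + 4 * v) / 4)\<^sup>2 - (614 / 1000 * m)\<^sup>2"
      unfolding power_mult_distrib muv by (simp add: power2_eq_square field_simps)
    finally show "(614 / 1000 * m)\<^sup>2 \<le> ((5 * u + 4 * v) / 4)\<^sup>2" by simp
  qed (use uv in simp)
  have k': "4724 / 10000 * m \<le> u / 2 + v" if "2 * u \<le> v"
  proof (rule power2_le_imp_le)
    have "2 * (u * u) \<le> u * v" "4 * (u * u) \<le> v * v"
      using mult_left_mono[OF that uv(1)] mult_mono[OF that that uv(2)] uv by simp_all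
    then have "0 \<le> 10735296 / 100000000 * (u * v - 2 * (u * u)) + 10735296 / 100000000 * (v * v - 4 * (u * u)) + 147072 / 100000000 * (u * u)"
      by simp
    also have "\<dots> = (u / 2 + v)\<^sup>2 - (4724 / 10000 * m)\<^sup>2"
      unfolding power_mult_distrib muv by (simp add: power2_eq_square field_simps)
    finally show "(4724 / 10000 * m)\<^sup>2 \<le> (u / 2 + v)\<^sup>2" by simp
  qed (use uv in simp)
  consider "m \<le> 1 / 4" | "13 / 10 \<le> m" | "v \<le> 2 * u" "1 / 4 \<le> m" "m \<le> 27 / 100" | "v \<le> 2 * u" "27 / 100 \<le> m" "m \<le> 13 / 10"
    | "2 * u \<le> v" "1 / 4 \<le> m" "m \<le> 93 / 100" | "2 * u \<le> v" "93 / 100 \<le> m" "m \<le> 13 / 10" by linarith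
  then show ?thesis unfolding s_def[symmetric]
  proof cases
    case 1 then show "(99 / 100)\<^sup>2 + m\<^sup>2 \<le> (s - 1 / 100)\<^sup>2" using small by (simp add: s_def)
  next
    case 2 then show "(99 / 100)\<^sup>2 + m\<^sup>2 \<le> (s - 1 / 100)\<^sup>2" using large by (simp add: s_def)
  next
    case 3
    have "1 - 485 / 1000 * (1 / 4)\<^sup>2 + 1 / 4 * m \<le> s" unfolding s_def by (rule loc) auto
    then have "(1 - 485 / 16000 - 1 / 100) + 1 / 100 + 1 / 4 * m \<le> s" by (simp add: power2_eq_square)
    then show "(99 / 100)\<^sup>2 + m\<^sup>2 \<le> (s - 1 / 100)\<^sup>2"
      by (rule dominated_parabola[OF _ 3(2,3)]) (simp_all add: power2_eq_square)
  next
    case 4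
    have "7 / 8 + (5 * u + 4 * v) / 4 \<le> s" using H unfolding s_def u_v_def by (simp add: field_simps)
    then have "(7 / 8 - 1 / 100) + 1 / 100 + 614 / 1000 * m \<le> s" using k[OF 4(1)] by linarith
    then show "(99 / 100)\<^sup>2 + m\<^sup>2 \<le> (s - 1 / 100)\<^sup>2"
      by (rule dominated_parabola[OF _ 4(2,3)]) (simp_all add: power2_eq_square)
  next
    case 5
    have "15 / 16 + (u / 2 + v) \<le> s" using D unfolding s_def u_v_def by (simp add: field_simps)
    then have "(15 / 16 - 1 / 100) + 1 / 100 + 4724 / 10000 * m \<le> s" using k'[OF 5(1)] by linarith
    then show "(99 / 100)\<^sup>2 + m\<^sup>2 \<le> (s - 1 / 100)\<^sup>2"
      by (rule dominated_parabola[OF _ 5(2,3)]) (simp_all add: power2_eq_square)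
  next
    case 6
    have "1 / 2 + 2 * (u / 2 + v) \<le> s" using M unfolding s_def u_v_def by (simp add: field_simps)
    moreover have "2 * (4724 / 10000 * m) \<le> 2 * (u / 2 + v)" by (rule mult_left_mono[OF k'[OF 6(1)]]) simp
    ultimately have "(1 / 2 - 1 / 100) + 1 / 100 + 9448 / 10000 * m \<le> s" by simp
    then show "(99 / 100)\<^sup>2 + m\<^sup>2 \<le> (s - 1 / 100)\<^sup>2"
      by (rule dominated_parabola[OF _ 6(2,3)]) (simp_all add: power2_eq_square)
  qed
qed

text \<open>The spread of the energies, equal to \<open>2 ((X - Y)\<^sup>2 + (Y - Z)\<^sup>2 + (Z - X)\<^sup>2)\<close>. The difference
  \<open>(X + Y + Z)\<^sup>2 - anisotropy X Y Z\<close> is twelve times the determinant of the Gram matrix of the gradient.\<close>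

definition anisotropy :: "real \<Rightarrow> real \<Rightarrow> real \<Rightarrow> real" where
  "anisotropy X Y Z = 4 * (X\<^sup>2 + Y\<^sup>2 + Z\<^sup>2 - X * Y - Y * Z - Z * X)"

lemma isotropic_discriminant:
  assumes "energies N X Y Z"
  shows "pi\<^sup>2 * N \<le> X" "pi\<^sup>2 * N \<le> Y" "pi\<^sup>2 * N \<le> Z"
    and "anisotropy X Y Z \<le> (X + Y + Z - 3 * (pi\<^sup>2 * N))\<^sup>2"
proof -
  obtain \<phi> \<phi>' where t: "test_function open_unit_triangle \<phi> \<phi>'" and E: "N = sq_int \<phi>"
     "X = sq_int (\<lambda>p. fst (\<phi>' p))" "Y = sq_int (\<lambda>p. snd (\<phi>' p))" "Z = sq_int (\<lambda>p. fst (\<phi>' p) - snd (\<phi>' p))"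
    using assms unfolding energies_def by blast
  define k where "k = pi\<^sup>2 * N"
  have iso: "(s\<^sup>2 + s * t + t\<^sup>2) * k \<le> (s\<^sup>2 + s * t) * X + (t\<^sup>2 + s * t) * Y - s * t * Z" for s t
    using isotropic_bound[OF t, of s t] unfolding E[symmetric] k_def by (simp add: algebra_simps)
  show "pi\<^sup>2 * N \<le> X" "pi\<^sup>2 * N \<le> Y" "pi\<^sup>2 * N \<le> Z"
    using iso[of 1 0] iso[of 0 1] iso[of 1 "-1"] by (simp_all add: k_def)
  have "((X + Y - Z - k) / 2)\<^sup>2 \<le> (X - k) * (Y - k)"
  proof (rule nonneg_quadratic_discriminant)
    show "0 \<le> (X - k) + 2 * t * ((X + Y - Z - k) / 2) + t\<^sup>2 * (Y - k)" for t
      using iso[of 1 t] by (simp add: field_simps)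
  qed
  then show "anisotropy X Y Z \<le> (X + Y + Z - 3 * (pi\<^sup>2 * N))\<^sup>2"
    unfolding k_def[symmetric] anisotropy_def by (simp add: power2_eq_square field_simps)
qed

text \<open>In the local regime the weights are chosen proportional to the deviations of the energies from their mean, with the negative sign,
  which is the worst direction: then the weighted sum is \<open>X + Y + Z - r m\<close>.\<close>

lemma anisotropy_bound_sorted:
  assumes E: "energies N X Y Z" and N: "N > 0" and o: "X \<le> Y" "Y \<le> Z"
  defines "K \<equiv> 8 * pi\<^sup>2 * N"
  shows "(99 / 100 * K)\<^sup>2 + anisotropy X Y Z \<le> (X + Y + Z - K / 100)\<^sup>2"
proof -
  obtain \<phi> \<phi>' where t: "test_function open_unit_triangle \<phi> \<phi>'" and e: "N = sq_int \<phi>"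
     "X = sq_int (\<lambda>p. fst (\<phi>' p))" "Y = sq_int (\<lambda>p. snd (\<phi>' p))" "Z = sq_int (\<lambda>p. fst (\<phi>' p) - snd (\<phi>' p))"
    using E unfolding energies_def by blast
  have K: "K > 0" using N by (simp add: K_def)
  have k: "pi\<^sup>2 * N = K / 8" by (simp add: K_def)
  define x y z where "x = X / K" "y = Y / K" "z = Z / K"
  have XYZ: "X = K * x" "Y = K * y" "Z = K * z" using K by (simp_all add: x_y_z_def)
  have an: "anisotropy X Y Z = K\<^sup>2 * anisotropy x y z" unfolding XYZ anisotropy_def by (simp add: power2_eq_square algebra_simps)
  have an0: "anisotropy x y z = 2 * ((x - y)\<^sup>2 + (y - z)\<^sup>2 + (z - x)\<^sup>2)" for x y z
    by (simp add: anisotropy_def power2_eq_square algebra_simps)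
  have anp: "anisotropy x y z \<ge> 0" unfolding an0 by simp
  define m where "m = sqrt (anisotropy x y z)"
  have m: "m \<ge> 0" "m\<^sup>2 = anisotropy x y z" using anp by (simp_all add: m_def)
  note I = isotropic_discriminant[OF E, unfolded k]
  have bounds: "1 / 8 \<le> x" "1 / 8 \<le> y" "1 / 8 \<le> z"
    using I(1-3) K unfolding XYZ by (simp_all add: field_simps)
  have "(99 / 100)\<^sup>2 + m\<^sup>2 \<le> (x + y + z - 1 / 100)\<^sup>2"
  proof (rule constraint_inequality[OF _ _ m(1)])
    show "x \<le> y" "y \<le> z" using o K unfolding XYZ by simp_all
    show "m\<^sup>2 = 4 * (x\<^sup>2 + y\<^sup>2 + z\<^sup>2 - x * y - y * z - z * x)" unfolding m(2) anisotropy_def ..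
    have "28 / 3 * pi\<^sup>2 * N \<le> 3 * X + Y" using half_equilateral_bound[OF t] unfolding e .
    then have "K * (7 / 6) \<le> K * (3 * x + y)" unfolding XYZ K_def by (simp add: algebra_simps)
    then show "7 / 6 \<le> 3 * x + y" using K by (simp only: mult_le_cancel_left_pos)
    have "5 * pi\<^sup>2 * N \<le> X + Y" using right_isosceles_bound[OF t] unfolding e .
    then have "K * (5 / 8) \<le> K * (x + y)" unfolding XYZ K_def by (simp add: algebra_simps)
    then show "5 / 8 \<le> x + y" using K by (simp only: mult_le_cancel_left_pos)
    have "pi\<^sup>2 * (1 + 1)\<^sup>2 * N \<le> (1\<^sup>2 + 1 * 1) * X + (1\<^sup>2 + 1 * 1) * Y + - (1 * 1) * Z" using direction_bounds(3)[OF t, of 1 1] unfolding e .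
    then have "K * (1 / 2) \<le> K * (2 * x + 2 * y - z)" unfolding XYZ K_def by (simp add: algebra_simps)
    then show "1 / 2 \<le> 2 * x + 2 * y - z" using K by (simp only: mult_le_cancel_left_pos)
    have "K\<^sup>2 * m\<^sup>2 \<le> K\<^sup>2 * (x + y + z - 3 / 8)\<^sup>2"
      using I(4) unfolding an m(2) unfolding XYZ by (simp add: power2_eq_square algebra_simps)
    then have "m\<^sup>2 \<le> (x + y + z - 3 / 8)\<^sup>2" using K by (simp only: mult_le_cancel_left_pos zero_less_power)
    then have "m \<le> x + y + z - 3 / 8" by (rule power2_le_imp_le) (use bounds in linarith)
    then show "m + 3 / 8 \<le> x + y + z" by simp
    fix r :: real assume r: "0 \<le> r" "r \<le> 1 / 4"
    show "1 - 485 / 1000 * r\<^sup>2 + r * m \<le> x + y + z"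
    proof (cases "m = 0")
      case True
      have "(1 - 485 / 1000 * 0\<^sup>2) * (8 * pi\<^sup>2) * N \<le> (1 + 0) * X + (1 + 0) * Y + (1 + 0) * Z"
        unfolding e by (rule near_isotropic_bound[OF t]) auto
      then have "K * 1 \<le> K * (x + y + z)" unfolding XYZ K_def by (simp add: algebra_simps)
      then have "1 \<le> x + y + z" using K by (simp only: mult_le_cancel_left_pos)
      moreover have "r\<^sup>2 \<ge> 0" by simp
      moreover have "r * m = 0" using True by simp
      ultimately show ?thesis by linarith
    next
      case False
      \<comment> \<open>The factor makes the sum of the squares of the weights equal to \<open>6 r\<^sup>2\<close>.\<close>
      define c where "c = - (6 * r / m)"
      define \<mu> where "\<mu> = (x + y + z) / 3"
      have \<mu>: "x + y + z = 3 * \<mu>" by (simp add: \<mu>_def)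
      have var: "(x - \<mu>)\<^sup>2 + (y - \<mu>)\<^sup>2 + (z - \<mu>)\<^sup>2 = m\<^sup>2 / 6"
        unfolding m(2) anisotropy_def \<mu>_def by (simp add: power2_eq_square field_simps)
      have cm: "c * m = - (6 * r)" using False by (simp add: c_def)
      have "(1 - 485 / 1000 * r\<^sup>2) * (8 * pi\<^sup>2) * N \<le> (1 + c * (x - \<mu>)) * X + (1 + c * (y - \<mu>)) * Y + (1 + c * (z - \<mu>)) * Z"
        unfolding e
      proof (rule near_isotropic_bound[OF t _ _ r])
        show "c * (x - \<mu>) + c * (y - \<mu>) + c * (z - \<mu>) = 0"
          unfolding distrib_left[symmetric] using \<mu> by simp
        have "(c * (x - \<mu>))\<^sup>2 + (c * (y - \<mu>))\<^sup>2 + (c * (z - \<mu>))\<^sup>2 = c\<^sup>2 * ((x - \<mu>)\<^sup>2 + (y - \<mu>)\<^sup>2 + (z - \<mu>)\<^sup>2)"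
          by (simp add: power_mult_distrib distrib_left)
        also have "\<dots> = (c * m)\<^sup>2 / 6" unfolding var by (simp add: power_mult_distrib)
        also have "\<dots> = 6 * r\<^sup>2" unfolding cm by (simp add: power_mult_distrib)
        finally show "(c * (x - \<mu>))\<^sup>2 + (c * (y - \<mu>))\<^sup>2 + (c * (z - \<mu>))\<^sup>2 = 6 * r\<^sup>2" .
      qed
      then have "K * (1 - 485 / 1000 * r\<^sup>2) \<le> K * ((1 + c * (x - \<mu>)) * x + (1 + c * (y - \<mu>)) * y + (1 + c * (z - \<mu>)) * z)"
        unfolding XYZ K_def by (simp add: algebra_simps)
      then have "1 - 485 / 1000 * r\<^sup>2 \<le> (1 + c * (x - \<mu>)) * x + (1 + c * (y - \<mu>)) * y + (1 + c * (z - \<mu>)) * z"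
        using K by (simp only: mult_le_cancel_left_pos)
      also have "\<dots> = (x + y + z) + c * ((x - \<mu>)\<^sup>2 + (y - \<mu>)\<^sup>2 + (z - \<mu>)\<^sup>2) + c * \<mu> * (x + y + z - 3 * \<mu>)"
        by (simp add: power2_eq_square algebra_simps)
      also have "\<dots> = (x + y + z) + c * m * m / 6" unfolding var \<mu> by (simp add: power2_eq_square)
      also have "\<dots> = (x + y + z) - r * m" unfolding cm by simp
      finally show ?thesis by simp
    qed
  qed
  then have "K\<^sup>2 * ((99 / 100)\<^sup>2 + m\<^sup>2) \<le> K\<^sup>2 * (x + y + z - 1 / 100)\<^sup>2" by (intro mult_left_mono) auto
  moreover have "X + Y + Z - K / 100 = K * (x + y + z - 1 / 100)" unfolding XYZ by (simp add: algebra_simps)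
  then have "(X + Y + Z - K / 100)\<^sup>2 = K\<^sup>2 * (x + y + z - 1 / 100)\<^sup>2" by (simp only: power_mult_distrib)
  moreover have "(99 / 100 * K)\<^sup>2 + K\<^sup>2 * m\<^sup>2 = K\<^sup>2 * ((99 / 100)\<^sup>2 + m\<^sup>2)" by (simp add: power2_eq_square field_simps)
  ultimately show ?thesis unfolding an m(2)[symmetric] by simp
qed

lemma energies_permute:
  assumes E: "energies N X Y Z"
    and p: "(A, B, C) \<in> {(X, Y, Z), (Y, Z, X), (Z, X, Y), (Y, X, Z), (X, Z, Y), (Z, Y, X)}"
  shows "\<exists>D>0. energies (D * N) (D * A) (D * B) (D * C)"
proof -
  have rot: "\<exists>D>0. energies (D * N) (D * Y) (D * Z) (D * X)" if r: "\<exists>D>0. energies (D * N) (D * X) (D * Y) (D * Z)" for X Y Z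
  proof -
    obtain D where D: "D > 0" "energies (D * N) (D * X) (D * Y) (D * Z)" using r by blast
    obtain D' where "D' > 0" "energies (D' * (D * N)) (D' * (D * Y)) (D' * (D * Z)) (D' * (D * X))"
      using energies_rotate[OF D(2)] by blast
    then show ?thesis using D(1) by (intro exI[of _ "D' * D"]) (simp add: mult.assoc)
  qed
  have id: "\<exists>D>0. energies (D * N) (D * X) (D * Y) (D * Z)" using E by (intro exI[of _ 1]) simp
  note s = energies_swap[OF E]
  show ?thesis
    using p id rot[OF id] rot[OF rot[OF id]] s rot[OF s] rot[OF rot[OF s]] by auto
qed

text \<open>Both sides are symmetric and homogeneous, so the energies may be sorted by a relabelling of the vertices.\<close>

lemma anisotropy_bound:
  assumes E: "energies N X Y Z" and N: "N > 0"
  defines "K \<equiv> 8 * pi\<^sup>2 * N"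
  shows "(99 / 100 * K)\<^sup>2 + anisotropy X Y Z \<le> (X + Y + Z - K / 100)\<^sup>2"
proof -
  have main: ?thesis
    if p: "(A, B, C) \<in> {(X, Y, Z), (Y, Z, X), (Z, X, Y), (Y, X, Z), (X, Z, Y), (Z, Y, X)}" and o: "A \<le> B" "B \<le> C" for A B C
  proof -
  obtain D where D: "D > 0" "energies (D * N) (D * A) (D * B) (D * C)" using energies_permute[OF E p] by blast
  have "(99 / 100 * (8 * pi\<^sup>2 * (D * N)))\<^sup>2 + anisotropy (D * A) (D * B) (D * C) \<le> (D * A + D * B + D * C - 8 * pi\<^sup>2 * (D * N) / 100)\<^sup>2"
    by (rule anisotropy_bound_sorted[OF D(2)]) (use D(1) N o in auto)
  moreover have "(99 / 100 * (8 * pi\<^sup>2 * (D * N)))\<^sup>2 = D\<^sup>2 * (99 / 100 * K)\<^sup>2"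
  proof -
    have "99 / 100 * (8 * pi\<^sup>2 * (D * N)) = D * (99 / 100 * K)" by (simp add: K_def)
    then show ?thesis by (simp only: power_mult_distrib)
  qed
  moreover have "anisotropy (D * A) (D * B) (D * C) = D\<^sup>2 * anisotropy A B C" by (simp add: anisotropy_def power2_eq_square algebra_simps)
  moreover have "(D * A + D * B + D * C - 8 * pi\<^sup>2 * (D * N) / 100)\<^sup>2 = D\<^sup>2 * (A + B + C - K / 100)\<^sup>2"
  proof -
    have "D * A + D * B + D * C - 8 * pi\<^sup>2 * (D * N) / 100 = D * (A + B + C - K / 100)" by (simp add: K_def algebra_simps)
    then show ?thesis by (simp only: power_mult_distrib)
  qed
  ultimately have "D\<^sup>2 * ((99 / 100 * K)\<^sup>2 + anisotropy A B C) \<le> D\<^sup>2 * (A + B + C - K / 100)\<^sup>2" by (simp add: distrib_left)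
  then have "(99 / 100 * K)\<^sup>2 + anisotropy A B C \<le> (A + B + C - K / 100)\<^sup>2"
    using D(1) by (simp only: mult_le_cancel_left_pos zero_less_power)
  moreover have "anisotropy A B C = anisotropy X Y Z" "A + B + C = X + Y + Z"
    using p by (auto simp: anisotropy_def algebra_simps)
  ultimately show ?thesis by simp
  qed
  consider "X \<le> Y" "Y \<le> Z" | "Y \<le> Z" "Z \<le> X" | "Z \<le> X" "X \<le> Y" | "Y \<le> X" "X \<le> Z" | "X \<le> Z" "Z \<le> Y" | "Z \<le> Y" "Y \<le> X"
    by linarith
  then show ?thesis
  proof cases
    case 1 then show ?thesis by (intro main[of X Y Z]) simp_all
  next
    case 2 then show ?thesis by (intro main[of Y Z X]) simp_all
  next
    case 3 then show ?thesis by (intro main[of Z X Y]) simp_all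
  next
    case 4 then show ?thesis by (intro main[of Y X Z]) simp_all
  next
    case 5 then show ?thesis by (intro main[of X Z Y]) simp_all
  next
    case 6 then show ?thesis by (intro main[of Z Y X]) simp_all
  qed
qed

section \<open>Bounds for the eigenvalue and the perimeter of a triangle\<close>

text \<open>The inequality \<open>tr (A B) \<ge> 2 \<surd>(det A det B)\<close> for positive matrices of order two, with \<open>det A = 1/4\<close>.\<close>

lemma trace_product_lower:
  fixes a b c A B W d :: real
  assumes ab: "a > 0" "b > 0" "a * b - c\<^sup>2 = 1 / 4" and AB: "A \<ge> 0" "B \<ge> 0" "d\<^sup>2 \<le> A * B - W\<^sup>2 / 4" and d: "d \<ge> 0"
  shows "d \<le> a * A + b * B - c * W"
proof -
  have "(c * W + d)\<^sup>2 \<le> (c * W + d)\<^sup>2 + (2 * c * d - W / 2)\<^sup>2" by simp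
  also have "\<dots> = 4 * ((c\<^sup>2 + 1 / 4) * (d\<^sup>2 + W\<^sup>2 / 4))" by (simp add: power2_eq_square field_simps)
  also have "\<dots> \<le> 4 * ((a * b) * (A * B))"
    using ab AB by (intro mult_left_mono mult_mono) auto
  also have "\<dots> \<le> (a * A + b * B)\<^sup>2"
  proof -
    have "(a * A + b * B)\<^sup>2 = 4 * ((a * b) * (A * B)) + (a * A - b * B)\<^sup>2" by (simp add: power2_eq_square algebra_simps)
    then show ?thesis by simp
  qed
  finally have "c * W + d \<le> a * A + b * B" by (rule power2_le_imp_le) (use ab AB in simp)
  then show ?thesis by simp
qed

text \<open>The inequality of Finsler and Hadwiger in terms of \<open>D\<close>, twice the area. With \<open>p = y + z\<close>, \<open>q = z + x\<close>, \<open>r = x + y\<close> it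
  becomes \<open>(x y + y z + z x)\<^sup>2 \<ge> 3 x y z (x + y + z)\<close>.\<close>

lemma Finsler_Hadwiger:
  fixes p q r D :: real
  assumes t: "p \<le> q + r" "q \<le> r + p" "r \<le> p + q" and D: "4 * D\<^sup>2 = 4 * p\<^sup>2 * q\<^sup>2 - (p\<^sup>2 + q\<^sup>2 - r\<^sup>2)\<^sup>2"
  shows "2 * sqrt 3 * D \<le> 2 * (p * q + q * r + r * p) - (p\<^sup>2 + q\<^sup>2 + r\<^sup>2)"
proof -
  define x y z where "x = (q + r - p) / 2" "y = (r + p - q) / 2" "z = (p + q - r) / 2"
  have nn: "x \<ge> 0" "y \<ge> 0" "z \<ge> 0" using t by (simp_all add: x_y_z_def)
  have pqr: "p = y + z" "q = z + x" "r = x + y" by (simp_all add: x_y_z_def field_simps)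
  have R: "2 * (p * q + q * r + r * p) - (p\<^sup>2 + q\<^sup>2 + r\<^sup>2) = 4 * (x * y + y * z + z * x)"
    unfolding pqr by (simp add: power2_eq_square algebra_simps)
  have D': "4 * D\<^sup>2 = 16 * (x * y * z * (x + y + z))" unfolding D pqr by (simp add: power2_eq_square algebra_simps)
  have "(2 * sqrt 3 * D)\<^sup>2 = 3 * (4 * D\<^sup>2)" by (simp add: power_mult_distrib)
  also have "\<dots> = 48 * (x * y * z * (x + y + z))" unfolding D' by simp
  also have "\<dots> \<le> (4 * (x * y + y * z + z * x))\<^sup>2"
  proof -
    have "(4 * (x * y + y * z + z * x))\<^sup>2 - 48 * (x * y * z * (x + y + z))
      = 8 * ((x * y - y * z)\<^sup>2 + (y * z - z * x)\<^sup>2 + (z * x - x * y)\<^sup>2)"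
      by (simp add: power2_eq_square algebra_simps)
    also have "\<dots> \<ge> 0" by simp
    finally show ?thesis by simp
  qed
  finally show ?thesis unfolding R by (rule power2_le_imp_le) (use nn in simp)
qed

context triangle
begin

definition "distortion = 2 * (cx + cy + cz) / sqrt 3"

definition "ground = 4 * pi\<^sup>2 / sqrt 3"

lemma ground_distortion: "ground * distortion = 8 / 3 * pi\<^sup>2 * (cx + cy + cz)"
proof -
  have "ground * distortion = 8 * pi\<^sup>2 * (cx + cy + cz) / (sqrt 3 * sqrt 3)"
    unfolding ground_def distortion_def by simp
  then show ?thesis by simp
qed

text \<open>The energies are lowered by \<open>K/300\<close> each; by the anisotropy bound the determinant of the lowered matrix is still at
  least the one of the isotropic case times \<open>(99/100)\<^sup>2\<close>. The subtracted part contributes \<open>K/300\<close> times the sum of the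
  weights, which is the term with the distortion.\<close>

lemma qform_lower:
  assumes t: "test_function open_unit_triangle \<phi> \<phi>'"
  shows "ground * (99 / 100 + distortion / 100) * sq_int \<phi> \<le> qform \<phi>'"
proof (cases "sq_int \<phi> = 0")
  case True
  have "0 \<le> sq_int (\<lambda>p. fst (\<phi>' p)) + sq_int (\<lambda>p. snd (\<phi>' p))" by (intro add_nonneg_nonneg sq_int_nonneg)
  also have "\<dots> \<le> 4 * (cx + cy + 2 * cz) * qform \<phi>'" by (rule qform_coercive[OF t])
  finally have "0 \<le> 4 * (cx + cy + 2 * cz) * qform \<phi>'" .
  moreover have "0 < 4 * (cx + cy + 2 * cz)" using coeff_pos by simp
  ultimately have "0 \<le> qform \<phi>'" by (simp only: zero_le_mult_iff) linarith
  then show ?thesis using True by simp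
next
  case False
  define N X Y Z where "N = sq_int \<phi>" "X = sq_int (\<lambda>p. fst (\<phi>' p))" "Y = sq_int (\<lambda>p. snd (\<phi>' p))" "Z = sq_int (\<lambda>p. fst (\<phi>' p) - snd (\<phi>' p))"
  have N: "N > 0" using False sq_int_nonneg[of \<phi>] by (simp add: N_X_Y_Z_def)
  have E: "energies N X Y Z" unfolding energies_def N_X_Y_Z_def using t by blast
  define K where "K = 8 * pi\<^sup>2 * N"
  have K: "K > 0" using N by (simp add: K_def)
  define X' Y' Z' where "X' = X - K / 300" "Y' = Y - K / 300" "Z' = Z - K / 300"
  have "pi\<^sup>2 * N = K / 8" by (simp add: K_def)
  then have XY: "X' \<ge> 0" "Y' \<ge> 0" using isotropic_discriminant(1,2)[OF E] K by (simp_all add: X'_Y'_Z'_def)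
  have key: "(99 / 100 * K)\<^sup>2 + anisotropy X Y Z \<le> (X + Y + Z - K / 100)\<^sup>2"
    using anisotropy_bound[OF E N] by (simp add: K_def)
  define W where "W = X' + Y' - Z'"
  define d where "d = 99 / 100 * K / (2 * sqrt 3)"
  have d2: "d\<^sup>2 = (99 / 100 * K)\<^sup>2 / 12" by (simp add: d_def power_divide power_mult_distrib)
  have "12 * (X' * Y' - W\<^sup>2 / 4) = (X + Y + Z - K / 100)\<^sup>2 - anisotropy X Y Z"
    unfolding W_def X'_Y'_Z'_def anisotropy_def by (simp add: power2_eq_square field_simps)
  then have dW: "d\<^sup>2 \<le> X' * Y' - W\<^sup>2 / 4" using key unfolding d2 by simp
  have "(cx + cz) * (cy + cz) - cz\<^sup>2 = 1 / 4" using coeff_det by (simp add: power2_eq_square algebra_simps)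
  from trace_product_lower[OF coeff_pos this XY dW]
  have "d \<le> (cx + cz) * X' + (cy + cz) * Y' - cz * W" using K by (simp add: d_def)
  also have "\<dots> = qform \<phi>' - K / 300 * (cx + cy + cz)"
    unfolding qform_def N_X_Y_Z_def(2-4)[symmetric] W_def X'_Y'_Z'_def by (simp add: algebra_simps)
  finally have "d + K / 300 * (cx + cy + cz) \<le> qform \<phi>'" by simp
  moreover have "d + K / 300 * (cx + cy + cz) = ground * (99 / 100 + distortion / 100) * N"
  proof -
    have "ground * (99 / 100 + distortion / 100) * N = 99 / 100 * (ground * N) + (ground * distortion) * N / 100"
      by (simp add: field_simps)
    then show ?thesis unfolding ground_distortion d_def K_def unfolding ground_def by (simp add: field_simps)
  qed
  ultimately show ?thesis by (simp add: N_X_Y_Z_def)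
qed

lemma eigenvalue_lower: "ground * (99 / 100 + distortion / 100) \<le> tri_area a b c * tri_eigenvalue a b c"
  by (rule le_eigenvalue[OF test_function_exists qform_lower])

text \<open>The same test function may be used in the three positions that arise by cyclic relabelling; the sum of the three
  inequalities contains only the sum of the weights.\<close>

lemma eigenvalue_upper: "tri_area a b c * tri_eigenvalue a b c \<le> ground * distortion"
proof -
  define M where "M = tri_area a b c * tri_eigenvalue a b c"
  define \<sigma> where "\<sigma> = cx + cy + cz"
  have avg: "3 * (M * N) \<le> \<sigma> * (X + Y + Z)" if E: "energies N X Y Z" for N X Y Z
  proof -
    have le: "M * N \<le> cx * A + cy * B + cz * C"
      if p: "(A, B, C) \<in> {(X, Y, Z), (Y, Z, X), (Z, X, Y), (Y, X, Z), (X, Z, Y), (Z, Y, X)}" for A B C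
    proof -
      obtain D where D: "D > 0" "energies (D * N) (D * A) (D * B) (D * C)" using energies_permute[OF E p] by blast
      then obtain \<phi> \<phi>' where t: "test_function open_unit_triangle \<phi> \<phi>'" and e: "D * N = sq_int \<phi>"
        "D * A = sq_int (\<lambda>p. fst (\<phi>' p))" "D * B = sq_int (\<lambda>p. snd (\<phi>' p))" "D * C = sq_int (\<lambda>p. fst (\<phi>' p) - snd (\<phi>' p))"
        unfolding energies_def by blast
      have "M * (D * N) \<le> cx * (D * A) + cy * (D * B) + cz * (D * C)"
        using eigenvalue_le[OF test_function_exists t] unfolding M_def e qform_def .
      then have "D * (M * N) \<le> D * (cx * A + cy * B + cz * C)" by (simp add: algebra_simps)
      then show ?thesis using D(1) by (simp only: mult_le_cancel_left_pos)
    qed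
    have "M * N \<le> cx * X + cy * Y + cz * Z" "M * N \<le> cx * Y + cy * Z + cz * X" "M * N \<le> cx * Z + cy * X + cz * Y"
      by (rule le, simp)+
    then show ?thesis unfolding \<sigma>_def by (simp add: algebra_simps)
  qed
  have \<sigma>: "\<sigma> > 0"
  proof -
    have "(norm (b - a))\<^sup>2 + (norm (c - a))\<^sup>2 - (b - a) \<bullet> (c - a) > 0"
    proof -
      have "(norm (b - a - (c - a)))\<^sup>2 = (norm (b - a))\<^sup>2 + (norm (c - a))\<^sup>2 - 2 * ((b - a) \<bullet> (c - a))"
        by (simp only: power2_norm_eq_inner inner_diff_left inner_diff_right inner_commute) (simp add: algebra_simps)
      moreover have "b - a \<noteq> 0" using edge_det by (auto simp: edge_det_def)
      then have "(norm (b - a))\<^sup>2 > 0" by simp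
      moreover have "(norm (b - a - (c - a)))\<^sup>2 \<ge> 0" "(norm (c - a))\<^sup>2 \<ge> 0" by simp_all
      ultimately show ?thesis by linarith
    qed
    then have "((norm (b - a))\<^sup>2 + (norm (c - a))\<^sup>2 - (b - a) \<bullet> (c - a)) / (2 * \<bar>edge_det\<bar>) > 0" using edge_det by simp
    also have "((norm (b - a))\<^sup>2 + (norm (c - a))\<^sup>2 - (b - a) \<bullet> (c - a)) / (2 * \<bar>edge_det\<bar>) = \<sigma>"
      unfolding \<sigma>_def cx_def cy_def cz_def by (simp add: add_divide_distrib diff_divide_distrib)
    finally show ?thesis .
  qed
  have gd: "ground * distortion = 8 / 3 * pi\<^sup>2 * \<sigma>"
    unfolding \<sigma>_def by (rule ground_distortion)
  have "M \<le> 8 / 3 * pi\<^sup>2 * \<sigma>"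
  proof (cases "M \<le> 0")
    case True
    moreover have "0 \<le> 8 / 3 * pi\<^sup>2 * \<sigma>" using \<sigma> by simp
    ultimately show ?thesis by linarith
  next
    case False
    show ?thesis
    proof (rule field_le_epsilon)
      fix e :: real assume e: "0 < e"
      \<comment> \<open>The loss \<open>6 \<epsilon>\<close> in the norm is multiplied by \<open>M\<close> and has to stay below \<open>3 e / 4\<close>.\<close>
      define \<epsilon> where "\<epsilon> = e / (8 * M)"
      have "\<epsilon> > 0" using e False by (simp add: \<epsilon>_def)
      from truncated_ground_state[OF this] obtain \<phi> \<phi>' where t: "test_function open_unit_triangle \<phi> \<phi>'" and N: "3 / 4 - 6 * \<epsilon> \<le> sq_int \<phi>"
        and S: "sq_int (\<lambda>p. fst (\<phi>' p)) + sq_int (\<lambda>p. snd (\<phi>' p)) + sq_int (\<lambda>p. fst (\<phi>' p) - snd (\<phi>' p)) \<le> 8 * pi\<^sup>2 * (3 / 4)" by blast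
      have "energies (sq_int \<phi>) (sq_int (\<lambda>p. fst (\<phi>' p))) (sq_int (\<lambda>p. snd (\<phi>' p))) (sq_int (\<lambda>p. fst (\<phi>' p) - snd (\<phi>' p)))"
        unfolding energies_def using t by blast
      from avg[OF this] have "3 * (M * sq_int \<phi>) \<le> \<sigma> * (8 * pi\<^sup>2 * (3 / 4))"
        using mult_left_mono[OF S, of \<sigma>] \<sigma> by linarith
      moreover have "M * (3 / 4 - 6 * \<epsilon>) \<le> M * sq_int \<phi>" using N False by (intro mult_left_mono) auto
      moreover have "M * (3 / 4 - 6 * \<epsilon>) = 3 / 4 * M - 3 / 4 * e" using False by (simp add: \<epsilon>_def field_simps)
      ultimately show "M \<le> 8 / 3 * pi\<^sup>2 * \<sigma> + e" by (simp add: algebra_simps)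
    qed
  qed
  then show ?thesis unfolding gd M_def .
qed

lemma sides:
  defines "p \<equiv> dist a b" and "q \<equiv> dist c a" and "r \<equiv> dist b c"
  shows "cx + cy + cz = (p\<^sup>2 + q\<^sup>2 + r\<^sup>2) / (4 * \<bar>edge_det\<bar>)"
    and "4 * \<bar>edge_det\<bar>\<^sup>2 = 4 * p\<^sup>2 * q\<^sup>2 - (p\<^sup>2 + q\<^sup>2 - r\<^sup>2)\<^sup>2"
proof -
  have pq: "p = norm (b - a)" "q = norm (c - a)" by (simp_all add: p_def q_def dist_norm norm_minus_commute)
  have "r = norm ((b - a) - (c - a))" by (simp add: r_def dist_norm)
  then have "r\<^sup>2 = p\<^sup>2 + q\<^sup>2 - 2 * ((b - a) \<bullet> (c - a))"
    unfolding pq by (simp only: power2_norm_eq_inner inner_diff_left inner_diff_right inner_commute) (simp add: algebra_simps)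
  then have ef: "(b - a) \<bullet> (c - a) = (p\<^sup>2 + q\<^sup>2 - r\<^sup>2) / 2" by simp
  have "cx + cy + cz = (p\<^sup>2 + q\<^sup>2 - (p\<^sup>2 + q\<^sup>2 - r\<^sup>2) / 2) / (2 * \<bar>edge_det\<bar>)"
    unfolding cx_def cy_def cz_def ef pq[symmetric] by (simp add: add_divide_distrib diff_divide_distrib)
  also have "\<dots> = (p\<^sup>2 + q\<^sup>2 + r\<^sup>2) / (4 * \<bar>edge_det\<bar>)" using edge_det by (simp add: field_simps)
  finally show "cx + cy + cz = (p\<^sup>2 + q\<^sup>2 + r\<^sup>2) / (4 * \<bar>edge_det\<bar>)" .
  show "4 * \<bar>edge_det\<bar>\<^sup>2 = 4 * p\<^sup>2 * q\<^sup>2 - (p\<^sup>2 + q\<^sup>2 - r\<^sup>2)\<^sup>2"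
    using Lagrange unfolding ef pq[symmetric] by (simp add: power_divide)
qed

text \<open>With \<open>S\<close> the sum of the squares and \<open>Q\<close> the sum of the products of the sides, the squared perimeter is \<open>S + 2 Q\<close>; the two
  comparisons are \<open>Q \<le> S\<close> and the inequality of Finsler and Hadwiger.\<close>

lemma deficit_bounds:
  shows "0 \<le> isoperimetric_deficit a b c" "isoperimetric_deficit a b c \<le> distortion - 1" "2 / 3 * (distortion - 1) \<le> isoperimetric_deficit a b c"
proof -
  define p q r where "p = dist a b" "q = dist c a" "r = dist b c"
  define D where "D = \<bar>edge_det\<bar>"
  have D: "D > 0" using edge_det by (simp add: D_def)
  note s = sides[folded p_q_r_def, folded D_def]
  define R where "R = sqrt 3 * D"
  have R: "R > 0" using D by (simp add: R_def)
  define S where "S = p\<^sup>2 + q\<^sup>2 + r\<^sup>2"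
  define Q where "Q = p * q + q * r + r * p"
  have tr: "p \<le> q + r" "q \<le> r + p" "r \<le> p + q"
    using dist_triangle[of a b c] dist_triangle[of c a b] dist_triangle[of b c a]
    by (simp_all add: p_q_r_def dist_commute add.commute)
  have FH: "2 * R \<le> 2 * Q - S" unfolding Q_def S_def R_def mult.assoc[symmetric] by (rule Finsler_Hadwiger[OF tr s(2)])
  have QS: "Q \<le> S"
  proof -
    have "2 * (S - Q) = (p - q)\<^sup>2 + (q - r)\<^sup>2 + (r - p)\<^sup>2" by (simp add: S_def Q_def power2_eq_square algebra_simps)
    also have "\<dots> \<ge> 0" by simp
    finally show ?thesis by simp
  qed
  have L: "(tri_perimeter a b c)\<^sup>2 = S + 2 * Q"
    unfolding tri_perimeter_def p_q_r_def[symmetric] S_def Q_def by (simp add: power2_eq_square algebra_simps)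
  have del: "isoperimetric_deficit a b c = (S + 2 * Q) / (6 * R) - 1"
    unfolding isoperimetric_deficit_def area L R_def D_def by (simp add: mult.commute)
  have dis: "distortion = S / (2 * R)"
    unfolding distortion_def s(1) S_def R_def using D by (simp add: field_simps)
  show "isoperimetric_deficit a b c \<le> distortion - 1"
    unfolding del dis using QS R by (simp add: field_simps)
  show d2: "2 / 3 * (distortion - 1) \<le> isoperimetric_deficit a b c"
  proof -
    have "(2 * S + 2 * R) / (6 * R) \<le> (S + 2 * Q) / (6 * R)" using FH R by (intro divide_right_mono) auto
    moreover have "(2 * S + 2 * R) / (6 * R) = 2 / 3 * (S / (2 * R)) + 1 / 3" using R by (simp add: field_simps)
    ultimately have "2 / 3 * (S / (2 * R)) + 1 / 3 \<le> (S + 2 * Q) / (6 * R)" by (simp only:)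
    moreover have "2 / 3 * (U - 1) \<le> V - 1" if "2 / 3 * U + 1 / 3 \<le> V" for U V :: real
      using that by simp
    ultimately show ?thesis unfolding del dis by blast
  qed
  have "2 * R \<le> S" using FH QS by linarith
  then have "1 \<le> distortion" unfolding dis using R by simp
  then show "0 \<le> isoperimetric_deficit a b c" by (intro order_trans[OF _ d2]) simp
qed

lemma equilateral_distortion:
  assumes "dist a b = dist b c" "dist b c = dist c a"
  shows "distortion = 1"
proof -
  define p D where "p = dist a b" "D = \<bar>edge_det\<bar>"
  have D: "D > 0" using edge_det by (simp add: p_D_def)
  have pq: "dist b c = p" "dist c a = p" using assms by (simp_all add: p_D_def)
  have "4 * D\<^sup>2 = 3 * (p\<^sup>2)\<^sup>2" using sides(2) unfolding p_D_def[symmetric] pq by (simp add: power2_eq_square)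
  then have "(2 * D)\<^sup>2 = (sqrt 3 * p\<^sup>2)\<^sup>2" by (simp add: power_mult_distrib)
  then have e: "2 * D = sqrt 3 * p\<^sup>2" by (rule power2_eq_imp_eq) (use D in auto)
  have "distortion = 2 * ((p\<^sup>2 + p\<^sup>2 + p\<^sup>2) / (4 * D)) / sqrt 3"
    unfolding distortion_def sides(1) unfolding p_D_def[symmetric] pq ..
  also have "\<dots> = sqrt 3 * (sqrt 3 * p\<^sup>2) / (2 * D * sqrt 3)" using D by (simp add: field_simps)
  also have "\<dots> = 1" unfolding e[symmetric] using D by simp
  finally show ?thesis .
qed

end

section \<open>The comparison of the deficits\<close>

lemma is_triangle_imp_triangle:
  assumes "is_triangle a b c" shows "triangle a b c"
proof
  show "(b - a) $ 1 * (c - a) $ 2 - (b - a) $ 2 * (c - a) $ 1 \<noteq> 0"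
  proof
    assume z: "(b - a) $ 1 * (c - a) $ 2 - (b - a) $ 2 * (c - a) $ 1 = 0"
    define e f where "e = b - a" "f = c - a"
    have z: "e $ 1 * f $ 2 = e $ 2 * f $ 1" using z by (simp add: e_f_def)
    have "e = 0 \<or> f = 0 \<or> (\<exists>k. f = k *\<^sub>R e)"
    proof (cases "e $ 1 = 0")
      case False
      then have "f = (f $ 1 / e $ 1) *\<^sub>R e" using z by (simp add: vec_eq_iff forall_2 field_simps)
      then show ?thesis by blast
    next
      case e1: True
      show ?thesis
      proof (cases "e $ 2 = 0")
        case False
        then have "f = (f $ 2 / e $ 2) *\<^sub>R e" using z e1 by (simp add: vec_eq_iff forall_2 field_simps)
        then show ?thesis by blast
      next
        case True
        then show ?thesis using e1 by (simp add: vec_eq_iff forall_2)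
      qed
    qed
    then have "collinear {0, e, f}" by (simp add: collinear_lemma)
    then have "collinear {b, a, c}" by (simp add: collinear_3 e_f_def)
    then have "collinear {a, b, c}" by (simp add: insert_commute)
    then show False using assms by (simp add: is_triangle_def)
  qed
qed

lemma recursive_const: "recursive_fun (\<lambda>_. k)"
proof (induction k)
  case 0
  show ?case by (rule recursive_fun.zero)
next
  case (Suc k)
  from recursive_fun.comp[OF recursive_fun.succ Suc] show ?case .
qed

lemma computable_nat: "computable_real (real k)"
  unfolding computable_real_def
  by (rule exI[of _ "\<lambda>_. k"], rule exI[of _ "\<lambda>_. 0"], rule exI[of _ "\<lambda>_. 0"]) (simp add: recursive_const)

lemma computable_reciprocal: "computable_real (1 / real (Suc k))"
  unfolding computable_real_def
  by (rule exI[of _ "\<lambda>_. 1"], rule exI[of _ "\<lambda>_. 0"], rule exI[of _ "\<lambda>_. k"]) (simp add: recursive_const)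

text \<open>The powers of the area of the equilateral triangle are a fixed number, so the constants only have to be chosen small and large
  enough; the reciprocal of an integer and an integer serve, and these are computable for trivial reasons.\<close>

theorem theorem1p10:
  fixes s :: real
  assumes "s > 0"
  shows "\<exists>a\<^sub>0 a\<^sub>1. computable_real a\<^sub>0 \<and> computable_real a\<^sub>1 \<and> a\<^sub>0 > 0 \<and> a\<^sub>1 > 0 \<and>
    (\<forall>a b c p q r :: real^2.
       is_triangle a b c \<longrightarrow> is_equilateral p q r \<longrightarrow> tri_area p q r = s \<longrightarrow>
         a\<^sub>0 * tri_area p q r powr (3/2) * isoperimetric_deficit a b c
           \<le> eigenvalue_deficit a b c p q r \<and>
         eigenvalue_deficit a b c p q r
           \<le> a\<^sub>1 * tri_area p q r powr (3/2) * isoperimetric_deficit a b c)"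
proof -
  define \<Lambda> where "\<Lambda> = 4 * pi\<^sup>2 / sqrt 3"
  define w where "w = s powr (3/2)"
  have \<Lambda>: "\<Lambda> > 0" by (simp add: \<Lambda>_def)
  have w: "w > 0" using assms by (simp add: w_def)
  obtain k where k: "inverse (real (Suc k)) < \<Lambda> / 100 / w"
    using reals_Archimedean[of "\<Lambda> / 100 / w"] \<Lambda> w by auto
  obtain l where l: "3 / 2 * \<Lambda> / w < real l" using reals_Archimedean2 by blast
  have k': "1 / real (Suc k) * w \<le> \<Lambda> / 100" using k w by (simp add: field_simps)
  have l': "3 / 2 * \<Lambda> \<le> real l * w" using l w by (simp add: field_simps)
  have l0: "real l > 0" by (rule less_trans[OF _ l]) (use \<Lambda> w in simp)
  show ?thesis
  proof (intro exI conjI allI impI)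
    show "computable_real (1 / real (Suc k))" by (rule computable_reciprocal)
    show "computable_real (real l)" by (rule computable_nat)
    show "1 / real (Suc k) > 0" by simp
    show "real l > 0" by (rule l0)
    fix a b c p q r :: "real^2"
    assume P: "is_triangle a b c" and E: "is_equilateral p q r" and s: "tri_area p q r = s"
    interpret P: triangle a b c by (rule is_triangle_imp_triangle[OF P])
    interpret E: triangle p q r using E by (intro is_triangle_imp_triangle) (simp add: is_equilateral_def)
    have g: "P.ground = \<Lambda>" "E.ground = \<Lambda>" by (simp_all add: P.ground_def E.ground_def \<Lambda>_def)
    have dE: "E.distortion = 1" using E by (intro E.equilateral_distortion) (simp_all add: is_equilateral_def)
    have "tri_area p q r * tri_eigenvalue p q r = \<Lambda>"
      using E.eigenvalue_lower E.eigenvalue_upper unfolding dE g by simp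
    then have def: "eigenvalue_deficit a b c p q r = tri_area a b c * tri_eigenvalue a b c - \<Lambda>"
      by (simp add: eigenvalue_deficit_def)
    define \<rho> \<delta> where "\<rho> = P.distortion" "\<delta> = isoperimetric_deficit a b c"
    note \<delta> = P.deficit_bounds[folded \<rho>_\<delta>_def]
    have "1 / real (Suc k) * w * \<delta> \<le> \<Lambda> / 100 * \<delta>" by (rule mult_right_mono[OF k' \<delta>(1)])
    also have "\<dots> \<le> \<Lambda> / 100 * (\<rho> - 1)" using \<delta>(2) \<Lambda> by (intro mult_left_mono) auto
    also have "\<dots> = \<Lambda> * (99 / 100 + \<rho> / 100) - \<Lambda>" by (simp add: field_simps)
    also have "\<dots> \<le> eigenvalue_deficit a b c p q r"
      using P.eigenvalue_lower unfolding def g \<rho>_\<delta>_def by simp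
    finally show "1 / real (Suc k) * tri_area p q r powr (3/2) * isoperimetric_deficit a b c \<le> eigenvalue_deficit a b c p q r"
      unfolding s w_def \<rho>_\<delta>_def .
    have "eigenvalue_deficit a b c p q r \<le> \<Lambda> * \<rho> - \<Lambda>"
      using P.eigenvalue_upper unfolding def g \<rho>_\<delta>_def by simp
    also have "\<dots> = 3 / 2 * \<Lambda> * (2 / 3 * (\<rho> - 1))" by (simp add: algebra_simps)
    also have "\<dots> \<le> 3 / 2 * \<Lambda> * \<delta>" using \<delta>(3) \<Lambda> by (intro mult_left_mono) auto
    also have "\<dots> \<le> real l * w * \<delta>" by (rule mult_right_mono[OF l' \<delta>(1)])
    finally show "eigenvalue_deficit a b c p q r \<le> real l * tri_area p q r powr (3/2) * isoperimetric_deficit a b c"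
      unfolding s w_def \<rho>_\<delta>_def .
  qed
qed

end
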